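(* Let $n\ge 3$. Let $\Gamma=\{x=(x',x_n)\in B_1: x_n=\psi(x')\}$ for some function $\psi:\mathbb{R}^{n-1}\to\mathbb{R}$, and let $g$ be a function on $\Gamma$. Assume that $0\in\Gamma$, $\nabla\psi(0)=0$, $\psi\in C^{1,\mathrm{Dini}}(0)$, and $g\in C^{0,\mathrm{Dini}}(0)$, and let $u\in C(B_1)$ be a bounded distributional solution to $$\Delta u=g\,dH^{n-1}|_\Gamma\quad\text{in }B_1 .$$ Then there exist linear polynomials $l^\pm(x)=a^\pm\cdot x+b$, with $a^\pm\in\mathbb{R}^n$ and $b\in\mathbb{R}$, a radius $0<R\le 1$ depending only on $\omega_{\nabla\psi,0}$, and a function $\sigma(r)$ depending only on $n$, $\|u\|_{L^\infty(B_1)}$, $|g(0)|$, $\omega_{\nabla\psi,0}$, and $\omega_{g,0}$, with $\sigma(r)\to0$ as $r\to0$, such that $$\sup_{\Omega^\pm\cap B_r}|u^\pm-l^\pm|\le r\,\sigma(r)\qquad\text{for all } r\le R .$$ Furthermore, $a^+-a^-=g(0)e_n$, and $$R|a^+|+R|a^-|+|b|\le C\left(\|u\|_{L^\infty(B_R)}+R|g(0)|+R\int_0^R\frac{\omega_{g,0}(r)}{r}\,dr\right)$$ for some constant $C>0$ depending only on $n$.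
   Context: $B_r\subset\mathbb{R}^n$ is the open ball of radius $r$ centered at $0$; $e_n$ is the $n$-th coordinate vector; $dH^{n-1}|_\Gamma$ is the Hausdorff measure restricted to $\Gamma$. $\Omega^+=\{x\in B_1: x_n>\psi(x')\}$, $\Omega^-=\{x\in B_1: x_n<\psi(x')\}$, and $u^\pm$ denotes $u$ restricted to the closure of $\Omega^\pm$ (in $B_1$). Distributional solution: $\int_{B_1}u\Delta\varphi\,dx=\int_\Gamma g\varphi\,dH^{n-1}$ for all $\varphi\in C_c^\infty(B_1)$. Dini function: a continuous nondecreasing $\omega:[0,\infty)\to[0,\infty)$ such that $\int_0^{R_0}\frac{\omega(r)}{r}\,dr<\infty$ for some $R_0>0$. (Moduli below are given the value $0$ at $r=0$.) $\psi\in C^{1,\mathrm{Dini}}(0)$: $\psi$ is $C^1$ and $\omega_{\nabla\psi,0}(r)=\sup_{x\in\Gamma\cap B_r}|\nabla\psi(x')-\nabla\psi(0)|$, $r>0$, is a Dini function. $g\in C^{0,\mathrm{Dini}}(0)$: $g$ is continuous on $\Gamma$ and $\omega_{g,0}(r)=\sup_{x\in\Gamma\cap B_r}|g(x)-g(0)|$, $r>0$, is a Dini function. *)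

theory Defs
  imports "HOL-Analysis.Analysis" "HOL-Probability.Essential_Supremum"
begin

text \<open>
  The radius in the theorem depends on the modulus of continuity of the gradient alone, hence not
  on the dimension \<open>n\<close>, so \<open>n\<close> has to be quantified inside the formula and cannot be a type.
  A point of \<open>\<real>\<^sup>n\<close> is a function in \<open>PiE {1..n} (\<lambda>_. UNIV)\<close>, the space of the product measure
  \<open>PiM {1..n} (\<lambda>_. lborel)\<close>. On this set the product topology of the type \<open>nat \<Rightarrow> real\<close>, to which
  \<open>continuous_on\<close> and \<open>compact\<close> refer below, is the Euclidean topology.
\<close>

type_synonym vec = "nat \<Rightarrow> real"

definition euc :: "nat \<Rightarrow> vec set" where
  "euc n = PiE {1..n} (\<lambda>_. UNIV)"

definition evec :: "nat \<Rightarrow> vec \<Rightarrow> vec" where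
  "evec n f = restrict f {1..n}"

definition ezero :: "nat \<Rightarrow> vec" where
  "ezero n = evec n (\<lambda>_. 0)"

definition eaxis :: "nat \<Rightarrow> nat \<Rightarrow> vec" where
  "eaxis n k = evec n (\<lambda>i. if i = k then 1 else 0)"

definition enorm :: "nat \<Rightarrow> vec \<Rightarrow> real" where
  "enorm n x = L2_set x {1..n}"

definition edist :: "nat \<Rightarrow> vec \<Rightarrow> vec \<Rightarrow> real" where
  "edist n x y = enorm n (\<lambda>i. x i - y i)"

definition einner :: "nat \<Rightarrow> vec \<Rightarrow> vec \<Rightarrow> real" where
  "einner n x y = (\<Sum>i=1..n. x i * y i)"

definition euc_ball :: "nat \<Rightarrow> real \<Rightarrow> vec set" where
  "euc_ball n r = {x \<in> euc n. enorm n x < r}"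

definition elebesgue :: "nat \<Rightarrow> vec measure" where
  "elebesgue n = PiM {1..n} (\<lambda>_. lborel)"

definition Linf_norm :: "nat \<Rightarrow> vec set \<Rightarrow> (vec \<Rightarrow> real) \<Rightarrow> real" where
  "Linf_norm n S f =
     real_of_ereal (esssup (restrict_space (elebesgue n) S) (\<lambda>x. ereal \<bar>f x\<bar>))"


definition partial :: "nat \<Rightarrow> (vec \<Rightarrow> real) \<Rightarrow> vec \<Rightarrow> real" where
  "partial i f x = deriv (\<lambda>t. f (x(i := t))) (x i)"

definition grad :: "nat \<Rightarrow> (vec \<Rightarrow> real) \<Rightarrow> vec \<Rightarrow> vec" where
  "grad n f x = evec n (\<lambda>i. partial i f x)"

definition laplacian :: "nat \<Rightarrow> (vec \<Rightarrow> real) \<Rightarrow> vec \<Rightarrow> real" where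
  "laplacian n f x = (\<Sum>i=1..n. partial i (partial i f) x)"

text \<open>Membership in \<open>C\<^sup>k(\<real>\<^sup>n)\<close>: all partial derivatives up to order \<open>k\<close> exist and are continuous.\<close>

primrec Ck :: "nat \<Rightarrow> nat \<Rightarrow> (vec \<Rightarrow> real) \<Rightarrow> bool" where
  "Ck n 0 f \<longleftrightarrow> continuous_on (euc n) f"
| "Ck n (Suc k) f \<longleftrightarrow> continuous_on (euc n) f \<and>
     (\<forall>i\<in>{1..n}. (\<forall>x\<in>euc n. (\<lambda>t. f (x(i := t))) differentiable (at (x i))) \<and> Ck n k (partial i f))"

definition test_function :: "nat \<Rightarrow> (vec \<Rightarrow> real) \<Rightarrow> bool" where
  "test_function n \<phi> \<longleftrightarrow> (\<forall>k. Ck n k \<phi>) \<and>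
     (\<exists>K. compact K \<and> K \<subseteq> euc_ball n 1 \<and> (\<forall>x\<in>euc n - K. \<phi> x = 0))"


definition ediam :: "nat \<Rightarrow> vec set \<Rightarrow> ennreal" where
  "ediam n A = (SUP x\<in>A. SUP y\<in>A. ennreal (edist n x y))"

text \<open>
  The \<open>d\<close>-dimensional Hausdorff measure on the Borel sets of \<open>\<real>\<^sup>n\<close>, for \<open>d \<ge> 1\<close> (for \<open>d = 0\<close> the
  empty set would be counted with weight 1). The factor \<open>unit_ball_vol d / 2 ^ d\<close> is the
  normalisation that makes it agree with the surface measure of a \<open>d\<close>-dimensional surface.
\<close>

definition hausdorff_pre :: "nat \<Rightarrow> nat \<Rightarrow> real \<Rightarrow> vec set \<Rightarrow> ennreal" where
  "hausdorff_pre n d \<delta> A =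
     (INF U \<in> {U :: nat \<Rightarrow> vec set. (\<forall>j. U j \<subseteq> euc n \<and> ediam n (U j) \<le> ennreal \<delta>) \<and> A \<subseteq> (\<Union>j. U j)}.
        \<Sum>j. ennreal (unit_ball_vol (real d)) * (ediam n (U j) / 2) ^ d)"

definition hausdorff_outer :: "nat \<Rightarrow> nat \<Rightarrow> vec set \<Rightarrow> ennreal" where
  "hausdorff_outer n d A = (SUP \<delta>\<in>{0<..}. hausdorff_pre n d \<delta> A)"

definition hausdorff :: "nat \<Rightarrow> nat \<Rightarrow> vec measure" where
  "hausdorff n d = measure_of (euc n) (sets (PiM {1..n} (\<lambda>_. borel))) (hausdorff_outer n d)"


text \<open>In the splitting \<open>x = (x', x\<^sub>n)\<close> the part \<open>x'\<close> is \<open>evec (n - 1) x\<close> and the last coordinate is \<open>x n\<close>.\<close>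

definition Gam :: "nat \<Rightarrow> (vec \<Rightarrow> real) \<Rightarrow> vec set" where
  "Gam n \<psi> = {x \<in> euc_ball n 1. x n = \<psi> (evec (n - 1) x)}"

definition Omega_plus :: "nat \<Rightarrow> (vec \<Rightarrow> real) \<Rightarrow> vec set" where
  "Omega_plus n \<psi> = {x \<in> euc_ball n 1. x n > \<psi> (evec (n - 1) x)}"

definition Omega_minus :: "nat \<Rightarrow> (vec \<Rightarrow> real) \<Rightarrow> vec set" where
  "Omega_minus n \<psi> = {x \<in> euc_ball n 1. x n < \<psi> (evec (n - 1) x)}"

definition distributional_solution ::
    "nat \<Rightarrow> (vec \<Rightarrow> real) \<Rightarrow> (vec \<Rightarrow> real) \<Rightarrow> (vec \<Rightarrow> real) \<Rightarrow> bool" where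
  "distributional_solution n \<psi> g u \<longleftrightarrow>
     (\<forall>\<phi>. test_function n \<phi> \<longrightarrow>
        (LINT x:euc_ball n 1|elebesgue n. u x * laplacian n \<phi> x)
          = (LINT x:Gam n \<psi>|hausdorff n (n - 1). g x * \<phi> x))"

definition dini :: "(real \<Rightarrow> real) \<Rightarrow> bool" where
  "dini \<omega> \<longleftrightarrow> continuous_on {0..} \<omega> \<and> mono_on {0..} \<omega> \<and> (\<forall>r\<ge>0. \<omega> r \<ge> 0) \<and>
     (\<exists>R0>0. set_integrable lborel {0<..R0} (\<lambda>r. \<omega> r / r))"

text \<open>The value \<open>0\<close> for negative \<open>r\<close> is a dummy: moduli are functions on \<open>[0, \<infinity>)\<close>.\<close>

definition sup_modulus :: "nat \<Rightarrow> vec set \<Rightarrow> (vec \<Rightarrow> real) \<Rightarrow> real \<Rightarrow> real" where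
  "sup_modulus n S d r = (if r \<le> 0 then 0 else (SUP x\<in>S \<inter> euc_ball n r. d x))"

definition grad_osc :: "nat \<Rightarrow> (vec \<Rightarrow> real) \<Rightarrow> vec \<Rightarrow> real" where
  "grad_osc n \<psi> x =
     edist (n - 1) (grad (n - 1) \<psi> (evec (n - 1) x)) (grad (n - 1) \<psi> (ezero (n - 1)))"

definition fun_osc :: "nat \<Rightarrow> (vec \<Rightarrow> real) \<Rightarrow> vec \<Rightarrow> real" where
  "fun_osc n g x = \<bar>g x - g (ezero n)\<bar>"

definition omega_grad :: "nat \<Rightarrow> (vec \<Rightarrow> real) \<Rightarrow> real \<Rightarrow> real" where
  "omega_grad n \<psi> = sup_modulus n (Gam n \<psi>) (grad_osc n \<psi>)"

definition omega_fun :: "nat \<Rightarrow> (vec \<Rightarrow> real) \<Rightarrow> (vec \<Rightarrow> real) \<Rightarrow> real \<Rightarrow> real" where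
  "omega_fun n \<psi> g = sup_modulus n (Gam n \<psi>) (fun_osc n g)"

text \<open>
  A Dini function is finite valued, so the suprema defining the moduli are finite. As \<open>Sup\<close> on the
  reals is unspecified for unbounded sets, this is stated separately; since \<open>Gam n \<psi>\<close> lies in the
  unit ball, it is enough to do so on all of \<open>Gam n \<psi>\<close>.
\<close>

definition C1_Dini :: "nat \<Rightarrow> (vec \<Rightarrow> real) \<Rightarrow> bool" where
  "C1_Dini n \<psi> \<longleftrightarrow> Ck (n - 1) 1 \<psi> \<and> bdd_above (grad_osc n \<psi> ` Gam n \<psi>) \<and> dini (omega_grad n \<psi>)"

definition C0_Dini :: "nat \<Rightarrow> (vec \<Rightarrow> real) \<Rightarrow> (vec \<Rightarrow> real) \<Rightarrow> bool" where
  "C0_Dini n \<psi> g \<longleftrightarrow> continuous_on (Gam n \<psi>) g \<and> bdd_above (fun_osc n g ` Gam n \<psi>) \<and>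
     dini (omega_fun n \<psi> g)"

end

theory Submission
  imports Defs "HOL-Computational_Algebra.Polynomial" "HOL-Probability.Sinc_Integral"
begin

text \<open>
  Subtracting \<open>g(0) max(0, x\<^sub>n)\<close>, whose Laplacian is \<open>g(0)\<close> times the surface measure of the hyperplane
  \<open>x\<^sub>n = 0\<close>, reduces the claim to approximating the remainder \<open>v\<close> by a single linear polynomial: the
  jump of the gradient comes from the subtracted term. The equation is tested with a cut-off of the
  regularised Newtonian kernel \<open>(\<bar>y - x\<bar>\<^sup>2 + e)\<close> to the power \<open>1 - n/2\<close>, whose Laplacian is an
  approximate identity as \<open>e\<close> tends to \<open>0\<close>. So \<open>v(x)\<close> is the sum of an integral of \<open>v\<close> over an annulus,
  which is smooth in \<open>x\<close>, and the potential of the difference between the measure on the graph and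
  \<open>g(0)\<close> times that on the hyperplane. In graph coordinates both live on \<open>\<real>\<^sup>n\<^sup>-\<^sup>1\<close>, and at distance \<open>t\<close>
  from \<open>0\<close> the densities differ by \<open>O(\<omega>\<^sub>g(ct) + \<bar>g(0)\<bar> \<omega>(ct))\<close>, where \<open>\<omega>\<^sub>g\<close> and \<open>\<omega>\<close> are the two moduli.
  Hence the first order Taylor coefficients of the potential at \<open>0\<close> converge by the Dini conditions.
  For the remainder the integral is split at distance \<open>M \<bar>x\<bar>\<close>: outside the Taylor expansion of
  the kernel gains a factor \<open>1/M\<close>, and inside, for fixed \<open>M\<close>, everything is \<open>o(\<bar>x\<bar>)\<close>.

  The density of the surface measure is found without an area formula. The Hausdorff measure of a
  hyperplane is Lebesgue measure (isodiametric inequality by Steiner symmetrisation, and a covering by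
  balls), and near \<open>0\<close> the graph map and its inverse have Lipschitz constants close to \<open>1\<close>.
\<close>

section \<open>Euclidean space and Lebesgue measure\<close>

text \<open>The dependence clauses shape the proof: \<open>C\<close> may depend only on the
  dimension, the radius only on \<omega>, and \<sigma> only on the listed data. Hence every estimate
  carries explicit constants, all lengths are dimensional multiples of R, and powers of the cut-off
  radius cancel. R is chosen with \<omega>(R) \<le> 1 and with the integral of \<omega>(r)/r up to R
  at most 1; the second condition absorbs the deviation of the graph from its tangent plane into R
  |g(0)|. Two obstacles recur. \<omega> controls the gradient only at graph points inside a ball of
  the full space, so one must know that the graph stays in the ball before using the bound that
  keeps it there; a continuity argument breaks the circle. And near x the Lipschitz bound of the
  kernel under a vertical shift just fails to be integrable; interpolation with the trivial bound
  gives up half a power and is integrable uniformly in x. At the origin the first derivative of the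
  kernel meets the moduli directly, and this is where the Dini integrals arise. All bounds are
  uniform in e; the limit is taken at the end, in the finished expansion.\<close>

declare One_nat_def [simp del]

interpretation lb: product_sigma_finite "\<lambda>_::nat. lborel :: real measure"
  by standard

lemma space_elebesgue [simp]: "space (elebesgue n) = euc n"
  by (simp add: elebesgue_def space_PiM euc_def)

lemma sets_elebesgue: "sets (elebesgue n) = sets (PiM {1..n} (\<lambda>_. borel))"
  unfolding elebesgue_def by (intro sets_PiM_cong) auto

lemma sigma_finite_elebesgue: "sigma_finite_measure (elebesgue n)"
  unfolding elebesgue_def by (rule lb.sigma_finite) auto

lemma measurable_elebesgue_coord [measurable]:
  "i \<in> {1..n} \<Longrightarrow> (\<lambda>x. x i) \<in> borel_measurable (elebesgue n)"
  unfolding elebesgue_def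
  by (subst measurable_cong_sets[OF refl sets_lborel[symmetric]]) (rule measurable_component_singleton)

lemma enorm_alt: "enorm n x = sqrt (\<Sum>i=1..n. (x i)\<^sup>2)"
  by (simp add: enorm_def L2_set_def)

lemma enorm_power2: "(enorm n x)\<^sup>2 = (\<Sum>i=1..n. (x i)\<^sup>2)"
  by (simp add: enorm_alt sum_nonneg)

lemma enorm_nonneg [simp]: "0 \<le> enorm n x"
  by (simp add: enorm_def)

lemma enorm_cong: "(\<And>i. i \<in> {1..n} \<Longrightarrow> x i = y i) \<Longrightarrow> enorm n x = enorm n y"
  by (simp add: enorm_alt)

lemma enorm_triangle: "enorm n (\<lambda>i. x i + y i) \<le> enorm n x + enorm n y"
  unfolding enorm_def by (rule L2_set_triangle_ineq)

lemma enorm_scale: "enorm n (\<lambda>i. c * x i) = \<bar>c\<bar> * enorm n x"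
  by (simp add: enorm_alt power_mult_distrib sum_distrib_left[symmetric] real_sqrt_mult)

lemma enorm_minus: "enorm n (\<lambda>i. - x i) = enorm n x"
  by (simp add: enorm_alt)

lemma edist_commute: "edist n x y = edist n y x"
  by (simp add: edist_def enorm_alt power2_commute)

lemma edist_nonneg [simp]: "0 \<le> edist n x y"
  by (simp add: edist_def)

lemma edist_triangle: "edist n x z \<le> edist n x y + edist n y z"
  using enorm_triangle[of n "\<lambda>i. x i - y i" "\<lambda>i. y i - z i"] by (simp add: edist_def)

lemma edist_self [simp]: "edist n x x = 0"
  by (simp add: edist_def enorm_alt)

lemma abs_coord_le_enorm: "i \<in> {1..n} \<Longrightarrow> \<bar>x i\<bar> \<le> enorm n x"
  using member_le_L2_set[of "{1..n}" i "\<lambda>i. \<bar>x i\<bar>"] by (simp add: enorm_def L2_set_def)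

lemma enorm_diff_le: "\<bar>enorm n x - enorm n y\<bar> \<le> edist n x y"
proof -
  have "enorm n x \<le> edist n x y + enorm n y"
    using enorm_triangle[of n "\<lambda>i. x i - y i" y] by (simp add: edist_def)
  moreover have "enorm n y \<le> edist n x y + enorm n x"
    using enorm_triangle[of n "\<lambda>i. y i - x i" x] edist_commute[of n x y] by (simp add: edist_def)
  ultimately show ?thesis by linarith
qed

lemma einner_le: "\<bar>einner n x y\<bar> \<le> enorm n x * enorm n y"
proof -
  have "\<bar>einner n x y\<bar> \<le> (\<Sum>i=1..n. \<bar>x i\<bar> * \<bar>y i\<bar>)"
    unfolding einner_def by (rule order.trans[OF sum_abs]) (simp add: abs_mult)
  also have "\<dots> \<le> enorm n x * enorm n y"
    unfolding enorm_def by (rule L2_set_mult_ineq)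
  finally show ?thesis .
qed

lemma enorm_diff_power2:
  "(enorm n (\<lambda>i. x i - y i))\<^sup>2 = (enorm n x)\<^sup>2 - 2 * einner n x y + (enorm n y)\<^sup>2"
  by (simp add: enorm_power2 einner_def power2_diff sum.distrib sum_subtractf sum_distrib_left algebra_simps)

lemma enorm_evec [simp]: "enorm n (evec n f) = enorm n f"
  by (rule enorm_cong) (simp add: evec_def)

lemma evec_in_euc [simp]: "evec n f \<in> euc n"
  by (simp add: evec_def euc_def)

lemma evec_apply [simp]: "i \<in> {1..n} \<Longrightarrow> evec n f i = f i"
  by (simp add: evec_def)

lemma evec_id: "x \<in> euc n \<Longrightarrow> evec n x = x"
  by (simp add: evec_def euc_def)

lemma euc_eqI: "x \<in> euc n \<Longrightarrow> y \<in> euc n \<Longrightarrow> (\<And>i. i \<in> {1..n} \<Longrightarrow> x i = y i) \<Longrightarrow> x = y"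
  unfolding euc_def by (rule PiE_ext)

lemma fun_upd_in_euc: "x \<in> euc n \<Longrightarrow> i \<in> {1..n} \<Longrightarrow> x(i := t) \<in> euc n"
  by (auto simp: euc_def PiE_def extensional_def)

lemma continuous_on_coord [continuous_intros]: "continuous_on S (\<lambda>x::vec. x i)"
  by (rule continuous_on_subset[OF continuous_on_product_coordinates]) auto

lemma continuous_on_enorm [continuous_intros]: "continuous_on S (enorm n)"
  unfolding enorm_alt[abs_def] by (intro continuous_intros)

lemma closed_euc: "closed (euc n)"
proof -
  have "euc n = (\<Inter>i\<in>-{1..n}. {x. x i = undefined})"
    by (auto simp: euc_def PiE_def extensional_def)
  moreover have "closed {x::vec. x i = undefined}" for i
    by (rule closed_Collect_eq) (auto intro!: continuous_intros)
  ultimately show ?thesis by (auto intro!: closed_INT)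
qed

text \<open>Coordinates outside the index range are pinned to \<open>undefined\<close>, so by
  Tychonoff the ball is a closed subset of a compact product of intervals and singletons.
  Compactness serves both for the support condition of test functions and for extracting a limit of
  the coefficient vectors.\<close>

lemma compact_euc_cball: "compact {x\<in>euc n. enorm n x \<le> r}"
proof -
  define S where "S = (\<lambda>i. if i \<in> {1..n} then {-r..r} else {undefined::real})"
  have "compactin (product_topology (\<lambda>i. euclidean) UNIV) (PiE UNIV S)"
    unfolding compactin_PiE by (auto simp: S_def)
  then have c: "compact (PiE UNIV S)"
    by (simp add: euclidean_product_topology)
  have cl: "closed {x\<in>euc n. enorm n x \<le> r}"
  proof -
    have "closed {x. enorm n x \<le> r}"
      by (intro closed_Collect_le continuous_intros)
    then have "closed (euc n \<inter> {x. enorm n x \<le> r})" by (intro closed_Int closed_euc)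
    then show ?thesis by (simp add: Int_def)
  qed
  have "{x\<in>euc n. enorm n x \<le> r} \<subseteq> PiE UNIV S"
  proof
    fix x assume x: "x \<in> {x\<in>euc n. enorm n x \<le> r}"
    have "x i \<in> S i" for i
    proof (cases "i \<in> {1..n}")
      case True
      then show ?thesis using x abs_coord_le_enorm[OF True, of x] by (auto simp: S_def)
    next
      case False
      then show ?thesis using x by (auto simp: S_def euc_def PiE_def extensional_def)
    qed
    then show "x \<in> PiE UNIV S" by auto
  qed
  then have "PiE UNIV S \<inter> {x\<in>euc n. enorm n x \<le> r} = {x\<in>euc n. enorm n x \<le> r}" by blast
  with compact_Int_closed[OF c cl] show ?thesis by simp
qed

text \<open>The bridge between two structures on \<open>euc n\<close>: the product sigma-algebra of
  n Borel factors, and the Borel sets of the type \<open>nat \<Rightarrow> real\<close>, in which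
  the topological statements live. The remaining coordinates are constant on
  \<open>euc n\<close>.\<close>

lemma id_measurable_elebesgue: "(\<lambda>x. x) \<in> measurable (elebesgue n) borel"
proof -
  have "(\<lambda>x. x) \<in> measurable (elebesgue n) (PiM UNIV (\<lambda>_. borel))"
  proof (rule measurable_PiM_single')
    fix i :: nat
    show "(\<lambda>x. x i) \<in> borel_measurable (elebesgue n)"
    proof (cases "i \<in> {1..n}")
      case False
      then show ?thesis
        by (subst measurable_cong[where g="\<lambda>_. undefined"])
           (auto simp: euc_def PiE_def extensional_def)
    qed simp
  qed auto
  then show ?thesis
    using measurable_cong_sets[OF refl sets_PiM_equal_borel] by blast
qed

lemma continuous_on_measurable_euc:
  fixes f :: "vec \<Rightarrow> 'a::topological_space"
  assumes "continuous_on A f" "A \<subseteq> euc n"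
  shows "f \<in> borel_measurable (restrict_space (elebesgue n) A)"
proof -
  have "(\<lambda>x. x) \<in> measurable (restrict_space (elebesgue n) A) (restrict_space borel A)"
    by (rule measurable_restrict_space3[OF id_measurable_elebesgue]) auto
  from measurable_compose[OF this borel_measurable_continuous_on_restrict[OF assms(1)]]
  show ?thesis by simp
qed

lemma continuous_measurable_euc:
  fixes f :: "vec \<Rightarrow> 'a::topological_space"
  assumes "continuous_on (euc n) f"
  shows "f \<in> borel_measurable (elebesgue n)"
proof -
  have "(\<lambda>x. x) \<in> measurable (elebesgue n) (restrict_space borel (euc n))"
    by (rule measurable_restrict_space2[OF _ id_measurable_elebesgue]) auto
  from measurable_compose[OF this borel_measurable_continuous_on_restrict[OF assms]]
  show ?thesis by simp
qed

lemma closed_in_sets_elebesgue: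
  assumes "closed C" "C \<subseteq> euc n"
  shows "C \<in> sets (elebesgue n)"
proof -
  have "(\<lambda>x. x) -` C \<inter> space (elebesgue n) \<in> sets (elebesgue n)"
    using assms by (intro measurable_sets[OF id_measurable_elebesgue]) auto
  then show ?thesis using assms by (simp add: Int_absorb2)
qed

lemma enorm_measurable [measurable]: "enorm n \<in> borel_measurable (elebesgue n)"
  by (intro continuous_measurable_euc continuous_intros)

lemma euc_ball_sets [measurable, simp]: "euc_ball n r \<in> sets (elebesgue n)"
proof -
  have "{x \<in> space (elebesgue n). enorm n x < r} \<in> sets (elebesgue n)" by measurable
  then show ?thesis by (simp add: euc_ball_def)
qed

section \<open>Affine changes of variables and polar coordinates\<close>

lemma distr_affine_elebesgue:
  assumes "c \<noteq> 0"
  shows "distr (elebesgue n) (elebesgue n) (\<lambda>z. evec n (\<lambda>i. a i + c * z i))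
       = density (elebesgue n) (\<lambda>_. ennreal (1 / \<bar>c\<bar> ^ n))"
proof -
  let ?T = "\<lambda>z. evec n (\<lambda>i. a i + c * z i)"
  have T [measurable]: "?T \<in> measurable (elebesgue n) (elebesgue n)"
  proof -
    have "(\<lambda>z. \<lambda>i\<in>{1..n}. a i + c * z i) \<in> measurable (elebesgue n) (PiM {1..n} (\<lambda>_. lborel))"
      by (intro measurable_restrict) measurable
    then show ?thesis by (simp add: evec_def elebesgue_def)
  qed
  have *: "emeasure lborel ((\<lambda>t. b + c * t) -` S) = ennreal (1 / \<bar>c\<bar>) * emeasure lborel S"
    if S: "S \<in> sets borel" for b and S :: "real set"
  proof -
    have "emeasure lborel S = emeasure (density (distr lborel borel (\<lambda>x. b + c *\<^sub>R x)) (\<lambda>_. \<bar>c\<bar>^DIM(real))) S"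
      using lborel_affine[OF assms, of b] by simp
    also have "\<dots> = ennreal \<bar>c\<bar> * emeasure lborel ((\<lambda>t. b + c * t) -` S)"
      using S by (simp add: emeasure_density_const emeasure_distr)
    finally have e: "emeasure lborel S = ennreal \<bar>c\<bar> * emeasure lborel ((\<lambda>t. b + c * t) -` S)" .
    show ?thesis unfolding e using assms
      by (simp add: mult.assoc[symmetric] ennreal_mult[symmetric])
  qed
  \<comment> \<open>A product measure is determined by its values on boxes; the weight |c|^n
    compensates the factor 1/|c| that a box picks up in each of its n coordinates.\<close>
  have "density (distr (elebesgue n) (elebesgue n) ?T) (\<lambda>_. ennreal (\<bar>c\<bar> ^ n)) = elebesgue n" (is "?P = _")
    unfolding elebesgue_def
  proof (rule lb.PiM_eqI)
    fix S :: "nat \<Rightarrow> real set" assume "\<And>i. i \<in> {1..n} \<Longrightarrow> S i \<in> sets lborel"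
    then have S: "S i \<in> sets borel" if "i \<in> {1..n}" for i using that by auto
    have SP: "PiE {1..n} S \<in> sets (PiM {1..n} (\<lambda>_. lborel))"
      using S by (intro sets_PiM_I_finite) auto
    have "?T -` (PiE {1..n} S) \<inter> space (PiM {1..n} (\<lambda>_. lborel)) = PiE {1..n} (\<lambda>i. (\<lambda>t. a i + c * t) -` S i)"
      by (auto simp: space_PiM evec_def PiE_iff)
    then have "emeasure (distr (PiM {1..n} (\<lambda>_. lborel)) (PiM {1..n} (\<lambda>_. lborel)) ?T) (PiE {1..n} S)
        = emeasure (PiM {1..n} (\<lambda>_. lborel)) (PiE {1..n} (\<lambda>i. (\<lambda>t. a i + c * t) -` S i))"
      using SP T by (subst emeasure_distr) (auto simp: elebesgue_def)
    also have "\<dots> = (\<Prod>i=1..n. emeasure lborel ((\<lambda>t. a i + c * t) -` S i))"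
      using S by (intro lb.emeasure_PiM) (auto intro!: measurable_sets_borel[of _ borel])
    also have "\<dots> = (\<Prod>i=1..n. ennreal (1 / \<bar>c\<bar>) * emeasure lborel (S i))"
      using * S by (intro prod.cong) auto
    also have "\<dots> = ennreal (1 / \<bar>c\<bar>) ^ n * (\<Prod>i=1..n. emeasure lborel (S i))"
      by (simp add: prod.distrib)
    finally have e: "emeasure (distr (PiM {1..n} (\<lambda>_. lborel)) (PiM {1..n} (\<lambda>_. lborel)) ?T) (PiE {1..n} S)
       = ennreal (1 / \<bar>c\<bar>) ^ n * (\<Prod>i=1..n. emeasure lborel (S i))" .
    have "ennreal (\<bar>c\<bar> ^ n) * ennreal (1 / \<bar>c\<bar>) ^ n = 1"
      using assms by (simp add: ennreal_power ennreal_mult[symmetric] power_mult_distrib[symmetric])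
    then show "emeasure (density (distr (PiM {1..n} (\<lambda>_. lborel)) (PiM {1..n} (\<lambda>_. lborel)) ?T) (\<lambda>_. ennreal (\<bar>c\<bar> ^ n))) (PiE {1..n} S)
      = (\<Prod>i=1..n. emeasure lborel (S i))"
      using SP by (simp add: emeasure_density_const e mult.assoc[symmetric])
  qed auto
  then have "density (elebesgue n) (\<lambda>_. ennreal (1 / \<bar>c\<bar> ^ n)) =
     density ?P (\<lambda>_. ennreal (1 / \<bar>c\<bar> ^ n))" by simp
  also have "\<dots> = density (distr (elebesgue n) (elebesgue n) ?T) (\<lambda>_. ennreal (\<bar>c\<bar> ^ n) * ennreal (1 / \<bar>c\<bar> ^ n))"
    by (subst density_density_eq) auto
  also have "\<dots> = distr (elebesgue n) (elebesgue n) ?T"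
    using assms by (simp add: ennreal_mult[symmetric] density_1)
  finally show ?thesis by simp
qed

lemma affine_measurable [measurable]:
  "(\<lambda>z. evec n (\<lambda>i. a i + c * z i)) \<in> measurable (elebesgue n) (elebesgue n)"
proof -
  have "(\<lambda>z. \<lambda>i\<in>{1..n}. a i + c * z i) \<in> measurable (elebesgue n) (PiM {1..n} (\<lambda>_. lborel))"
    by (intro measurable_restrict) measurable
  then show ?thesis by (simp add: evec_def elebesgue_def)
qed

lemma nn_integral_affine_elebesgue:
  assumes "c \<noteq> 0" and f [measurable]: "f \<in> borel_measurable (elebesgue n)"
  shows "(\<integral>\<^sup>+z. f (evec n (\<lambda>i. a i + c * z i)) \<partial>elebesgue n) = ennreal (1 / \<bar>c\<bar> ^ n) * (\<integral>\<^sup>+z. f z \<partial>elebesgue n)"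
proof -
  have "(\<integral>\<^sup>+z. f (evec n (\<lambda>i. a i + c * z i)) \<partial>elebesgue n)
    = (\<integral>\<^sup>+z. f z \<partial>distr (elebesgue n) (elebesgue n) (\<lambda>z. evec n (\<lambda>i. a i + c * z i)))"
    by (subst nn_integral_distr) auto
  also have "\<dots> = ennreal (1 / \<bar>c\<bar> ^ n) * (\<integral>\<^sup>+z. f z \<partial>elebesgue n)"
    unfolding distr_affine_elebesgue[OF assms(1)] by (subst nn_integral_density) (auto simp: nn_integral_cmult)
  finally show ?thesis .
qed

lemma integral_affine_elebesgue:
  fixes f :: "vec \<Rightarrow> real"
  assumes "c \<noteq> 0" and f [measurable]: "f \<in> borel_measurable (elebesgue n)"
  shows "(\<integral>z. f (evec n (\<lambda>i. a i + c * z i)) \<partial>elebesgue n) = (1 / \<bar>c\<bar> ^ n) * (\<integral>z. f z \<partial>elebesgue n)"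
proof -
  have "(\<integral>z. f (evec n (\<lambda>i. a i + c * z i)) \<partial>elebesgue n)
    = (\<integral>z. f z \<partial>distr (elebesgue n) (elebesgue n) (\<lambda>z. evec n (\<lambda>i. a i + c * z i)))"
    by (subst integral_distr) auto
  also have "\<dots> = (1 / \<bar>c\<bar> ^ n) * (\<integral>z. f z \<partial>elebesgue n)"
    unfolding distr_affine_elebesgue[OF assms(1)] by (subst integral_density) auto
  finally show ?thesis .
qed

lemma emeasure_euc_cball:
  assumes "r > 0"
  shows "emeasure (elebesgue n) {x\<in>euc n. enorm n x \<le> r} = ennreal (unit_ball_vol n * r ^ n)"
proof -
  have "{f. sqrt (\<Sum>i\<in>{1..n}. (f i)\<^sup>2) \<le> r} \<inter> space (Pi\<^sub>M {1..n} (\<lambda>_. lborel)) = {x\<in>euc n. enorm n x \<le> r}"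
    by (auto simp: enorm_alt euc_def space_PiM)
  then show ?thesis using emeasure_cball_aux[of "{1..n}" r] assms by (simp add: elebesgue_def)
qed

lemma emeasure_ezero_ball:
  assumes "n \<ge> 1"
  shows "emeasure (elebesgue n) {x\<in>euc n. enorm n x \<le> 0} = 0"
proof -
  have m: "{x\<in>euc n. enorm n x \<le> r} \<in> sets (elebesgue n)" for r
  proof -
    have "{x\<in>space (elebesgue n). enorm n x \<le> r} \<in> sets (elebesgue n)" by measurable
    then show ?thesis by simp
  qed
  have "emeasure (elebesgue n) {x\<in>euc n. enorm n x \<le> 0} \<le> ennreal (unit_ball_vol n * r ^ n)" if "r > 0" for r
  proof -
    have "emeasure (elebesgue n) {x\<in>euc n. enorm n x \<le> 0} \<le> emeasure (elebesgue n) {x\<in>euc n. enorm n x \<le> r}"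
      using that m by (intro emeasure_mono) auto
    then show ?thesis using emeasure_euc_cball[OF that] by simp
  qed
  note le = this
  have "((\<lambda>r. ennreal (unit_ball_vol n * r ^ n)) \<longlongrightarrow> ennreal (unit_ball_vol n * 0 ^ n)) (at_right 0)"
    by (intro tendsto_intros)
  then have "((\<lambda>r. ennreal (unit_ball_vol n * r ^ n)) \<longlongrightarrow> 0) (at_right 0)" using assms by (simp add: zero_power)
  then have "emeasure (elebesgue n) {x\<in>euc n. enorm n x \<le> 0} \<le> 0"
    by (rule tendsto_lowerbound) (auto simp: eventually_at_right_less le intro!: eventually_at_rightI[of 0 1])
  then show ?thesis by simp
qed

text \<open>Polar coordinates without a measure on the sphere: the law of the norm is determined by
  the volumes of balls, and its density is the derivative of \<open>unit_ball_vol n * r ^ n\<close>.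
  Closed half-lines form a generating family that is stable under intersection.\<close>

lemma distr_enorm_elebesgue:
  assumes n: "n \<ge> 1"
  shows "distr (elebesgue n) borel (enorm n)
       = density lborel (\<lambda>s. ennreal (n * unit_ball_vol n * s ^ (n - 1)) * indicator {0..} s)"
proof (rule measure_eqI_generator_eq[where E="range atMost" and \<Omega>=UNIV and A="\<lambda>k::nat. {..real k}"])
  show "Int_stable (range atMost :: real set set)" by (auto simp: Int_stable_def)
  show "sets (distr (elebesgue n) borel (enorm n)) = sigma_sets UNIV (range atMost)"
    by (simp add: borel_eq_atMost)
  show "sets (density lborel (\<lambda>s. ennreal (n * unit_ball_vol n * s ^ (n - 1)) * indicator {0..} s)) = sigma_sets UNIV (range atMost)"
    by (simp add: borel_eq_atMost)
  show "(\<Union>i::nat. {..real i}) = UNIV" by (auto intro: real_arch_simple)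
  have L: "emeasure (distr (elebesgue n) borel (enorm n)) {..r} = (if r \<le> 0 then 0 else ennreal (unit_ball_vol n * r ^ n))" for r
  proof -
    have "emeasure (distr (elebesgue n) borel (enorm n)) {..r} = emeasure (elebesgue n) {x\<in>euc n. enorm n x \<le> r}"
      by (subst emeasure_distr) (auto intro!: arg_cong2[where f=emeasure])
    moreover have "{x\<in>euc n. enorm n x \<le> r} = {}" if "r < 0"
      using that enorm_nonneg[of n] by (auto simp: not_le intro: less_le_trans)
    ultimately show ?thesis
      using emeasure_euc_cball[of r n] emeasure_ezero_ball[OF n]
      by (cases "r < 0"; cases "r = 0") auto
  qed
  have R: "emeasure (density lborel (\<lambda>s. ennreal (n * unit_ball_vol n * s ^ (n - 1)) * indicator {0..} s)) {..r}
    = (if r \<le> 0 then 0 else ennreal (unit_ball_vol n * r ^ n))" for r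
  proof -
    have "emeasure (density lborel (\<lambda>s. ennreal (n * unit_ball_vol n * s ^ (n - 1)) * indicator {0..} s)) {..r}
      = (\<integral>\<^sup>+s. ennreal (n * unit_ball_vol n * s ^ (n - 1)) * indicator {0..r} s \<partial>lborel)"
      by (subst emeasure_density) (auto intro!: nn_integral_cong split: split_indicator)
    also have "\<dots> = (if r \<le> 0 then 0 else ennreal (unit_ball_vol n * r ^ n))"
    proof (cases "r > 0")
      case True
      have "(\<integral>\<^sup>+s. ennreal (n * unit_ball_vol n * s ^ (n - 1)) * indicator {0..r} s \<partial>lborel)
        = ennreal (unit_ball_vol n * r ^ n - unit_ball_vol n * 0 ^ n)"
        using True by (intro nn_integral_FTC_Icc) (auto intro!: derivative_eq_intros simp: One_nat_def)
      then show ?thesis using True n by (simp add: zero_power)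
    next
      case False
      have "(\<integral>\<^sup>+s. ennreal (n * unit_ball_vol n * s ^ (n - 1)) * indicator {0..r} s \<partial>lborel) = (\<integral>\<^sup>+s. 0 \<partial>(lborel::real measure))"
        using False by (intro nn_integral_cong_AE AE_I[where N="{0}"]) (auto split: split_indicator)
      then show ?thesis using False by simp
    qed
    finally show ?thesis .
  qed
  show "emeasure (distr (elebesgue n) borel (enorm n)) X =
      emeasure (density lborel (\<lambda>s. ennreal (n * unit_ball_vol n * s ^ (n - 1)) * indicator {0..} s)) X"
    if "X \<in> range atMost" for X using that L R by auto
  show "emeasure (distr (elebesgue n) borel (enorm n)) {..real i} \<noteq> \<infinity>" for i
    by (simp add: L)
qed auto

lemma nn_integral_radial:
  assumes n: "n \<ge> 1" and [measurable]: "h \<in> borel_measurable borel"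
  shows "(\<integral>\<^sup>+y. h (enorm n y) \<partial>elebesgue n) =
         ennreal (n * unit_ball_vol n) * (\<integral>\<^sup>+s. h s * ennreal (s ^ (n - 1)) * indicator {0<..} s \<partial>lborel)"
proof -
  have "(\<integral>\<^sup>+y. h (enorm n y) \<partial>elebesgue n) = (\<integral>\<^sup>+s. h s \<partial>distr (elebesgue n) borel (enorm n))"
    by (subst nn_integral_distr) auto
  also have "\<dots> = (\<integral>\<^sup>+s. (ennreal (n * unit_ball_vol n * s ^ (n - 1)) * indicator {0..} s) * h s \<partial>lborel)"
    unfolding distr_enorm_elebesgue[OF n] by (subst nn_integral_density) auto
  also have "\<dots> = (\<integral>\<^sup>+s. ennreal (n * unit_ball_vol n) * (h s * ennreal (s ^ (n - 1)) * indicator {0<..} s) \<partial>lborel)"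
    by (intro nn_integral_cong_AE AE_I[where N="{0}"])
       (auto split: split_indicator simp: ennreal_mult mult_ac)
  also have "\<dots> = ennreal (n * unit_ball_vol n) * (\<integral>\<^sup>+s. h s * ennreal (s ^ (n - 1)) * indicator {0<..} s \<partial>lborel)"
    by (subst nn_integral_cmult) auto
  finally show ?thesis .
qed

section \<open>Hausdorff measure\<close>

lemma ediam_empty [simp]: "ediam n {} = 0"
  by (simp add: ediam_def bot_ennreal)

lemma ediam_mono: "A \<subseteq> B \<Longrightarrow> ediam n A \<le> ediam n B"
  unfolding ediam_def by (intro SUP_subset_mono) auto

lemma ediam_leI:
  assumes "\<And>x y. x \<in> A \<Longrightarrow> y \<in> A \<Longrightarrow> edist n x y \<le> D"
  shows "ediam n A \<le> ennreal D"
  unfolding ediam_def using assms by (intro SUP_least) (auto intro: ennreal_leI)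

lemma edist_le_ediam: "x \<in> A \<Longrightarrow> y \<in> A \<Longrightarrow> ennreal (edist n x y) \<le> ediam n A"
  unfolding ediam_def by (intro SUP_upper2[of x] SUP_upper2[of y]) auto

definition hcost :: "nat \<Rightarrow> nat \<Rightarrow> vec set \<Rightarrow> ennreal" where
  "hcost n d U = ennreal (unit_ball_vol (real d)) * (ediam n U / 2) ^ d"

definition hcovers :: "nat \<Rightarrow> real \<Rightarrow> vec set \<Rightarrow> (nat \<Rightarrow> vec set) set" where
  "hcovers n \<delta> A = {U. (\<forall>j. U j \<subseteq> euc n \<and> ediam n (U j) \<le> ennreal \<delta>) \<and> A \<subseteq> (\<Union>j. U j)}"

lemma hausdorff_pre_alt: "hausdorff_pre n d \<delta> A = (INF U\<in>hcovers n \<delta> A. \<Sum>j. hcost n d (U j))"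
  by (simp add: hausdorff_pre_def hcost_def hcovers_def)

lemma hcost_mono: "A \<subseteq> B \<Longrightarrow> hcost n d A \<le> hcost n d B"
  unfolding hcost_def
  by (intro mult_left_mono power_mono divide_right_mono_ennreal ediam_mono) auto

lemma hcost_empty: "d \<ge> 1 \<Longrightarrow> hcost n d {} = 0"
  by (simp add: hcost_def zero_power)

lemma hausdorff_pre_empty: "d \<ge> 1 \<Longrightarrow> hausdorff_pre n d \<delta> {} = 0"
proof -
  assume "d \<ge> 1"
  then have "hausdorff_pre n d \<delta> {} \<le> 0"
    unfolding hausdorff_pre_alt
    by (intro INF_lower2[of "\<lambda>_. {}"]) (auto simp: hcovers_def hcost_empty)
  then show ?thesis by simp
qed

lemma hausdorff_pre_mono: "A \<subseteq> B \<Longrightarrow> hausdorff_pre n d \<delta> A \<le> hausdorff_pre n d \<delta> B"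
  unfolding hausdorff_pre_alt by (intro INF_superset_mono) (auto simp: hcovers_def)

lemma hausdorff_pre_antimono: "\<delta> \<le> \<delta>' \<Longrightarrow> hausdorff_pre n d \<delta>' A \<le> hausdorff_pre n d \<delta> A"
  unfolding hausdorff_pre_alt
  by (intro INF_superset_mono) (auto simp: hcovers_def intro: order_trans[OF _ ennreal_leI])

lemma hausdorff_pre_UN:
  fixes A :: "nat \<Rightarrow> vec set"
  shows "hausdorff_pre n d \<delta> (\<Union>i. A i) \<le> (\<Sum>i. hausdorff_pre n d \<delta> (A i))"
proof (rule ennreal_le_epsilon)
  fix e :: real assume e: "0 < e" and fin: "(\<Sum>i. hausdorff_pre n d \<delta> (A i)) < top"
  have lt: "hausdorff_pre n d \<delta> (A i) < top" for i
    by (rule ennreal_suminf_lessD[OF fin])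
  have "\<exists>U\<in>hcovers n \<delta> (A i). (\<Sum>j. hcost n d (U j)) < hausdorff_pre n d \<delta> (A i) + ennreal (e * (1/2) ^ Suc i)" for i
  proof -
    have "hausdorff_pre n d \<delta> (A i) < hausdorff_pre n d \<delta> (A i) + ennreal (e * (1/2) ^ Suc i)"
      using lt[of i] e by (simp add: ennreal_add_left_cancel_less[of _ 0, simplified] ennreal_less_zero_iff)
    then show ?thesis
      by (subst (asm) (1) hausdorff_pre_alt) (simp add: INF_less_iff)
  qed
  then obtain U where U: "\<And>i. U i \<in> hcovers n \<delta> (A i)"
    "\<And>i. (\<Sum>j. hcost n d (U i j)) < hausdorff_pre n d \<delta> (A i) + ennreal (e * (1/2) ^ Suc i)"
    by metis
  define V where "V k = (case prod_decode k of (i, j) \<Rightarrow> U i j)" for k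
  have V: "V \<in> hcovers n \<delta> (\<Union>i. A i)"
    unfolding hcovers_def
  proof (intro CollectI conjI allI)
    fix k show "V k \<subseteq> euc n" "ediam n (V k) \<le> ennreal \<delta>"
      using U(1) by (auto simp: V_def hcovers_def split: prod.splits)
  next
    show "(\<Union>i. A i) \<subseteq> (\<Union>k. V k)"
    proof
      fix x assume "x \<in> (\<Union>i. A i)"
      then obtain i j where "x \<in> U i j" using U(1) by (fastforce simp: hcovers_def)
      then have "x \<in> V (prod_encode (i, j))" by (simp add: V_def)
      then show "x \<in> (\<Union>k. V k)" by blast
    qed
  qed
  have "hausdorff_pre n d \<delta> (\<Union>i. A i) \<le> (\<Sum>k. hcost n d (V k))"
    unfolding hausdorff_pre_alt using V by (rule INF_lower)
  also have "\<dots> = (\<Sum>k. (\<lambda>(i, j). hcost n d (U i j)) (prod_decode k))"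
    by (intro suminf_cong) (simp add: V_def split: prod.splits)
  also have "\<dots> = (\<Sum>i. \<Sum>j. hcost n d (U i j))"
    by (rule suminf_ennreal_2dimen) simp
  also have "\<dots> \<le> (\<Sum>i. hausdorff_pre n d \<delta> (A i) + ennreal (e * (1/2) ^ Suc i))"
    using U(2) by (intro suminf_le) (auto intro: less_imp_le)
  also have "\<dots> = (\<Sum>i. hausdorff_pre n d \<delta> (A i)) + (\<Sum>i. ennreal (e * (1/2) ^ Suc i))"
    by (rule suminf_add[symmetric]) auto
  also have "(\<Sum>i. ennreal (e * (1/2) ^ Suc i)) = ennreal e"
  proof (rule suminf_ennreal_eq)
    show "(\<lambda>i. e * (1/2) ^ Suc i) sums e"
      using sums_mult[OF power_half_series, of e] by simp
  qed (use e in auto)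
  finally show "hausdorff_pre n d \<delta> (\<Union>i. A i) \<le> (\<Sum>i. hausdorff_pre n d \<delta> (A i)) + ennreal e" .
qed

lemma hausdorff_outer_empty: "d \<ge> 1 \<Longrightarrow> hausdorff_outer n d {} = 0"
  by (simp add: hausdorff_outer_def hausdorff_pre_empty)

lemma hausdorff_outer_mono: "A \<subseteq> B \<Longrightarrow> hausdorff_outer n d A \<le> hausdorff_outer n d B"
  unfolding hausdorff_outer_def by (intro SUP_mono) (auto intro: hausdorff_pre_mono)

lemma hausdorff_pre_le_outer: "\<delta> > 0 \<Longrightarrow> hausdorff_pre n d \<delta> A \<le> hausdorff_outer n d A"
  unfolding hausdorff_outer_def by (intro SUP_upper) auto

lemma hausdorff_outer_UN:
  fixes A :: "nat \<Rightarrow> vec set"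
  shows "hausdorff_outer n d (\<Union>i. A i) \<le> (\<Sum>i. hausdorff_outer n d (A i))"
proof -
  have "hausdorff_pre n d \<delta> (\<Union>i. A i) \<le> (\<Sum>i. hausdorff_outer n d (A i))" if "\<delta> > 0" for \<delta>
    by (rule order.trans[OF hausdorff_pre_UN])
       (intro suminf_le hausdorff_pre_le_outer that, auto)
  then show ?thesis unfolding hausdorff_outer_def[of n d "\<Union>i. A i"] by (intro SUP_least) auto
qed

lemma countable_subadd_imp_Un:
  fixes F :: "vec set \<Rightarrow> ennreal"
  assumes "\<And>A :: nat \<Rightarrow> vec set. F (\<Union>i. A i) \<le> (\<Sum>i. F (A i))" "F {} = 0"
  shows "F (A \<union> B) \<le> F A + F B"
proof -
  have "F (A \<union> B) = F (\<Union>i. binaryset A B i)" by (simp add: UN_binaryset_eq)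
  also have "\<dots> \<le> (\<Sum>i. F (binaryset A B i))" by (rule assms)
  also have "\<dots> = F A + F B"
    using suminf_binaryset_eq[of F A B] assms(2) by simp
  finally show ?thesis .
qed

text \<open>A covering set of diameter at most \<delta> < t meets only one of the two sets, so a
  cover of the union splits into two covers without extra cost.\<close>

lemma hausdorff_pre_separated:
  assumes d: "d \<ge> 1" and t: "0 < \<delta>" "\<delta> < t"
    and sep: "\<And>x y. x \<in> A \<Longrightarrow> y \<in> B \<Longrightarrow> t \<le> edist n x y"
  shows "hausdorff_pre n d \<delta> A + hausdorff_pre n d \<delta> B \<le> hausdorff_pre n d \<delta> (A \<union> B)"
proof -
  have "hausdorff_pre n d \<delta> A + hausdorff_pre n d \<delta> B \<le> (\<Sum>j. hcost n d (U j))"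
    if U: "U \<in> hcovers n \<delta> (A \<union> B)" for U
  proof -
    have "(\<lambda>j. U j \<inter> C) \<in> hcovers n \<delta> C" if "C = A \<or> C = B" for C
      using U that by (auto simp: hcovers_def intro: order_trans[OF ediam_mono[OF Int_lower1]])
    then have "hausdorff_pre n d \<delta> A + hausdorff_pre n d \<delta> B
      \<le> (\<Sum>j. hcost n d (U j \<inter> A)) + (\<Sum>j. hcost n d (U j \<inter> B))"
      unfolding hausdorff_pre_alt by (intro add_mono INF_lower) auto
    also have "\<dots> = (\<Sum>j. hcost n d (U j \<inter> A) + hcost n d (U j \<inter> B))"
      by (rule suminf_add) auto
    also have "\<dots> \<le> (\<Sum>j. hcost n d (U j))"
    proof (rule suminf_le)
      fix j
      have "U j \<inter> A = {} \<or> U j \<inter> B = {}"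
      proof (rule ccontr)
        assume "\<not> ?thesis"
        then obtain x y where xy: "x \<in> U j" "x \<in> A" "y \<in> U j" "y \<in> B" by blast
        have "ennreal (edist n x y) \<le> ennreal \<delta>"
          using edist_le_ediam[OF xy(1,3), of n] U by (auto simp: hcovers_def intro: order_trans)
        then have "edist n x y \<le> \<delta>" using t by (simp add: ennreal_le_iff)
        then show False using sep[OF xy(2,4)] t by simp
      qed
      then show "hcost n d (U j \<inter> A) + hcost n d (U j \<inter> B) \<le> hcost n d (U j)"
        by (auto simp: hcost_empty[OF d] intro: hcost_mono)
    qed auto
    finally show ?thesis .
  qed
  then show ?thesis unfolding hausdorff_pre_alt[of n d \<delta> "A \<union> B"] by (intro INF_greatest) auto
qed

lemma hausdorff_outer_separated:
  assumes d: "d \<ge> 1" and t: "0 < t"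
    and sep: "\<And>x y. x \<in> A \<Longrightarrow> y \<in> B \<Longrightarrow> t \<le> edist n x y"
  shows "hausdorff_outer n d A + hausdorff_outer n d B \<le> hausdorff_outer n d (A \<union> B)"
proof -
  have 1: "hausdorff_pre n d \<delta> A + hausdorff_pre n d \<delta>' B \<le> hausdorff_outer n d (A \<union> B)"
    if "\<delta> > 0" "\<delta>' > 0" for \<delta> \<delta>'
  proof -
    \<comment> \<open>Additivity is available only at scales below the distance t. Shrinking the
      scale increases both premeasures, so one may pass to a common small scale.\<close>
    define m where "m = min (min \<delta> \<delta>') (t / 2)"
    have "hausdorff_pre n d \<delta> A + hausdorff_pre n d \<delta>' B \<le> hausdorff_pre n d m A + hausdorff_pre n d m B"
      by (intro add_mono hausdorff_pre_antimono) (auto simp: m_def)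
    also have "\<dots> \<le> hausdorff_pre n d m (A \<union> B)"
      using that t by (intro hausdorff_pre_separated[OF d _ _ sep]) (auto simp: m_def)
    also have "\<dots> \<le> hausdorff_outer n d (A \<union> B)"
      using that t by (intro hausdorff_pre_le_outer) (auto simp: m_def)
    finally show ?thesis .
  qed
  have 2: "hausdorff_pre n d \<delta> A + hausdorff_outer n d B \<le> hausdorff_outer n d (A \<union> B)" if "\<delta> > 0" for \<delta>
  proof -
    have "hausdorff_pre n d \<delta> A + hausdorff_outer n d B = (SUP \<delta>'\<in>{0<..}. hausdorff_pre n d \<delta> A + hausdorff_pre n d \<delta>' B)"
      unfolding hausdorff_outer_def by (rule ennreal_SUP_add_right) auto
    then show ?thesis using 1[OF that] by (auto intro!: SUP_least)
  qed
  have "hausdorff_outer n d A + hausdorff_outer n d B = (SUP \<delta>\<in>{0<..}. hausdorff_pre n d \<delta> A + hausdorff_outer n d B)"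
    unfolding hausdorff_outer_def[of n d A] by (rule ennreal_SUP_add_left[symmetric]) auto
  then show ?thesis using 2 by (auto intro!: SUP_least)
qed

text \<open>
  Caratheodory's criterion, by cutting the open side of the half-space into slabs: every second
  slab has positive distance from the others, which makes the measures of the slabs summable.
\<close>

lemma hausdorff_outer_halfspace:
  assumes d: "d \<ge> 1" and i: "i \<in> {1..n}"
  shows "hausdorff_outer n d {x\<in>X. x i \<le> a} + hausdorff_outer n d {x\<in>X. x i > a} \<le> hausdorff_outer n d X"
proof (rule ennreal_le_epsilon)
  let ?H = "hausdorff_outer n d"
  fix e :: real assume e: "e > 0" and fin: "?H X < top"
  define D where "D k = {x\<in>X. x i > a + 1 / real (Suc k)}" for k
  define R where "R k = {x\<in>X. a + 1 / real (Suc (Suc k)) < x i \<and> x i \<le> a + 1 / real (Suc k)}" for k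
  define Q where "Q = {x\<in>X. x i \<le> a}"
  define P where "P = {x\<in>X. x i > a}"
  have dist: "x i - y i \<le> edist n x y" for x y
    using abs_coord_le_enorm[OF i, of "\<lambda>i. x i - y i"] by (simp add: edist_def)
  have sub: "?H (\<Union>i. A i) \<le> (\<Sum>i. ?H (A i))" for A :: "nat \<Rightarrow> vec set" by (rule hausdorff_outer_UN)
  have QD: "?H Q + ?H (D k) \<le> ?H X" for k
  proof -
    have "?H (D k) + ?H Q \<le> ?H (D k \<union> Q)"
    proof (rule hausdorff_outer_separated[OF d])
      show "0 < 1 / real (Suc k)" by simp
      fix x y assume "x \<in> D k" "y \<in> Q"
      then show "1 / real (Suc k) \<le> edist n x y" using dist[of x y] by (auto simp: D_def Q_def)
    qed
    also have "\<dots> \<le> ?H X" by (intro hausdorff_outer_mono) (auto simp: D_def Q_def)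
    finally show ?thesis by (simp add: add.commute)
  qed
  have alt: "(\<Sum>k<m. ?H (R (2 * k + c))) \<le> ?H (\<Union>k<m. R (2 * k + c))" for m c
  proof (induction m)
    case (Suc m)
    have "?H (\<Union>k<m. R (2 * k + c)) + ?H (R (2 * m + c)) \<le> ?H ((\<Union>k<m. R (2 * k + c)) \<union> R (2 * m + c))"
    proof (cases "m = 0")
      case True
      then show ?thesis by (simp add: hausdorff_outer_empty[OF d])
    next
      case False
      define t where "t = 1 / real (2 * m + c) - 1 / real (Suc (2 * m + c))"
      show ?thesis
      proof (rule hausdorff_outer_separated[OF d])
        have "1 / real (Suc (2 * m + c)) < 1 / real (2 * m + c)"
          using False by (intro divide_strict_left_mono) auto
        then show "0 < t" by (simp add: t_def)
        fix x y assume xy: "x \<in> (\<Union>k<m. R (2 * k + c))" "y \<in> R (2 * m + c)"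
        then obtain k where k: "k < m" "x \<in> R (2 * k + c)" by auto
        have "1 / real (2 * m + c) \<le> 1 / real (Suc (Suc (2 * k + c)))"
          using k(1) by (intro divide_left_mono) auto
        then have "x i - y i \<ge> t" using k(2) xy(2) by (auto simp: R_def t_def)
        then show "t \<le> edist n x y" using dist[of x y] by simp
      qed
    qed
    then have "(\<Sum>k<m. ?H (R (2 * k + c))) + ?H (R (2 * m + c)) \<le> ?H ((\<Union>k<m. R (2 * k + c)) \<union> R (2 * m + c))"
      using Suc by (meson add_right_mono order_trans)
    then show ?case by (simp add: lessThan_Suc Un_commute add.commute)
  qed simp
  have alt2: "(\<Sum>k<m. ?H (R (2 * k + c))) \<le> ?H X" for m c
    by (rule order.trans[OF alt hausdorff_outer_mono]) (auto simp: R_def)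
  have par: "(\<Sum>k<2 * m. ?H (R k)) = (\<Sum>k<m. ?H (R (2 * k + 0))) + (\<Sum>k<m. ?H (R (2 * k + 1)))" for m
    by (induction m) (simp_all add: ac_simps One_nat_def)
  have "(\<Sum>k<m. ?H (R k)) \<le> ?H X + ?H X" for m
  proof -
    have "(\<Sum>k<m. ?H (R k)) \<le> (\<Sum>k<2 * m. ?H (R k))" by (intro sum_mono2) auto
    also have "\<dots> \<le> ?H X + ?H X" unfolding par by (intro add_mono alt2)
    finally show ?thesis .
  qed
  then have "(\<Sum>k. ?H (R k)) \<le> ?H X + ?H X"
    by (auto simp: suminf_eq_SUP intro!: SUP_least)
  also have "\<dots> < top" using fin by simp
  finally have sfin: "(\<Sum>k. ?H (R k)) < top" .
  define r where "r k = enn2real (?H (R k))" for k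
  have r: "?H (R k) = ennreal (r k)" for k
    using ennreal_suminf_lessD[OF sfin, of k] by (simp add: r_def)
  have r0: "r k \<ge> 0" for k by (simp add: r_def)
  have "summable r"
    using sfin r0 unfolding r by (intro summable_suminf_not_top) auto
  obtain k where k: "norm (\<Sum>j. r (j + k)) < e"
    using suminf_exist_split[OF e \<open>summable r\<close>] by auto
  have "P \<subseteq> D k \<union> (\<Union>j. R (j + k))"
  proof
    fix x assume x: "x \<in> P"
    show "x \<in> D k \<union> (\<Union>j. R (j + k))"
    proof (cases "x \<in> D k")
      case False
      have "\<exists>m. 1 / real (Suc m) < x i - a" using x reals_Archimedean[of "x i - a"] by (auto simp: P_def inverse_eq_divide)
      then have ex: "\<exists>m. x \<in> D m" using x by (auto simp: D_def P_def algebra_simps)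
      define m where "m = (LEAST m. x \<in> D m)"
      have m: "x \<in> D m" unfolding m_def using ex by (rule LeastI_ex)
      have mk: "\<not> m \<le> k"
      proof
        assume "m \<le> k"
        then have "1 / real (Suc k) \<le> 1 / real (Suc m)" by (intro divide_left_mono) auto
        then show False using m False by (auto simp: D_def)
      qed
      then obtain m' where m': "m = Suc m'" "m' \<ge> k" by (cases m) auto
      have "x \<notin> D m'" using m' not_less_Least[of m' "\<lambda>m. x \<in> D m"] by (auto simp: m_def)
      then have "x \<in> R m'" using m m' x by (auto simp: D_def R_def)
      then have "x \<in> R ((m' - k) + k)" using m' by simp
      then show ?thesis by blast
    qed simp
  qed
  then have "?H P \<le> ?H (D k \<union> (\<Union>j. R (j + k)))" by (rule hausdorff_outer_mono)
  also have "\<dots> \<le> ?H (D k) + ?H (\<Union>j. R (j + k))"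
    by (rule countable_subadd_imp_Un[OF sub hausdorff_outer_empty[OF d]])
  also have "?H (\<Union>j. R (j + k)) \<le> (\<Sum>j. ?H (R (j + k)))" by (rule sub)
  also have "\<dots> = ennreal (\<Sum>j. r (j + k))"
    unfolding r using r0 \<open>summable r\<close> by (intro suminf_ennreal2) (auto simp: summable_iff_shift)
  also have "\<dots> \<le> ennreal e" using k by (intro ennreal_leI) auto
  finally have "?H P \<le> ?H (D k) + ennreal e" by (simp add: add_left_mono)
  then have "?H Q + ?H P \<le> (?H Q + ?H (D k)) + ennreal e" by (simp add: add.assoc add_left_mono)
  also have "\<dots> \<le> ?H X + ennreal e" by (intro add_right_mono QD)
  finally show "?H {x\<in>X. x i \<le> a} + ?H {x\<in>X. x i > a} \<le> ?H X + ennreal e"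
    by (simp add: Q_def P_def)
qed

lemma hausdorff_outer_measure_space:
  assumes d: "d \<ge> 1"
  shows "outer_measure_space (Pow (euc n)) (hausdorff_outer n d)"
  unfolding outer_measure_space_def positive_def increasing_def countably_subadditive_def
  by (auto simp: hausdorff_outer_empty[OF d] intro: hausdorff_outer_mono hausdorff_outer_UN)

text \<open>A definition through \<open>measure_of\<close> silently yields the zero measure unless
  the given function is countably additive on the sigma-algebra. Half-spaces satisfy Caratheodory's
  condition, hence the coordinates are measurable for the Caratheodory sigma-algebra, which
  therefore contains the product sigma-algebra.\<close>

lemma hausdorff_measure:
  assumes d: "d \<ge> 1"
  shows "sets (hausdorff n d) = sets (elebesgue n)" "space (hausdorff n d) = euc n"
    "A \<in> sets (elebesgue n) \<Longrightarrow> emeasure (hausdorff n d) A = hausdorff_outer n d A"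
proof -
  have sp: "space (PiM {1..n} (\<lambda>_. borel :: real measure)) = euc n" by (simp add: space_PiM euc_def)
  interpret P: sigma_algebra "euc n" "Pow (euc n)" by (rule sigma_algebra_Pow)
  define L where "L = lambda_system (euc n) (Pow (euc n)) (hausdorff_outer n d)"
  have ms: "measure_space (euc n) L (hausdorff_outer n d)"
    unfolding L_def by (rule P.caratheodory_lemma[OF hausdorff_outer_measure_space[OF d]])
  then have sL: "sigma_algebra (euc n) L" by (simp add: measure_space_def)
  define M' where "M' = measure_of (euc n) L (hausdorff_outer n d)"
  have M': "sets M' = L" "space M' = euc n"
    unfolding M'_def using sL by (simp_all add: sigma_algebra.sets_measure_of_eq sigma_algebra.space_measure_of_eq)
  have coord: "(\<lambda>x. x i) \<in> borel_measurable M'" if i: "i \<in> {1..n}" for i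
    unfolding borel_measurable_iff_le M'
  proof
    fix a
    have "{w \<in> euc n. w i \<le> a} \<in> L"
      unfolding L_def lambda_system_def
    proof (intro CollectI conjI ballI)
      fix X assume X: "X \<in> Pow (euc n)"
      have 1: "{w \<in> euc n. w i \<le> a} \<inter> X = {x\<in>X. x i \<le> a}" "(euc n - {w \<in> euc n. w i \<le> a}) \<inter> X = {x\<in>X. x i > a}"
        using X by auto
      have "hausdorff_outer n d X = hausdorff_outer n d ({x\<in>X. x i \<le> a} \<union> {x\<in>X. x i > a})"
        by (intro arg_cong[where f="hausdorff_outer n d"]) auto
      also have "\<dots> \<le> hausdorff_outer n d {x\<in>X. x i \<le> a} + hausdorff_outer n d {x\<in>X. x i > a}"
        by (rule countable_subadd_imp_Un[OF hausdorff_outer_UN hausdorff_outer_empty[OF d]])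
      finally show "hausdorff_outer n d ({w \<in> euc n. w i \<le> a} \<inter> X) + hausdorff_outer n d ((euc n - {w \<in> euc n. w i \<le> a}) \<inter> X) =
         hausdorff_outer n d X"
        unfolding 1 by (intro antisym hausdorff_outer_halfspace[OF d i])
    qed auto
    then show "{w \<in> euc n. w i \<le> a} \<in> L" .
  qed
  have sub: "sets (PiM {1..n} (\<lambda>_. borel :: real measure)) \<subseteq> L"
    unfolding sets_PiM_single
  proof (rule sigma_algebra.sigma_sets_subset)
    show "sigma_algebra (\<Pi>\<^sub>E i\<in>{1..n}. space borel) L" using sL by (simp add: euc_def)
    show "{{f \<in> \<Pi>\<^sub>E i\<in>{1..n}. space borel. f i \<in> A} |i A. i \<in> {1..n} \<and> A \<in> sets (borel :: real measure)} \<subseteq> L"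
    proof safe
      fix i A assume i: "i \<in> {1..n}" and A: "A \<in> sets (borel :: real measure)"
      have "(\<lambda>x. x i) -` A \<inter> space M' \<in> sets M'" by (rule measurable_sets[OF coord[OF i] A])
      moreover have "(\<lambda>x. x i) -` A \<inter> space M' = {f \<in> \<Pi>\<^sub>E i\<in>{1..n}. space borel. f i \<in> A}"
        by (auto simp: M' euc_def)
      ultimately show "{f \<in> \<Pi>\<^sub>E i\<in>{1..n}. space borel. f i \<in> A} \<in> L" by (simp add: M')
    qed
  qed
  have sig: "sigma_algebra (euc n) (sets (PiM {1..n} (\<lambda>_. borel :: real measure)))"
    using sets.sigma_algebra_axioms[of "PiM {1..n} (\<lambda>_. borel :: real measure)"] by (simp add: sp)
  show 1: "sets (hausdorff n d) = sets (elebesgue n)" "space (hausdorff n d) = euc n"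
    unfolding hausdorff_def sets_elebesgue using sig
    by (simp_all add: sigma_algebra.sets_measure_of_eq sigma_algebra.space_measure_of_eq)
  assume A: "A \<in> sets (elebesgue n)"
  have pos: "positive (sets (hausdorff n d)) (hausdorff_outer n d)"
    by (simp add: positive_def hausdorff_outer_empty[OF d])
  have ca: "countably_additive (sets (hausdorff n d)) (hausdorff_outer n d)"
    using ms sub unfolding measure_space_def countably_additive_def 1 sets_elebesgue by blast
  show "emeasure (hausdorff n d) A = hausdorff_outer n d A"
    by (rule emeasure_measure_of[OF hausdorff_def _ pos ca])
       (use A sets.sets_into_space[of _ "PiM {1..n} (\<lambda>_. borel :: real measure)"] in \<open>auto simp: sp 1\<close>)
qed

text \<open>Applied to translations, to the vertical projection with l = 1, and to the graph map. As
  f is Lipschitz only on A, the sets of a cover are first cut down to A; the change of scale from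
  \<delta> to \<open>\<delta> / l\<close> disappears in the supremum over all scales.\<close>

lemma hausdorff_outer_lipschitz_image:
  assumes l: "l > 0" and d: "d \<ge> 1"
    and f: "\<And>x. x \<in> A \<Longrightarrow> f x \<in> euc m"
    and lip: "\<And>x y. x \<in> A \<Longrightarrow> y \<in> A \<Longrightarrow> edist m (f x) (f y) \<le> l * edist n x y"
  shows "hausdorff_outer m d (f ` A) \<le> ennreal (l ^ d) * hausdorff_outer n d A"
  unfolding hausdorff_outer_def[of m]
proof (rule SUP_least)
  fix \<delta> :: real assume "\<delta> \<in> {0<..}"
  then have \<delta>: "\<delta> > 0" by simp
  have diam: "ediam m (f ` (U \<inter> A)) \<le> ennreal l * ediam n U" for U
    unfolding ediam_def[of m]
  proof (intro SUP_least)
    fix x y assume "x \<in> f ` (U \<inter> A)" "y \<in> f ` (U \<inter> A)"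
    then obtain a b where ab: "a \<in> U" "a \<in> A" "b \<in> U" "b \<in> A" "x = f a" "y = f b" by auto
    have "ennreal (edist m x y) \<le> ennreal (l * edist n a b)" using ab lip by (intro ennreal_leI) auto
    also have "\<dots> = ennreal l * ennreal (edist n a b)" using l by (simp add: ennreal_mult)
    also have "\<dots> \<le> ennreal l * ediam n U" using ab by (intro mult_left_mono edist_le_ediam) auto
    finally show "ennreal (edist m x y) \<le> ennreal l * ediam n U" .
  qed
  have cost: "hcost m d (f ` (U \<inter> A)) \<le> ennreal (l ^ d) * hcost n d U" for U
  proof -
    have "(ediam m (f ` (U \<inter> A)) / 2) ^ d \<le> (ennreal l * ediam n U / 2) ^ d"
      by (intro power_mono divide_right_mono_ennreal diam) auto
    also have "\<dots> = ennreal (l ^ d) * (ediam n U / 2) ^ d"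
      using l by (simp add: ennreal_times_divide[symmetric] power_mult_distrib ennreal_power)
    finally show ?thesis unfolding hcost_def
      by (metis (no_types, lifting) mult.left_commute mult_left_mono zero_le)
  qed
  have "hausdorff_pre m d \<delta> (f ` A) \<le> ennreal (l ^ d) * hausdorff_pre n d (\<delta> / l) A"
  proof -
    have "hausdorff_pre m d \<delta> (f ` A) \<le> ennreal (l ^ d) * (\<Sum>j. hcost n d (U j))"
      if U: "U \<in> hcovers n (\<delta> / l) A" for U
    proof -
      have "(\<lambda>j. f ` (U j \<inter> A)) \<in> hcovers m \<delta> (f ` A)"
        unfolding hcovers_def
      proof (intro CollectI conjI allI)
        fix j
        show "f ` (U j \<inter> A) \<subseteq> euc m" using f by auto
        have "ediam m (f ` (U j \<inter> A)) \<le> ennreal l * ediam n (U j)" by (rule diam)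
        also have "\<dots> \<le> ennreal l * ennreal (\<delta> / l)" using U by (intro mult_left_mono) (auto simp: hcovers_def)
        also have "\<dots> = ennreal \<delta>" using l \<delta> by (simp add: ennreal_mult[symmetric])
        finally show "ediam m (f ` (U j \<inter> A)) \<le> ennreal \<delta>" .
      next
        show "f ` A \<subseteq> (\<Union>j. f ` (U j \<inter> A))" using U by (fastforce simp: hcovers_def)
      qed
      then have "hausdorff_pre m d \<delta> (f ` A) \<le> (\<Sum>j. hcost m d (f ` (U j \<inter> A)))"
        unfolding hausdorff_pre_alt by (rule INF_lower)
      also have "\<dots> \<le> (\<Sum>j. ennreal (l ^ d) * hcost n d (U j))"
        by (intro suminf_le cost) auto
      finally show ?thesis by simp
    qed
    note le = this
    have inv: "ennreal (1 / l ^ d) * ennreal (l ^ d) = 1" "ennreal (l ^ d) * ennreal (1 / l ^ d) = 1"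
      using l by (simp_all add: ennreal_mult[symmetric])
    have "ennreal (1 / l ^ d) * hausdorff_pre m d \<delta> (f ` A) \<le> hausdorff_pre n d (\<delta> / l) A"
      unfolding hausdorff_pre_alt[of n]
    proof (rule INF_greatest)
      fix U assume U: "U \<in> hcovers n (\<delta> / l) A"
      have "ennreal (1 / l ^ d) * hausdorff_pre m d \<delta> (f ` A) \<le> ennreal (1 / l ^ d) * (ennreal (l ^ d) * (\<Sum>j. hcost n d (U j)))"
        by (intro mult_left_mono le U) auto
      then show "ennreal (1 / l ^ d) * hausdorff_pre m d \<delta> (f ` A) \<le> (\<Sum>j. hcost n d (U j))"
        by (simp add: mult.assoc[symmetric] inv)
    qed
    then have "ennreal (l ^ d) * (ennreal (1 / l ^ d) * hausdorff_pre m d \<delta> (f ` A)) \<le> ennreal (l ^ d) * hausdorff_pre n d (\<delta> / l) A"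
      by (intro mult_left_mono) auto
    then show ?thesis by (simp add: mult.assoc[symmetric] inv)
  qed
  also have "\<dots> \<le> ennreal (l ^ d) * hausdorff_outer n d A"
    using l \<delta> by (intro mult_left_mono hausdorff_pre_le_outer) auto
  finally show "hausdorff_pre m d \<delta> (f ` A) \<le> ennreal (l ^ d) * hausdorff_outer n d A" .
qed

section \<open>The isodiametric inequality\<close>

lemma edist_leI:
  assumes "i \<in> {1..d}" "0 \<le> D" "(x i - y i)\<^sup>2 + (\<Sum>j\<in>{1..d}-{i}. (x j - y j)\<^sup>2) \<le> D\<^sup>2"
  shows "edist d x y \<le> D"
proof -
  have "(edist d x y)\<^sup>2 = (x i - y i)\<^sup>2 + (\<Sum>j\<in>{1..d}-{i}. (x j - y j)\<^sup>2)"
    unfolding edist_def enorm_power2 by (rule sum.remove) (use assms(1) in auto)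
  then have "(edist d x y)\<^sup>2 \<le> D\<^sup>2" using assms(3) by simp
  then show ?thesis by (rule power2_le_imp_le) (rule assms(2))
qed

text \<open>Steiner symmetrisation: every line in direction i keeps the length of its section,
  rearranged as an open interval centred at 0. The strict inequality leaves the new section empty
  when the old one is null, so a point of the result always comes with points of A on the same
  line.\<close>

definition steiner :: "nat \<Rightarrow> nat \<Rightarrow> vec set \<Rightarrow> vec set" where
  "steiner d i A = {x\<in>euc d. ennreal (2 * \<bar>x i\<bar>) < emeasure lborel {t. x(i := t) \<in> A}}"

lemma section_measurable:
  assumes i: "i \<in> {1..d}" and A: "A \<in> sets (elebesgue d)"
  shows "(\<lambda>x. emeasure lborel {t. x(i := t) \<in> A}) \<in> borel_measurable (elebesgue d)"
proof -
  have ins: "insert i {1..d} = {1..d}" using i by auto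
  have 1: "(\<lambda>(f, y). f(i := y)) \<in> measurable (elebesgue d \<Otimes>\<^sub>M lborel) (elebesgue d)"
    using measurable_add_dim[of i "{1..d}" "\<lambda>_. lborel :: real measure"] unfolding ins elebesgue_def .
  let ?Q = "(\<lambda>(f, y). f(i := y)) -` A \<inter> space (elebesgue d \<Otimes>\<^sub>M lborel)"
  have "?Q \<in> sets (elebesgue d \<Otimes>\<^sub>M lborel)" by (rule measurable_sets[OF 1 A])
  from lborel.measurable_emeasure_Pair[OF this]
  have "(\<lambda>x. emeasure lborel (Pair x -` ?Q)) \<in> borel_measurable (elebesgue d)" .
  then show ?thesis
    by (rule measurable_cong[THEN iffD1, rotated])
       (auto simp: space_pair_measure intro!: arg_cong2[where f=emeasure])
qed

lemma steiner_measurable: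
  assumes i: "i \<in> {1..d}" and A: "A \<in> sets (elebesgue d)"
  shows "steiner d i A \<in> sets (elebesgue d)"
proof -
  note section_measurable[OF assms, measurable]
  have [measurable]: "(\<lambda>x. x i) \<in> borel_measurable (elebesgue d)" using i by measurable
  have "{x\<in>space (elebesgue d). ennreal (2 * \<bar>x i\<bar>) < emeasure lborel {t. x(i := t) \<in> A}} \<in> sets (elebesgue d)"
    by measurable
  then show ?thesis by (simp add: steiner_def)
qed

lemma emeasure_centered: "emeasure lborel {y::real. ennreal (2 * \<bar>y\<bar>) < M} = M"
proof (cases M)
  case (real r)
  then have "{y. ennreal (2 * \<bar>y\<bar>) < M} = {-(r/2)<..<r/2}" by (auto simp: ennreal_less_iff)
  then show ?thesis using real by simp
next
  case top
  then show ?thesis by simp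
qed

lemma emeasure_by_sections:
  assumes i: "i \<in> {1..d}" and A: "A \<in> sets (elebesgue d)"
  shows "emeasure (elebesgue d) A = (\<integral>\<^sup>+x. emeasure lborel {t. x(i := t) \<in> A} \<partial>PiM ({1..d}-{i}) (\<lambda>_. lborel))"
proof -
  have ins: "insert i ({1..d}-{i}) = {1..d}" using i by auto
  have "emeasure (elebesgue d) A = (\<integral>\<^sup>+x. indicator A x \<partial>PiM (insert i ({1..d}-{i})) (\<lambda>_. lborel))"
    using A unfolding ins elebesgue_def by simp
  also have "\<dots> = (\<integral>\<^sup>+x. \<integral>\<^sup>+y. indicator A (x(i := y)) \<partial>lborel \<partial>PiM ({1..d}-{i}) (\<lambda>_. lborel))"
  proof (rule lb.product_nn_integral_insert)
    show "indicator A \<in> borel_measurable (PiM (insert i ({1..d}-{i})) (\<lambda>_. lborel :: real measure))"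
      using A unfolding ins elebesgue_def by simp
  qed auto
  also have "\<dots> = (\<integral>\<^sup>+x. emeasure lborel {t. x(i := t) \<in> A} \<partial>PiM ({1..d}-{i}) (\<lambda>_. lborel))"
  proof (intro nn_integral_cong)
    fix x assume x: "x \<in> space (PiM ({1..d}-{i}) (\<lambda>_. lborel :: real measure))"
    have "(\<lambda>y. x(i := y)) \<in> measurable lborel (PiM (insert i ({1..d}-{i})) (\<lambda>_. lborel))"
      using measurable_component_update[OF x, of i] by simp
    then have "(\<lambda>y. x(i := y)) -` A \<inter> space lborel \<in> sets lborel"
      using A unfolding ins elebesgue_def by (rule measurable_sets)
    then have m: "{y. x(i := y) \<in> A} \<in> sets borel" by (simp add: vimage_def)
    have "(\<integral>\<^sup>+y. indicator A (x(i := y)) \<partial>lborel) = (\<integral>\<^sup>+y. indicator {y. x(i := y) \<in> A} y \<partial>lborel)"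
      by (intro nn_integral_cong) (auto split: split_indicator)
    then show "(\<integral>\<^sup>+y. indicator A (x(i := y)) \<partial>lborel) = emeasure lborel {t. x(i := t) \<in> A}"
      using m by simp
  qed
  finally show ?thesis .
qed

lemma emeasure_steiner:
  assumes i: "i \<in> {1..d}" and A: "A \<in> sets (elebesgue d)"
  shows "emeasure (elebesgue d) (steiner d i A) = emeasure (elebesgue d) A"
  unfolding emeasure_by_sections[OF i steiner_measurable[OF i A]] emeasure_by_sections[OF i A]
proof (intro nn_integral_cong)
  fix x assume x: "x \<in> space (PiM ({1..d}-{i}) (\<lambda>_. lborel :: real measure))"
  then have "x(i := t) \<in> euc d" for t
    using i by (auto simp: space_PiM euc_def PiE_def extensional_def)
  then have "{t. x(i := t) \<in> steiner d i A} = {t. ennreal (2 * \<bar>t\<bar>) < emeasure lborel {t. x(i := t) \<in> A}}"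
    by (simp add: steiner_def)
  then show "emeasure lborel {t. x(i := t) \<in> steiner d i A} = emeasure lborel {t. x(i := t) \<in> A}"
    by (simp add: emeasure_centered)
qed

text \<open>On two parallel lines at squared distance h the sections S and T satisfy Sup S - Inf T
  \<le> \<tau> and Sup T - Inf S \<le> \<tau>. Adding these, the two lengths sum to at most 2
  \<tau>. The heights of x and y are at most half the lengths of their sections, so they differ by
  at most \<tau>.\<close>

lemma steiner_diam:
  assumes i: "i \<in> {1..d}" and D: "\<And>x y. x \<in> A \<Longrightarrow> y \<in> A \<Longrightarrow> edist d x y \<le> D"
    and xy: "x \<in> steiner d i A" "y \<in> steiner d i A"
  shows "edist d x y \<le> D"
proof -
  define S where "S = {t. x(i := t) \<in> A}"
  define T where "T = {t. y(i := t) \<in> A}"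
  define h where "h = (\<Sum>j\<in>{1..d}-{i}. (x j - y j)\<^sup>2)"
  have mS: "ennreal (2 * \<bar>x i\<bar>) < emeasure lborel S" and mT: "ennreal (2 * \<bar>y i\<bar>) < emeasure lborel T"
    using xy by (auto simp: steiner_def S_def T_def)
  then obtain s0 t0 where s0: "s0 \<in> S" and t0: "t0 \<in> T" by (metis emeasure_empty ex_in_conv not_less_zero)
  have ST: "(s - t)\<^sup>2 + h \<le> D\<^sup>2" if "s \<in> S" "t \<in> T" for s t
  proof -
    have "edist d (x(i := s)) (y(i := t)) \<le> D" using that D by (auto simp: S_def T_def)
    then have "(edist d (x(i := s)) (y(i := t)))\<^sup>2 \<le> D\<^sup>2" by (intro power_mono) auto
    also have "(edist d (x(i := s)) (y(i := t)))\<^sup>2 = (s - t)\<^sup>2 + h"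
    proof -
      have "(edist d (x(i := s)) (y(i := t)))\<^sup>2 =
        ((x(i := s)) i - (y(i := t)) i)\<^sup>2 + (\<Sum>j\<in>{1..d}-{i}. ((x(i := s)) j - (y(i := t)) j)\<^sup>2)"
        unfolding edist_def enorm_power2 by (rule sum.remove) (use i in auto)
      also have "(\<Sum>j\<in>{1..d}-{i}. ((x(i := s)) j - (y(i := t)) j)\<^sup>2) = h"
        unfolding h_def by (intro sum.cong) auto
      finally show ?thesis by (simp only: fun_upd_same)
    qed
    finally show ?thesis .
  qed
  \<comment> \<open>The height difference left for two points at distance D when the other
    coordinates contribute h.\<close>
  define \<tau> where "\<tau> = sqrt (D\<^sup>2 - h)"
  have Dh: "D\<^sup>2 - h \<ge> 0" using ST[OF s0 t0] by (smt (verit) zero_le_power2)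
  have D0: "D \<ge> 0" using D[of "x(i := s0)" "x(i := s0)"] s0 by (simp add: S_def)
  have bd: "s - t \<le> \<tau>" "t - s \<le> \<tau>" if "s \<in> S" "t \<in> T" for s t
    using ST[OF that] abs_le_square_iff[of "s - t" \<tau>] Dh by (auto simp: \<tau>_def real_le_rsqrt power2_commute)
  have bS: "bdd_above S" "bdd_below S" and bT: "bdd_above T" "bdd_below T"
    using bd[OF _ t0] bd[OF s0]
    by (auto intro!: bdd_aboveI[of S "t0 + \<tau>"] bdd_belowI[of S "t0 - \<tau>"] bdd_aboveI[of T "s0 + \<tau>"] bdd_belowI[of T "s0 - \<tau>"] simp: algebra_simps)
  have len: "2 * \<bar>z\<bar> < Sup U - Inf U" if "ennreal (2 * \<bar>z\<bar>) < emeasure lborel U" "bdd_above U" "bdd_below U" "u \<in> U"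
    for z u and U :: "real set"
  proof -
    have sub: "U \<subseteq> {Inf U..Sup U}" using that by (auto intro: cInf_lower cSup_upper)
    have le: "Inf U \<le> Sup U" using sub that(4) by fastforce
    have "emeasure lborel U \<le> emeasure lborel {Inf U..Sup U}" using sub by (intro emeasure_mono) auto
    then have "ennreal (2 * \<bar>z\<bar>) < ennreal (Sup U - Inf U)" using that(1) le by simp
    then show ?thesis using ennreal_less_iff by force
  qed
  have "Sup S - Inf T \<le> \<tau>"
  proof -
    have "s \<le> Inf T + \<tau>" if "s \<in> S" for s
      using bd(1)[OF that] t0 cInf_greatest[of T "s - \<tau>"] by (fastforce simp: algebra_simps)
    then have "Sup S \<le> Inf T + \<tau>" using s0 by (intro cSup_least) auto
    then show ?thesis by simp
  qed
  moreover have "Sup T - Inf S \<le> \<tau>"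
  proof -
    have "t \<le> Inf S + \<tau>" if "t \<in> T" for t
      using bd(2)[OF _ that] s0 cInf_greatest[of S "t - \<tau>"] by (fastforce simp: algebra_simps)
    then have "Sup T \<le> Inf S + \<tau>" using t0 by (intro cSup_least) auto
    then show ?thesis by simp
  qed
  ultimately have "\<bar>x i - y i\<bar> \<le> \<tau>"
    using len[OF mS bS s0] len[OF mT bT t0] by linarith
  then have "(x i - y i)\<^sup>2 \<le> \<tau>\<^sup>2" by (metis abs_ge_zero power2_abs power_mono)
  then have "(x i - y i)\<^sup>2 + h \<le> D\<^sup>2" using Dh by (simp add: \<tau>_def)
  then show ?thesis using edist_leI[OF i D0] by (simp add: h_def)
qed

lemma steiner_symmetric:
  assumes "i \<in> {1..d}" "x \<in> steiner d i A"
  shows "x(i := - x i) \<in> steiner d i A"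
  using assms by (auto simp: steiner_def fun_upd_in_euc)

text \<open>The sections over x and over its mirror image in direction j are the same subset of the
  line, so symmetries gained in earlier steps survive the later ones.\<close>

lemma steiner_keeps_symmetric:
  assumes ij: "i \<in> {1..d}" "j \<in> {1..d}" "j \<noteq> i"
    and sym: "\<And>x. x \<in> A \<Longrightarrow> x(j := - x j) \<in> A"
    and x: "x \<in> steiner d i A"
  shows "x(j := - x j) \<in> steiner d i A"
proof -
  have tw: "x(j := - x j, i := t) = (x(i := t))(j := - (x(i := t)) j)" for t
    using ij by (auto simp: fun_eq_iff)
  have "{t. x(j := - x j, i := t) \<in> A} = {t. x(i := t) \<in> A}"
  proof safe
    fix t assume "x(j := - x j, i := t) \<in> A"
    from sym[OF this] have "(x(j := - x j, i := t))(j := - (x(j := - x j, i := t)) j) \<in> A" .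
    moreover have "(x(j := - x j, i := t))(j := - (x(j := - x j, i := t)) j) = x(i := t)"
      using ij by (auto simp: fun_eq_iff)
    ultimately show "x(i := t) \<in> A" by simp
  qed (use sym tw in metis)
  then show ?thesis using x ij by (auto simp: steiner_def fun_upd_in_euc)
qed

lemma steiner_iterate:
  assumes A: "A \<in> sets (elebesgue d)" and D: "\<And>x y. x \<in> A \<Longrightarrow> y \<in> A \<Longrightarrow> edist d x y \<le> D"
    and I: "finite I" "I \<subseteq> {1..d}"
  shows "\<exists>A'\<in>sets (elebesgue d). emeasure (elebesgue d) A' = emeasure (elebesgue d) A \<and>
    (\<forall>x\<in>A'. \<forall>y\<in>A'. edist d x y \<le> D) \<and> (\<forall>j\<in>I. \<forall>x\<in>A'. x(j := - x j) \<in> A')"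
  using I
proof (induction I rule: finite_induct)
  case empty
  then show ?case using A D by blast
next
  case (insert i I)
  then obtain A' where A': "A' \<in> sets (elebesgue d)" "emeasure (elebesgue d) A' = emeasure (elebesgue d) A"
    "\<And>x y. x\<in>A' \<Longrightarrow> y\<in>A' \<Longrightarrow> edist d x y \<le> D" "\<And>j x. j\<in>I \<Longrightarrow> x\<in>A' \<Longrightarrow> x(j := - x j) \<in> A'"
    by blast
  have i: "i \<in> {1..d}" using insert by auto
  show ?case
  proof (rule bexI[of _ "steiner d i A'"], intro conjI ballI)
    show "emeasure (elebesgue d) (steiner d i A') = emeasure (elebesgue d) A"
      using emeasure_steiner[OF i A'(1)] A'(2) by simp
    show "edist d x y \<le> D" if "x \<in> steiner d i A'" "y \<in> steiner d i A'" for x y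
      using steiner_diam[OF i A'(3) that] by simp
    show "x(j := - x j) \<in> steiner d i A'" if "j \<in> insert i I" "x \<in> steiner d i A'" for j x
      using that steiner_symmetric[OF i] steiner_keeps_symmetric[OF i _ _ A'(4)] insert by (cases "j = i") auto
    show "steiner d i A' \<in> sets (elebesgue d)" by (rule steiner_measurable[OF i A'(1)])
  qed
qed

text \<open>Symmetrised in all coordinates, the set contains -x along with x, so the bound D on the
  distance of these two points puts the set into the ball of radius D / 2. This is the sharp
  constant that the normalisation of the Hausdorff measure calls for.\<close>

lemma isodiametric:
  assumes d: "d \<ge> 1" and A: "A \<in> sets (elebesgue d)" and D: "\<And>x y. x \<in> A \<Longrightarrow> y \<in> A \<Longrightarrow> edist d x y \<le> D"
    and D0: "D \<ge> 0"
  shows "emeasure (elebesgue d) A \<le> ennreal (unit_ball_vol d * (D / 2) ^ d)"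
proof -
  obtain A' where A': "A' \<in> sets (elebesgue d)" "emeasure (elebesgue d) A' = emeasure (elebesgue d) A"
    "\<And>x y. x\<in>A' \<Longrightarrow> y\<in>A' \<Longrightarrow> edist d x y \<le> D" "\<And>j x. j\<in>{1..d} \<Longrightarrow> x\<in>A' \<Longrightarrow> x(j := - x j) \<in> A'"
    using steiner_iterate[OF A D, of "{1..d}"] by auto
  have flip: "(\<lambda>i. if i \<in> J then - x i else x i) \<in> A'" if "x \<in> A'" "finite J" "J \<subseteq> {1..d}" for x J
    using that(2,3)
  proof (induction J rule: finite_induct)
    case (insert j J)
    then have "(\<lambda>i. if i \<in> J then - x i else x i)(j := - (if j \<in> J then - x j else x j)) \<in> A'"
      using A'(4)[of j "\<lambda>i. if i \<in> J then - x i else x i"] by auto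
    moreover have "(\<lambda>i. if i \<in> J then - x i else x i)(j := - (if j \<in> J then - x j else x j))
      = (\<lambda>i. if i \<in> insert j J then - x i else x i)" using insert by (auto simp: fun_eq_iff)
    ultimately show ?case by simp
  qed (simp add: that)
  have nrm: "enorm d x \<le> D / 2" if "x \<in> A'" for x
  proof -
    have "edist d x (\<lambda>i. if i \<in> {1..d} then - x i else x i) \<le> D"
      by (intro A'(3) that flip) auto
    also have "edist d x (\<lambda>i. if i \<in> {1..d} then - x i else x i) = enorm d (\<lambda>i. 2 * x i)"
      unfolding edist_def by (rule enorm_cong) auto
    finally show ?thesis by (simp add: enorm_scale)
  qed
  have "A' \<subseteq> {x\<in>euc d. enorm d x \<le> D / 2}"
    using nrm sets.sets_into_space[OF A'(1)] by auto
  moreover have "{x\<in>space (elebesgue d). enorm d x \<le> D / 2} \<in> sets (elebesgue d)" by measurable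
  ultimately have "emeasure (elebesgue d) A' \<le> emeasure (elebesgue d) {x\<in>euc d. enorm d x \<le> D / 2}"
    by (intro emeasure_mono) auto
  also have "\<dots> \<le> ennreal (unit_ball_vol d * (D / 2) ^ d)"
    using emeasure_euc_cball[of "D / 2" d] emeasure_ezero_ball[OF d] D0 by (cases "D = 0") auto
  finally show ?thesis using A'(2) by simp
qed

text \<open>Covers in the Hausdorff measure consist of arbitrary sets. Passing to the closure keeps
  the bound on the diameter, by density in one argument at a time, and gives a Borel set to which
  the isodiametric inequality applies.\<close>

lemma borel_hull_hcost:
  assumes d: "d \<ge> 1" and U: "U \<subseteq> euc d"
  shows "\<exists>C\<in>sets (elebesgue d). U \<subseteq> C \<and> emeasure (elebesgue d) C \<le> hcost d d U"
proof (cases "ediam d U")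
  case top
  have "(top :: ennreal) / 2 = top" by (simp add: ennreal_top_divide)
  then have "hcost d d U = top" using d unfolding hcost_def top
    using unit_ball_vol_pos[of "real d"] by (simp add: top_power_ennreal ennreal_mult_top del: unit_ball_vol_pos)
  then show ?thesis using U by (intro bexI[of _ "euc d"]) (auto simp flip: space_elebesgue)
next
  case (real D)
  have D: "edist d x y \<le> D" if "x \<in> U" "y \<in> U" for x y
    using edist_le_ediam[OF that, of d] real by simp
  have cl: "closure U \<subseteq> euc d" using U closed_euc by (rule closure_minimal)
  have 1: "edist d x y \<le> D" if "x \<in> U" "y \<in> closure U" for x y
  proof -
    have "closed {y. edist d x y \<le> D}"
      unfolding edist_def enorm_alt by (intro closed_Collect_le continuous_intros)
    moreover have "U \<subseteq> {y. edist d x y \<le> D}" using D[OF that(1)] by auto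
    ultimately have "closure U \<subseteq> {y. edist d x y \<le> D}" by (rule closure_minimal[rotated])
    then show ?thesis using that(2) by auto
  qed
  have 2: "edist d x y \<le> D" if "x \<in> closure U" "y \<in> closure U" for x y
  proof -
    have "closed {x. edist d x y \<le> D}"
      unfolding edist_def enorm_alt by (intro closed_Collect_le continuous_intros)
    moreover have "U \<subseteq> {x. edist d x y \<le> D}" using 1 that(2) by auto
    ultimately have "closure U \<subseteq> {x. edist d x y \<le> D}" by (rule closure_minimal[rotated])
    then show ?thesis using that(1) by auto
  qed
  have m: "closure U \<in> sets (elebesgue d)" by (intro closed_in_sets_elebesgue cl) auto
  have "hcost d d U = ennreal (unit_ball_vol d * (D / 2) ^ d)"
    using real unfolding hcost_def real(1) by (simp add: ennreal_mult ennreal_power[symmetric] divide_ennreal[symmetric])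
  then show ?thesis using isodiametric[OF d m 2] real m closure_subset by auto
qed

lemma lebesgue_le_hausdorff_outer:
  assumes d: "d \<ge> 1" and A: "A \<in> sets (elebesgue d)"
  shows "emeasure (elebesgue d) A \<le> hausdorff_outer d d A"
proof -
  have "emeasure (elebesgue d) A \<le> hausdorff_pre d d 1 A"
    unfolding hausdorff_pre_alt
  proof (rule INF_greatest)
    fix U assume U: "U \<in> hcovers d 1 A"
    then have "\<exists>C\<in>sets (elebesgue d). U j \<subseteq> C \<and> emeasure (elebesgue d) C \<le> hcost d d (U j)" for j
      by (intro borel_hull_hcost[OF d]) (auto simp: hcovers_def)
    then obtain C where C: "\<And>j. C j \<in> sets (elebesgue d)" "\<And>j. U j \<subseteq> C j"
      "\<And>j. emeasure (elebesgue d) (C j) \<le> hcost d d (U j)" by metis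
    have "A \<subseteq> (\<Union>j. C j)" using U C(2) unfolding hcovers_def by blast
    then have "emeasure (elebesgue d) A \<le> emeasure (elebesgue d) (\<Union>j. C j)"
      using C by (intro emeasure_mono) auto
    also have "\<dots> \<le> (\<Sum>j. emeasure (elebesgue d) (C j))"
      using C by (intro emeasure_subadditive_countably) auto
    also have "\<dots> \<le> (\<Sum>j. hcost d d (U j))" by (intro suminf_le C) auto
    finally show "emeasure (elebesgue d) A \<le> (\<Sum>j. hcost d d (U j))" .
  qed
  also have "\<dots> \<le> hausdorff_outer d d A" by (rule hausdorff_pre_le_outer) simp
  finally show ?thesis .
qed

section \<open>Hausdorff measure is Lebesgue measure\<close>

lemma translate_measurable_hausdorff:
  assumes "d \<ge> 1"
  shows "(\<lambda>z. evec d (\<lambda>i. a i + z i)) \<in> measurable (hausdorff d d) (hausdorff d d)"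
  using affine_measurable[of d a 1] hausdorff_measure(1)[OF assms, of d]
  by (simp cong: measurable_cong_sets)

lemma hausdorff_outer_translate:
  assumes d: "d \<ge> 1" and A: "A \<subseteq> euc d"
  shows "hausdorff_outer d d ((\<lambda>z. evec d (\<lambda>i. a i + z i)) ` A) = hausdorff_outer d d A"
proof -
  have le: "hausdorff_outer d d ((\<lambda>z. evec d (\<lambda>i. a i + z i)) ` A) \<le> hausdorff_outer d d A" for a A
  proof -
    have "edist d (evec d (\<lambda>i. a i + x i)) (evec d (\<lambda>i. a i + y i)) = edist d x y" for x y
      unfolding edist_def by (rule enorm_cong) auto
    then show ?thesis
      using hausdorff_outer_lipschitz_image[of 1 d A "\<lambda>z. evec d (\<lambda>i. a i + z i)" d d] d by simp
  qed
  have "evec d (\<lambda>i. - a i + evec d (\<lambda>i. a i + z i) i) = z" if "z \<in> euc d" for z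
    by (rule euc_eqI[OF _ that]) auto
  then have "(\<lambda>z. evec d (\<lambda>i. - a i + z i)) ` ((\<lambda>z. evec d (\<lambda>i. a i + z i)) ` A) = A"
    using A by (force simp: image_image)
  then have "hausdorff_outer d d A \<le> hausdorff_outer d d ((\<lambda>z. evec d (\<lambda>i. a i + z i)) ` A)"
    using le[of "\<lambda>i. - a i" "(\<lambda>z. evec d (\<lambda>i. a i + z i)) ` A"] by simp
  then show ?thesis using le by (intro antisym)
qed

lemma distr_translate_hausdorff:
  assumes d: "d \<ge> 1"
  shows "distr (hausdorff d d) (hausdorff d d) (\<lambda>z. evec d (\<lambda>i. a i + z i)) = hausdorff d d"
proof (rule measure_eqI)
  let ?T = "\<lambda>a z. evec d (\<lambda>i. a i + z i)"
  fix A assume "A \<in> sets (distr (hausdorff d d) (hausdorff d d) (?T a))"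
  then have A: "A \<in> sets (hausdorff d d)" by simp
  then have Ae: "A \<subseteq> euc d" using sets.sets_into_space hausdorff_measure(2)[OF d] by metis
  have T: "?T a -` A \<inter> space (hausdorff d d) \<in> sets (hausdorff d d)"
    by (rule measurable_sets[OF translate_measurable_hausdorff[OF d] A])
  have "?T a (?T (\<lambda>i. - a i) x) = x" "?T (\<lambda>i. - a i) (?T a x) = x" if "x \<in> euc d" for x
    using that by (auto intro!: euc_eqI)
  then have "?T a -` A \<inter> euc d = ?T (\<lambda>i. - a i) ` A"
    using Ae by (force simp: image_iff)
  then have "hausdorff_outer d d (?T a -` A \<inter> euc d) = hausdorff_outer d d A"
    using hausdorff_outer_translate[OF d Ae, of "\<lambda>i. - a i"] by simp
  then show "emeasure (distr (hausdorff d d) (hausdorff d d) (?T a)) A = emeasure (hausdorff d d) A"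
    using A T hausdorff_measure[OF d] translate_measurable_hausdorff[OF d]
    by (simp add: emeasure_distr)
qed simp

definition ucube :: "nat \<Rightarrow> vec set" where
  "ucube d = {x\<in>euc d. \<forall>i\<in>{1..d}. 0 \<le> x i \<and> x i < 1}"

definition gcube :: "nat \<Rightarrow> nat \<Rightarrow> (nat \<Rightarrow> nat) \<Rightarrow> vec set" where
  "gcube d N k = {x\<in>euc d. \<forall>i\<in>{1..d}. real (k i) / N \<le> x i \<and> x i < (real (k i) + 1) / N}"

lemma gcube_sets: "gcube d N k \<in> sets (elebesgue d)" "ucube d \<in> sets (elebesgue d)"
proof -
  have "PiE {1..d} (\<lambda>i. {real (k i) / N..<(real (k i) + 1) / N}) \<in> sets (elebesgue d)"
    "PiE {1..d} (\<lambda>i. {0..<1}) \<in> sets (elebesgue d)"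
    unfolding elebesgue_def by (intro sets_PiM_I_finite; simp)+
  moreover have "PiE {1..d} (\<lambda>i. {real (k i) / N..<(real (k i) + 1) / N}) = gcube d N k"
    "PiE {1..d} (\<lambda>i. {0..<1}) = ucube d"
    by (auto simp: gcube_def ucube_def euc_def PiE_iff extensional_def)
  ultimately show "gcube d N k \<in> sets (elebesgue d)" "ucube d \<in> sets (elebesgue d)" by auto
qed

lemma emeasure_gcube:
  assumes "N \<ge> 1"
  shows "emeasure (elebesgue d) (gcube d N k) = ennreal ((1 / N) ^ d)"
proof -
  have "PiE {1..d} (\<lambda>i. {real (k i) / N..<(real (k i) + 1) / N}) = gcube d N k"
    by (auto simp: gcube_def euc_def PiE_iff extensional_def)
  then have "emeasure (elebesgue d) (gcube d N k) = (\<Prod>i=1..d. emeasure lborel {real (k i) / N..<(real (k i) + 1) / N})"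
    unfolding elebesgue_def using lb.emeasure_PiM[of "{1..d}" "\<lambda>i. {real (k i) / N..<(real (k i) + 1) / N}"] by simp
  also have "\<dots> = (\<Prod>i=1..d. ennreal (1 / N))"
    using assms by (intro prod.cong refl) (simp add: divide_right_mono diff_divide_distrib[symmetric])
  finally show ?thesis by (simp add: ennreal_power)
qed

lemma emeasure_ucube: "emeasure (elebesgue d) (ucube d) = 1"
proof -
  have "gcube d 1 (\<lambda>_. 0) = ucube d" by (auto simp: gcube_def ucube_def)
  then show ?thesis using emeasure_gcube[of 1 d "\<lambda>_. 0"] by simp
qed

definition gidx :: "nat \<Rightarrow> nat \<Rightarrow> (nat \<Rightarrow> nat) set" where
  "gidx d N = PiE {1..d} (\<lambda>_. {0..<N})"

lemma gidx: "finite (gidx d N)" "card (gidx d N) = N ^ d"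
  by (auto simp: gidx_def finite_PiE card_PiE)

lemma ucube_subset_grid:
  assumes N: "N \<ge> 1"
  shows "ucube d \<subseteq> (\<Union>k\<in>gidx d N. gcube d N k)"
proof
  fix x assume x: "x \<in> ucube d"
  define k where "k = (\<lambda>i\<in>{1..d}. nat \<lfloor>N * x i\<rfloor>)"
  have *: "real (nat \<lfloor>N * x i\<rfloor>) \<le> N * x i" "N * x i < real (nat \<lfloor>N * x i\<rfloor>) + 1" "nat \<lfloor>N * x i\<rfloor> < N"
    if "i \<in> {1..d}" for i
  proof -
    have "0 \<le> x i" "x i < 1" using x that by (auto simp: ucube_def)
    then have 0: "0 \<le> N * x i" "N * x i < N" using N by auto
    then show "real (nat \<lfloor>N * x i\<rfloor>) \<le> N * x i" "N * x i < real (nat \<lfloor>N * x i\<rfloor>) + 1" by linarith+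
    then show "nat \<lfloor>N * x i\<rfloor> < N" using 0 by linarith
  qed
  have "k \<in> gidx d N" using *(3) by (auto simp: k_def gidx_def)
  moreover have "x \<in> gcube d N k"
    using x N *(1,2) by (auto simp: gcube_def k_def ucube_def field_simps)
  ultimately show "x \<in> (\<Union>k\<in>gidx d N. gcube d N k)" by blast
qed

lemma gcube_edist:
  assumes "x \<in> gcube d N k" "y \<in> gcube d N k" "N \<ge> 1"
  shows "edist d x y \<le> sqrt d / N"
proof -
  have "(x i - y i)\<^sup>2 \<le> (1 / N)\<^sup>2" if i: "i \<in> {1..d}" for i
  proof -
    have "real (k i) / N \<le> x i" "x i < real (k i) / N + 1 / N" "real (k i) / N \<le> y i" "y i < real (k i) / N + 1 / N"
      using assms i by (auto simp: gcube_def add_divide_distrib)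
    then have "\<bar>x i - y i\<bar> \<le> 1 / N" by linarith
    then show ?thesis by (metis abs_ge_zero power2_abs power_mono)
  qed
  then have "(\<Sum>i=1..d. (x i - y i)\<^sup>2) \<le> (\<Sum>i=1..d. (1 / N)\<^sup>2)" by (intro sum_mono)
  then have "edist d x y \<le> sqrt (d * (1 / N)\<^sup>2)" unfolding edist_def enorm_alt by simp
  also have "\<dots> = sqrt d / N" using assms(3) by (simp add: real_sqrt_mult)
  finally show ?thesis .
qed

lemma hausdorff_pre_le_hcost:
  assumes "d \<ge> 1" "U \<subseteq> euc n" "ediam n U \<le> ennreal \<delta>"
  shows "hausdorff_pre n d \<delta> U \<le> hcost n d U"
proof -
  have "(\<lambda>j::nat. if j = 0 then U else {}) \<in> hcovers n \<delta> U"
    using assms by (auto simp: hcovers_def intro: exI[of _ "0::nat"] split: if_splits)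
  then have "hausdorff_pre n d \<delta> U \<le> (\<Sum>j::nat. hcost n d (if j = 0 then U else {}))"
    unfolding hausdorff_pre_alt by (rule INF_lower)
  also have "\<dots> = (\<Sum>j\<in>{0::nat}. hcost n d (if j = 0 then U else {}))"
    using assms(1) by (intro suminf_finite) (auto simp: hcost_empty)
  finally show ?thesis by simp
qed

lemma hcost_le:
  assumes "\<And>x y. x \<in> U \<Longrightarrow> y \<in> U \<Longrightarrow> edist n x y \<le> D" "D \<ge> 0"
  shows "hcost n d U \<le> ennreal (unit_ball_vol d * (D / 2) ^ d)"
proof -
  have "hcost n d U \<le> ennreal (unit_ball_vol (real d)) * (ennreal D / 2) ^ d"
    unfolding hcost_def by (intro mult_left_mono power_mono divide_right_mono_ennreal ediam_leI assms) auto
  also have "\<dots> = ennreal (unit_ball_vol d * (D / 2) ^ d)"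
    using assms(2) by (simp add: ennreal_mult ennreal_power[symmetric] divide_ennreal[symmetric])
  finally show ?thesis .
qed

lemma hausdorff_pre_finite_UN:
  fixes A :: "'i \<Rightarrow> vec set"
  assumes d: "d \<ge> 1" and "finite I"
  shows "hausdorff_pre n d \<delta> (\<Union>i\<in>I. A i) \<le> (\<Sum>i\<in>I. hausdorff_pre n d \<delta> (A i))"
  using assms(2)
proof (induction I rule: finite_induct)
  case (insert i I)
  have "hausdorff_pre n d \<delta> (\<Union>i\<in>insert i I. A i) \<le> hausdorff_pre n d \<delta> (A i) + hausdorff_pre n d \<delta> (\<Union>i\<in>I. A i)"
    using countable_subadd_imp_Un[where F="hausdorff_pre n d \<delta>" and A="A i" and B="\<Union>i\<in>I. A i", OF hausdorff_pre_UN hausdorff_pre_empty[OF d]] by simp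
  also have "\<dots> \<le> hausdorff_pre n d \<delta> (A i) + (\<Sum>i\<in>I. hausdorff_pre n d \<delta> (A i))" using insert by (intro add_left_mono) auto
  finally show ?case using insert by simp
qed (simp add: hausdorff_pre_empty[OF d])

lemma small_grid:
  assumes "\<delta> > 0"
  obtains N :: nat where "N \<ge> 1" "sqrt d / N \<le> \<delta>"
proof -
  obtain m :: nat where m: "sqrt d / \<delta> < m" using reals_Archimedean2 by blast
  have "sqrt d \<le> \<delta> * real (Suc m)" using m assms by (simp add: field_simps)
  then have "sqrt d / real (Suc m) \<le> \<delta>" by (simp add: field_simps)
  then show ?thesis by (intro that[of "Suc m"]) auto
qed

text \<open>A crude bound from the grid with N^d cubes. It makes the constant of proportionality to
  Lebesgue measure a real number and yields sigma-finiteness.\<close>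

lemma hausdorff_ucube_finite:
  assumes d: "d \<ge> 1"
  shows "hausdorff_outer d d (ucube d) < top"
proof -
  have "hausdorff_pre d d \<delta> (ucube d) \<le> ennreal (unit_ball_vol d * (sqrt d / 2) ^ d)" if \<delta>: "\<delta> > 0" for \<delta>
  proof -
    obtain N :: nat where N: "N \<ge> 1" "sqrt d / N \<le> \<delta>" using small_grid[OF \<delta>] .
    have "hausdorff_pre d d \<delta> (ucube d) \<le> hausdorff_pre d d \<delta> (\<Union>k\<in>gidx d N. gcube d N k)"
      by (intro hausdorff_pre_mono ucube_subset_grid N)
    also have "\<dots> \<le> (\<Sum>k\<in>gidx d N. hausdorff_pre d d \<delta> (gcube d N k))"
      by (intro hausdorff_pre_finite_UN d gidx)
    also have "\<dots> \<le> (\<Sum>k\<in>gidx d N. ennreal (unit_ball_vol d * ((sqrt d / N) / 2) ^ d))"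
    proof (intro sum_mono)
      fix k
      have "ediam d (gcube d N k) \<le> ennreal (sqrt d / N)" using gcube_edist N by (intro ediam_leI) blast
      also have "\<dots> \<le> ennreal \<delta>" using N by (intro ennreal_leI)
      finally have "hausdorff_pre d d \<delta> (gcube d N k) \<le> hcost d d (gcube d N k)"
        by (intro hausdorff_pre_le_hcost d) (auto simp: gcube_def)
      also have "\<dots> \<le> ennreal (unit_ball_vol d * ((sqrt d / N) / 2) ^ d)"
        using gcube_edist N by (intro hcost_le) auto
      finally show "hausdorff_pre d d \<delta> (gcube d N k) \<le> ennreal (unit_ball_vol d * ((sqrt d / N) / 2) ^ d)" .
    qed
    also have "\<dots> = ennreal (real (N ^ d) * (unit_ball_vol d * ((sqrt d / N) / 2) ^ d))"
      by (subst sum_ennreal) (auto simp: gidx)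
    also have "real (N ^ d) * (unit_ball_vol d * ((sqrt d / N) / 2) ^ d) = unit_ball_vol d * (sqrt d / 2) ^ d"
      using N by (simp add: power_divide)
    finally show ?thesis .
  qed
  then have "hausdorff_outer d d (ucube d) \<le> ennreal (unit_ball_vol d * (sqrt d / 2) ^ d)"
    unfolding hausdorff_outer_def by (intro SUP_least) auto
  then show ?thesis using ennreal_less_top order.strict_trans1 by blast
qed

text \<open>Integer translates of the unit cube exhaust the space. Sigma-finiteness is the
  hypothesis of Tonelli's theorem in the uniqueness argument that follows.\<close>

lemma sigma_finite_hausdorff:
  assumes d: "d \<ge> 1"
  shows "sigma_finite_measure (hausdorff d d)"
proof
  define Z where "Z = PiE {1..d} (\<lambda>_. UNIV :: int set)"
  define T where "T k = (\<lambda>z. evec d (\<lambda>i. real_of_int (k i) + z i)) ` ucube d" for k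
  have Zc: "countable Z" unfolding Z_def by (intro countable_PiE) auto
  have Tm: "T k \<in> sets (hausdorff d d)" for k
  proof -
    have "T k = (\<lambda>z. evec d (\<lambda>i. - real_of_int (k i) + z i)) -` ucube d \<inter> space (hausdorff d d)"
    proof (intro set_eqI iffI)
      fix x assume "x \<in> T k"
      then obtain z where z: "z \<in> ucube d" "x = evec d (\<lambda>i. real_of_int (k i) + z i)" by (auto simp: T_def)
      then have "evec d (\<lambda>i. - real_of_int (k i) + x i) = z"
        by (intro euc_eqI[of _ d]) (auto simp: ucube_def)
      then show "x \<in> (\<lambda>z. evec d (\<lambda>i. - real_of_int (k i) + z i)) -` ucube d \<inter> space (hausdorff d d)"
        using z by (simp add: hausdorff_measure[OF d])
    next
      fix x assume x: "x \<in> (\<lambda>z. evec d (\<lambda>i. - real_of_int (k i) + z i)) -` ucube d \<inter> space (hausdorff d d)"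
      then have "x = evec d (\<lambda>i. real_of_int (k i) + evec d (\<lambda>i. - real_of_int (k i) + x i) i)"
        by (intro euc_eqI[of _ d]) (auto simp: hausdorff_measure[OF d])
      then show "x \<in> T k" using x unfolding T_def by blast
    qed
    moreover have "(\<lambda>z. evec d (\<lambda>i. - real_of_int (k i) + z i)) -` ucube d \<inter> space (hausdorff d d) \<in> sets (hausdorff d d)"
      by (rule measurable_sets[OF translate_measurable_hausdorff[OF d]]) (simp add: hausdorff_measure[OF d] gcube_sets)
    ultimately show ?thesis by (simp only:)
  qed
  show "\<exists>A. countable A \<and> A \<subseteq> sets (hausdorff d d) \<and> \<Union> A = space (hausdorff d d) \<and> (\<forall>a\<in>A. emeasure (hausdorff d d) a \<noteq> \<infinity>)"
  proof (intro exI[of _ "T ` Z"] conjI ballI)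
    show "countable (T ` Z)" using Zc by simp
    show "T ` Z \<subseteq> sets (hausdorff d d)" using Tm by auto
    show "\<Union> (T ` Z) = space (hausdorff d d)"
    proof (intro set_eqI iffI)
      fix x assume "x \<in> \<Union> (T ` Z)"
      then show "x \<in> space (hausdorff d d)" by (auto simp: T_def hausdorff_measure[OF d])
    next
      fix x assume x: "x \<in> space (hausdorff d d)"
      define k where "k = (\<lambda>i\<in>{1..d}. \<lfloor>x i\<rfloor>)"
      have "x = evec d (\<lambda>i. real_of_int (k i) + evec d (\<lambda>i. frac (x i)) i)"
        using x by (intro euc_eqI[of _ d]) (auto simp: hausdorff_measure[OF d] k_def frac_def)
      moreover have "evec d (\<lambda>i. frac (x i)) \<in> ucube d"
        by (auto simp: ucube_def frac_lt_1)
      ultimately have "x \<in> T k" unfolding T_def by blast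
      moreover have "k \<in> Z" by (auto simp: k_def Z_def)
      ultimately show "x \<in> \<Union> (T ` Z)" by blast
    qed
    fix a assume "a \<in> T ` Z"
    then obtain k where k: "a = T k" by auto
    have "emeasure (hausdorff d d) a = hausdorff_outer d d (ucube d)"
      unfolding k using Tm[of k] hausdorff_outer_translate[OF d, of "ucube d" "\<lambda>i. real_of_int (k i)"]
      by (simp add: hausdorff_measure[OF d] T_def ucube_def)
    then show "emeasure (hausdorff d d) a \<noteq> \<infinity>" using hausdorff_ucube_finite[OF d] by simp
  qed
qed

text \<open>Uniqueness of translation invariant measures. The product of the indicators of B at x
  and of the cube at y - x is integrated in both orders. One order gives H(B); in the other,
  shifting x by y gives H(N) L(B), with N the reflected cube. Taking for B the cube itself
  identifies H(N) with H of the cube.\<close>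

lemma hausdorff_eq_scaled_lebesgue:
  assumes d: "d \<ge> 1" and A: "A \<in> sets (elebesgue d)"
  shows "emeasure (hausdorff d d) A = emeasure (hausdorff d d) (ucube d) * emeasure (elebesgue d) A"
proof -
  let ?H = "hausdorff d d" and ?L = "elebesgue d"
  let ?R = "\<lambda>y x. evec d (\<lambda>i. y i - x i)"
  interpret L: sigma_finite_measure ?L by (rule sigma_finite_elebesgue)
  interpret H: sigma_finite_measure ?H by (rule sigma_finite_hausdorff[OF d])
  interpret P: pair_sigma_finite ?H ?L by standard
  have sH: "sets ?H = sets ?L" by (rule hausdorff_measure(1)[OF d])
  have sHL: "sets (?H \<Otimes>\<^sub>M ?L) = sets (?L \<Otimes>\<^sub>M ?L)" by (intro sets_pair_measure_cong sH refl)
  define N where "N = {x\<in>euc d. evec d (\<lambda>i. - x i) \<in> ucube d}"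
  have Nm: "N \<in> sets ?H"
  proof -
    have "N = (\<lambda>z. evec d (\<lambda>i. 0 + (-1) * z i)) -` ucube d \<inter> space ?L" by (auto simp: N_def)
    then show ?thesis using measurable_sets[OF affine_measurable gcube_sets(2), of d "\<lambda>_. 0" "-1"] sH by simp
  qed
  have eqn: "emeasure ?H B = emeasure ?H N * emeasure ?L B" if B: "B \<in> sets ?L" for B
  proof -
    have BH [measurable]: "B \<in> sets ?H" using B sH by simp
    have Q [measurable]: "ucube d \<in> sets ?L" by (rule gcube_sets)
    have dm: "(\<lambda>(x, y). ?R y x) \<in> measurable (?L \<Otimes>\<^sub>M ?L) ?L"
    proof -
      have "(\<lambda>p. \<lambda>i\<in>{1..d}. snd p i - fst p i) \<in> measurable (?L \<Otimes>\<^sub>M ?L) (PiM {1..d} (\<lambda>_. lborel))"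
        by (intro measurable_restrict borel_measurable_diff borel_measurable_add sets_lborel
            measurable_compose[OF measurable_fst measurable_elebesgue_coord]
            measurable_compose[OF measurable_snd measurable_elebesgue_coord] | simp)+
      then show ?thesis by (simp add: evec_def elebesgue_def split_beta)
    qed
    have am: "(\<lambda>(x, y). evec d (\<lambda>i. y i + x i)) \<in> measurable (?L \<Otimes>\<^sub>M ?L) ?L"
    proof -
      have "(\<lambda>p. \<lambda>i\<in>{1..d}. snd p i + fst p i) \<in> measurable (?L \<Otimes>\<^sub>M ?L) (PiM {1..d} (\<lambda>_. lborel))"
        by (intro measurable_restrict borel_measurable_diff borel_measurable_add sets_lborel
            measurable_compose[OF measurable_fst measurable_elebesgue_coord]
            measurable_compose[OF measurable_snd measurable_elebesgue_coord] | simp)+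
      then show ?thesis by (simp add: evec_def elebesgue_def split_beta)
    qed
    have m1: "(\<lambda>(x, y). indicator B x * indicator (ucube d) (?R y x) :: ennreal) \<in> borel_measurable (?H \<Otimes>\<^sub>M ?L)"
    proof -
      note dm[measurable]
      have "(\<lambda>p. indicator B (fst p) * indicator (ucube d) ((\<lambda>(x, y). ?R y x) p) :: ennreal) \<in> borel_measurable (?L \<Otimes>\<^sub>M ?L)"
        using B by measurable
      then show ?thesis by (simp add: split_beta cong: measurable_cong_sets[OF sHL refl])
    qed
    have m2: "(\<lambda>(x, y). indicator B (evec d (\<lambda>i. y i + x i)) * indicator N x :: ennreal) \<in> borel_measurable (?H \<Otimes>\<^sub>M ?L)"
    proof -
      note am[measurable]
      have [measurable]: "N \<in> sets ?L" using Nm sH by simp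
      have "(\<lambda>p. indicator B ((\<lambda>(x, y). evec d (\<lambda>i. y i + x i)) p) * indicator N (fst p) :: ennreal) \<in> borel_measurable (?L \<Otimes>\<^sub>M ?L)"
        using B by measurable
      then show ?thesis by (simp add: split_beta cong: measurable_cong_sets[OF sHL refl])
    qed
    have "emeasure ?H B = (\<integral>\<^sup>+x. indicator B x \<partial>?H)" by simp
    also have "\<dots> = (\<integral>\<^sup>+x. \<integral>\<^sup>+y. indicator B x * indicator (ucube d) (?R y x) \<partial>?L \<partial>?H)"
    proof (intro nn_integral_cong)
      fix x
      have "(\<integral>\<^sup>+y. indicator (ucube d) (evec d (\<lambda>i. - x i + 1 * y i)) \<partial>?L) = emeasure ?L (ucube d)"
        by (subst nn_integral_affine_elebesgue) auto
      then have "(\<integral>\<^sup>+y. indicator (ucube d) (?R y x) \<partial>?L) = 1"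
        by (simp add: emeasure_ucube algebra_simps)
      then show "indicator B x = (\<integral>\<^sup>+y. indicator B x * indicator (ucube d) (?R y x) \<partial>?L)"
        by (cases "x \<in> B") auto
    qed
    also have "\<dots> = (\<integral>\<^sup>+y. \<integral>\<^sup>+x. indicator B x * indicator (ucube d) (?R y x) \<partial>?H \<partial>?L)"
      by (rule P.Fubini'[symmetric]) (use m1 in simp)
    also have "\<dots> = (\<integral>\<^sup>+y. \<integral>\<^sup>+x. indicator B (evec d (\<lambda>i. y i + x i)) * indicator N x \<partial>?H \<partial>?L)"
    proof (rule nn_integral_cong)
      fix y assume y: "y \<in> space ?L"
      have my: "(\<lambda>x. indicator B x * indicator (ucube d) (?R y x) :: ennreal) \<in> borel_measurable ?H"
        using measurable_Pair1[OF m1, of y] y by simp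
      have "(\<integral>\<^sup>+x. indicator B x * indicator (ucube d) (?R y x) \<partial>?H) =
        (\<integral>\<^sup>+x. indicator B x * indicator (ucube d) (?R y x) \<partial>distr ?H ?H (\<lambda>z. evec d (\<lambda>i. y i + z i)))"
        by (simp add: distr_translate_hausdorff[OF d])
      also have "\<dots> = (\<integral>\<^sup>+x. indicator B (evec d (\<lambda>i. y i + x i)) * indicator (ucube d) (?R y (evec d (\<lambda>i. y i + x i))) \<partial>?H)"
        by (rule nn_integral_distr[OF translate_measurable_hausdorff[OF d]]) (use my in simp)
      also have "\<dots> = (\<integral>\<^sup>+x. indicator B (evec d (\<lambda>i. y i + x i)) * indicator N x \<partial>?H)"
      proof (intro nn_integral_cong)
        fix x assume "x \<in> space ?H"
        moreover have "?R y (evec d (\<lambda>i. y i + x i)) = evec d (\<lambda>i. - x i)" by (intro euc_eqI[of _ d]) auto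
        ultimately show "indicator B (evec d (\<lambda>i. y i + x i)) * indicator (ucube d) (?R y (evec d (\<lambda>i. y i + x i)))
          = (indicator B (evec d (\<lambda>i. y i + x i)) * indicator N x :: ennreal)"
          by (simp add: N_def hausdorff_measure[OF d] indicator_def)
      qed
      finally show "(\<integral>\<^sup>+x. indicator B x * indicator (ucube d) (?R y x) \<partial>?H) =
        (\<integral>\<^sup>+x. indicator B (evec d (\<lambda>i. y i + x i)) * indicator N x \<partial>?H)" .
    qed
    also have "\<dots> = (\<integral>\<^sup>+x. \<integral>\<^sup>+y. indicator B (evec d (\<lambda>i. y i + x i)) * indicator N x \<partial>?L \<partial>?H)"
      by (rule P.Fubini') (use m2 in simp)
    also have "\<dots> = (\<integral>\<^sup>+x. emeasure ?L B * indicator N x \<partial>?H)"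
    proof (intro nn_integral_cong)
      fix x
      have "(\<integral>\<^sup>+y. indicator B (evec d (\<lambda>i. x i + 1 * y i)) \<partial>?L) = emeasure ?L B"
        using B by (subst nn_integral_affine_elebesgue) auto
      then show "(\<integral>\<^sup>+y. indicator B (evec d (\<lambda>i. y i + x i)) * indicator N x \<partial>?L) = emeasure ?L B * indicator N x"
        by (cases "x \<in> N") (auto simp: add.commute)
    qed
    also have "\<dots> = emeasure ?H N * emeasure ?L B"
      unfolding nn_integral_cmult_indicator[OF Nm] by (rule mult.commute)
    finally show ?thesis .
  qed
  show ?thesis using eqn[OF A] eqn[OF gcube_sets(2)] by (simp add: emeasure_ucube)
qed

text \<open>
  Filling the grid cubes with balls of comparable volume: the balls cost exactly their volume, so
  the constant \<open>c\<close> of proportionality satisfies \<open>c \<le> \<theta> + c (1 - \<theta>)\<close> with a fixed \<open>\<theta> > 0\<close>.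
\<close>

lemma hausdorff_ucube_le_1:
  assumes d: "d \<ge> 1"
  shows "emeasure (hausdorff d d) (ucube d) \<le> 1"
proof -
  let ?H = "hausdorff d d" and ?L = "elebesgue d"
  define c where "c = enn2real (emeasure ?H (ucube d))"
  have H: "emeasure ?H A = hausdorff_outer d d A" if "A \<in> sets ?L" for A
    using hausdorff_measure(3)[OF d that] .
  have c: "emeasure ?H (ucube d) = ennreal c" and c0: "c \<ge> 0"
    using hausdorff_ucube_finite[OF d] H[OF gcube_sets(2)] by (auto simp: c_def)
  \<comment> \<open>The share of a cube of side 1/N that a ball of radius 1/(4N) occupies. A quarter
    of the side keeps the closed ball inside the half-open cube and its diameter below
    \<delta>.\<close>
  define \<theta> where "\<theta> = unit_ball_vol d * (1 / 4) ^ d"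
  have \<theta>: "\<theta> > 0" by (simp add: \<theta>_def)
  have main: "hausdorff_pre d d \<delta> (ucube d) \<le> ennreal (\<theta> + c * (1 - \<theta>))" if \<delta>: "\<delta> > 0" for \<delta>
  proof -
    obtain N :: nat where N: "N \<ge> 1" "sqrt d / N \<le> \<delta>" using small_grid[OF \<delta>] .
    have N1: "1 / N \<le> \<delta>"
    proof -
      have "1 \<le> sqrt d" using d by simp
      then have "1 / N \<le> sqrt d / N" using N by (intro divide_right_mono) auto
      then show ?thesis using N by simp
    qed
    define r where "r = 1 / (4 * real N)"
    have r: "r > 0" using N by (simp add: r_def)
    have "r = (1 / 4) * (1 / N)" by (simp add: r_def)
    then have rd: "r ^ d = (1 / 4) ^ d * (1 / N) ^ d" by (simp only: power_mult_distrib)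
    define ctr where "ctr k = (\<lambda>i. (real (k i) + 1/2) / N)" for k :: "nat \<Rightarrow> nat"
    define b where "b k = {x\<in>euc d. edist d x (ctr k) \<le> r}" for k
    have bm: "b k \<in> sets ?L" for k
    proof -
      have "closed {x. edist d x (ctr k) \<le> r}"
        unfolding edist_def enorm_alt by (intro closed_Collect_le continuous_intros)
      then have "closed (euc d \<inter> {x. edist d x (ctr k) \<le> r})" by (intro closed_Int closed_euc)
      then show ?thesis unfolding b_def by (intro closed_in_sets_elebesgue) (auto simp: Int_def)
    qed
    have bsub: "b k \<subseteq> gcube d N k" for k
    proof
      fix x assume x: "x \<in> b k"
      have "\<bar>x i - ctr k i\<bar> < 1 / (2 * N)" if "i \<in> {1..d}" for i
      proof -
        have "\<bar>x i - ctr k i\<bar> \<le> r"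
          using x abs_coord_le_enorm[OF that, of "\<lambda>i. x i - ctr k i"] by (simp add: b_def edist_def)
        also have "\<dots> < 1 / (2 * N)" using N by (simp add: r_def field_simps)
        finally show ?thesis .
      qed
      moreover have "ctr k i = real (k i) / N + 1 / (2 * N)" "(real (k i) + 1) / N = real (k i) / N + 1 / (2 * N) + 1 / (2 * N)" for i
        using N by (simp_all add: ctr_def field_simps)
      ultimately show "x \<in> gcube d N k" using x unfolding gcube_def b_def by (fastforce simp: abs_less_iff)
    qed
    have bL: "emeasure ?L (b k) = ennreal (\<theta> * (1 / N) ^ d)" for k
    proof -
      have bm0: "{x\<in>euc d. enorm d x \<le> r} \<in> sets ?L"
      proof -
        have "{x\<in>space ?L. enorm d x \<le> r} \<in> sets ?L" by measurable
        then show ?thesis by simp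
      qed
      have "emeasure ?L (b k) = (\<integral>\<^sup>+x. indicator (b k) x \<partial>?L)" using bm by simp
      also have "\<dots> = (\<integral>\<^sup>+x. indicator {x\<in>euc d. enorm d x \<le> r} (evec d (\<lambda>i. - ctr k i + 1 * x i)) \<partial>?L)"
      proof (intro nn_integral_cong)
        fix x assume "x \<in> space ?L"
        then show "indicator (b k) x = (indicator {x\<in>euc d. enorm d x \<le> r} (evec d (\<lambda>i. - ctr k i + 1 * x i)) :: ennreal)"
          by (simp add: b_def indicator_def edist_def)
      qed
      also have "\<dots> = emeasure ?L {x\<in>euc d. enorm d x \<le> r}"
        using bm0 by (subst nn_integral_affine_elebesgue) auto
      also have "\<dots> = ennreal (unit_ball_vol d * r ^ d)" by (rule emeasure_euc_cball[OF r])
      also have "unit_ball_vol d * r ^ d = \<theta> * (1 / N) ^ d"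
        by (simp only: \<theta>_def rd mult.assoc)
      finally show ?thesis .
    qed
    have pb: "hausdorff_pre d d \<delta> (b k) \<le> ennreal (\<theta> * (1 / N) ^ d)" for k
    proof -
      have dm: "edist d x y \<le> 2 * r" if "x \<in> b k" "y \<in> b k" for x y
        using that edist_triangle[of d x y "ctr k"] edist_commute[of d y "ctr k"] by (auto simp: b_def)
      have "2 * r \<le> 1 / N" using N by (simp add: r_def field_simps)
      then have "2 * r \<le> \<delta>" using N1 by simp
      have "ediam d (b k) \<le> ennreal (2 * r)" by (intro ediam_leI dm)
      also have "\<dots> \<le> ennreal \<delta>" using \<open>2 * r \<le> \<delta>\<close> by (intro ennreal_leI)
      finally have "hausdorff_pre d d \<delta> (b k) \<le> hcost d d (b k)"
        by (intro hausdorff_pre_le_hcost d) (auto simp: b_def)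
      also have "\<dots> \<le> ennreal (unit_ball_vol d * ((2 * r) / 2) ^ d)" using dm r by (intro hcost_le) auto
      also have "(2 * r) / 2 = r" by simp
      also have "unit_ball_vol d * r ^ d = \<theta> * (1 / N) ^ d"
        by (simp only: \<theta>_def rd mult.assoc)
      finally show ?thesis .
    qed
    have pr: "hausdorff_pre d d \<delta> (gcube d N k - b k) \<le> ennreal (c * ((1 - \<theta>) * (1 / N) ^ d))" for k
    proof -
      have m: "gcube d N k - b k \<in> sets ?L" using bm gcube_sets by auto
      have "hausdorff_pre d d \<delta> (gcube d N k - b k) \<le> emeasure ?H (gcube d N k - b k)"
        unfolding H[OF m] by (rule hausdorff_pre_le_outer[OF \<delta>])
      also have "\<dots> = ennreal c * emeasure ?L (gcube d N k - b k)"
        using hausdorff_eq_scaled_lebesgue[OF d m] c by simp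
      also have "emeasure ?L (gcube d N k - b k) = ennreal ((1 / N) ^ d) - ennreal (\<theta> * (1 / N) ^ d)"
        using bsub bm gcube_sets by (subst emeasure_Diff) (auto simp: bL emeasure_gcube[OF N(1)])
      also have "\<dots> = ennreal ((1 - \<theta>) * (1 / N) ^ d)"
        using \<theta> by (subst ennreal_minus) (auto simp: algebra_simps)
      finally show ?thesis using c0 by (simp add: ennreal_mult')
    qed
    have le1: "\<theta> \<le> 1"
    proof -
      have "emeasure ?L (b (\<lambda>_. 0)) \<le> emeasure ?L (gcube d N (\<lambda>_. 0))" by (intro emeasure_mono bsub gcube_sets)
      then have "\<theta> * (1 / N) ^ d \<le> (1 / N) ^ d" by (simp add: bL emeasure_gcube[OF N(1)] ennreal_le_iff)
      then show ?thesis using N by (simp add: mult_le_cancel_right1)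
    qed
    have "hausdorff_pre d d \<delta> (ucube d) \<le> hausdorff_pre d d \<delta> (\<Union>k\<in>gidx d N. gcube d N k)"
      by (intro hausdorff_pre_mono ucube_subset_grid N)
    also have "\<dots> \<le> (\<Sum>k\<in>gidx d N. hausdorff_pre d d \<delta> (gcube d N k))"
      by (intro hausdorff_pre_finite_UN d gidx)
    also have "\<dots> \<le> (\<Sum>k\<in>gidx d N. ennreal (\<theta> * (1 / N) ^ d + c * ((1 - \<theta>) * (1 / N) ^ d)))"
    proof (intro sum_mono)
      fix k
      have "hausdorff_pre d d \<delta> (gcube d N k) \<le> hausdorff_pre d d \<delta> (b k \<union> (gcube d N k - b k))"
        by (intro hausdorff_pre_mono) auto
      also have "\<dots> \<le> hausdorff_pre d d \<delta> (b k) + hausdorff_pre d d \<delta> (gcube d N k - b k)"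
        by (rule countable_subadd_imp_Un[where F="hausdorff_pre d d \<delta>", OF hausdorff_pre_UN hausdorff_pre_empty[OF d]])
      also have "\<dots> \<le> ennreal (\<theta> * (1 / N) ^ d) + ennreal (c * ((1 - \<theta>) * (1 / N) ^ d))"
        by (intro add_mono pb pr)
      also have "\<dots> = ennreal (\<theta> * (1 / N) ^ d + c * ((1 - \<theta>) * (1 / N) ^ d))"
        using \<theta> c0 le1 by (intro ennreal_plus[symmetric]) auto
      finally show "hausdorff_pre d d \<delta> (gcube d N k) \<le> ennreal (\<theta> * (1 / N) ^ d + c * ((1 - \<theta>) * (1 / N) ^ d))" .
    qed
    also have "\<dots> = ennreal (real (N ^ d) * (\<theta> * (1 / N) ^ d + c * ((1 - \<theta>) * (1 / N) ^ d)))"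
      using \<theta> c0 le1 by (subst sum_ennreal) (auto simp: gidx)
    also have "real (N ^ d) * (\<theta> * (1 / N) ^ d + c * ((1 - \<theta>) * (1 / N) ^ d)) = \<theta> + c * (1 - \<theta>)"
    proof -
      have "real (N ^ d) * (\<theta> * (1 / N) ^ d + c * ((1 - \<theta>) * (1 / N) ^ d)) = (real (N ^ d) * (1 / N) ^ d) * (\<theta> + c * (1 - \<theta>))"
        by (simp only: algebra_simps)
      moreover have "real (N ^ d) * (1 / N) ^ d = 1" using N by (simp add: power_divide)
      ultimately show ?thesis by (simp only: mult_1_left)
    qed
    finally show ?thesis .
  qed
  have "ennreal c \<le> ennreal (\<theta> + c * (1 - \<theta>))"
  proof -
    have "ennreal c = hausdorff_outer d d (ucube d)" using c H[OF gcube_sets(2)] by simp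
    also have "\<dots> \<le> ennreal (\<theta> + c * (1 - \<theta>))"
      unfolding hausdorff_outer_def using main by (intro SUP_least) auto
    finally show ?thesis .
  qed
  then have "c \<le> max 0 (\<theta> + c * (1 - \<theta>))" using c0 unfolding ennreal_le_iff2 by (auto simp: max_def)
  then have "c \<le> 1"
  proof (cases "\<theta> + c * (1 - \<theta>) \<le> 0")
    case False
    then have "c * \<theta> \<le> 1 * \<theta>" using \<open>c \<le> max 0 (\<theta> + c * (1 - \<theta>))\<close> by (simp add: algebra_simps)
    then show ?thesis using \<theta> by (metis mult_le_cancel_right_pos)
  qed (use \<open>c \<le> max 0 (\<theta> + c * (1 - \<theta>))\<close> in auto)
  then show ?thesis using c by (simp add: ennreal_le_1)
qed

lemma hausdorff_eq_lebesgue: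
  assumes d: "d \<ge> 1" and A: "A \<in> sets (elebesgue d)"
  shows "hausdorff_outer d d A = emeasure (elebesgue d) A"
proof (rule antisym)
  show "emeasure (elebesgue d) A \<le> hausdorff_outer d d A" by (rule lebesgue_le_hausdorff_outer[OF assms])
  have "hausdorff_outer d d A = emeasure (hausdorff d d) (ucube d) * emeasure (elebesgue d) A"
    using hausdorff_eq_scaled_lebesgue[OF assms] hausdorff_measure(3)[OF assms] by simp
  also have "\<dots> \<le> 1 * emeasure (elebesgue d) A" by (intro mult_right_mono hausdorff_ucube_le_1 d) auto
  finally show "hausdorff_outer d d A \<le> emeasure (elebesgue d) A" by simp
qed

section \<open>Smooth functions\<close>

text \<open>A relation, because \<open>partial\<close> is a total function built on
  \<open>deriv\<close> and carries no information where the derivative fails to exist. It speaks of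
  points of \<open>euc n\<close> only, as do all the derivatives below.\<close>

definition has_pd :: "nat \<Rightarrow> nat \<Rightarrow> (vec \<Rightarrow> real) \<Rightarrow> (vec \<Rightarrow> real) \<Rightarrow> bool" where
  "has_pd n i f f' \<longleftrightarrow> (\<forall>x\<in>euc n. ((\<lambda>t. f (x(i := t))) has_real_derivative f' x) (at (x i)))"

lemma has_pd_partial: "has_pd n i f f' \<Longrightarrow> x \<in> euc n \<Longrightarrow> partial i f x = f' x"
  unfolding has_pd_def partial_def by (auto intro: DERIV_imp_deriv)

lemma has_pd_cong:
  assumes "has_pd n i g f'" "i \<in> {1..n}" "\<And>x. x \<in> euc n \<Longrightarrow> f x = g x"
  shows "has_pd n i f f'"
  unfolding has_pd_def
proof
  fix x assume x: "x \<in> euc n"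
  have "(\<lambda>t. f (x(i := t))) = (\<lambda>t. g (x(i := t)))"
    using assms(3) fun_upd_in_euc[OF x assms(2)] by auto
  then show "((\<lambda>t. f (x(i := t))) has_real_derivative f' x) (at (x i))"
    using assms(1) x by (simp add: has_pd_def)
qed

lemma has_pd_line:
  assumes "has_pd n i f f'" "x \<in> euc n" "i \<in> {1..n}"
  shows "((\<lambda>t. f (x(i := t))) has_real_derivative f' (x(i := s))) (at s)"
  using assms(1)[unfolded has_pd_def, rule_format, OF fun_upd_in_euc[OF assms(2,3), of s]] by simp

text \<open>Closure of S under partial derivatives feeds the recursion of \<open>Ck\<close> at every
  order. Membership is taken up to equality on \<open>euc n\<close>, since
  \<open>partial i f\<close> is known to agree with the derivative found in S only there.\<close>

lemma Ck_coinduct: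
  assumes S: "\<And>f. f \<in> S \<Longrightarrow> continuous_on (euc n) f \<and> (\<forall>i\<in>{1..n}. \<exists>f'\<in>S. has_pd n i f f')"
  shows "(\<exists>g\<in>S. \<forall>x\<in>euc n. f x = g x) \<Longrightarrow> Ck n k f"
proof (induction k arbitrary: f)
  case 0
  then obtain g where g: "g \<in> S" "\<And>x. x \<in> euc n \<Longrightarrow> f x = g x" by auto
  then show ?case using S[OF g(1)] by (simp cong: continuous_on_cong)
next
  case (Suc k)
  then obtain g where g: "g \<in> S" "\<And>x. x \<in> euc n \<Longrightarrow> f x = g x" by auto
  have "continuous_on (euc n) f" using S[OF g(1)] g(2) by (simp cong: continuous_on_cong)
  moreover have "(\<forall>x\<in>euc n. (\<lambda>t. f (x(i := t))) differentiable at (x i)) \<and> Ck n k (partial i f)" if i: "i \<in> {1..n}" for i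
  proof -
    obtain f' where f': "f' \<in> S" "has_pd n i g f'" using S[OF g(1)] i by blast
    have h: "has_pd n i f f'" by (rule has_pd_cong[OF f'(2) i g(2)])
    show ?thesis
      using h has_pd_partial[OF h] f'(1) Suc.IH[of "partial i f"]
      by (auto simp: has_pd_def real_differentiable_def)
  qed
  ultimately show ?case by simp
qed

text \<open>A syntactic class, so that closure under derivatives is an induction. The rule
  \<open>comp\<close> carries the whole sequence D of derivatives of the outer function, valid on an
  open set containing the range of h: differentiating \<open>D k\<close> leads to
  \<open>D (Suc k)\<close> and stays in the class.\<close>

inductive smooth :: "nat \<Rightarrow> (vec \<Rightarrow> real) \<Rightarrow> bool" for n where
  const: "smooth n (\<lambda>x. c)"
| coord: "i \<in> {1..n} \<Longrightarrow> smooth n (\<lambda>x. x i)"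
| add: "smooth n f \<Longrightarrow> smooth n g \<Longrightarrow> smooth n (\<lambda>x. f x + g x)"
| mult: "smooth n f \<Longrightarrow> smooth n g \<Longrightarrow> smooth n (\<lambda>x. f x * g x)"
| comp: "smooth n h \<Longrightarrow> open S \<Longrightarrow> (\<And>x. x \<in> euc n \<Longrightarrow> h x \<in> S) \<Longrightarrow>
         (\<And>k s. s \<in> S \<Longrightarrow> (D k has_real_derivative D (Suc k) s) (at s)) \<Longrightarrow> smooth n (\<lambda>x. D (k::nat) (h x))"

lemma smooth_continuous: "smooth n f \<Longrightarrow> continuous_on (euc n) f"
proof (induction rule: smooth.induct)
  case (comp h S D k)
  have "continuous_on S (D k)"
    using comp(4) by (intro continuous_at_imp_continuous_on) (auto intro: DERIV_isCont)
  then show ?case by (rule continuous_on_compose2[OF _ comp(5)]) (use comp(3) in auto)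
qed (auto intro!: continuous_intros)

lemma smooth_deriv: "smooth n f \<Longrightarrow> i \<in> {1..n} \<Longrightarrow> \<exists>f'. smooth n f' \<and> has_pd n i f f'"
proof (induction rule: smooth.induct)
  case (const c)
  show ?case by (intro exI[of _ "\<lambda>_. 0"] conjI smooth.const) (simp add: has_pd_def)
next
  case (coord j)
  show ?case
    by (intro exI[of _ "\<lambda>_. if i = j then 1 else 0"] conjI smooth.const) (auto simp: has_pd_def)
next
  case (add f g)
  then obtain f' g' where fg: "smooth n f'" "has_pd n i f f'" "smooth n g'" "has_pd n i g g'" by auto
  show ?case
    by (intro exI[of _ "\<lambda>x. f' x + g' x"] conjI smooth.add fg)
       (use fg in \<open>auto simp: has_pd_def intro!: DERIV_add\<close>)
next
  case (mult f g)
  then obtain f' g' where fg: "smooth n f'" "has_pd n i f f'" "smooth n g'" "has_pd n i g g'" by auto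
  show ?case
  proof (intro exI[of _ "\<lambda>x. f' x * g x + g' x * f x"] conjI smooth.add smooth.mult fg mult)
    show "has_pd n i (\<lambda>x. f x * g x) (\<lambda>x. f' x * g x + g' x * f x)"
      unfolding has_pd_def
    proof
      fix x assume x: "x \<in> euc n"
      have "((\<lambda>t. f (x(i := t)) * g (x(i := t))) has_real_derivative
         f' x * g (x(i := x i)) + g' x * f (x(i := x i))) (at (x i))"
        using fg x by (intro DERIV_mult) (auto simp: has_pd_def)
      then show "((\<lambda>t. f (x(i := t)) * g (x(i := t))) has_real_derivative f' x * g x + g' x * f x) (at (x i))"
        by simp
    qed
  qed
next
  case (comp h S D k)
  then obtain h' where h': "smooth n h'" "has_pd n i h h'" by auto
  show ?case
  proof (intro exI[of _ "\<lambda>x. D (Suc k) (h x) * h' x"] conjI smooth.mult h')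
    show "smooth n (\<lambda>x. D (Suc k) (h x))"
      by (rule smooth.comp[where S=S]) (use comp in auto)
    show "has_pd n i (\<lambda>x. D k (h x)) (\<lambda>x. D (Suc k) (h x) * h' x)"
      unfolding has_pd_def
    proof
      fix x assume x: "x \<in> euc n"
      have "(D k has_real_derivative D (Suc k) (h x)) (at (h (x(i := x i))))" using comp(3,4) x by simp
      then show "((\<lambda>t. D k (h (x(i := t)))) has_real_derivative D (Suc k) (h x) * h' x) (at (x i))"
        by (rule DERIV_chain2) (rule h'(2)[unfolded has_pd_def, rule_format, OF x])
    qed
  qed
qed

lemma smooth_Ck: "smooth n f \<Longrightarrow> Ck n k f"
  using Ck_coinduct[of "{f. smooth n f}" n f k] smooth_continuous smooth_deriv by blast

lemma test_functionI:
  assumes "smooth n \<phi>" "r < 1" "\<And>x. x \<in> euc n \<Longrightarrow> r < enorm n x \<Longrightarrow> \<phi> x = 0"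
  shows "test_function n \<phi>"
  unfolding test_function_def
proof (intro conjI allI exI[of _ "{x\<in>euc n. enorm n x \<le> r}"])
  show "Ck n k \<phi>" for k by (rule smooth_Ck[OF assms(1)])
  show "compact {x\<in>euc n. enorm n x \<le> r}" by (rule compact_euc_cball)
  show "\<forall>x\<in>euc n - {x\<in>euc n. enorm n x \<le> r}. \<phi> x = 0"
  proof
    fix x assume "x \<in> euc n - {x\<in>euc n. enorm n x \<le> r}"
    then show "\<phi> x = 0" by (intro assms(3)) auto
  qed
qed (use assms(2) in \<open>auto simp: euc_ball_def\<close>)

lemma smooth_sum: "finite I \<Longrightarrow> (\<And>i. i \<in> I \<Longrightarrow> smooth n (f i)) \<Longrightarrow> smooth n (\<lambda>x. \<Sum>i\<in>I. f i x)"
  by (induction I rule: finite_induct) (auto intro: smooth.intros)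

lemma laplacian_eq:
  assumes "\<And>i. i \<in> {1..n} \<Longrightarrow> has_pd n i f (f1 i)" "\<And>i. i \<in> {1..n} \<Longrightarrow> has_pd n i (f1 i) (f2 i)" "x \<in> euc n"
  shows "laplacian n f x = (\<Sum>i=1..n. f2 i x)"
  unfolding laplacian_def
proof (intro sum.cong refl)
  fix i assume i: "i \<in> {1..n}"
  have "has_pd n i (partial i f) (f2 i)"
    by (rule has_pd_cong[OF assms(2)[OF i] i]) (rule has_pd_partial[OF assms(1)[OF i]])
  then show "partial i (partial i f) x = f2 i x" by (rule has_pd_partial) (rule assms(3))
qed

section \<open>A smooth cut-off function on the line\<close>

definition expq :: "real poly \<Rightarrow> real \<Rightarrow> real" where
  "expq P t = (if t > 0 then poly P (1 / t) * exp (- (1 / t)) else 0)"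

lemma expq_limit: fixes P :: "real poly" shows "((\<lambda>s. poly P s * exp (- s)) \<longlongrightarrow> 0) at_top"
proof -
  have "((\<lambda>s. \<Sum>i\<le>degree P. coeff P i * (s ^ i / exp s)) \<longlongrightarrow> (\<Sum>i\<le>degree P. coeff P i * 0)) at_top"
    by (intro tendsto_sum tendsto_mult tendsto_const tendsto_power_div_exp_0)
  moreover have "(\<lambda>s. poly P s * exp (- s)) = (\<lambda>s. \<Sum>i\<le>degree P. coeff P i * (s ^ i / exp s))"
    by (simp add: poly_altdef sum_distrib_right exp_minus divide_inverse mult.assoc)
  ultimately show ?thesis by simp
qed

text \<open>With s = 1/t the chain rule gives s^2 (P(s) - P'(s)) exp(-s), hence the new polynomial;
  at t = 0 the exponential beats every polynomial. Carrying P along makes the family closed under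
  differentiation.\<close>

lemma expq_deriv: "(expq P has_real_derivative expq ([:0, 0, 1:] * (P - pderiv P)) t) (at t)"
proof -
  consider "t > 0" | "t < 0" | "t = 0" by linarith
  then show ?thesis
  proof cases
    case 1
    have "((\<lambda>t. poly P (1 / t) * exp (- (1 / t))) has_real_derivative
       (poly (pderiv P) (1 / t) * (- (1 / t\<^sup>2))) * exp (- (1 / t)) + (exp (- (1 / t)) * (1 / t\<^sup>2)) * poly P (1 / t)) (at t)"
      using 1 by (auto intro!: derivative_eq_intros DERIV_chain2[OF poly_DERIV] simp: power2_eq_square)
    then have "((\<lambda>t. poly P (1 / t) * exp (- (1 / t))) has_real_derivative expq ([:0, 0, 1:] * (P - pderiv P)) t) (at t)"
      by (rule DERIV_cong) (use 1 in \<open>simp add: expq_def field_simps power2_eq_square\<close>)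
    then show ?thesis
      by (rule DERIV_cong_ev[THEN iffD1, OF refl _ refl, rotated])
         (use 1 in \<open>auto simp: expq_def eventually_at_topological intro!: eventually_nhds_in_open[of "{0<..}", THEN eventually_mono]\<close>)
  next
    case 2
    have "((\<lambda>_. 0) has_real_derivative expq ([:0, 0, 1:] * (P - pderiv P)) t) (at t)"
      using 2 by (simp add: expq_def)
    then show ?thesis
      by (rule DERIV_cong_ev[THEN iffD1, OF refl _ refl, rotated])
         (use 2 in \<open>auto simp: expq_def intro!: eventually_nhds_in_open[of "{..<0}", THEN eventually_mono]\<close>)
  next
    case 3
    have "((\<lambda>h. (expq P (0 + h) - expq P 0) / h) \<longlongrightarrow> 0) (at 0)"
    proof (rule filterlim_split_at)
      show "((\<lambda>h. (expq P (0 + h) - expq P 0) / h) \<longlongrightarrow> 0) (at_left 0)"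
        by (rule tendsto_eventually) (auto simp: expq_def eventually_at_filter)
      have "((\<lambda>h. poly (pCons 0 P) (inverse h) * exp (- (inverse h))) \<longlongrightarrow> 0) (at_right 0)"
        by (rule filterlim_compose[OF expq_limit filterlim_inverse_at_top_right])
      then show "((\<lambda>h. (expq P (0 + h) - expq P 0) / h) \<longlongrightarrow> 0) (at_right 0)"
        by (rule Lim_transform_eventually) (auto simp: expq_def eventually_at_filter field_simps)
    qed
    then show ?thesis using 3 by (simp add: DERIV_def expq_def)
  qed
qed

text \<open>The one-variable analogue of \<open>smooth\<close>, with inverses for a normalising
  quotient. Dependent choice then turns closure under derivatives into the sequence of derivatives
  that \<open>smooth.comp\<close> demands.\<close>

inductive rsmooth :: "(real \<Rightarrow> real) \<Rightarrow> bool" where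
  const: "rsmooth (\<lambda>t. c)"
| ident: "rsmooth (\<lambda>t. t)"
| add: "rsmooth f \<Longrightarrow> rsmooth g \<Longrightarrow> rsmooth (\<lambda>t. f t + g t)"
| mult: "rsmooth f \<Longrightarrow> rsmooth g \<Longrightarrow> rsmooth (\<lambda>t. f t * g t)"
| inv: "rsmooth f \<Longrightarrow> (\<And>t. f t \<noteq> 0) \<Longrightarrow> rsmooth (\<lambda>t. inverse (f t))"
| expq: "rsmooth f \<Longrightarrow> rsmooth (\<lambda>t. expq P (f t))"

lemma rsmooth_deriv: "rsmooth f \<Longrightarrow> \<exists>f'. rsmooth f' \<and> (\<forall>t. (f has_real_derivative f' t) (at t))"
proof (induction rule: rsmooth.induct)
  case (const c)
  show ?case by (intro exI[of _ "\<lambda>_. 0"] conjI rsmooth.const) auto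
next
  case ident
  show ?case by (intro exI[of _ "\<lambda>_. 1"] conjI rsmooth.const) auto
next
  case (add f g)
  then obtain f' g' where "rsmooth f'" "rsmooth g'" "\<And>t. (f has_real_derivative f' t) (at t)"
    "\<And>t. (g has_real_derivative g' t) (at t)" by auto
  then show ?case by (intro exI[of _ "\<lambda>t. f' t + g' t"]) (auto intro: rsmooth.add DERIV_add)
next
  case (mult f g)
  then obtain f' g' where "rsmooth f'" "rsmooth g'" "\<And>t. (f has_real_derivative f' t) (at t)"
    "\<And>t. (g has_real_derivative g' t) (at t)" by auto
  then show ?case using mult
    by (intro exI[of _ "\<lambda>t. f' t * g t + g' t * f t"]) (auto intro: rsmooth.intros DERIV_mult)
next
  case (inv f)
  then obtain f' where f': "rsmooth f'" "\<And>t. (f has_real_derivative f' t) (at t)" by auto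
  have "((\<lambda>t. inverse (f t)) has_real_derivative ((- 1) * (f' t * (inverse (f t) * inverse (f t))))) (at t)" for t
    using DERIV_inverse_fun[OF f'(2)[of t] inv(2)] by (rule DERIV_cong) (simp add: power2_eq_square)
  then show ?case
    by (intro exI[of _ "\<lambda>t. (- 1) * (f' t * (inverse (f t) * inverse (f t)))"] conjI allI
          rsmooth.mult rsmooth.const rsmooth.inv inv f'(1))
next
  case (expq f P)
  then obtain f' where f': "rsmooth f'" "\<And>t. (f has_real_derivative f' t) (at t)" by auto
  show ?case
    by (intro exI[of _ "\<lambda>t. expq ([:0, 0, 1:] * (P - pderiv P)) (f t) * f' t"] conjI allI rsmooth.mult rsmooth.expq f' expq
          DERIV_chain2[OF expq_deriv])
qed

lemma rsmooth_seq:
  assumes "rsmooth f"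
  shows "\<exists>D :: nat \<Rightarrow> real \<Rightarrow> real. D 0 = f \<and> (\<forall>k t. (D k has_real_derivative D (Suc k) t) (at t))"
proof -
  have "\<exists>D. \<forall>k. (rsmooth (D k) \<and> (k = 0 \<longrightarrow> D k = f)) \<and> (\<forall>t. (D k has_real_derivative D (Suc k) t) (at t))"
    by (rule dependent_nat_choice) (use assms rsmooth_deriv in auto)
  then show ?thesis by blast
qed

text \<open>With e(t) = exp(-1/t) for t > 0 and e(t) = 0 otherwise, the function is e(4 - t) / (e(4
  - t) + e(t - 1)). It will be evaluated at |y|^2 / \<rho>^2, so the thresholds 1 and 4 stand for
  the radii \<rho> and 2 \<rho>. The first two derivatives vanish off a compact interval and are
  therefore bounded.\<close>

lemma cutoff_exists:
  "\<exists>(D :: nat \<Rightarrow> real \<Rightarrow> real) B. (\<forall>k t. (D k has_real_derivative D (Suc k) t) (at t)) \<and>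
     (\<forall>t\<le>1. D 0 t = 1) \<and> (\<forall>t\<ge>4. D 0 t = 0) \<and> (\<forall>t. 0 \<le> D 0 t \<and> D 0 t \<le> 1) \<and>
     (\<forall>t. t < 1 \<or> t > 4 \<longrightarrow> D 1 t = 0 \<and> D 2 t = 0) \<and> (\<forall>t. \<bar>D 1 t\<bar> \<le> B \<and> \<bar>D 2 t\<bar> \<le> B)"
proof -
  define e where "e = expq 1"
  have e: "e t \<ge> 0" "t > 0 \<Longrightarrow> e t > 0" "t \<le> 0 \<Longrightarrow> e t = 0" for t by (auto simp: e_def expq_def)
  have den: "e (4 + (-1) * t) + e (t + (-1)) > 0" for t
    using e(1)[of "4 + (-1) * t"] e(1)[of "t + (-1)"] e(2)[of "4 + (-1) * t"] e(2)[of "t + (-1)"] by (cases "t < 4") auto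
  define f where "f = (\<lambda>t. e (4 + (-1) * t) * inverse (e (4 + (-1) * t) + e (t + (-1))))"
  have "rsmooth f"
    unfolding f_def e_def using den unfolding e_def
    by (intro rsmooth.mult rsmooth.inv rsmooth.add rsmooth.expq rsmooth.const rsmooth.ident) (auto simp: less_le)
  then obtain D :: "nat \<Rightarrow> real \<Rightarrow> real" where D: "D 0 = f" "\<And>k t. (D k has_real_derivative D (Suc k) t) (at t)"
    using rsmooth_seq by blast
  have f1: "f t = 1" if "t \<le> 1" for t using that e(2)[of "4 + (-1) * t"] e(3)[of "t + (-1)"] by (simp add: f_def)
  have f4: "f t = 0" if "t \<ge> 4" for t using that e(3)[of "4 + (-1) * t"] by (simp add: f_def)
  have f01: "0 \<le> f t" "f t \<le> 1" for t
    using e(1)[of "4 + (-1) * t"] e(1)[of "t + (-1)"] den[of t] by (auto simp: f_def field_simps)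
  have loc: "D (Suc k) t = 0" if "open S" "t \<in> S" "\<And>s. s \<in> S \<Longrightarrow> D k s = c" for S t c k
  proof -
    have "((\<lambda>_. c) has_real_derivative D (Suc k) t) (at t)"
      using DERIV_cong_ev[THEN iffD1, OF refl _ refl D(2)[of k t], of "\<lambda>_. c"] that
      by (auto intro: eventually_nhds_in_open[of S, THEN eventually_mono])
    then show ?thesis using DERIV_const DERIV_unique by blast
  qed
  have z1: "D 1 t = 0" if "t < 1 \<or> t > 4" for t
  proof (cases "t < 1")
    case True
    then show ?thesis using loc[of "{..<1}" t 0 1] f1 D(1) by (auto simp: One_nat_def)
  next
    case False
    then show ?thesis using loc[of "{4<..}" t 0 0] f4 D(1) that by (auto simp: One_nat_def)
  qed
  have z2: "D 2 t = 0" if "t < 1 \<or> t > 4" for t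
  proof -
    have "open ({..<1} \<union> {4<..} :: real set)" by (intro open_Un) auto
    then show ?thesis
      using loc[of "{..<1} \<union> {4<..}" t 1 0] z1 that by (auto simp: numeral_2_eq_2 One_nat_def)
  qed
  have "\<exists>B. \<forall>t. \<bar>D k t\<bar> \<le> B" if k: "k = 1 \<or> k = 2" for k
  proof -
    have "continuous_on {1..4} (D k)"
      using D(2) by (intro continuous_at_imp_continuous_on) (auto intro: DERIV_isCont)
    then have "bounded (D k ` {1..4})" by (intro compact_imp_bounded compact_continuous_image) auto
    then obtain B where B: "\<And>t. t \<in> {1..4} \<Longrightarrow> \<bar>D k t\<bar> \<le> B" unfolding bounded_iff real_norm_def by blast
    have "\<bar>D k t\<bar> \<le> max B 0" for t
      using B[of t] z1[of t] z2[of t] k by (cases "t \<in> {1..4}") auto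
    then show ?thesis by blast
  qed
  then obtain B1 B2 where B: "\<And>t. \<bar>D 1 t\<bar> \<le> B1" "\<And>t. \<bar>D 2 t\<bar> \<le> B2" by metis
  show ?thesis
    by (intro exI[of _ D] exI[of _ "max B1 B2"])
       (use D f1 f4 f01 z1 z2 B in \<open>auto intro: max.coboundedI1 max.coboundedI2\<close>)
qed

lemma continuous_on_update: "continuous_on A (\<lambda>t. (x::vec)(i := t))"
proof (rule continuous_on_coordinatewise_then_product)
  fix j show "continuous_on A (\<lambda>t. (x(i := t)) j)" by (cases "j = i") (auto intro: continuous_intros)
qed

section \<open>The Laplacian of the positive part of a coordinate\<close>

lemma has_pd_zero:
  assumes pd: "has_pd n i f f'" and i: "i \<in> {1..n}" and z: "\<And>x. x \<in> euc n \<Longrightarrow> r < enorm n x \<Longrightarrow> f x = 0"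
    and x: "x \<in> euc n" "r < enorm n x"
  shows "f' x = 0"
proof -
  let ?S = "{t. r < enorm n (x(i := t))}"
  have c: "continuous_on UNIV (\<lambda>t. enorm n (x(i := t)))"
    by (rule continuous_on_compose2[OF continuous_on_enorm[of UNIV] continuous_on_update]) auto
  have "open ?S" by (intro open_Collect_less c continuous_intros)
  then have ev: "\<forall>\<^sub>F t in nhds (x i). t \<in> ?S" using x(2) by (intro eventually_nhds_in_open) auto
  have "((\<lambda>t. f (x(i := t))) has_real_derivative f' x) (at (x i))" using pd x(1) by (simp add: has_pd_def)
  moreover have "\<forall>\<^sub>F t in nhds (x i). f (x(i := t)) = 0"
    using ev by eventually_elim (intro z fun_upd_in_euc x i, simp)
  ultimately have "((\<lambda>_. 0) has_real_derivative f' x) (at (x i))"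
    by (subst (asm) DERIV_cong_ev[OF refl _ refl])
  then show ?thesis using DERIV_const DERIV_unique by blast
qed

lemma euc_cball_finite:
  "{x\<in>euc n. enorm n x \<le> r} \<in> sets (elebesgue n)" "emeasure (elebesgue n) {x\<in>euc n. enorm n x \<le> r} < top"
proof -
  have m: "{x\<in>euc n. enorm n x \<le> r} \<in> sets (elebesgue n)" for r
  proof -
    have "{x\<in>space (elebesgue n). enorm n x \<le> r} \<in> sets (elebesgue n)" by measurable
    then show ?thesis by simp
  qed
  then show "{x\<in>euc n. enorm n x \<le> r} \<in> sets (elebesgue n)" .
  have "emeasure (elebesgue n) {x\<in>euc n. enorm n x \<le> r} \<le> emeasure (elebesgue n) {x\<in>euc n. enorm n x \<le> \<bar>r\<bar> + 1}"
    using m by (intro emeasure_mono) auto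
  also have "\<dots> < top" by (subst emeasure_euc_cball) auto
  finally show "emeasure (elebesgue n) {x\<in>euc n. enorm n x \<le> r} < top" .
qed

lemma integrable_euc_bounded_support:
  fixes f :: "vec \<Rightarrow> real"
  assumes "f \<in> borel_measurable (elebesgue n)" "\<And>x. x \<in> euc n \<Longrightarrow> enorm n x \<le> r \<Longrightarrow> \<bar>f x\<bar> \<le> B"
    and "\<And>x. x \<in> euc n \<Longrightarrow> r < enorm n x \<Longrightarrow> f x = 0"
  shows "integrable (elebesgue n) f"
  by (rule integrableI_bounded_set[where A="{x\<in>euc n. enorm n x \<le> r}" and B=B])
     (use assms euc_cball_finite[of n r] in \<open>auto simp: not_le\<close>)

lemma integrable_euc_continuous:
  fixes f :: "vec \<Rightarrow> real"
  assumes c: "continuous_on (euc n) f" and z: "\<And>x. x \<in> euc n \<Longrightarrow> r < enorm n x \<Longrightarrow> f x = 0"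
  shows "integrable (elebesgue n) f"
proof -
  have "compact (f ` {x\<in>euc n. enorm n x \<le> r})"
    by (intro compact_continuous_image compact_euc_cball continuous_on_subset[OF c]) auto
  then have "bounded (f ` {x\<in>euc n. enorm n x \<le> r})" by (rule compact_imp_bounded)
  then obtain B where "\<And>x. x \<in> euc n \<Longrightarrow> enorm n x \<le> r \<Longrightarrow> \<bar>f x\<bar> \<le> B"
    unfolding bounded_iff real_norm_def by blast
  then show ?thesis by (intro integrable_euc_bounded_support[OF continuous_measurable_euc[OF c] _ z])
qed

lemma integral_deriv_compact_support:
  fixes F F' :: "real \<Rightarrow> real"
  assumes D: "\<And>t. (F has_real_derivative F' t) (at t)" and c: "\<And>t. isCont F' t"
    and z: "\<And>t. r < \<bar>t\<bar> \<Longrightarrow> F t = 0" "\<And>t. r < \<bar>t\<bar> \<Longrightarrow> F' t = 0"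
  shows "(\<integral>t. F' t \<partial>lborel) = 0"
proof -
  define R where "R = \<bar>r\<bar> + 1"
  have "(\<integral>t. F' t \<partial>lborel) = (\<integral>t. F' t * indicator {-R..R} t \<partial>lborel)"
  proof (intro Bochner_Integration.integral_cong refl)
    fix t show "F' t = F' t * indicator {-R..R} t"
      using z(2)[of t] by (cases "t \<in> {-R..R}"; cases "r < \<bar>t\<bar>") (auto simp: R_def)
  qed
  also have "\<dots> = F R - F (-R)" by (rule integral_FTC_Icc_real) (use D c in \<open>auto simp: R_def\<close>)
  also have "\<dots> = 0" using z(1) by (simp add: R_def)
  finally show ?thesis .
qed

text \<open>The second derivative of max(0, t) is a unit point mass at 0. Here this comes from the
  antiderivative \<open>t * F1 t - F t\<close> of \<open>t * F2 t\<close>.\<close>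

lemma integral_pos_part_second_deriv:
  fixes F F1 F2 :: "real \<Rightarrow> real"
  assumes D: "\<And>t. (F has_real_derivative F1 t) (at t)" "\<And>t. (F1 has_real_derivative F2 t) (at t)"
    and c: "\<And>t. isCont F2 t"
    and z: "\<And>t. r < \<bar>t\<bar> \<Longrightarrow> F t = 0" "\<And>t. r < \<bar>t\<bar> \<Longrightarrow> F1 t = 0" "\<And>t. r < \<bar>t\<bar> \<Longrightarrow> F2 t = 0"
  shows "(\<integral>t. max 0 t * F2 t \<partial>lborel) = F 0"
proof -
  define R where "R = \<bar>r\<bar> + 1"
  have "(\<integral>t. max 0 t * F2 t \<partial>lborel) = (\<integral>t. (t * F2 t) * indicator {0..R} t \<partial>lborel)"
    using z(3) by (intro Bochner_Integration.integral_cong refl) (auto simp: R_def indicator_def not_le)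
  also have "\<dots> = (R * F1 R - F R) - (0 * F1 0 - F 0)"
    by (rule integral_FTC_Icc_real[where F="\<lambda>t. t * F1 t - F t"])
       (use D c in \<open>auto simp: R_def intro!: derivative_eq_intros continuous_intros\<close>)
  also have "\<dots> = F 0" using z(1,2) by (simp add: R_def)
  finally show ?thesis .
qed

lemma smooth_two_derivs:
  assumes "smooth n \<phi>"
  obtains f1 f2 where "\<And>i. i \<in> {1..n} \<Longrightarrow> smooth n (f1 i)" "\<And>i. i \<in> {1..n} \<Longrightarrow> smooth n (f2 i)"
    "\<And>i. i \<in> {1..n} \<Longrightarrow> has_pd n i \<phi> (f1 i)" "\<And>i. i \<in> {1..n} \<Longrightarrow> has_pd n i (f1 i) (f2 i)"
proof -
  have "\<forall>i. \<exists>f f'. i \<in> {1..n} \<longrightarrow> smooth n f \<and> smooth n f' \<and> has_pd n i \<phi> f \<and> has_pd n i f f'"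
    using smooth_deriv assms by metis
  then obtain f1 f2 where "\<forall>i. i \<in> {1..n} \<longrightarrow> smooth n (f1 i) \<and> smooth n (f2 i) \<and> has_pd n i \<phi> (f1 i) \<and> has_pd n i (f1 i) (f2 i)"
    by metis
  then show ?thesis by (intro that[of f1 f2]) auto
qed

lemma smooth_line_isCont:
  assumes "smooth n f" "x \<in> euc n" "i \<in> {1..n}"
  shows "isCont (\<lambda>t. f (x(i := t))) s"
  using smooth_deriv[OF assms(1,3)] has_pd_line[OF _ assms(2,3)] DERIV_isCont by blast

lemma enorm_update_ge:
  assumes "i \<in> {1..n}" "r < \<bar>t\<bar>"
  shows "r < enorm n (x(i := t))"
  using abs_coord_le_enorm[OF assms(1), of "x(i := t)"] assms(2) by simp

text \<open>Along a coordinate i < n the factor max(0, x_n) is constant, and a second derivative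
  with compact support integrates to 0. The last coordinate yields the value on the hyperplane. This
  is the weak equation solved by the subtracted term.\<close>

lemma laplacian_pos_part:
  assumes n: "n \<ge> 2" and sm: "smooth n \<phi>" and z: "\<And>x. x \<in> euc n \<Longrightarrow> r < enorm n x \<Longrightarrow> \<phi> x = 0"
  shows "(\<integral>x. max 0 (x n) * laplacian n \<phi> x \<partial>elebesgue n) = (\<integral>y. \<phi> (y(n := 0)) \<partial>elebesgue (n - 1))"
proof -
  obtain f1 f2 where f: "\<And>i. i \<in> {1..n} \<Longrightarrow> smooth n (f1 i)" "\<And>i. i \<in> {1..n} \<Longrightarrow> smooth n (f2 i)"
    "\<And>i. i \<in> {1..n} \<Longrightarrow> has_pd n i \<phi> (f1 i)" "\<And>i. i \<in> {1..n} \<Longrightarrow> has_pd n i (f1 i) (f2 i)"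
    using smooth_two_derivs[OF sm] by metis
  have z1: "f1 i x = 0" if "i \<in> {1..n}" "x \<in> euc n" "r < enorm n x" for i x
    by (rule has_pd_zero[OF f(3)[OF that(1)] that(1) z that(2,3)])
  have z2: "f2 i x = 0" if "i \<in> {1..n}" "x \<in> euc n" "r < enorm n x" for i x
    by (rule has_pd_zero[OF f(4)[OF that(1)] that(1) z1[OF that(1)] that(2,3)])
  have int: "integrable (elebesgue n) (\<lambda>x. max 0 (x n) * f2 i x)" if "i \<in> {1..n}" for i
    by (rule integrable_euc_continuous[where r=r])
       (use z2[OF that] in \<open>auto intro!: continuous_on_mult continuous_on_max continuous_on_const
          continuous_on_coord smooth_continuous[OF f(2)[OF that]]\<close>)
  have term_i: "(\<integral>x. max 0 (x n) * f2 i x \<partial>elebesgue n) =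
      (\<integral>x. \<integral>y. max 0 ((x(i := y)) n) * f2 i (x(i := y)) \<partial>lborel \<partial>PiM ({1..n}-{i}) (\<lambda>_. lborel))"
    if i: "i \<in> {1..n}" for i
  proof -
    have ins: "insert i ({1..n}-{i}) = {1..n}" using i by auto
    have "integrable (PiM (insert i ({1..n}-{i})) (\<lambda>_. lborel)) (\<lambda>x. max 0 (x n) * f2 i x)"
      using int[OF i] unfolding ins elebesgue_def .
    from lb.product_integral_insert[OF _ _ this]
    show ?thesis unfolding ins elebesgue_def by simp
  qed
  have in_euc: "x(i := t) \<in> euc n" if "x \<in> space (PiM ({1..n}-{i}) (\<lambda>_. lborel :: real measure))" "i \<in> {1..n}" for x i t
    using that by (auto simp: space_PiM euc_def PiE_def extensional_def)
  have zero: "(\<integral>x. max 0 (x n) * f2 i x \<partial>elebesgue n) = 0" if i: "i \<in> {1..n}" "i \<noteq> n" for i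
    unfolding term_i[OF i(1)]
  proof (rule integral_eq_zero_AE, rule AE_I2)
    fix x assume x: "x \<in> space (PiM ({1..n}-{i}) (\<lambda>_. lborel :: real measure))"
    let ?x = "x(i := 0)"
    have x0: "?x \<in> euc n" using in_euc x i by auto
    have "(\<integral>y. f2 i (?x(i := y)) \<partial>lborel) = 0"
    proof (rule integral_deriv_compact_support[where F="\<lambda>t. f1 i (?x(i := t))" and r=r])
      show "((\<lambda>t. f1 i (?x(i := t))) has_real_derivative f2 i (?x(i := t))) (at t)" for t
        by (rule has_pd_line[OF f(4)[OF i(1)] x0 i(1)])
      show "isCont (\<lambda>t. f2 i (?x(i := t))) t" for t by (rule smooth_line_isCont[OF f(2)[OF i(1)] x0 i(1)])
      show "f1 i (?x(i := t)) = 0" "f2 i (?x(i := t)) = 0" if "r < \<bar>t\<bar>" for t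
        by (intro z1 z2 i fun_upd_in_euc x0 enorm_update_ge that)+
    qed
    moreover have "(\<integral>y. max 0 ((x(i := y)) n) * f2 i (x(i := y)) \<partial>lborel) = max 0 (x n) * (\<integral>y. f2 i (?x(i := y)) \<partial>lborel)"
      using i by simp
    ultimately show "(\<integral>y. max 0 ((x(i := y)) n) * f2 i (x(i := y)) \<partial>lborel) = 0" by simp
  qed
  have n1: "n \<in> {1..n}" "{1..n}-{n} = {1..n-1}" using n by auto
  have "(\<integral>x. max 0 (x n) * laplacian n \<phi> x \<partial>elebesgue n) = (\<integral>x. (\<Sum>i=1..n. max 0 (x n) * f2 i x) \<partial>elebesgue n)"
  proof (intro Bochner_Integration.integral_cong refl)
    fix x assume "x \<in> space (elebesgue n)"
    then have "laplacian n \<phi> x = (\<Sum>i=1..n. f2 i x)"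
      using laplacian_eq[of n \<phi> f1 f2 x] f(3,4) by simp
    then show "max 0 (x n) * laplacian n \<phi> x = (\<Sum>i=1..n. max 0 (x n) * f2 i x)"
      by (simp add: sum_distrib_left)
  qed
  also have "\<dots> = (\<Sum>i=1..n. \<integral>x. max 0 (x n) * f2 i x \<partial>elebesgue n)"
    by (rule Bochner_Integration.integral_sum) (rule int)
  also have "\<dots> = (\<integral>x. max 0 (x n) * f2 n x \<partial>elebesgue n)"
    by (subst sum.remove[OF _ n1(1)]) (auto intro!: sum.neutral zero)
  also have "\<dots> = (\<integral>x. \<phi> (x(n := 0)) \<partial>PiM ({1..n}-{n}) (\<lambda>_. lborel))"
    unfolding term_i[OF n1(1)]
  proof (rule Bochner_Integration.integral_cong[OF refl])
    fix x assume x: "x \<in> space (PiM ({1..n}-{n}) (\<lambda>_. lborel :: real measure))"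
    let ?x = "x(n := 0)"
    have x0: "?x \<in> euc n" using in_euc x n1 by auto
    have "(\<integral>t. max 0 t * f2 n (?x(n := t)) \<partial>lborel) = \<phi> (?x(n := 0))"
    proof (rule integral_pos_part_second_deriv[where F="\<lambda>t. \<phi> (?x(n := t))" and ?F1.0="\<lambda>t. f1 n (?x(n := t))" and r=r])
      show "((\<lambda>t. \<phi> (?x(n := t))) has_real_derivative f1 n (?x(n := t))) (at t)"
        "((\<lambda>t. f1 n (?x(n := t))) has_real_derivative f2 n (?x(n := t))) (at t)" for t
        by (rule has_pd_line[OF _ x0 n1(1)] f(3)[OF n1(1)] f(4)[OF n1(1)])+
      show "isCont (\<lambda>t. f2 n (?x(n := t))) t" for t by (rule smooth_line_isCont[OF f(2)[OF n1(1)] x0 n1(1)])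
      show "\<phi> (?x(n := t)) = 0" "f1 n (?x(n := t)) = 0" "f2 n (?x(n := t)) = 0" if "r < \<bar>t\<bar>" for t
        by (intro z z1 z2 n1 fun_upd_in_euc x0 enorm_update_ge that)+
    qed
    then show "(\<integral>y. max 0 ((x(n := y)) n) * f2 n (x(n := y)) \<partial>lborel) = \<phi> (x(n := 0))" by simp
  qed
  finally show ?thesis unfolding n1(2) elebesgue_def .
qed

section \<open>The regularised Newtonian kernel\<close>

definition cutoff_family :: "(nat \<Rightarrow> real \<Rightarrow> real) \<Rightarrow> real \<Rightarrow> bool" where
  "cutoff_family D B \<longleftrightarrow> (\<forall>k t. (D k has_real_derivative D (Suc k) t) (at t)) \<and>
     (\<forall>t\<le>1. D 0 t = 1) \<and> (\<forall>t\<ge>4. D 0 t = 0) \<and> (\<forall>t. 0 \<le> D 0 t \<and> D 0 t \<le> 1) \<and>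
     (\<forall>t. t < 1 \<or> t > 4 \<longrightarrow> D 1 t = 0 \<and> D 2 t = 0) \<and> (\<forall>t. \<bar>D 1 t\<bar> \<le> B \<and> \<bar>D 2 t\<bar> \<le> B)"

text \<open>Chosen once and for all, so that \<open>chiB\<close> is an absolute constant and the
  constants built from it depend on the dimension only.\<close>

definition chi :: "nat \<Rightarrow> real \<Rightarrow> real" where
  "chi = (SOME D. \<exists>B. cutoff_family D B)"

definition chiB :: real where
  "chiB = (SOME B. cutoff_family chi B)"

lemma chi_family: "cutoff_family chi chiB"
proof -
  have "\<exists>D B. cutoff_family D B" unfolding cutoff_family_def by (rule cutoff_exists)
  then have "\<exists>B. cutoff_family chi B" unfolding chi_def by (rule someI_ex)
  then show ?thesis unfolding chiB_def by (rule someI_ex)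
qed

lemma chi:
  "(chi k has_real_derivative chi (Suc k) t) (at t)" "t \<le> 1 \<Longrightarrow> chi 0 t = 1" "t \<ge> 4 \<Longrightarrow> chi 0 t = 0"
  "0 \<le> chi 0 t" "chi 0 t \<le> 1" "t < 1 \<Longrightarrow> chi 1 t = 0" "t > 4 \<Longrightarrow> chi 1 t = 0"
  "t < 1 \<Longrightarrow> chi 2 t = 0" "t > 4 \<Longrightarrow> chi 2 t = 0"
  using chi_family unfolding cutoff_family_def by blast+

lemma chiB: "\<bar>chi 1 t\<bar> \<le> chiB" "\<bar>chi 2 t\<bar> \<le> chiB"
  using chi_family unfolding cutoff_family_def by blast+

lemma chiB_nonneg: "0 \<le> chiB"
  using chiB(1)[of 0] by linarith

text \<open>The k-th derivative of the rescaled cut-off as a function of the squared distance s,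
  whence the powers of \<open>\<rho>\<^sup>2\<close>.\<close>

definition cutoff :: "real \<Rightarrow> nat \<Rightarrow> real \<Rightarrow> real" where
  "cutoff \<rho> k s = chi k (s / \<rho>\<^sup>2) / (\<rho>\<^sup>2) ^ k"

text \<open>For k = 0 and s = |z|^2 this is the Newtonian kernel regularised by e. Larger k are its
  derivatives in s up to the factors -(n/2 - 1 + k), which are kept outside so that every member of
  the family is nonnegative.\<close>

definition bub :: "nat \<Rightarrow> real \<Rightarrow> nat \<Rightarrow> real \<Rightarrow> real" where
  "bub n e k s = (s + e) powr (- (real n / 2 - 1 + real k))"

lemma cutoff_deriv: "\<rho> > 0 \<Longrightarrow> (cutoff \<rho> k has_real_derivative cutoff \<rho> (Suc k) s) (at s)"
proof -
  assume "\<rho> > 0"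
  have "((\<lambda>s. chi k (s / \<rho>\<^sup>2)) has_real_derivative chi (Suc k) (s / \<rho>\<^sup>2) * (1 / \<rho>\<^sup>2)) (at s)"
    by (rule DERIV_chain2[OF chi(1)]) (intro DERIV_cdivide DERIV_ident)
  from DERIV_cdivide[OF this, of "(\<rho>\<^sup>2) ^ k"] show ?thesis
    by (simp add: cutoff_def[abs_def])
qed

lemma bub_deriv:
  assumes "s > - e"
  shows "(bub n e k has_real_derivative - (real n / 2 - 1 + real k) * bub n e (Suc k) s) (at s)"
proof -
  have "((\<lambda>s. (s + e) powr (- (real n / 2 - 1 + real k))) has_real_derivative
      - (real n / 2 - 1 + real k) * (s + e) powr (- (real n / 2 - 1 + real k) - 1)) (at s)"
    using assms by (auto intro!: derivative_eq_intros)
  moreover have "- (real n / 2 - 1 + real k) - 1 = - (real n / 2 - 1 + real (Suc k))" by simp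
  ultimately show ?thesis unfolding bub_def[abs_def] by simp
qed

lemma has_pd_comp:
  assumes "has_pd n i h h'" "\<And>x. x \<in> euc n \<Longrightarrow> (F has_real_derivative F' (h x)) (at (h x))"
  shows "has_pd n i (\<lambda>x. F (h x)) (\<lambda>x. F' (h x) * h' x)"
  unfolding has_pd_def
proof
  fix x assume x: "x \<in> euc n"
  have "(F has_real_derivative F' (h x)) (at (h (x(i := x i))))" using assms(2)[OF x] by simp
  then show "((\<lambda>t. F (h (x(i := t)))) has_real_derivative F' (h x) * h' x) (at (x i))"
    by (rule DERIV_chain2) (rule assms(1)[unfolded has_pd_def, rule_format, OF x])
qed

lemma has_pd_mult:
  assumes "has_pd n i f f'" "has_pd n i g g'"
  shows "has_pd n i (\<lambda>x. f x * g x) (\<lambda>x. f' x * g x + g' x * f x)"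
  unfolding has_pd_def
proof
  fix x assume x: "x \<in> euc n"
  have "((\<lambda>t. f (x(i := t)) * g (x(i := t))) has_real_derivative
     f' x * g (x(i := x i)) + g' x * f (x(i := x i))) (at (x i))"
    using assms x by (intro DERIV_mult) (auto simp: has_pd_def)
  then show "((\<lambda>t. f (x(i := t)) * g (x(i := t))) has_real_derivative f' x * g x + g' x * f x) (at (x i))"
    by simp
qed

lemma has_pd_add:
  assumes "has_pd n i f f'" "has_pd n i g g'"
  shows "has_pd n i (\<lambda>x. f x + g x) (\<lambda>x. f' x + g' x)"
  using assms by (auto simp: has_pd_def intro!: DERIV_add)

lemma has_pd_const: "has_pd n i (\<lambda>x. c) (\<lambda>x. 0)"
  by (auto simp: has_pd_def)

lemma has_pd_enorm2:
  assumes i: "i \<in> {1..n}"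
  shows "has_pd n i (\<lambda>y. (enorm n (\<lambda>j. y j - x j))\<^sup>2) (\<lambda>y. 2 * (y i - x i))"
  unfolding has_pd_def
proof
  fix y :: vec assume "y \<in> euc n"
  have *: "(enorm n (\<lambda>j. (y(i := t)) j - x j))\<^sup>2 = (t - x i)\<^sup>2 + (\<Sum>j\<in>{1..n}-{i}. (y j - x j)\<^sup>2)" for t
  proof -
    have "(enorm n (\<lambda>j. (y(i := t)) j - x j))\<^sup>2
      = ((y(i := t)) i - x i)\<^sup>2 + (\<Sum>j\<in>{1..n}-{i}. ((y(i := t)) j - x j)\<^sup>2)"
      unfolding enorm_power2 by (rule sum.remove) (use i in auto)
    also have "(\<Sum>j\<in>{1..n}-{i}. ((y(i := t)) j - x j)\<^sup>2) = (\<Sum>j\<in>{1..n}-{i}. (y j - x j)\<^sup>2)"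
      by (intro sum.cong) auto
    finally show ?thesis by (simp only: fun_upd_same)
  qed
  show "((\<lambda>t. (enorm n (\<lambda>j. (y(i := t)) j - x j))\<^sup>2) has_real_derivative 2 * (y i - x i)) (at (y i))"
    unfolding * by (auto intro!: derivative_eq_intros)
qed

lemma smooth_enorm2: "smooth n (\<lambda>y. (enorm n (\<lambda>j. y j - x j))\<^sup>2)"
proof -
  have "smooth n (\<lambda>y. \<Sum>j=1..n. (y j + - x j) * (y j + - x j))"
    by (intro smooth_sum smooth.mult smooth.add smooth.coord smooth.const) auto
  then show ?thesis unfolding enorm_power2 by (simp add: power2_eq_square)
qed

text \<open>The cut-off is centred at 0 and not at x. So all these test functions vanish outside the
  same ball, and the terms in which the cut-off is differentiated live on a fixed annulus, where the
  kernel is smooth in x near 0.\<close>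

definition ker :: "nat \<Rightarrow> real \<Rightarrow> real \<Rightarrow> vec \<Rightarrow> vec \<Rightarrow> real" where
  "ker n \<rho> e x y = cutoff \<rho> 0 ((enorm n y)\<^sup>2) * bub n e 0 ((enorm n (\<lambda>j. y j - x j))\<^sup>2)"

lemma cutoff_0_eq_0: "\<rho> > 0 \<Longrightarrow> 2 * \<rho> \<le> s \<Longrightarrow> cutoff \<rho> 0 (s\<^sup>2) = 0"
proof -
  assume *: "\<rho> > 0" "2 * \<rho> \<le> s"
  then have "(2 * \<rho>)\<^sup>2 \<le> s\<^sup>2" by (intro power_mono) auto
  then have "4 \<le> s\<^sup>2 / \<rho>\<^sup>2" using * by (simp add: field_simps power_mult_distrib)
  then show ?thesis by (simp add: cutoff_def chi(3))
qed

lemma cutoff_0_eq_1: "\<rho> > 0 \<Longrightarrow> 0 \<le> s \<Longrightarrow> s \<le> \<rho> \<Longrightarrow> cutoff \<rho> 0 (s\<^sup>2) = 1"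
proof -
  assume *: "\<rho> > 0" "0 \<le> s" "s \<le> \<rho>"
  then have "s\<^sup>2 \<le> \<rho>\<^sup>2" by (intro power_mono) auto
  then have "s\<^sup>2 / \<rho>\<^sup>2 \<le> 1" using * by (simp add: field_simps)
  then show ?thesis by (simp add: cutoff_def chi(2))
qed

lemma cutoff_12_eq_0:
  assumes "\<rho> > 0" "0 \<le> s" "s < \<rho> \<or> 2 * \<rho> < s"
  shows "cutoff \<rho> 1 (s\<^sup>2) = 0" "cutoff \<rho> 2 (s\<^sup>2) = 0"
proof -
  have "s\<^sup>2 / \<rho>\<^sup>2 < 1 \<or> s\<^sup>2 / \<rho>\<^sup>2 > 4"
  proof (cases "s < \<rho>")
    case True
    then have "s\<^sup>2 < \<rho>\<^sup>2" using assms by (intro power_strict_mono) auto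
    then show ?thesis using assms by (simp add: field_simps)
  next
    case False
    then have "(2 * \<rho>)\<^sup>2 < s\<^sup>2" using assms by (intro power_strict_mono) auto
    then show ?thesis using assms by (simp add: field_simps power_mult_distrib)
  qed
  then show "cutoff \<rho> 1 (s\<^sup>2) = 0" "cutoff \<rho> 2 (s\<^sup>2) = 0"
    by (auto simp: cutoff_def chi chi(6,7)[unfolded One_nat_def])
qed

lemma cutoff_01: "0 \<le> cutoff \<rho> 0 s" "cutoff \<rho> 0 s \<le> 1"
  by (auto simp: cutoff_def chi)

lemma cutoff_bounds: "\<bar>cutoff \<rho> 1 s\<bar> \<le> chiB / \<rho>\<^sup>2" "\<bar>cutoff \<rho> 2 s\<bar> \<le> chiB / \<rho> ^ 4"
  using chiB[of "s / \<rho>\<^sup>2"] by (auto simp: cutoff_def divide_right_mono power_mult[symmetric])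

lemma smooth_ker:
  assumes "\<rho> > 0" "e > 0"
  shows "smooth n (ker n \<rho> e x)"
proof -
  have 1: "smooth n (\<lambda>y. cutoff \<rho> 0 ((enorm n y)\<^sup>2))"
    by (rule smooth.comp[where S=UNIV and D="cutoff \<rho>" and h="\<lambda>y. (enorm n y)\<^sup>2"])
       (use smooth_enorm2[of n "\<lambda>_. 0"] cutoff_deriv[OF assms(1)] in auto)
  define D where "D k s = (\<Prod>j<k. - (real n / 2 - 1 + real j)) * bub n e k s" for k s
  have "smooth n (\<lambda>y. D 0 ((enorm n (\<lambda>j. y j - x j))\<^sup>2))"
  proof (rule smooth.comp[where S="{- e<..}" and D=D and h="\<lambda>y. (enorm n (\<lambda>j. y j - x j))\<^sup>2"])
    show "smooth n (\<lambda>y. (enorm n (\<lambda>j. y j - x j))\<^sup>2)" by (rule smooth_enorm2)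
    show "(enorm n (\<lambda>j. y j - x j))\<^sup>2 \<in> {- e<..}" for y
      using assms(2) by (auto intro: less_le_trans[of _ 0])
    fix k s assume "s \<in> {- e<..}"
    then have "((\<lambda>s. (\<Prod>j<k. - (real n / 2 - 1 + real j)) * bub n e k s) has_real_derivative
        (\<Prod>j<k. - (real n / 2 - 1 + real j)) * (- (real n / 2 - 1 + real k) * bub n e (Suc k) s)) (at s)"
      by (intro DERIV_cmult bub_deriv) auto
    then show "(D k has_real_derivative D (Suc k) s) (at s)"
      unfolding D_def[abs_def] by (simp only: prod.lessThan_Suc mult.assoc)
  qed auto
  then have "smooth n (\<lambda>y. bub n e 0 ((enorm n (\<lambda>j. y j - x j))\<^sup>2))" by (simp add: D_def)
  from smooth.mult[OF 1 this] show ?thesis by (simp add: ker_def[abs_def])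
qed

lemma ker_zero: "\<rho> > 0 \<Longrightarrow> 2 * \<rho> \<le> enorm n y \<Longrightarrow> ker n \<rho> e x y = 0"
  by (simp add: ker_def cutoff_0_eq_0)

text \<open>The part of the Laplacian of \<open>ker\<close> that contains derivatives of the
  cut-off: the Laplacian of the cut-off times the kernel, plus twice the product of the two
  gradients. It lives where \<rho> \<le> |y| \<le> 2 \<rho>.\<close>

definition cutpart :: "nat \<Rightarrow> real \<Rightarrow> real \<Rightarrow> vec \<Rightarrow> vec \<Rightarrow> real" where
  "cutpart n \<rho> e x y =
     (2 * real n * cutoff \<rho> 1 ((enorm n y)\<^sup>2) + 4 * (enorm n y)\<^sup>2 * cutoff \<rho> 2 ((enorm n y)\<^sup>2))
       * bub n e 0 ((enorm n (\<lambda>j. y j - x j))\<^sup>2)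
     - 4 * (real n - 2) * cutoff \<rho> 1 ((enorm n y)\<^sup>2) * bub n e 1 ((enorm n (\<lambda>j. y j - x j))\<^sup>2)
       * ((enorm n y)\<^sup>2 - einner n x y)"

lemma laplacian_ker:
  assumes \<rho>: "\<rho> > 0" and e: "e > 0" and y: "y \<in> euc n"
  shows "laplacian n (ker n \<rho> e x) y =
    - (real n * (real n - 2)) * (cutoff \<rho> 0 ((enorm n y)\<^sup>2) * (e * bub n e 2 ((enorm n (\<lambda>j. y j - x j))\<^sup>2)))
    + cutpart n \<rho> e x y"
proof -
  define p where "p = real n / 2 - 1"
  define a where "a y = (enorm n y)\<^sup>2" for y
  define b where "b y = (enorm n (\<lambda>j. y j - x j))\<^sup>2" for y :: vec
  define X where "X = cutoff \<rho>"
  define q where "q k s = bub n e k s" for k s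
  have b0: "b y > - e" for y
    unfolding b_def by (rule less_le_trans[of _ 0]) (use e in auto)
  have pa: "has_pd n i a (\<lambda>y. 2 * (y i - 0))" if "i \<in> {1..n}" for i
    using has_pd_enorm2[OF that, of "\<lambda>_. 0"] by (simp add: a_def[abs_def])
  have pb: "has_pd n i b (\<lambda>y. 2 * (y i - x i))" if "i \<in> {1..n}" for i
    using has_pd_enorm2[OF that, of x] by (simp add: b_def[abs_def])
  have pX: "has_pd n i (\<lambda>y. X k (a y)) (\<lambda>y. X (Suc k) (a y) * (2 * (y i - 0)))" if "i \<in> {1..n}" for i k
    unfolding X_def by (rule has_pd_comp[OF pa[OF that] cutoff_deriv[OF \<rho>]])
  have pq: "has_pd n i (\<lambda>y. q k (b y)) (\<lambda>y. - (p + real k) * q (Suc k) (b y) * (2 * (y i - x i)))" if "i \<in> {1..n}" for i k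
    unfolding q_def p_def by (rule has_pd_comp[OF pb[OF that] bub_deriv[OF b0]])
  define f1 where "f1 i y = X 1 (a y) * (2 * (y i - 0)) * q 0 (b y) + - (p + real 0) * q 1 (b y) * (2 * (y i - x i)) * X 0 (a y)" for i y
  have 1: "has_pd n i (ker n \<rho> e x) (f1 i)" if i: "i \<in> {1..n}" for i
    using has_pd_mult[OF pX[OF i, of 0] pq[OF i, of 0]]
    by (simp add: f1_def[abs_def] ker_def[abs_def] X_def a_def b_def q_def One_nat_def)
  have pc: "has_pd n i (\<lambda>y. 2 * (y i - c)) (\<lambda>y. 2)" for i c
    by (auto simp: has_pd_def intro!: derivative_eq_intros)
  define f2 where "f2 i y =
     ((X 2 (a y) * (2 * (y i - 0)) * (2 * (y i - 0)) + 2 * X 1 (a y)) * q 0 (b y)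
       + (- (p + real 0) * q 1 (b y) * (2 * (y i - x i))) * (X 1 (a y) * (2 * (y i - 0))))
     + - (p + real 0) * (((- (p + real 1) * q 2 (b y) * (2 * (y i - x i))) * (2 * (y i - x i)) + 2 * q 1 (b y)) * X 0 (a y)
       + (X 1 (a y) * (2 * (y i - 0))) * (q 1 (b y) * (2 * (y i - x i))))" for i y
  have 2: "has_pd n i (f1 i) (f2 i)" if i: "i \<in> {1..n}" for i
  proof -
    have A: "has_pd n i (\<lambda>y. X 1 (a y) * (2 * (y i - 0)) * q 0 (b y))
      (\<lambda>y. (X 2 (a y) * (2 * (y i - 0)) * (2 * (y i - 0)) + 2 * X 1 (a y)) * q 0 (b y)
       + (- (p + real 0) * q 1 (b y) * (2 * (y i - x i))) * (X 1 (a y) * (2 * (y i - 0))))"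
      using has_pd_mult[OF has_pd_mult[OF pX[OF i, of 1] pc] pq[OF i, of 0]]
      by (simp only: One_nat_def numeral_2_eq_2)
    have B: "has_pd n i (\<lambda>y. q 1 (b y) * (2 * (y i - x i)) * X 0 (a y))
      (\<lambda>y. ((- (p + real 1) * q 2 (b y) * (2 * (y i - x i))) * (2 * (y i - x i)) + 2 * q 1 (b y)) * X 0 (a y)
       + (X 1 (a y) * (2 * (y i - 0))) * (q 1 (b y) * (2 * (y i - x i))))"
      using has_pd_mult[OF has_pd_mult[OF pq[OF i, of 1] pc] pX[OF i, of 0]]
      by (simp only: One_nat_def numeral_2_eq_2)
    have C: "has_pd n i (\<lambda>y. - (p + real 0) * (q 1 (b y) * (2 * (y i - x i)) * X 0 (a y)))
       (\<lambda>y. 0 * (q 1 (b y) * (2 * (y i - x i)) * X 0 (a y)) + (((- (p + real 1) * q 2 (b y) * (2 * (y i - x i))) * (2 * (y i - x i)) + 2 * q 1 (b y)) * X 0 (a y)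
       + (X 1 (a y) * (2 * (y i - 0))) * (q 1 (b y) * (2 * (y i - x i)))) * - (p + real 0))"
      by (rule has_pd_mult[OF has_pd_const B])
    show ?thesis using has_pd_add[OF A C] unfolding f1_def f2_def by (simp add: mult.assoc mult.commute[of _ p])
  qed
  have y2: "(\<Sum>i=1..n. y i * y i) = a y" unfolding a_def enorm_power2 by (simp add: power2_eq_square)
  have b2: "(\<Sum>i=1..n. (y i - x i) * (y i - x i)) = b y" unfolding b_def enorm_power2 by (simp add: power2_eq_square)
  have xy: "(\<Sum>i=1..n. y i * (y i - x i)) = a y - einner n x y"
    by (simp add: y2[symmetric] einner_def right_diff_distrib sum_subtractf mult.commute)
  have f2': "f2 i y = 4 * X 2 (a y) * q 0 (b y) * (y i * y i) + 2 * X 1 (a y) * q 0 (b y)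
     - 8 * p * X 1 (a y) * q 1 (b y) * (y i * (y i - x i))
     + 4 * p * (p + 1) * X 0 (a y) * q 2 (b y) * ((y i - x i) * (y i - x i)) - 2 * p * X 0 (a y) * q 1 (b y)" for i
    by (simp add: f2_def algebra_simps)
  have "laplacian n (ker n \<rho> e x) y = (\<Sum>i=1..n. f2 i y)"
    using laplacian_eq[of n "ker n \<rho> e x" f1 f2 y] 1 2 y by blast
  also have "\<dots> = 4 * X 2 (a y) * q 0 (b y) * a y + n * (2 * X 1 (a y) * q 0 (b y))
     - 8 * p * X 1 (a y) * q 1 (b y) * (a y - einner n x y)
     + 4 * p * (p + 1) * X 0 (a y) * q 2 (b y) * b y - n * (2 * p * X 0 (a y) * q 1 (b y))"
    unfolding f2' sum.distrib sum_subtractf sum_distrib_left[symmetric] y2 b2 xy by simp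
  finally have "laplacian n (ker n \<rho> e x) y = 4 * X 2 (a y) * q 0 (b y) * a y + n * (2 * X 1 (a y) * q 0 (b y))
     - 8 * p * X 1 (a y) * q 1 (b y) * (a y - einner n x y)
     + 4 * p * (p + 1) * X 0 (a y) * q 2 (b y) * b y - n * (2 * p * X 0 (a y) * q 1 (b y))" .
  note lap = this
  \<comment> \<open>As 2 (p + 1) = n, writing \<open>q 1\<close> as \<open>q 2\<close> times b + e
    cancels the terms in b and leaves only e: the kernel is harmonic up to a small concentrated
    bubble.\<close>
  have q1: "q 1 (b y) = q 2 (b y) * (b y + e)"
  proof -
    have "b y + e > 0" using b0[of y] by simp
    then show ?thesis by (simp add: q_def bub_def powr_mult_base mult.commute)
  qed
  have "4 * p * (p + 1) * X 0 (a y) * q 2 (b y) * b y - n * (2 * p * X 0 (a y) * q 1 (b y))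
     = - (real n * (real n - 2)) * (X 0 (a y) * (e * q 2 (b y)))"
    unfolding q1 by (simp add: p_def field_simps)
  with lap show ?thesis
    unfolding cutpart_def X_def[symmetric] b_def[symmetric] a_def[symmetric] q_def[symmetric]
    by (simp add: p_def algebra_simps)
qed

lemma euc_sets [measurable, simp]: "euc n \<in> sets (elebesgue n)"
  using sets.top[of "elebesgue n"] by simp

section \<open>The bubble as an approximate identity\<close>

definition bubint :: "nat \<Rightarrow> real" where
  "bubint n = (\<integral>z. bub n 1 2 ((enorm n z)\<^sup>2) \<partial>elebesgue n)"

lemma bub_nonneg [simp]: "0 \<le> bub n e k s"
  by (simp add: bub_def)

lemma bub_measurable [measurable]: "bub n e k \<in> borel_measurable borel"
  unfolding bub_def[abs_def] by measurable

text \<open>In polar coordinates the integrand is at most (1 + s^2)^(-1), because s^(n-1) \<le> (1 +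
  s^2)^(n/2).\<close>

lemma integrable_bub:
  assumes n: "n \<ge> 1"
  shows "integrable (elebesgue n) (\<lambda>z. bub n 1 2 ((enorm n z)\<^sup>2))"
proof (rule integrableI_nonneg)
  show "(\<lambda>z. bub n 1 2 ((enorm n z)\<^sup>2)) \<in> borel_measurable (elebesgue n)" by measurable
  have "(\<integral>\<^sup>+z. ennreal (bub n 1 2 ((enorm n z)\<^sup>2)) \<partial>elebesgue n) =
     ennreal (n * unit_ball_vol n) * (\<integral>\<^sup>+s. ennreal (bub n 1 2 (s\<^sup>2)) * ennreal (s ^ (n - 1)) * indicator {0<..} s \<partial>lborel)"
    by (rule nn_integral_radial[OF n, of "\<lambda>s. ennreal (bub n 1 2 (s\<^sup>2))"]) measurable
  note I = this
  have "(\<integral>\<^sup>+s. ennreal (bub n 1 2 (s\<^sup>2)) * ennreal (s ^ (n - 1)) * indicator {0<..} s \<partial>lborel)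
    \<le> (\<integral>\<^sup>+s. ennreal (inverse (1 + s\<^sup>2)) \<partial>lborel)"
  proof (rule nn_integral_mono)
    fix s :: real
    have "bub n 1 2 (s\<^sup>2) * s ^ (n - 1) \<le> inverse (1 + s\<^sup>2)" if s: "s > 0"
    proof -
      have pos: "1 + s\<^sup>2 > 0" by (simp add: add_pos_nonneg)
      have "s \<le> sqrt (1 + s\<^sup>2)" using s by (simp add: real_le_rsqrt)
      then have "s ^ (n - 1) \<le> sqrt (1 + s\<^sup>2) ^ (n - 1)" using s by (intro power_mono) auto
      also have "\<dots> \<le> sqrt (1 + s\<^sup>2) ^ n" by (intro power_increasing) auto
      also have "\<dots> = (1 + s\<^sup>2) powr (real n / 2)"
        using pos by (simp add: powr_half_sqrt[symmetric] powr_realpow[symmetric] powr_powr)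
      finally have "bub n 1 2 (s\<^sup>2) * s ^ (n - 1) \<le> bub n 1 2 (s\<^sup>2) * (1 + s\<^sup>2) powr (real n / 2)"
        by (intro mult_left_mono) auto
      also have "\<dots> = (1 + s\<^sup>2) powr (-1)"
        by (simp add: bub_def powr_add[symmetric] add.commute)
      also have "\<dots> = inverse (1 + s\<^sup>2)" using pos by (simp add: powr_minus)
      finally show ?thesis .
    qed
    then show "ennreal (bub n 1 2 (s\<^sup>2)) * ennreal (s ^ (n - 1)) * indicator {0<..} s \<le> ennreal (inverse (1 + s\<^sup>2))"
      by (auto simp: indicator_def ennreal_mult'[symmetric] intro!: ennreal_leI)
  qed
  also have "(\<integral>\<^sup>+s. ennreal (inverse (1 + s\<^sup>2)) \<partial>lborel) < \<infinity>"
  proof -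
    have "integrable lborel (\<lambda>s::real. inverse (1 + s\<^sup>2))"
      using integrable_inverse_1_plus_square by (simp add: set_integrable_def einterval_iff einterval_eq_UNIV)
    then show ?thesis by (simp add: integrable_iff_bounded abs_of_nonneg add_nonneg_nonneg)
  qed
  finally have "(\<integral>\<^sup>+s. ennreal (bub n 1 2 (s\<^sup>2)) * ennreal (s ^ (n - 1)) * indicator {0<..} s \<partial>lborel) < \<infinity>" .
  then show "(\<integral>\<^sup>+z. ennreal (bub n 1 2 ((enorm n z)\<^sup>2)) \<partial>elebesgue n) < \<infinity>"
    unfolding I by (simp add: ennreal_mult_less_top)
qed auto

lemma bubint_pos:
  assumes n: "n \<ge> 1"
  shows "bubint n > 0"
proof -
  have ge: "bubint n \<ge> 0" unfolding bubint_def by (rule Bochner_Integration.integral_nonneg) simp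
  have "bubint n \<noteq> 0"
  proof
    assume "bubint n = 0"
    then have "AE z in elebesgue n. bub n 1 2 ((enorm n z)\<^sup>2) = 0"
      unfolding bubint_def using integral_nonneg_eq_0_iff_AE[OF integrable_bub[OF n]] by simp
    moreover have "bub n 1 2 ((enorm n z)\<^sup>2) \<noteq> 0" for z
      using add_pos_nonneg[of 1 "(enorm n z)\<^sup>2"] by (simp add: bub_def add.commute)
    ultimately have "AE z in elebesgue n. False" by simp
    then have "emeasure (elebesgue n) (space (elebesgue n)) = 0"
      using AE_iff_measurable[of "space (elebesgue n)" "elebesgue n" "\<lambda>_. False"] sets.top[of "elebesgue n"] by simp
    moreover have "emeasure (elebesgue n) {x\<in>euc n. enorm n x \<le> 1} \<le> emeasure (elebesgue n) (space (elebesgue n))"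
      by (intro emeasure_mono) auto
    ultimately show False using emeasure_euc_cball[of 1 n] unit_ball_vol_pos[of "real n"]
      by (simp add: ennreal_eq_0_iff not_le del: unit_ball_vol_pos)
  qed
  then show ?thesis using ge by simp
qed

lemma bub_scaling:
  assumes "\<epsilon> > 0" "s \<ge> 0"
  shows "\<epsilon>\<^sup>2 * bub n (\<epsilon>\<^sup>2) 2 (\<epsilon>\<^sup>2 * s) * \<epsilon> ^ n = bub n 1 2 s"
proof -
  have "\<epsilon>\<^sup>2 * s + \<epsilon>\<^sup>2 = \<epsilon>\<^sup>2 * (s + 1)" by (simp add: algebra_simps)
  then have "bub n (\<epsilon>\<^sup>2) 2 (\<epsilon>\<^sup>2 * s) = (\<epsilon>\<^sup>2) powr (- (real n / 2 + 1)) * bub n 1 2 s"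
    using assms by (simp add: bub_def powr_mult add.commute)
  also have "(\<epsilon>\<^sup>2) powr (- (real n / 2 + 1)) = \<epsilon> powr (- (real n + 2))"
  proof -
    have "\<epsilon>\<^sup>2 = \<epsilon> powr 2" using assms by simp
    then have "(\<epsilon>\<^sup>2) powr (- (real n / 2 + 1)) = \<epsilon> powr (2 * (- (real n / 2 + 1)))" by (simp only: powr_powr)
    also have "2 * (- (real n / 2 + 1)) = - (real n + 2)" by simp
    finally show ?thesis .
  qed
  finally have 1: "bub n (\<epsilon>\<^sup>2) 2 (\<epsilon>\<^sup>2 * s) = \<epsilon> powr (- (real n + 2)) * bub n 1 2 s" .
  have 2: "\<epsilon>\<^sup>2 = \<epsilon> powr 2" "\<epsilon> ^ n = \<epsilon> powr (real n)" using assms by (simp_all add: powr_realpow)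
  have "\<epsilon>\<^sup>2 * bub n (\<epsilon>\<^sup>2) 2 (\<epsilon>\<^sup>2 * s) * \<epsilon> ^ n = (\<epsilon> powr 2 * \<epsilon> powr (- (real n + 2)) * \<epsilon> powr (real n)) * bub n 1 2 s"
    unfolding 1 unfolding 2 by (simp only: mult_ac)
  also have "\<epsilon> powr 2 * \<epsilon> powr (- (real n + 2)) * \<epsilon> powr (real n) = 1"
    unfolding powr_add[symmetric] using assms by simp
  finally show ?thesis by simp
qed

text \<open>Rescaling by \<epsilon>, with e = \<epsilon>^2, turns the bubble into a fixed integrable
  profile, and dominated convergence applies. Convergence of w is asked for only along the points x
  + \<epsilon> z, since w will be a truncated function that is continuous merely near x.\<close>

lemma bubble_approximate_identity:
  fixes w :: "vec \<Rightarrow> real" and \<epsilon> :: "nat \<Rightarrow> real"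
  assumes n: "n \<ge> 1" and w [measurable]: "w \<in> borel_measurable (elebesgue n)"
    and B: "\<And>y. y \<in> euc n \<Longrightarrow> \<bar>w y\<bar> \<le> B"
    and \<epsilon>: "\<And>k. \<epsilon> k > 0"
    and cont: "\<And>z. z \<in> euc n \<Longrightarrow> (\<lambda>k. w (evec n (\<lambda>i. x i + \<epsilon> k * z i))) \<longlonglongrightarrow> w x"
  shows "(\<lambda>k. \<integral>y. w y * ((\<epsilon> k)\<^sup>2 * bub n ((\<epsilon> k)\<^sup>2) 2 ((enorm n (\<lambda>j. y j - x j))\<^sup>2)) \<partial>elebesgue n) \<longlonglongrightarrow> bubint n * w x"
proof -
  have eq: "(\<integral>y. w y * (e\<^sup>2 * bub n (e\<^sup>2) 2 ((enorm n (\<lambda>j. y j - x j))\<^sup>2)) \<partial>elebesgue n)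
     = (\<integral>z. w (evec n (\<lambda>i. x i + e * z i)) * bub n 1 2 ((enorm n z)\<^sup>2) \<partial>elebesgue n)" if e: "e > 0" for e
  proof -
    have mm: "(\<lambda>y. enorm n (\<lambda>j. y j - x j)) \<in> borel_measurable (elebesgue n)"
    proof (rule continuous_measurable_euc)
      show "continuous_on (euc n) (\<lambda>y. enorm n (\<lambda>j. y j - x j))"
        unfolding enorm_alt by (intro continuous_intros)
    qed
    let ?F = "\<lambda>y. w y * (e\<^sup>2 * bub n (e\<^sup>2) 2 ((enorm n (\<lambda>j. y j - x j))\<^sup>2))"
    have Fm: "?F \<in> borel_measurable (elebesgue n)" using mm by measurable
    have "(\<integral>z. w (evec n (\<lambda>i. x i + e * z i)) * bub n 1 2 ((enorm n z)\<^sup>2) \<partial>elebesgue n)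
      = (\<integral>z. e ^ n * ?F (evec n (\<lambda>i. x i + e * z i)) \<partial>elebesgue n)"
    proof (intro Bochner_Integration.integral_cong refl)
      fix z
      have "enorm n (\<lambda>j. evec n (\<lambda>i. x i + e * z i) j - x j) = enorm n (\<lambda>j. e * z j)"
        by (rule enorm_cong) simp
      also have "\<dots> = e * enorm n z" using e by (simp add: enorm_scale)
      finally have N: "enorm n (\<lambda>j. evec n (\<lambda>i. x i + e * z i) j - x j) = e * enorm n z" .
      have s: "e\<^sup>2 * bub n (e\<^sup>2) 2 ((e * enorm n z)\<^sup>2) * e ^ n = bub n 1 2 ((enorm n z)\<^sup>2)"
        using bub_scaling[OF e, of "(enorm n z)\<^sup>2" n] by (simp add: power_mult_distrib)
      show "w (evec n (\<lambda>i. x i + e * z i)) * bub n 1 2 ((enorm n z)\<^sup>2) = e ^ n * ?F (evec n (\<lambda>i. x i + e * z i))"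
        unfolding N s[symmetric] by (simp only: mult_ac)
    qed
    also have "\<dots> = e ^ n * (\<integral>z. ?F (evec n (\<lambda>i. x i + e * z i)) \<partial>elebesgue n)" by simp
    also have "(\<integral>z. ?F (evec n (\<lambda>i. x i + e * z i)) \<partial>elebesgue n) = 1 / \<bar>e\<bar> ^ n * (\<integral>y. ?F y \<partial>elebesgue n)"
      by (rule integral_affine_elebesgue[OF _ Fm]) (use e in auto)
    finally show ?thesis using e by simp
  qed
  have "(\<lambda>k. \<integral>z. w (evec n (\<lambda>i. x i + \<epsilon> k * z i)) * bub n 1 2 ((enorm n z)\<^sup>2) \<partial>elebesgue n)
    \<longlonglongrightarrow> (\<integral>z. w x * bub n 1 2 ((enorm n z)\<^sup>2) \<partial>elebesgue n)"
  proof (rule integral_dominated_convergence[where w="\<lambda>z. B * bub n 1 2 ((enorm n z)\<^sup>2)"])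
    show "integrable (elebesgue n) (\<lambda>z. B * bub n 1 2 ((enorm n z)\<^sup>2))"
      by (intro integrable_mult_right integrable_bub n)
    show "AE z in elebesgue n. (\<lambda>k. w (evec n (\<lambda>i. x i + \<epsilon> k * z i)) * bub n 1 2 ((enorm n z)\<^sup>2)) \<longlonglongrightarrow> w x * bub n 1 2 ((enorm n z)\<^sup>2)"
      by (rule AE_I2) (intro tendsto_mult tendsto_const cont, simp)
    show "AE z in elebesgue n. norm (w (evec n (\<lambda>i. x i + \<epsilon> k * z i)) * bub n 1 2 ((enorm n z)\<^sup>2)) \<le> B * bub n 1 2 ((enorm n z)\<^sup>2)" for k
      using B by (intro AE_I2) (simp add: abs_mult mult_right_mono)
  qed measurable
  then show ?thesis unfolding eq[OF \<epsilon>] by (simp add: bubint_def mult.commute)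
qed

section \<open>The surface measure of the graph\<close>

text \<open>A continuity argument: the bound C on the derivative may be used only while |k| < B. Up
  to the first time at which |k| reaches the level B', the mean value theorem bounds |k| by A + C,
  which lies strictly below that level.\<close>

lemma bootstrap_bound:
  fixes k k' :: "real \<Rightarrow> real"
  assumes D: "\<And>t. (k has_real_derivative k' t) (at t)"
    and 0: "\<bar>k 0\<bar> \<le> A" and C: "\<And>t. 0 \<le> t \<Longrightarrow> t \<le> 1 \<Longrightarrow> \<bar>k t\<bar> < B \<Longrightarrow> \<bar>k' t\<bar> \<le> C"
    and B: "A + C < B" and C0: "0 \<le> C"
  shows "\<bar>k 1\<bar> \<le> A + C"
proof (rule ccontr)
  assume *: "\<not> \<bar>k 1\<bar> \<le> A + C"
  \<comment> \<open>The minimum with \<open>\<bar>k 1\<bar>\<close> puts the time 1 into S, so a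
    first time exists; by the contrary assumption B' still exceeds A + C.\<close>
  define B' where "B' = min B \<bar>k 1\<bar>"
  have B': "A + C < B'" "B' \<le> B" using * B by (auto simp: B'_def)
  define S where "S = {t. 0 \<le> t \<and> t \<le> 1 \<and> B' \<le> \<bar>k t\<bar>}"
  have ck: "continuous_on UNIV k" using D by (intro continuous_at_imp_continuous_on) (auto intro: DERIV_isCont)
  have "closed S"
  proof -
    have "S = {0..1} \<inter> {t. B' \<le> \<bar>k t\<bar>}" by (auto simp: S_def)
    moreover have "closed {t. B' \<le> \<bar>k t\<bar>}" by (intro closed_Collect_le continuous_intros ck)
    ultimately show ?thesis by (simp add: closed_Int)
  qed
  moreover have S1: "1 \<in> S" by (simp add: S_def B'_def)
  moreover have bb: "bdd_below S" by (rule bdd_belowI[of _ 0]) (simp add: S_def)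
  ultimately have t: "Inf S \<in> S" by (intro closed_contains_Inf) auto
  define t where "t = Inf S"
  have tS: "0 \<le> t" "t \<le> 1" "B' \<le> \<bar>k t\<bar>" using t by (auto simp: S_def t_def)
  have "t \<noteq> 0" using tS(3) 0 B' C0 by auto
  then have t0: "0 < t" using tS by simp
  obtain z where z: "0 < z" "z < t" "k t - k 0 = (t - 0) * k' z"
    using MVT2[OF t0, of k k'] D by auto
  have "z \<notin> S" using z cInf_lower[OF _ bb, of z] by (auto simp: t_def)
  then have "\<bar>k z\<bar> < B" using z tS B' by (auto simp: S_def)
  then have "\<bar>k' z\<bar> \<le> C" using z tS C[of z] by simp
  then have "\<bar>t * k' z\<bar> \<le> 1 * C" unfolding abs_mult using tS by (intro mult_mono) auto
  then have "\<bar>k t\<bar> \<le> A + C" using z(3) 0 by simp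
  then show False using tS(3) B' by simp
qed

definition lift :: "nat \<Rightarrow> (vec \<Rightarrow> real) \<Rightarrow> vec \<Rightarrow> vec" where
  "lift n \<psi> y = y(n := \<psi> y)"

lemma atLeastAtMost_pred: "n \<ge> 2 \<Longrightarrow> {1..n} = insert n {1..n-1}" for n :: nat
  by auto

lemma lift_props:
  assumes n: "n \<ge> 2" and y: "y \<in> euc (n - 1)"
  shows "lift n \<psi> y \<in> euc n" "evec (n - 1) (lift n \<psi> y) = y" "lift n \<psi> y n = \<psi> y"
    "(enorm n (lift n \<psi> y))\<^sup>2 = (enorm (n - 1) y)\<^sup>2 + (\<psi> y)\<^sup>2"
proof -
  show "lift n \<psi> y \<in> euc n" using n y by (auto simp: lift_def euc_def PiE_def extensional_def)
  show "evec (n - 1) (lift n \<psi> y) = y"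
    by (rule euc_eqI[OF _ y]) (use n in \<open>auto simp: lift_def\<close>)
  show "lift n \<psi> y n = \<psi> y" by (simp add: lift_def)
  have "(\<Sum>i=1..n. (lift n \<psi> y i)\<^sup>2) = (lift n \<psi> y n)\<^sup>2 + (\<Sum>i=1..n-1. (lift n \<psi> y i)\<^sup>2)"
    unfolding atLeastAtMost_pred[OF n] using n by (subst sum.insert) auto
  also have "(\<Sum>i=1..n-1. (lift n \<psi> y i)\<^sup>2) = (\<Sum>i=1..n-1. (y i)\<^sup>2)"
    using n by (intro sum.cong) (auto simp: lift_def)
  finally show "(enorm n (lift n \<psi> y))\<^sup>2 = (enorm (n - 1) y)\<^sup>2 + (\<psi> y)\<^sup>2"
    unfolding enorm_power2 by (simp add: lift_def)
qed

lemma enorm_split: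
  assumes n: "n \<ge> 2"
  shows "(enorm n x)\<^sup>2 = (enorm (n - 1) x)\<^sup>2 + (x n)\<^sup>2"
  unfolding enorm_power2 atLeastAtMost_pred[OF n] using n by (subst sum.insert) auto

lemma enorm_pred_le: "n \<ge> 2 \<Longrightarrow> enorm (n - 1) x \<le> enorm n x"
  by (rule power2_le_imp_le) (simp_all add: enorm_split)

lemma l1_le_enorm: "(\<Sum>i=1..d. \<bar>y i\<bar>) \<le> real d * enorm d y"
proof -
  have "(\<Sum>i=1..d. \<bar>y i\<bar>) \<le> (\<Sum>i=1..d. enorm d y)" by (intro sum_mono abs_coord_le_enorm) auto
  then show ?thesis by simp
qed

lemma C1_has_pd:
  assumes "Ck d 1 f" "i \<in> {1..d}"
  shows "has_pd d i f (partial i f)"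
  unfolding has_pd_def
proof
  fix x assume x: "x \<in> euc d"
  have "(\<lambda>t. f (x(i := t))) differentiable (at (x i))" using assms x by (simp add: One_nat_def)
  then show "((\<lambda>t. f (x(i := t))) has_real_derivative partial i f x) (at (x i))"
    unfolding partial_def by (simp add: DERIV_deriv_iff_real_differentiable)
qed

text \<open>The coordinates are changed one at a time from a to b, so partial derivatives and the
  one-dimensional bootstrap suffice, at the price of the l1-distance. The bound on the partials is
  assumed only where f has moved by less than B, which is the form in which a modulus taken over
  graph points can be applied.\<close>

lemma coordinate_path_bound:
  assumes f: "Ck d 1 f" and c0: "0 \<le> c" and a: "a \<in> euc d" and b: "b \<in> euc d"
    and c: "\<And>z i. z \<in> euc d \<Longrightarrow> enorm d z \<le> enorm d a + enorm d b \<Longrightarrow> i \<in> {1..d} \<Longrightarrow>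
        \<bar>f z - f a\<bar> < B \<Longrightarrow> \<bar>partial i f z\<bar> \<le> c"
    and B: "c * (\<Sum>i=1..d. \<bar>b i - a i\<bar>) < B"
  shows "\<bar>f b - f a\<bar> \<le> c * (\<Sum>i=1..d. \<bar>b i - a i\<bar>)"
proof -
  define y where "y j = evec d (\<lambda>i. if i \<le> j then b i else a i)" for j
  have "\<bar>f (y j) - f a\<bar> \<le> c * (\<Sum>i=1..j. \<bar>b i - a i\<bar>)" if "j \<le> d" for j
    using that
  proof (induction j)
    case 0
    have "y 0 = a" by (rule euc_eqI[OF _ a]) (auto simp: y_def)
    then show ?case by simp
  next
    case (Suc j)
    let ?i = "Suc j"
    have i: "?i \<in> {1..d}" using Suc by auto
    have ye: "y j \<in> euc d" by (simp add: y_def)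
    have y0: "(y j)(?i := a ?i) = y j"
      using i by (auto simp: y_def fun_eq_iff evec_def)
    have y1: "(y j)(?i := b ?i) = y (Suc j)"
      using i by (auto simp: y_def fun_eq_iff evec_def le_Suc_eq)
    define L where "L = b ?i - a ?i"
    define h where "h t = f ((y j)(?i := a ?i + t * L)) - f a" for t
    have "\<bar>h 1\<bar> \<le> c * (\<Sum>i=1..j. \<bar>b i - a i\<bar>) + c * \<bar>L\<bar>"
    proof (rule bootstrap_bound[where B=B and k'="\<lambda>t. partial ?i f ((y j)(?i := a ?i + t * L)) * L"])
      show "(h has_real_derivative partial ?i f ((y j)(?i := a ?i + t * L)) * L) (at t)" for t
      proof -
        have "((\<lambda>s. f ((y j)(?i := s))) has_real_derivative partial ?i f ((y j)(?i := a ?i + t * L))) (at (a ?i + t * L))"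
          by (rule has_pd_line[OF C1_has_pd[OF f i] ye i])
        then have "((\<lambda>s. f ((y j)(?i := a ?i + s * L))) has_real_derivative partial ?i f ((y j)(?i := a ?i + t * L)) * L) (at t)"
          by (rule DERIV_chain2) (auto intro!: derivative_eq_intros)
        from DERIV_diff[OF this DERIV_const[of "f a"]] show ?thesis unfolding h_def[abs_def] by simp
      qed
      show "\<bar>h 0\<bar> \<le> c * (\<Sum>i=1..j. \<bar>b i - a i\<bar>)" using Suc y0 by (simp add: h_def)
      have "(\<Sum>i=1..Suc j. \<bar>b i - a i\<bar>) \<le> (\<Sum>i=1..d. \<bar>b i - a i\<bar>)" using Suc by (intro sum_mono2) auto
      then have "c * (\<Sum>i=1..Suc j. \<bar>b i - a i\<bar>) \<le> c * (\<Sum>i=1..d. \<bar>b i - a i\<bar>)" using c0 by (intro mult_left_mono)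
      moreover have "c * (\<Sum>i=1..Suc j. \<bar>b i - a i\<bar>) = c * (\<Sum>i=1..j. \<bar>b i - a i\<bar>) + c * \<bar>L\<bar>"
        by (simp add: L_def distrib_left)
      ultimately show "c * (\<Sum>i=1..j. \<bar>b i - a i\<bar>) + c * \<bar>L\<bar> < B" using B by linarith
      fix t :: real assume t: "0 \<le> t" "t \<le> 1" and h: "\<bar>h t\<bar> < B"
      let ?z = "(y j)(?i := a ?i + t * L)"
      have "\<bar>a ?i + t * L\<bar> = \<bar>(1 - t) * a ?i + t * b ?i\<bar>" by (simp add: L_def algebra_simps)
      also have "\<dots> \<le> (1 - t) * \<bar>a ?i\<bar> + t * \<bar>b ?i\<bar>"
        using t abs_triangle_ineq[of "(1 - t) * a ?i" "t * b ?i"] by (simp add: abs_mult)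
      also have "\<dots> \<le> 1 * \<bar>a ?i\<bar> + 1 * \<bar>b ?i\<bar>" using t by (intro add_mono mult_right_mono) auto
      finally have tt: "\<bar>a ?i + t * L\<bar> \<le> \<bar>a ?i\<bar> + \<bar>b ?i\<bar>" by simp
      \<comment> \<open>The norm along the path need not stay below the larger of the two end norms.
        Each coordinate is dominated by \<open>\<bar>a i\<bar> + \<bar>b i\<bar>\<close>, which
        gives the bound by their sum.\<close>
      have "\<bar>?z i\<bar> \<le> \<bar>a i\<bar> + \<bar>b i\<bar>" if "i \<in> {1..d}" for i
      proof (cases "i = ?i")
        case True
        then show ?thesis using tt by (simp only: fun_upd_same)
      next
        case False
        then show ?thesis using that by (simp add: y_def)
      qed
      then have "L2_set (\<lambda>i. \<bar>?z i\<bar>) {1..d} \<le> L2_set (\<lambda>i. \<bar>a i\<bar> + \<bar>b i\<bar>) {1..d}"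
        by (intro L2_set_mono) auto
      then have "enorm d ?z \<le> enorm d (\<lambda>i. \<bar>a i\<bar> + \<bar>b i\<bar>)" by (simp only: enorm_def L2_set_def power2_abs)
      also have "\<dots> \<le> enorm d (\<lambda>i. \<bar>a i\<bar>) + enorm d (\<lambda>i. \<bar>b i\<bar>)" by (rule enorm_triangle)
      also have "\<dots> = enorm d a + enorm d b" by (simp add: enorm_alt)
      finally have "\<bar>partial ?i f ?z\<bar> \<le> c"
        by (intro c fun_upd_in_euc ye i) (use h in \<open>simp_all only: h_def\<close>)
      then show "\<bar>partial ?i f ?z * L\<bar> \<le> c * \<bar>L\<bar>" unfolding abs_mult by (intro mult_right_mono) auto
    qed (use c0 in auto)
    moreover have "h 1 = f (y (Suc j)) - f a" using y1 by (simp add: h_def L_def)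
    moreover have "c * (\<Sum>i=1..Suc j. \<bar>b i - a i\<bar>) = c * (\<Sum>i=1..j. \<bar>b i - a i\<bar>) + c * \<bar>L\<bar>"
      by (simp add: L_def distrib_left)
    ultimately show ?case by (simp only:)
  qed
  moreover have "y d = b" by (rule euc_eqI[OF _ b]) (auto simp: y_def)
  ultimately show ?thesis using order_refl by metis
qed

text \<open>On [0, 1] all higher powers of w are at most w. This linearises the power of a Lipschitz
  constant in its small part; equality holds at w = 0 and w = 1.\<close>

lemma one_plus_power_le:
  fixes w :: real
  assumes "0 \<le> w" "w \<le> 1" "0 \<le> a"
  shows "(1 + a * w) ^ k \<le> 1 + ((1 + a) ^ k - 1) * w"
proof (induction k)
  case (Suc k)
  define A where "A = (1 + a) ^ k - 1"
  have A0: "A \<ge> 0" using assms one_le_power[of "1 + a" k] by (simp add: A_def)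
  have "w * w \<le> w * 1" using assms by (intro mult_left_mono) auto
  then have "A * a * (w * w) \<le> A * a * w" using A0 assms by (intro mult_left_mono) auto
  moreover have "(1 + a * w) * (1 + A * w) = 1 + (A + a) * w + A * a * (w * w)" by (simp add: algebra_simps)
  moreover have "(1 + a) ^ Suc k - 1 = A + a + A * a" by (simp add: A_def algebra_simps)
  moreover have "(1 + a * w) ^ Suc k \<le> (1 + a * w) * (1 + A * w)"
    using Suc assms by (simp add: A_def mult_left_mono)
  ultimately show ?case by (simp add: algebra_simps)
qed simp

section \<open>The graph near the origin\<close>

locale dini_graph =
  fixes n :: nat and \<psi> :: "vec \<Rightarrow> real" and R :: real
  assumes n3: "n \<ge> 3" and zero_in: "ezero n \<in> Gam n \<psi>"
    and grad0: "grad (n - 1) \<psi> (ezero (n - 1)) = ezero (n - 1)" and C1D: "C1_Dini n \<psi>"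
    and R: "0 < R" "R \<le> 1" "omega_grad n \<psi> R \<le> 1"
begin

definition \<omega> :: "real \<Rightarrow> real" where "\<omega> = omega_grad n \<psi>"

lemma Ck1: "Ck (n - 1) 1 \<psi>"
  using C1D by (simp add: C1_Dini_def)

lemma psi_continuous: "continuous_on (euc (n - 1)) \<psi>"
  using Ck1 by (simp add: One_nat_def)

lemma om_mono: "0 \<le> r \<Longrightarrow> r \<le> s \<Longrightarrow> \<omega> r \<le> \<omega> s"
  using C1D by (auto simp: C1_Dini_def dini_def \<omega>_def mono_on_def)

lemma om_nonneg: "0 \<le> r \<Longrightarrow> 0 \<le> \<omega> r"
  using C1D by (auto simp: C1_Dini_def dini_def \<omega>_def)

lemma om_continuous: "continuous_on {0..} \<omega>"
  using C1D by (auto simp: C1_Dini_def dini_def \<omega>_def)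

lemma om_le_1: "0 \<le> r \<Longrightarrow> r \<le> R \<Longrightarrow> \<omega> r \<le> 1"
  using om_mono[of r R] R by (simp add: \<omega>_def)

lemma psi_0: "\<psi> (ezero (n - 1)) = 0"
proof -
  have "evec (n - 1) (ezero n) = ezero (n - 1)"
    by (rule euc_eqI[of _ "n - 1"]) (auto simp: ezero_def)
  moreover have "ezero n n = 0" using n3 by (simp add: ezero_def)
  ultimately show ?thesis using zero_in by (simp add: Gam_def)
qed

text \<open>The supremum in the modulus runs over the open ball, hence the strict inequality for the
  norm of x; the boundedness stored in \<open>C1_Dini\<close> makes that supremum an upper
  bound.\<close>

lemma partial_le:
  assumes x: "x \<in> Gam n \<psi>" "enorm n x < s" and i: "i \<in> {1..n-1}"
  shows "\<bar>partial i \<psi> (evec (n - 1) x)\<bar> \<le> \<omega> s"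
proof -
  have s: "s > 0" using x(2) enorm_nonneg[of n x] by linarith
  have gi: "grad (n - 1) \<psi> (evec (n - 1) x) i = partial i \<psi> (evec (n - 1) x)"
    using i by (simp add: grad_def)
  have "ezero (n - 1) i = 0" using i by (simp add: ezero_def)
  then have "\<bar>partial i \<psi> (evec (n - 1) x)\<bar> \<le> grad_osc n \<psi> x"
    using abs_coord_le_enorm[OF i, of "\<lambda>i. grad (n - 1) \<psi> (evec (n - 1) x) i - ezero (n - 1) i"]
    unfolding grad_osc_def edist_def grad0 gi by simp
  also have "\<dots> \<le> (SUP x\<in>Gam n \<psi> \<inter> euc_ball n s. grad_osc n \<psi> x)"
  proof (rule cSUP_upper)
    show "x \<in> Gam n \<psi> \<inter> euc_ball n s" using x by (simp add: Gam_def euc_ball_def)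
    show "bdd_above (grad_osc n \<psi> ` (Gam n \<psi> \<inter> euc_ball n s))"
      by (rule bdd_above_mono[of "grad_osc n \<psi> ` Gam n \<psi>"]) (use C1D in \<open>auto simp: C1_Dini_def\<close>)
  qed
  also have "\<dots> = \<omega> s" using s by (simp add: \<omega>_def omega_grad_def sup_modulus_def)
  finally show ?thesis .
qed

lemma lift_in_Gam:
  assumes "y \<in> euc (n - 1)" "enorm n (lift n \<psi> y) < 1"
  shows "lift n \<psi> y \<in> Gam n \<psi>"
  using assms lift_props[of n y \<psi>] n3 by (simp add: Gam_def euc_ball_def)

lemma enorm_lift_le: "y \<in> euc (n - 1) \<Longrightarrow> enorm n (lift n \<psi> y) \<le> enorm (n - 1) y + \<bar>\<psi> y\<bar>"
proof (rule power2_le_imp_le)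
  assume y: "y \<in> euc (n - 1)"
  have "(enorm n (lift n \<psi> y))\<^sup>2 = (enorm (n - 1) y)\<^sup>2 + \<bar>\<psi> y\<bar>\<^sup>2" using lift_props(4)[of n y \<psi>] n3 y by simp
  also have "\<dots> \<le> (enorm (n - 1) y + \<bar>\<psi> y\<bar>)\<^sup>2" by (simp add: power2_sum)
  finally show "(enorm n (lift n \<psi> y))\<^sup>2 \<le> (enorm (n - 1) y + \<bar>\<psi> y\<bar>)\<^sup>2" .
qed auto

text \<open>The circular point: \<omega>(s) bounds the gradient at y only if the lifted point lies
  in the ball of radius s, which is itself a bound on \<psi>. For |y| < s/(2n) the estimate
  \<omega>(s) \<le> 1 lets \<psi> grow to less than s/2, and as long as |\<psi>| < s/2 the lifted
  point is in the ball. So the bootstrap closes.\<close>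

lemma small:
  assumes s: "0 < s" "s \<le> R" and y: "y \<in> euc (n - 1)" "enorm (n - 1) y < s / (2 * real n)"
  shows "\<bar>\<psi> y\<bar> \<le> real (n - 1) * \<omega> s * enorm (n - 1) y" "lift n \<psi> y \<in> Gam n \<psi>" "enorm n (lift n \<psi> y) < s"
proof -
  have w: "0 \<le> \<omega> s" "\<omega> s \<le> 1" using om_nonneg[of s] om_le_1[of s] s by auto
  have ez: "ezero (n - 1) \<in> euc (n - 1)" "enorm (n - 1) (ezero (n - 1)) = 0"
    by (auto simp: ezero_def enorm_alt)
  have sn: "s / (2 * real n) \<le> s / 2" using s n3 by (simp add: field_simps)
  have z: "enorm n (lift n \<psi> z) < s"
    if "z \<in> euc (n - 1)" "enorm (n - 1) z < s / (2 * real n)" "\<bar>\<psi> z\<bar> < s / 2" for z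
    using enorm_lift_le[OF that(1)] that(2,3) sn by linarith
  have sum: "(\<Sum>i=1..n-1. \<bar>y i - ezero (n - 1) i\<bar>) \<le> real (n - 1) * enorm (n - 1) y"
  proof -
    have "(\<Sum>i=1..n-1. \<bar>y i - ezero (n - 1) i\<bar>) = (\<Sum>i=1..n-1. \<bar>y i\<bar>)"
      by (intro sum.cong) (auto simp: ezero_def)
    then show ?thesis using l1_le_enorm[where d="n - 1" and y=y] by simp
  qed
  have "\<omega> s * (\<Sum>i=1..n-1. \<bar>y i - ezero (n - 1) i\<bar>) \<le> 1 * (real (n - 1) * enorm (n - 1) y)"
    using w sum by (intro mult_mono) (auto intro: sum_nonneg)
  also have "\<dots> < s / 2"
  proof -
    have "real (n - 1) * enorm (n - 1) y \<le> real n * enorm (n - 1) y" by (intro mult_right_mono) auto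
    also have "\<dots> < real n * (s / (2 * real n))" using y(2) n3 by (intro mult_strict_left_mono) auto
    also have "\<dots> = s / 2" using n3 by simp
    finally show ?thesis by simp
  qed
  finally have B: "\<omega> s * (\<Sum>i=1..n-1. \<bar>y i - ezero (n - 1) i\<bar>) < s / 2" .
  have "\<bar>\<psi> y - \<psi> (ezero (n - 1))\<bar> \<le> \<omega> s * (\<Sum>i=1..n-1. \<bar>y i - ezero (n - 1) i\<bar>)"
  proof (rule coordinate_path_bound[OF Ck1 w(1) ez(1) y(1) _ B])
    fix v i assume v: "v \<in> euc (n - 1)" "enorm (n - 1) v \<le> enorm (n - 1) (ezero (n - 1)) + enorm (n - 1) y"
      "i \<in> {1..n-1}" "\<bar>\<psi> v - \<psi> (ezero (n - 1))\<bar> < s / 2"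
    have Tv: "enorm n (lift n \<psi> v) < s" using v y(2) ez(2) psi_0 by (intro z) auto
    then have "\<bar>partial i \<psi> (evec (n - 1) (lift n \<psi> v))\<bar> \<le> \<omega> s"
      using s R by (intro partial_le lift_in_Gam v) auto
    then show "\<bar>partial i \<psi> v\<bar> \<le> \<omega> s" using lift_props(2)[of n v \<psi>] n3 v(1) by simp
  qed
  note 1 = this
  then have "\<bar>\<psi> y\<bar> < s / 2" using B psi_0 by simp
  then show l: "enorm n (lift n \<psi> y) < s" using z[OF y] by simp
  then show "lift n \<psi> y \<in> Gam n \<psi>" using s R by (intro lift_in_Gam y) auto
  have "\<omega> s * (\<Sum>i=1..n-1. \<bar>y i - ezero (n - 1) i\<bar>) \<le> \<omega> s * (real (n - 1) * enorm (n - 1) y)"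
    using w sum by (intro mult_left_mono)
  then show "\<bar>\<psi> y\<bar> \<le> real (n - 1) * \<omega> s * enorm (n - 1) y" using 1 psi_0 by (simp add: mult_ac)
qed

lemma psi_lipschitz:
  assumes s: "0 < s" "s \<le> R" and ab: "a \<in> euc (n - 1)" "b \<in> euc (n - 1)"
    "enorm (n - 1) a + enorm (n - 1) b < s / (2 * real n)"
  shows "\<bar>\<psi> b - \<psi> a\<bar> \<le> real (n - 1) * \<omega> s * edist (n - 1) b a"
proof -
  have w: "0 \<le> \<omega> s" using om_nonneg[of s] s by auto
  have "\<bar>\<psi> b - \<psi> a\<bar> \<le> \<omega> s * (\<Sum>i=1..n-1. \<bar>b i - a i\<bar>)"
  \<comment> \<open>The threshold is put out of reach: \<open>small\<close> already places every
    lifted point of the path in the ball of radius s, so the bound on the partials holds along the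
    whole path.\<close>
  proof (rule coordinate_path_bound[OF Ck1 w ab(1,2), where B="\<omega> s * (\<Sum>i=1..n-1. \<bar>b i - a i\<bar>) + 1"])
    fix v i assume v: "v \<in> euc (n - 1)" "enorm (n - 1) v \<le> enorm (n - 1) a + enorm (n - 1) b" "i \<in> {1..n-1}"
    have v2: "enorm (n - 1) v < s / (2 * real n)" using v(2) ab(3) by linarith
    have "\<bar>partial i \<psi> (evec (n - 1) (lift n \<psi> v))\<bar> \<le> \<omega> s"
      using small[OF s v(1) v2] by (intro partial_le v)
    then show "\<bar>partial i \<psi> v\<bar> \<le> \<omega> s" using lift_props(2)[of n v \<psi>] n3 v(1) by simp
  qed simp
  also have "\<dots> \<le> \<omega> s * (real (n - 1) * edist (n - 1) b a)"
    unfolding edist_def by (intro mult_left_mono l1_le_enorm w)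
  finally show ?thesis by (simp add: mult_ac)
qed

text \<open>The radius of the chart. It ensures 8n|y| \<le> R, hence \<omega>(8n|y|) \<le> 1,
  throughout. A factor 4n comes from comparing pairs of lifted points, the remaining 2 is spent when
  the surface density is localised at a point.\<close>

definition r0 :: real where "r0 = R / (8 * real n)"

lemma r0_pos: "0 < r0" using R n3 by (simp add: r0_def)

definition D0 :: "vec set" where "D0 = euc_ball (n - 1) r0"

text \<open>Described by conditions on the projection and not as an image under \<open>lift\<close>,
  so that measurability is immediate.\<close>

definition surf :: "vec set \<Rightarrow> vec set" where
  "surf E = {x\<in>euc n. evec (n - 1) x \<in> E \<and> x n = \<psi> (evec (n - 1) x)}"

lemma proj_measurable [measurable]: "evec (n - 1) \<in> measurable (elebesgue n) (elebesgue (n - 1))"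
proof -
  have "(\<lambda>x. \<lambda>i\<in>{1..n-1}. x i) \<in> measurable (elebesgue n) (PiM {1..n-1} (\<lambda>_. lborel))"
    using measurable_elebesgue_coord[of _ n] by (intro measurable_restrict) auto
  then show ?thesis by (simp add: evec_def[abs_def] elebesgue_def)
qed

lemma psi_measurable [measurable]: "\<psi> \<in> borel_measurable (elebesgue (n - 1))"
  by (rule continuous_measurable_euc[OF psi_continuous])

lemma surf_sets:
  assumes [measurable]: "E \<in> sets (elebesgue (n - 1))"
  shows "surf E \<in> sets (elebesgue n)"
proof -
  have [measurable]: "(\<lambda>x. x n) \<in> borel_measurable (elebesgue n)" using n3 by (intro measurable_elebesgue_coord) auto
  have "{x\<in>space (elebesgue n). x n = \<psi> (evec (n - 1) x)} \<in> sets (elebesgue n)"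
    by (intro borel_measurable_eq measurable_compose[OF proj_measurable psi_measurable]) measurable
  moreover have "{x\<in>space (elebesgue n). evec (n - 1) x \<in> E} \<in> sets (elebesgue n)" by measurable
  ultimately have "{x\<in>space (elebesgue n). evec (n - 1) x \<in> E} \<inter> {x\<in>space (elebesgue n). x n = \<psi> (evec (n - 1) x)} \<in> sets (elebesgue n)"
    by (intro sets.Int)
  moreover have "{x\<in>space (elebesgue n). evec (n - 1) x \<in> E} \<inter> {x\<in>space (elebesgue n). x n = \<psi> (evec (n - 1) x)} = surf E"
    by (auto simp: surf_def)
  ultimately show ?thesis by simp
qed

lemma surf_image: "E \<subseteq> euc (n - 1) \<Longrightarrow> surf E = lift n \<psi> ` E"
proof (intro set_eqI iffI)
  fix x assume E: "E \<subseteq> euc (n - 1)" and "x \<in> surf E"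
  then have x: "x \<in> euc n" "evec (n - 1) x \<in> E" "x n = \<psi> (evec (n - 1) x)" by (auto simp: surf_def)
  have "lift n \<psi> (evec (n - 1) x) = x"
    by (rule euc_eqI[OF lift_props(1) x(1)]) (use n3 x atLeastAtMost_pred[of n] in \<open>auto simp: lift_def\<close>)
  then show "x \<in> lift n \<psi> ` E" using x by force
next
  fix x assume E: "E \<subseteq> euc (n - 1)" and "x \<in> lift n \<psi> ` E"
  then obtain y where y: "y \<in> E" "y \<in> euc (n - 1)" "x = lift n \<psi> y" by auto
  then show "x \<in> surf E" using lift_props[of n y \<psi>] n3 by (simp add: surf_def)
qed

lemma lift_proj: "x \<in> surf E \<Longrightarrow> lift n \<psi> (evec (n - 1) x) = x"
proof -
  assume x: "x \<in> surf E"
  then have x: "x \<in> euc n" "x n = \<psi> (evec (n - 1) x)" by (auto simp: surf_def)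
  show ?thesis
    by (rule euc_eqI[OF lift_props(1) x(1)]) (use n3 x atLeastAtMost_pred[of n] in \<open>auto simp: lift_def\<close>)
qed

text \<open>The projection is 1-Lipschitz and maps the surface back onto E, where Hausdorff and
  Lebesgue measure agree.\<close>

lemma hausdorff_surf_ge:
  assumes E: "E \<in> sets (elebesgue (n - 1))"
  shows "emeasure (elebesgue (n - 1)) E \<le> hausdorff_outer n (n - 1) (surf E)"
proof -
  have d: "n - 1 \<ge> 1" using n3 by simp
  have Ee: "E \<subseteq> euc (n - 1)" using sets.sets_into_space[OF E] by simp
  have "evec (n - 1) ` surf E = E"
    unfolding surf_image[OF Ee] using Ee lift_props(2)[of n _ \<psi>] n3 by (force simp: image_image)
  then have "emeasure (elebesgue (n - 1)) E = hausdorff_outer (n - 1) (n - 1) (evec (n - 1) ` surf E)"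
    using hausdorff_eq_lebesgue[OF d E] by simp
  also have "\<dots> \<le> ennreal (1 ^ (n - 1)) * hausdorff_outer n (n - 1) (surf E)"
  proof (rule hausdorff_outer_lipschitz_image[OF _ d])
    fix x y
    have "edist (n - 1) (evec (n - 1) x) (evec (n - 1) y) = enorm (n - 1) (\<lambda>i. x i - y i)"
      unfolding edist_def by (rule enorm_cong) simp
    also have "\<dots> \<le> edist n x y" unfolding edist_def using n3 by (intro enorm_pred_le) auto
    finally show "edist (n - 1) (evec (n - 1) x) (evec (n - 1) y) \<le> 1 * edist n x y" by simp
  qed auto
  finally show ?thesis by simp
qed

text \<open>Over the ball of radius t the graph map has Lipschitz constant 1 + (n - 1)
  \<omega>(4nt), and the measure grows at most by its power n - 1. As t tends to 0 this meets the
  lower bound at the rate of the modulus.\<close>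

lemma hausdorff_surf_le:
  assumes E: "E \<in> sets (elebesgue (n - 1))" "E \<subseteq> euc_ball (n - 1) t" and t: "0 < t" "t \<le> r0"
  shows "hausdorff_outer n (n - 1) (surf E) \<le>
    ennreal (1 + ((1 + real (n - 1)) ^ (n - 1) - 1) * \<omega> (4 * real n * t)) * emeasure (elebesgue (n - 1)) E"
proof -
  have d: "n - 1 \<ge> 1" using n3 by simp
  \<comment> \<open>Two points of the ball have norms summing to less than 2t = s/(2n), the range of
    \<open>psi_lipschitz\<close>.\<close>
  define s where "s = 4 * real n * t"
  have s: "0 < s" "s \<le> R" "s / (2 * real n) = 2 * t" using t n3 R by (auto simp: s_def r0_def field_simps)
  have w: "0 \<le> \<omega> s" "\<omega> s \<le> 1" using om_nonneg[of s] om_le_1[of s] s by auto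
  have Ee: "E \<subseteq> euc (n - 1)" using sets.sets_into_space[OF E(1)] by simp
  define l where "l = 1 + real (n - 1) * \<omega> s"
  have l: "l > 0" using w by (simp add: l_def add_pos_nonneg)
  have "hausdorff_outer n (n - 1) (lift n \<psi> ` E) \<le> ennreal (l ^ (n - 1)) * hausdorff_outer (n - 1) (n - 1) E"
  proof (rule hausdorff_outer_lipschitz_image[OF l d])
    show "lift n \<psi> x \<in> euc n" if "x \<in> E" for x using that Ee lift_props(1)[of n x \<psi>] n3 by auto
    fix a b assume ab: "a \<in> E" "b \<in> E"
    have "enorm (n - 1) a < t" "enorm (n - 1) b < t"
      using subsetD[OF E(2) ab(1)] subsetD[OF E(2) ab(2)] by (simp_all add: euc_ball_def)
    then have "enorm (n - 1) b + enorm (n - 1) a < s / (2 * real n)" unfolding s(3) by linarith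
    then have L: "\<bar>\<psi> a - \<psi> b\<bar> \<le> real (n - 1) * \<omega> s * edist (n - 1) a b"
      using ab Ee by (intro psi_lipschitz s) auto
    have "(edist n (lift n \<psi> a) (lift n \<psi> b))\<^sup>2 = (edist (n - 1) a b)\<^sup>2 + \<bar>\<psi> a - \<psi> b\<bar>\<^sup>2"
    proof -
      have "(edist n (lift n \<psi> a) (lift n \<psi> b))\<^sup>2 =
         (enorm (n - 1) (\<lambda>i. lift n \<psi> a i - lift n \<psi> b i))\<^sup>2 + (lift n \<psi> a n - lift n \<psi> b n)\<^sup>2"
        unfolding edist_def using n3 by (intro enorm_split) auto
      also have "enorm (n - 1) (\<lambda>i. lift n \<psi> a i - lift n \<psi> b i) = edist (n - 1) a b"
        unfolding edist_def by (rule enorm_cong) (use n3 in \<open>auto simp: lift_def\<close>)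
      finally have e: "(edist n (lift n \<psi> a) (lift n \<psi> b))\<^sup>2 =
         (edist (n - 1) a b)\<^sup>2 + (lift n \<psi> a n - lift n \<psi> b n)\<^sup>2" .
      have "lift n \<psi> a n = \<psi> a" "lift n \<psi> b n = \<psi> b" by (simp_all add: lift_def)
      with e show ?thesis by (simp only: power2_abs)
    qed
    also have "\<dots> \<le> (edist (n - 1) a b + \<bar>\<psi> a - \<psi> b\<bar>)\<^sup>2" by (simp add: power2_sum)
    finally have "edist n (lift n \<psi> a) (lift n \<psi> b) \<le> edist (n - 1) a b + \<bar>\<psi> a - \<psi> b\<bar>"
      by (rule power2_le_imp_le) simp
    then show "edist n (lift n \<psi> a) (lift n \<psi> b) \<le> l * edist (n - 1) a b"
      using L by (simp add: l_def distrib_right)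
  qed
  also have "hausdorff_outer (n - 1) (n - 1) E = emeasure (elebesgue (n - 1)) E" by (rule hausdorff_eq_lebesgue[OF d E(1)])
  also have "ennreal (l ^ (n - 1)) * emeasure (elebesgue (n - 1)) E \<le>
    ennreal (1 + ((1 + real (n - 1)) ^ (n - 1) - 1) * \<omega> s) * emeasure (elebesgue (n - 1)) E"
    unfolding l_def by (intro mult_right_mono ennreal_leI one_plus_power_le w) auto
  finally show ?thesis unfolding surf_image[OF Ee] s_def .
qed

text \<open>What \<open>one_plus_power_le\<close> yields for a = n - 1 and k = n - 1.\<close>

definition cdens :: real where "cdens = (1 + real (n - 1)) ^ (n - 1) - 1"

lemma cdens_nonneg: "0 \<le> cdens"
  using one_le_power[of "1 + real (n - 1)" "n - 1"] by (simp add: cdens_def)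

end

text \<open>If f exceeded c on a subset of B of positive measure, integrating the excess over that
  set would contradict the hypothesis; the finite measure of B allows the subtraction.\<close>

lemma density_AE_le:
  fixes c :: ennreal
  assumes [measurable]: "f \<in> borel_measurable M" and B [measurable]: "B \<in> sets M" and fin: "emeasure M B < top" and c: "c < top"
    and le: "\<And>A. A \<in> sets M \<Longrightarrow> A \<subseteq> B \<Longrightarrow> emeasure (density M f) A \<le> c * emeasure M A"
  shows "AE x in M. x \<in> B \<longrightarrow> f x \<le> c"
proof -
  define A where "A = {x\<in>space M. x \<in> B \<and> c < f x}"
  have A [measurable]: "A \<in> sets M" unfolding A_def by measurable
  have AB: "A \<subseteq> B" by (auto simp: A_def)
  have "(\<integral>\<^sup>+x. f x * indicator A x \<partial>M) \<le> c * emeasure M A"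
    using le[OF A AB] by (simp add: emeasure_density)
  then have *: "(\<integral>\<^sup>+x. f x * indicator A x \<partial>M) \<le> (\<integral>\<^sup>+x. c * indicator A x \<partial>M)"
    by (simp add: nn_integral_cmult_indicator)
  have fA: "emeasure M A < top" using emeasure_mono[OF AB B] fin by (rule le_less_trans)
  have cA: "c * emeasure M A < top" using c fA by (simp add: ennreal_mult_less_top)
  have 0: "(\<integral>\<^sup>+x. (f x * indicator A x - c * indicator A x) \<partial>M) = 0"
  proof -
    have "(\<integral>\<^sup>+x. (f x * indicator A x - c * indicator A x) \<partial>M) = (\<integral>\<^sup>+x. f x * indicator A x \<partial>M) - (\<integral>\<^sup>+x. c * indicator A x \<partial>M)"
    proof (rule nn_integral_diff)
      show "(\<integral>\<^sup>+x. c * indicator A x \<partial>M) \<noteq> \<infinity>" using cA by (simp add: nn_integral_cmult_indicator)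
      show "AE x in M. c * indicator A x \<le> f x * indicator A x"
        by (rule AE_I2) (auto simp: A_def indicator_def)
    qed auto
    then show ?thesis using * by (simp add: diff_eq_0_iff_ennreal cA nn_integral_cmult_indicator order.strict_trans1)
  qed
  then have "AE x in M. f x * indicator A x - c * indicator A x = 0"
    by (subst (asm) nn_integral_0_iff_AE) auto
  then show ?thesis
  proof eventually_elim
    case (elim x)
    show ?case
    proof (intro impI, rule ccontr)
      assume x: "x \<in> B" "\<not> f x \<le> c"
      then have "x \<in> A" using sets.sets_into_space[OF B] by (auto simp: A_def)
      then have "f x - c = 0" using elim by simp
      then show False using x(2) by (simp add: diff_eq_0_iff_ennreal less_top c)
    qed
  qed
qed

lemma density_AE_ge:
  assumes [measurable]: "f \<in> borel_measurable M" and B [measurable]: "B \<in> sets M" and fin: "emeasure M B < top"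
    and le: "\<And>A. A \<in> sets M \<Longrightarrow> A \<subseteq> B \<Longrightarrow> emeasure M A \<le> emeasure (density M f) A"
  shows "AE x in M. x \<in> B \<longrightarrow> 1 \<le> f x"
proof -
  define A where "A = {x\<in>space M. x \<in> B \<and> f x < 1}"
  have A [measurable]: "A \<in> sets M" unfolding A_def by measurable
  have AB: "A \<subseteq> B" by (auto simp: A_def)
  have fA: "emeasure M A < top" using emeasure_mono[OF AB B] fin by (rule le_less_trans)
  have le': "(\<integral>\<^sup>+x. indicator A x \<partial>M) \<le> (\<integral>\<^sup>+x. f x * indicator A x \<partial>M)"
    using le[OF A AB] by (simp add: emeasure_density)
  have fin2: "(\<integral>\<^sup>+x. f x * indicator A x \<partial>M) < top"
  proof -
    have "(\<integral>\<^sup>+x. f x * indicator A x \<partial>M) \<le> (\<integral>\<^sup>+x. indicator A x \<partial>M)"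
      by (intro nn_integral_mono) (auto simp: A_def indicator_def)
    then show ?thesis using fA by (simp add: order.strict_trans1)
  qed
  have 0: "(\<integral>\<^sup>+x. (indicator A x - f x * indicator A x) \<partial>M) = 0"
  proof -
    have "(\<integral>\<^sup>+x. (indicator A x - f x * indicator A x) \<partial>M) = (\<integral>\<^sup>+x. indicator A x \<partial>M) - (\<integral>\<^sup>+x. f x * indicator A x \<partial>M)"
    proof (rule nn_integral_diff)
      show "AE x in M. f x * indicator A x \<le> indicator A x"
        by (rule AE_I2) (auto simp: A_def indicator_def)
    qed (use fin2 in auto)
    then show ?thesis using le' fA by (simp add: diff_eq_0_iff_ennreal)
  qed
  then have "AE x in M. indicator A x - f x * indicator A x = 0"
    by (subst (asm) nn_integral_0_iff_AE) auto
  then show ?thesis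
  proof eventually_elim
    case (elim x)
    show ?case
    proof (intro impI, rule ccontr)
      assume x: "x \<in> B" "\<not> 1 \<le> f x"
      then have "x \<in> A" using sets.sets_into_space[OF B] by (auto simp: A_def)
      then have "1 - f x = 0" using elim by simp
      then show False using x(2) by (simp add: diff_eq_0_iff_ennreal)
    qed
  qed
qed

section \<open>Density of the surface measure in graph coordinates\<close>

context dini_graph
begin

text \<open>The surface measure transported to the base of the graph, where the Radon-Nikodym
  theorem can compare it with Lebesgue measure.\<close>

definition surfmeas :: "vec measure" where
  "surfmeas = distr (restrict_space (hausdorff n (n - 1)) (surf D0)) (elebesgue (n - 1)) (evec (n - 1))"

lemma D0_sets: "D0 \<in> sets (elebesgue (n - 1))" "D0 \<subseteq> euc (n - 1)"
proof -
  show "D0 \<in> sets (elebesgue (n - 1))" unfolding D0_def by (rule euc_ball_sets)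
  show "D0 \<subseteq> euc (n - 1)" by (auto simp: D0_def euc_ball_def)
qed

lemma hd: "sets (hausdorff n (n - 1)) = sets (elebesgue n)" "space (hausdorff n (n - 1)) = euc n"
  "A \<in> sets (elebesgue n) \<Longrightarrow> emeasure (hausdorff n (n - 1)) A = hausdorff_outer n (n - 1) A"
  using hausdorff_measure[where d="n - 1" and n=n] n3 by auto

lemma proj_measurable_surf:
  "evec (n - 1) \<in> measurable (restrict_space (hausdorff n (n - 1)) (surf D0)) (elebesgue (n - 1))"
  by (rule measurable_restrict_space1) (use proj_measurable hd(1) in \<open>simp cong: measurable_cong_sets\<close>)

lemma emeasure_surfmeas:
  assumes E: "E \<in> sets (elebesgue (n - 1))"
  shows "emeasure surfmeas E = hausdorff_outer n (n - 1) (surf (E \<inter> D0))"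
proof -
  have s: "surf D0 \<in> sets (elebesgue n)" "surf (E \<inter> D0) \<in> sets (elebesgue n)"
    using E D0_sets by (auto intro!: surf_sets)
  have "evec (n - 1) -` E \<inter> space (restrict_space (hausdorff n (n - 1)) (surf D0)) = surf (E \<inter> D0)"
    unfolding space_restrict_space hd(2) by (auto simp: surf_def)
  then have "emeasure surfmeas E = emeasure (restrict_space (hausdorff n (n - 1)) (surf D0)) (surf (E \<inter> D0))"
    unfolding surfmeas_def using E proj_measurable_surf by (simp add: emeasure_distr)
  also have "\<dots> = emeasure (hausdorff n (n - 1)) (surf (E \<inter> D0))"
    by (rule emeasure_restrict_space) (use s hd in \<open>auto simp: surf_def\<close>)
  also have "\<dots> = hausdorff_outer n (n - 1) (surf (E \<inter> D0))" by (rule hd(3)[OF s(2)])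
  finally show ?thesis .
qed

text \<open>Comparison with Lebesgue measure on subsets of small balls gives absolute continuity,
  and Radon-Nikodym a density. The setwise bounds become pointwise: at least 1, and at most 1 +
  O(\<omega>(8n|y|)) at y. This plays the part of the classical factor sqrt(1 + |grad
  \<psi>|^2).\<close>

lemma surf_density:
  "\<exists>\<theta> :: vec \<Rightarrow> real. \<theta> \<in> borel_measurable (elebesgue (n - 1)) \<and>
     (\<forall>y. 1 \<le> \<theta> y \<and> \<theta> y \<le> 1 + cdens * \<omega> (8 * real n * enorm (n - 1) y)) \<and>
     surfmeas = density (elebesgue (n - 1)) (\<lambda>y. ennreal (indicator D0 y * \<theta> y))"
proof -
  let ?L = "elebesgue (n - 1)"
  interpret L: sigma_finite_measure ?L by (rule sigma_finite_elebesgue)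
  have d1: "n - 1 \<ge> 1" using n3 by simp
  have sS: "sets surfmeas = sets ?L" by (simp add: surfmeas_def)
  have ball: "euc_ball (n - 1) t \<in> sets ?L" "emeasure ?L (euc_ball (n - 1) t) < top" for t
  proof -
    have "emeasure ?L (euc_ball (n - 1) t) \<le> emeasure ?L {x\<in>euc (n - 1). enorm (n - 1) x \<le> t}"
      by (intro emeasure_mono euc_cball_finite) (auto simp: euc_ball_def)
    then show "emeasure ?L (euc_ball (n - 1) t) < top" using euc_cball_finite(2) by (rule le_less_trans)
  qed simp
  have up: "emeasure surfmeas E \<le> ennreal (1 + cdens * \<omega> (4 * real n * t)) * emeasure ?L E"
    if "E \<in> sets ?L" "E \<subseteq> euc_ball (n - 1) t" "0 < t" "t \<le> r0" for E t
  proof -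
    have "E \<inter> D0 = E" using that by (auto simp: D0_def euc_ball_def)
    then show ?thesis using hausdorff_surf_le[OF that] emeasure_surfmeas[OF that(1)] by (simp add: cdens_def)
  qed
  have ac: "absolutely_continuous ?L surfmeas"
    unfolding absolutely_continuous_def null_sets_def
  proof safe
    fix E assume E: "E \<in> sets ?L" "emeasure ?L E = 0"
    then show "E \<in> sets surfmeas" using sS by simp
    have "emeasure ?L (E \<inter> D0) \<le> emeasure ?L E" using E by (intro emeasure_mono) auto
    then have "emeasure ?L (E \<inter> D0) = 0" using E by simp
    then have "emeasure surfmeas (E \<inter> D0) \<le> 0"
      using up[of "E \<inter> D0" r0] E D0_sets r0_pos by (auto simp: D0_def)
    moreover have "emeasure surfmeas E = emeasure surfmeas (E \<inter> D0)"
      using emeasure_surfmeas[of E] emeasure_surfmeas[of "E \<inter> D0"] E D0_sets by (simp add: Int_assoc)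
    ultimately show "emeasure surfmeas E = 0" by simp
  qed
  obtain f where f [measurable]: "f \<in> borel_measurable ?L" and fd: "density ?L f = surfmeas"
    using L.Radon_Nikodym[OF ac sS] by auto
  have AE1: "AE y in ?L. y \<in> D0 \<longrightarrow> 1 \<le> f y"
  proof (rule density_AE_ge[OF f D0_sets(1)])
    show "emeasure ?L D0 < top" unfolding D0_def by (rule ball)
    fix A assume A: "A \<in> sets ?L" "A \<subseteq> D0"
    then have "A \<inter> D0 = A" by auto
    then show "emeasure ?L A \<le> emeasure (density ?L f) A"
      unfolding fd using emeasure_surfmeas[OF A(1)] hausdorff_surf_ge[OF A(1)] by simp
  qed
  have AE2: "AE y in ?L. y \<in> euc_ball (n - 1) t \<longrightarrow> f y \<le> ennreal (1 + cdens * \<omega> (4 * real n * t))" if "0 < t" "t \<le> r0" for t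
    by (rule density_AE_le[OF f ball(1) ball(2)]) (use up that fd in auto)
  \<comment> \<open>Rational radii, so that one null set serves all balls. Further down a rational
    strictly between |y| and 2|y| is used, which turns the factor 4n into 8n.\<close>
  have AE2': "AE y in ?L. \<forall>q::rat. 0 < real_of_rat q \<longrightarrow> real_of_rat q \<le> r0 \<longrightarrow> y \<in> euc_ball (n - 1) (real_of_rat q) \<longrightarrow>
     f y \<le> ennreal (1 + cdens * \<omega> (4 * real n * real_of_rat q))"
    unfolding AE_all_countable using AE2 by (auto intro: AE_I2)
  have AE3: "AE y in ?L. y \<in> euc (n - 1) - D0 \<longrightarrow> f y = 0"
  proof -
    let ?B = "euc (n - 1) - D0"
    have B: "?B \<in> sets ?L" using D0_sets by auto
    have "emeasure surfmeas ?B = 0"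
    proof -
      have "surf (?B \<inter> D0) = {}" by (auto simp: surf_def)
      then show ?thesis using emeasure_surfmeas[OF B] hausdorff_outer_empty[OF d1] by simp
    qed
    then have "(\<integral>\<^sup>+y. f y * indicator ?B y \<partial>?L) = 0" unfolding fd[symmetric] using B by (simp add: emeasure_density)
    then have "AE y in ?L. f y * indicator ?B y = 0" using B by (subst (asm) nn_integral_0_iff_AE) auto
    then show ?thesis by eventually_elim (auto simp: indicator_def)
  qed
  have AE4: "AE y in ?L. enorm (n - 1) y \<noteq> 0"
  proof (rule AE_I[where N="{x\<in>euc (n - 1). enorm (n - 1) x \<le> 0}"])
    show "emeasure ?L {x\<in>euc (n - 1). enorm (n - 1) x \<le> 0} = 0" by (rule emeasure_ezero_ball[OF d1])
  qed (use euc_cball_finite in auto)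
  define ub where "ub y = 1 + cdens * \<omega> (8 * real n * enorm (n - 1) y)" for y
  have ub1: "1 \<le> ub y" for y
    using om_nonneg[of "8 * real n * enorm (n - 1) y"] cdens_nonneg by (simp add: ub_def)
  have ubm: "ub \<in> borel_measurable ?L"
  proof (rule continuous_measurable_euc)
    show "continuous_on (euc (n - 1)) ub"
      unfolding ub_def
      by (intro continuous_intros continuous_on_compose2[OF om_continuous]) auto
  qed
  \<comment> \<open>Clamping alters the density inside \<open>D0\<close> only on a null set and
    makes both bounds hold at every point.\<close>
  define \<theta> where "\<theta> y = max 1 (min (enn2real (f y)) (ub y))" for y
  have AEeq: "AE y in ?L. f y = ennreal (indicator D0 y * \<theta> y)"
    using AE1 AE2' AE3 AE4 AE_space
  proof eventually_elim
    case (elim y)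
    show ?case
    proof (cases "y \<in> D0")
      case True
      then have y: "y \<in> euc (n - 1)" "enorm (n - 1) y < r0" by (auto simp: D0_def euc_ball_def)
      have y0: "0 < enorm (n - 1) y" using elim(4) enorm_nonneg[of "n - 1" y] by linarith
      have "enorm (n - 1) y < min r0 (2 * enorm (n - 1) y)" using y y0 by simp
      then obtain q where q: "enorm (n - 1) y < real_of_rat q" "real_of_rat q < min r0 (2 * enorm (n - 1) y)"
        using of_rat_dense by blast
      then have "f y \<le> ennreal (1 + cdens * \<omega> (4 * real n * real_of_rat q))"
      proof -
        have "0 < real_of_rat q" using q(1) y0 by linarith
        then show ?thesis using q elim(2)[rule_format, of q] y by (simp add: euc_ball_def)
      qed
      also have "\<dots> \<le> ennreal (ub y)"
      proof -
        have "\<omega> (4 * real n * real_of_rat q) \<le> \<omega> (8 * real n * enorm (n - 1) y)"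
        proof (rule om_mono)
          have "0 \<le> (real_of_rat q :: real)" using q(1) y0 by linarith
          then show "0 \<le> 4 * real n * real_of_rat q" by (intro mult_nonneg_nonneg) auto
          have "4 * real n * real_of_rat q \<le> 4 * real n * (2 * enorm (n - 1) y)"
            using q by (intro mult_left_mono) auto
          then show "4 * real n * real_of_rat q \<le> 8 * real n * enorm (n - 1) y" by simp
        qed
        then show ?thesis unfolding ub_def using cdens_nonneg by (intro ennreal_leI add_left_mono mult_left_mono) auto
      qed
      finally have le: "f y \<le> ennreal (ub y)" .
      have ge: "1 \<le> f y" using elim(1) True by simp
      obtain r where r: "f y = ennreal r" "r \<ge> 0" using le by (cases "f y") (auto simp: top_unique)
      have "1 \<le> r" "r \<le> ub y" using le ge ub1[of y] r by (auto simp: ennreal_le_iff ennreal_ge_1)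
      then show ?thesis using True r by (simp add: \<theta>_def)
    next
      case False
      then show ?thesis using elim(3,5) by simp
    qed
  qed
  show ?thesis
  proof (intro exI[of _ \<theta>] conjI allI)
    show tm: "\<theta> \<in> borel_measurable ?L" unfolding \<theta>_def[abs_def] using ubm by measurable
    show "1 \<le> \<theta> y" for y by (simp add: \<theta>_def)
    show "\<theta> y \<le> 1 + cdens * \<omega> (8 * real n * enorm (n - 1) y)" for y
      using ub1[of y] by (simp add: \<theta>_def ub_def)
    have "density ?L f = density ?L (\<lambda>y. ennreal (indicator D0 y * \<theta> y))"
      by (rule density_cong) (use AEeq tm D0_sets in auto)
    then show "surfmeas = density ?L (\<lambda>y. ennreal (indicator D0 y * \<theta> y))" using fd by simp
  qed
qed

text \<open>Points of the graph over the complement of \<open>D0\<close> have norm at least r0,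
  where G vanishes; so the chart carries the whole integral.\<close>

lemma surface_integral:
  assumes th: "\<theta> \<in> borel_measurable (elebesgue (n - 1))" "\<And>y. 1 \<le> \<theta> y"
     "surfmeas = density (elebesgue (n - 1)) (\<lambda>y. ennreal (indicator D0 y * \<theta> y))"
    and F: "F \<in> borel_measurable (elebesgue (n - 1))" "\<And>y. y \<in> D0 \<Longrightarrow> F y = G (lift n \<psi> y)"
    and G: "\<And>x. x \<in> Gam n \<psi> \<Longrightarrow> r0 \<le> enorm n x \<Longrightarrow> G x = 0"
  shows "(LINT x:Gam n \<psi>|hausdorff n (n - 1). G x) = (\<integral>y. indicator D0 y * \<theta> y * F y \<partial>elebesgue (n - 1))"
proof -
  let ?H = "hausdorff n (n - 1)" and ?L = "elebesgue (n - 1)"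
  have r0R: "r0 * (2 * real n) < R" using R n3 by (simp add: r0_def)
  have surf_Gam: "surf D0 \<subseteq> Gam n \<psi>"
  proof
    fix x assume x: "x \<in> surf D0"
    then have y: "evec (n - 1) x \<in> euc (n - 1)" "enorm (n - 1) (evec (n - 1) x) < r0"
      by (auto simp: surf_def D0_def euc_ball_def)
    from y(2) have "enorm (n - 1) (evec (n - 1) x) * (2 * real n) < r0 * (2 * real n)"
      using n3 by (intro mult_strict_right_mono) auto
    then have "enorm (n - 1) (evec (n - 1) x) < R / (2 * real n)"
      using r0R n3 by (subst pos_less_divide_eq) (simp, linarith)
    from small(2)[OF R(1) order_refl y(1) this] show "x \<in> Gam n \<psi>" using lift_proj[OF x] by simp
  qed
  have ss: "surf D0 \<inter> space ?H \<in> sets ?H" using surf_sets[OF D0_sets(1)] hd by auto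
  have "(LINT x:Gam n \<psi>|?H. G x) = (\<integral>x. indicator (Gam n \<psi>) x *\<^sub>R G x \<partial>?H)" by (simp add: set_lebesgue_integral_def)
  also have "\<dots> = (\<integral>x. indicator (surf D0) x *\<^sub>R G x \<partial>?H)"
  proof (intro Bochner_Integration.integral_cong refl)
    fix x
    have "G x = 0" if x: "x \<in> Gam n \<psi>" "x \<notin> surf D0"
    proof (rule G[OF x(1)])
      have xe: "x \<in> euc n" "x n = \<psi> (evec (n - 1) x)" using x by (auto simp: Gam_def euc_ball_def)
      then have "evec (n - 1) x \<notin> D0" using x(2) by (auto simp: surf_def)
      then have "r0 \<le> enorm (n - 1) x" by (simp add: D0_def euc_ball_def)
      also have "\<dots> \<le> enorm n x" using n3 by (intro enorm_pred_le) auto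
      finally show "r0 \<le> enorm n x" .
    qed
    then show "indicator (Gam n \<psi>) x *\<^sub>R G x = indicator (surf D0) x *\<^sub>R G x"
      using surf_Gam by (cases "x \<in> surf D0"; cases "x \<in> Gam n \<psi>") auto
  qed
  also have "\<dots> = (\<integral>x. G x \<partial>restrict_space ?H (surf D0))" by (rule integral_restrict_space[OF ss, symmetric])
  also have "\<dots> = (\<integral>x. F (evec (n - 1) x) \<partial>restrict_space ?H (surf D0))"
  proof (intro Bochner_Integration.integral_cong refl)
    fix x assume "x \<in> space (restrict_space ?H (surf D0))"
    then have x: "x \<in> surf D0" by (simp add: space_restrict_space)
    then have "evec (n - 1) x \<in> D0" by (simp add: surf_def)
    then show "G x = F (evec (n - 1) x)" using F(2) lift_proj[OF x] by simp
  qed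
  also have "\<dots> = (\<integral>y. F y \<partial>surfmeas)"
    unfolding surfmeas_def by (rule integral_distr[OF proj_measurable_surf F(1), symmetric])
  also have "\<dots> = (\<integral>y. (indicator D0 y * \<theta> y) *\<^sub>R F y \<partial>?L)"
    unfolding th(3)
  proof (rule integral_density[OF F(1)])
    show "(\<lambda>y. indicator D0 y * \<theta> y) \<in> borel_measurable ?L" using th(1) D0_sets by measurable
    show "AE y in ?L. 0 \<le> indicator D0 y * \<theta> y"
      using th(2) by (intro AE_I2 mult_nonneg_nonneg) (auto intro: order_trans[OF zero_le_one])
  qed
  finally show ?thesis by simp
qed

end

section \<open>Expansion of the kernel\<close>

text \<open>Dropping e only enlarges a negative power. The resulting bound does not see e, so the
  estimates that rest on it are uniform in the regularisation.\<close>

lemma bub_le: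
  assumes n: "n \<ge> 2" and t: "0 < \<tau>" "\<tau> \<le> \<sigma>" and e: "0 < e"
  shows "bub n e k (\<sigma>\<^sup>2) \<le> 1 / \<tau> ^ (n - 2 + 2 * k)"
proof -
  define a where "a = real n / 2 - 1 + real k"
  have a: "a \<ge> 0" using n by (simp add: a_def)
  have "\<tau>\<^sup>2 \<le> \<sigma>\<^sup>2" using t by (intro power_mono) auto
  then have "\<tau>\<^sup>2 \<le> \<sigma>\<^sup>2 + e" using e by linarith
  then have "(\<sigma>\<^sup>2 + e) powr (- a) \<le> (\<tau>\<^sup>2) powr (- a)"
    using t e a by (intro powr_mono2') auto
  also have "(\<tau>\<^sup>2) powr (- a) = \<tau> powr (2 * (- a))"
  proof -
    have "\<tau>\<^sup>2 = \<tau> powr 2" using t by simp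
    then show ?thesis by (simp only: powr_powr)
  qed
  also have "2 * (- a) = - real (n - 2 + 2 * k)" using n by (simp add: a_def of_nat_diff)
  also have "\<tau> powr (- real (n - 2 + 2 * k)) = 1 / \<tau> ^ (n - 2 + 2 * k)"
    using t by (simp add: powr_minus powr_realpow inverse_eq_divide del: of_nat_add of_nat_mult)
  finally show ?thesis by (simp add: bub_def a_def)
qed

lemma bub_Suc_mult_le:
  assumes "0 < e" "0 \<le> s"
  shows "bub n e (Suc k) s * s \<le> bub n e k s"
proof -
  have "bub n e (Suc k) s * s \<le> bub n e (Suc k) s * (s + e)" using assms by (intro mult_left_mono) auto
  also have "\<dots> = bub n e k s"
  proof -
    have "1 + - (real n / 2 - 1 + real (Suc k)) = - (real n / 2 - 1 + real k)" by simp
    moreover have "(s + e) * (s + e) powr - (real n / 2 - 1 + real (Suc k)) = (s + e) powr (1 + - (real n / 2 - 1 + real (Suc k)))"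
      using assms by (intro powr_mult_base) auto
    ultimately show ?thesis unfolding bub_def by (metis mult.commute)
  qed
  finally show ?thesis .
qed

lemma taylor2_bound:
  fixes f f1 f2 :: "real \<Rightarrow> real"
  assumes "\<And>t. 0 \<le> t \<Longrightarrow> t \<le> 1 \<Longrightarrow> (f has_real_derivative f1 t) (at t)"
    "\<And>t. 0 \<le> t \<Longrightarrow> t \<le> 1 \<Longrightarrow> (f1 has_real_derivative f2 t) (at t)"
    "\<And>t. 0 \<le> t \<Longrightarrow> t \<le> 1 \<Longrightarrow> \<bar>f2 t\<bar> \<le> B"
  shows "\<bar>f 1 - f 0 - f1 0\<bar> \<le> B"
proof -
  obtain z where z: "0 < z" "z < 1" "f 1 - f 0 = (1 - 0) * f1 z"
    using MVT2[of 0 1 f f1] assms(1) by auto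
  obtain w where w: "0 < w" "w < z" "f1 z - f1 0 = (z - 0) * f2 w"
    using MVT2[of 0 z f1 f2] assms(2) z by auto
  have "\<bar>z * f2 w\<bar> \<le> 1 * B" unfolding abs_mult using z w assms(3)[of w] by (intro mult_mono) auto
  then show ?thesis using z w by simp
qed

definition bexp :: "nat \<Rightarrow> nat \<Rightarrow> real" where "bexp n k = real n / 2 - 1 + real k"

text \<open>A bound for the second derivative along the segment from y to y - x: the two summands
  are its two terms, and the power of 2 is the price of |y - t x| \<ge> |y| / 2.\<close>

definition tayc :: "nat \<Rightarrow> nat \<Rightarrow> real" where
  "tayc n k = (4 * bexp n k * bexp n (Suc k) + 2 * bexp n k) * 2 ^ (n + 2 * k)"

lemma bexp_nonneg: "n \<ge> 2 \<Longrightarrow> 0 \<le> bexp n k"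
  by (simp add: bexp_def)

lemma tayc_nonneg: "n \<ge> 2 \<Longrightarrow> 0 \<le> tayc n k"
  by (simp add: tayc_def bexp_nonneg)

text \<open>Taylor's formula in t for the squared distance s(t) from y to t x. By Cauchy-Schwarz the
  square of s' is at most 4 |x|^2 s, so it is absorbed by one power of the kernel and the second
  derivative has the homogeneous size |x|^2 |y|^(-n-2k).\<close>

lemma bub_taylor:
  assumes n: "n \<ge> 2" and e: "0 < e" and xy: "2 * enorm n x \<le> enorm n y" "0 < enorm n y"
  shows "\<bar>bub n e k ((enorm n (\<lambda>j. y j - x j))\<^sup>2) - bub n e k ((enorm n y)\<^sup>2)
      - 2 * bexp n k * einner n x y * bub n e (Suc k) ((enorm n y)\<^sup>2)\<bar>
    \<le> tayc n k * (enorm n x)\<^sup>2 / enorm n y ^ (n + 2 * k)"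
proof -
  define Y where "Y = enorm n y"
  define X where "X = enorm n x"
  define c where "c = einner n x y"
  define s where "s t = Y\<^sup>2 - 2 * t * c + t\<^sup>2 * X\<^sup>2" for t
  have X0: "0 \<le> X" by (simp add: X_def)
  have Y0: "0 < Y" using xy by (simp add: Y_def)
  have s: "s t = (enorm n (\<lambda>j. y j - t * x j))\<^sup>2" for t
  proof -
    have "einner n y (\<lambda>j. t * x j) = t * c"
      by (simp add: einner_def c_def sum_distrib_left mult_ac)
    then show ?thesis
      unfolding enorm_diff_power2 s_def enorm_scale by (simp add: Y_def X_def power_mult_distrib)
  qed
  have s0: "0 \<le> s t" for t unfolding s by simp
  have half: "Y / 2 \<le> enorm n (\<lambda>j. y j - t * x j)" if t: "0 \<le> t" "t \<le> 1" for t
  proof -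
    have "enorm n y - enorm n (\<lambda>j. t * x j) \<le> enorm n (\<lambda>j. y j - t * x j)"
      using enorm_diff_le[of n y "\<lambda>j. t * x j"] by (simp add: edist_def)
    moreover have "enorm n (\<lambda>j. t * x j) \<le> 1 * X" unfolding enorm_scale X_def using t by (intro mult_right_mono) auto
    ultimately show ?thesis using xy by (simp add: Y_def X_def)
  qed
  let ?b = "\<lambda>j t. bub n e j (s t)"
  define s1 where "s1 t = - 2 * c + 2 * t * X\<^sup>2" for t
  have ds: "(s has_real_derivative s1 t) (at t)" for t
    unfolding s_def s1_def by (auto intro!: derivative_eq_intros)
  have ds1: "(s1 has_real_derivative 2 * X\<^sup>2) (at t)" for t
    unfolding s1_def by (auto intro!: derivative_eq_intros)
  have db: "((\<lambda>t. ?b j t) has_real_derivative - bexp n j * ?b (Suc j) t * s1 t) (at t)" for j t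
    unfolding bexp_def by (rule DERIV_chain2[OF bub_deriv ds]) (use s0[of t] e in linarith)
  define f1 where "f1 t = - bexp n k * ?b (Suc k) t * s1 t" for t
  define f2 where "f2 t = - bexp n k * (- bexp n (Suc k) * ?b (Suc (Suc k)) t * s1 t) * s1 t + 2 * X\<^sup>2 * (- bexp n k * ?b (Suc k) t)" for t
  have df1: "(f1 has_real_derivative f2 t) (at t)" for t
    unfolding f1_def f2_def by (rule DERIV_mult[OF DERIV_cmult[OF db] ds1])
  have s1s: "(s1 t)\<^sup>2 \<le> 4 * X\<^sup>2 * s t" for t
  proof -
    have "s1 t = - 2 * einner n x (\<lambda>j. y j - t * x j)"
    proof -
      have "einner n x (\<lambda>j. y j - t * x j) = c - t * (enorm n x)\<^sup>2"
        unfolding c_def einner_def enorm_power2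
        by (simp add: right_diff_distrib sum_subtractf sum_distrib_left power2_eq_square mult_ac)
      then show ?thesis by (simp add: s1_def X_def)
    qed
    then have "\<bar>s1 t\<bar> \<le> 2 * (X * enorm n (\<lambda>j. y j - t * x j))"
      using einner_le[of n x "\<lambda>j. y j - t * x j"] by (simp add: X_def abs_mult)
    then have "\<bar>s1 t\<bar>\<^sup>2 \<le> (2 * (X * enorm n (\<lambda>j. y j - t * x j)))\<^sup>2" by (intro power_mono) auto
    then show ?thesis unfolding s by (simp add: power_mult_distrib)
  qed
  have bnd: "\<bar>f2 t\<bar> \<le> tayc n k * X\<^sup>2 / Y ^ (n + 2 * k)" if t: "0 \<le> t" "t \<le> 1" for t
  proof -
    have b0: "0 \<le> bexp n k" "0 \<le> bexp n (Suc k)" using bexp_nonneg[OF n] by auto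
    have "?b (Suc (Suc k)) t * (s1 t)\<^sup>2 \<le> ?b (Suc (Suc k)) t * (4 * X\<^sup>2 * s t)"
      by (intro mult_left_mono s1s) auto
    also have "\<dots> = 4 * X\<^sup>2 * (?b (Suc (Suc k)) t * s t)" by simp
    also have "\<dots> \<le> 4 * X\<^sup>2 * ?b (Suc k) t" by (intro mult_left_mono bub_Suc_mult_le e s0) auto
    finally have 1: "?b (Suc (Suc k)) t * (s1 t)\<^sup>2 \<le> 4 * X\<^sup>2 * ?b (Suc k) t" .
    have "\<bar>f2 t\<bar> \<le> bexp n k * bexp n (Suc k) * (?b (Suc (Suc k)) t * (s1 t)\<^sup>2) + 2 * bexp n k * X\<^sup>2 * ?b (Suc k) t"
    proof -
      have "f2 t = bexp n k * bexp n (Suc k) * (?b (Suc (Suc k)) t * (s1 t)\<^sup>2) - 2 * bexp n k * X\<^sup>2 * ?b (Suc k) t"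
        by (simp add: f2_def power2_eq_square)
      moreover have "0 \<le> bexp n k * bexp n (Suc k) * (?b (Suc (Suc k)) t * (s1 t)\<^sup>2)" "0 \<le> 2 * bexp n k * X\<^sup>2 * ?b (Suc k) t"
        using b0 by auto
      ultimately show ?thesis by linarith
    qed
    also have "\<dots> \<le> bexp n k * bexp n (Suc k) * (4 * X\<^sup>2 * ?b (Suc k) t) + 2 * bexp n k * X\<^sup>2 * ?b (Suc k) t"
      by (intro add_right_mono mult_left_mono 1) (use b0 in auto)
    also have "\<dots> = (4 * bexp n k * bexp n (Suc k) + 2 * bexp n k) * X\<^sup>2 * ?b (Suc k) t" by (simp add: algebra_simps)
    also have "\<dots> \<le> (4 * bexp n k * bexp n (Suc k) + 2 * bexp n k) * X\<^sup>2 * (1 / (Y / 2) ^ (n - 2 + 2 * Suc k))"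
      unfolding s by (intro mult_left_mono bub_le n half t) (use b0 Y0 e in auto)
    also have "n - 2 + 2 * Suc k = n + 2 * k" using n by simp
    also have "(4 * bexp n k * bexp n (Suc k) + 2 * bexp n k) * X\<^sup>2 * (1 / (Y / 2) ^ (n + 2 * k)) = tayc n k * X\<^sup>2 / Y ^ (n + 2 * k)"
      by (simp add: tayc_def power_divide)
    finally show ?thesis .
  qed
  have "\<bar>?b k 1 - ?b k 0 - f1 0\<bar> \<le> tayc n k * X\<^sup>2 / Y ^ (n + 2 * k)"
    by (rule taylor2_bound[where ?f1.0=f1 and ?f2.0=f2]) (use db df1 bnd f1_def in auto)
  moreover have "s 1 = (enorm n (\<lambda>j. y j - x j))\<^sup>2" "s 0 = (enorm n y)\<^sup>2" unfolding s by simp_all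
  moreover have "f1 0 = 2 * bexp n k * c * ?b (Suc k) 0" by (simp add: f1_def s1_def)
  ultimately show ?thesis by (simp add: c_def X_def Y_def)
qed

lemma bub_diff_le:
  assumes n: "n \<ge> 2" and e: "0 < e" and xy: "2 * enorm n x \<le> enorm n y" "0 < enorm n y"
  shows "\<bar>bub n e k ((enorm n (\<lambda>j. y j - x j))\<^sup>2) - bub n e k ((enorm n y)\<^sup>2)\<bar>
    \<le> (tayc n k + 2 * bexp n k) * (enorm n x * enorm n y) / enorm n y ^ (n + 2 * k)"
proof -
  define Y where "Y = enorm n y"
  define X where "X = enorm n x"
  have XY: "0 \<le> X" "0 < Y" "2 * X \<le> Y" using xy by (auto simp: X_def Y_def)
  have Xsq: "X\<^sup>2 \<le> X * Y" using XY by (simp add: power2_eq_square mult_left_mono)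
  have b0: "0 \<le> bexp n k" using bexp_nonneg[OF n] .
  have "\<bar>2 * bexp n k * einner n x y * bub n e (Suc k) (Y\<^sup>2)\<bar> \<le> 2 * bexp n k * (X * Y) * (1 / Y ^ (n - 2 + 2 * Suc k))"
  proof -
    have bb: "bub n e (Suc k) (Y\<^sup>2) \<le> 1 / Y ^ (n - 2 + 2 * Suc k)"
      by (intro bub_le n e) (use XY in auto)
    have "\<bar>2 * bexp n k * einner n x y * bub n e (Suc k) (Y\<^sup>2)\<bar> = 2 * bexp n k * \<bar>einner n x y\<bar> * bub n e (Suc k) (Y\<^sup>2)"
      using b0 by (simp add: abs_mult)
    also have "\<dots> \<le> 2 * bexp n k * (X * Y) * (1 / Y ^ (n - 2 + 2 * Suc k))"
      by (intro mult_mono bb mult_left_mono) (use b0 XY einner_le[of n x y] in \<open>auto simp only: X_def Y_def bub_nonneg intro!: mult_nonneg_nonneg\<close>)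
    finally show ?thesis .
  qed
  also have "n - 2 + 2 * Suc k = n + 2 * k" using n by simp
  finally have 1: "\<bar>2 * bexp n k * einner n x y * bub n e (Suc k) (Y\<^sup>2)\<bar> \<le> 2 * bexp n k * (X * Y) / Y ^ (n + 2 * k)" by simp
  have 2: "tayc n k * X\<^sup>2 / Y ^ (n + 2 * k) \<le> tayc n k * (X * Y) / Y ^ (n + 2 * k)"
    using tayc_nonneg[OF n] XY Xsq by (intro divide_right_mono mult_left_mono) auto
  have "(tayc n k + 2 * bexp n k) * (X * Y) / Y ^ (n + 2 * k) = tayc n k * (X * Y) / Y ^ (n + 2 * k) + 2 * bexp n k * (X * Y) / Y ^ (n + 2 * k)"
    by (simp add: distrib_right add_divide_distrib)
  then show ?thesis using bub_taylor[OF n e xy, of k] 1 2 unfolding X_def[symmetric] Y_def[symmetric] by linarith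
qed

text \<open>Two bounds for a vertical shift are at hand: the trivial one of size w^(2-n), and the
  Lipschitz one of size |a - b| w^(1-n). On a base of dimension n - 1 the second is not integrable
  at w = 0. Since min(1, q) \<le> sqrt q, combining them costs only w^(-1/2) compared with the
  trivial bound, is integrable, and still tends to 0 with the shift.\<close>

lemma bub_vertical:
  assumes n: "n \<ge> 3" and e: "0 < e" and w: "0 < w"
  shows "\<bar>bub n e 0 (w\<^sup>2 + a\<^sup>2) - bub n e 0 (w\<^sup>2 + b\<^sup>2)\<bar> \<le> real n * sqrt (\<bar>a - b\<bar> / w) / w ^ (n - 2)"
proof -
  have n2: "n \<ge> 2" using n by simp
  have le0: "bub n e 0 (w\<^sup>2 + t\<^sup>2) \<le> 1 / w ^ (n - 2)" for t
  proof -
    have "w \<le> sqrt (w\<^sup>2 + t\<^sup>2)" using w by (simp add: real_le_rsqrt)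
    from bub_le[OF n2 w this e, of 0] show ?thesis by simp
  qed
  have triv: "\<bar>bub n e 0 (w\<^sup>2 + a\<^sup>2) - bub n e 0 (w\<^sup>2 + b\<^sup>2)\<bar> \<le> 1 / w ^ (n - 2)"
    using le0[of a] le0[of b] bub_nonneg[of n e 0 "w\<^sup>2 + a\<^sup>2"] bub_nonneg[of n e 0 "w\<^sup>2 + b\<^sup>2"] by linarith
  have lip: "\<bar>bub n e 0 (w\<^sup>2 + a\<^sup>2) - bub n e 0 (w\<^sup>2 + b\<^sup>2)\<bar> \<le> real n * \<bar>a - b\<bar> / w ^ (n - 1)"
  proof -
    have "norm (bub n e 0 (w\<^sup>2 + a\<^sup>2) - bub n e 0 (w\<^sup>2 + b\<^sup>2)) \<le> (real n / w ^ (n - 1)) * norm (a - b)"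
    proof (rule field_differentiable_bound[of UNIV "\<lambda>t. bub n e 0 (w\<^sup>2 + t\<^sup>2)"
        "\<lambda>t. - bexp n 0 * bub n e (Suc 0) (w\<^sup>2 + t\<^sup>2) * (2 * t)"])
      fix t :: real
      have "w\<^sup>2 + t\<^sup>2 > - e" using e by (smt (verit) zero_le_power2)
      then show "((\<lambda>t. bub n e 0 (w\<^sup>2 + t\<^sup>2)) has_field_derivative - bexp n 0 * bub n e (Suc 0) (w\<^sup>2 + t\<^sup>2) * (2 * t)) (at t within UNIV)"
        unfolding bexp_def by (intro DERIV_chain2[OF bub_deriv]) (auto intro!: derivative_eq_intros)
      define \<sigma> where "\<sigma> = sqrt (w\<^sup>2 + t\<^sup>2)"
      have \<sigma>: "w \<le> \<sigma>" "\<bar>t\<bar> \<le> \<sigma>" "\<sigma>\<^sup>2 = w\<^sup>2 + t\<^sup>2" "0 < \<sigma>"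
        using w by (auto simp: \<sigma>_def real_le_rsqrt add_pos_nonneg intro!: real_le_rsqrt)
      have "bub n e (Suc 0) (\<sigma>\<^sup>2) * \<bar>t\<bar> \<le> (1 / \<sigma> ^ (n - 2 + 2 * Suc 0)) * \<sigma>"
        using \<sigma> by (intro mult_mono bub_le n2 e) auto
      also have "\<sigma> ^ (n - 2 + 2 * Suc 0) = \<sigma> ^ (n - 1) * \<sigma>"
      proof -
        have "n - 2 + 2 * Suc 0 = Suc (n - 1)" using n by simp
        then show ?thesis by (simp only: power_Suc2)
      qed
      also have "(1 / (\<sigma> ^ (n - 1) * \<sigma>)) * \<sigma> = 1 / \<sigma> ^ (n - 1)" using \<sigma> by simp
      also have "\<dots> \<le> 1 / w ^ (n - 1)" using w \<sigma> by (intro divide_left_mono power_mono mult_pos_pos) auto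
      finally have 1: "bub n e (Suc 0) (w\<^sup>2 + t\<^sup>2) * \<bar>t\<bar> \<le> 1 / w ^ (n - 1)" unfolding \<sigma>(3) .
      have b0: "0 \<le> bexp n 0" "2 * bexp n 0 \<le> real n" using n by (auto simp: bexp_def)
      have "norm (- bexp n 0 * bub n e (Suc 0) (w\<^sup>2 + t\<^sup>2) * (2 * t)) = 2 * bexp n 0 * (bub n e (Suc 0) (w\<^sup>2 + t\<^sup>2) * \<bar>t\<bar>)"
        using b0 by (simp add: abs_mult)
      also have "\<dots> \<le> real n * (1 / w ^ (n - 1))" using b0 1 by (intro mult_mono) auto
      finally show "norm (- bexp n 0 * bub n e (Suc 0) (w\<^sup>2 + t\<^sup>2) * (2 * t)) \<le> real n / w ^ (n - 1)" by simp
    qed auto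
    then show ?thesis by simp
  qed
  show ?thesis
  proof (cases "\<bar>a - b\<bar> \<le> w")
    case True
    have q: "0 \<le> \<bar>a - b\<bar> / w" "\<bar>a - b\<bar> / w \<le> 1" using True w by auto
    have "\<bar>a - b\<bar> / w = sqrt (\<bar>a - b\<bar> / w) * sqrt (\<bar>a - b\<bar> / w)" using q w by simp
    also have "\<dots> \<le> 1 * sqrt (\<bar>a - b\<bar> / w)" using q by (intro mult_right_mono) auto
    finally have sq: "\<bar>a - b\<bar> / w \<le> sqrt (\<bar>a - b\<bar> / w)" by simp
    have "w ^ (n - 1) = w * w ^ (n - 2)"
    proof -
      have "n - 1 = Suc (n - 2)" using n by simp
      then show ?thesis by (simp only: power_Suc)
    qed
    then have "real n * \<bar>a - b\<bar> / w ^ (n - 1) = real n * (\<bar>a - b\<bar> / w) / w ^ (n - 2)" by simp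
    also have "\<dots> \<le> real n * sqrt (\<bar>a - b\<bar> / w) / w ^ (n - 2)"
      using sq w by (intro divide_right_mono mult_left_mono) auto
    finally show ?thesis using lip by linarith
  next
    case False
    then have "1 \<le> sqrt (\<bar>a - b\<bar> / w)" using w by simp
    then have "1 \<le> real n * sqrt (\<bar>a - b\<bar> / w)" using n mult_mono[of 1 "real n" 1 "sqrt (\<bar>a - b\<bar> / w)"] by simp
    then have "1 / w ^ (n - 2) \<le> real n * sqrt (\<bar>a - b\<bar> / w) / w ^ (n - 2)"
      using w by (intro divide_right_mono) auto
    then show ?thesis using triv by linarith
  qed
qed

section \<open>Radial integrals\<close>

text \<open>The area of the unit sphere in dimension n - 1, the factor of polar coordinates on the
  base of the graph.\<close>

definition sph :: "nat \<Rightarrow> real" where "sph n = real (n - 1) * unit_ball_vol (real (n - 1))"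

lemma sph_pos: "n \<ge> 2 \<Longrightarrow> sph n > 0"
  by (simp add: sph_def)

lemma enorm_shift_measurable [measurable]: "(\<lambda>y. enorm n (\<lambda>i. y i - x i)) \<in> borel_measurable (elebesgue n)"
proof (rule continuous_measurable_euc)
  show "continuous_on (euc n) (\<lambda>y. enorm n (\<lambda>j. y j - x j))"
    unfolding enorm_alt by (intro continuous_intros)
qed

lemma radial_translate:
  assumes n: "n \<ge> 2" and h: "h \<in> borel_measurable borel"
  shows "(\<integral>\<^sup>+y. h (enorm (n - 1) (\<lambda>i. y i - x i)) \<partial>elebesgue (n - 1)) =
         ennreal (sph n) * (\<integral>\<^sup>+s. h s * ennreal (s ^ (n - 2)) * indicator {0<..} s \<partial>lborel)"
proof -
  have n1: "n - 1 \<ge> 1" "n - 1 - 1 = n - 2" using n by auto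
  have [measurable]: "(\<lambda>y. h (enorm (n - 1) (\<lambda>i. y i - x i))) \<in> borel_measurable (elebesgue (n - 1))"
    using measurable_compose[OF enorm_shift_measurable h] .
  have "(\<integral>\<^sup>+y. h (enorm (n - 1) (\<lambda>i. y i - x i)) \<partial>elebesgue (n - 1)) =
     (\<integral>\<^sup>+z. h (enorm (n - 1) (\<lambda>i. evec (n - 1) (\<lambda>i. x i + 1 * z i) i - x i)) \<partial>elebesgue (n - 1))"
    by (subst nn_integral_affine_elebesgue) auto
  also have "\<dots> = (\<integral>\<^sup>+z. h (enorm (n - 1) z) \<partial>elebesgue (n - 1))"
    by (intro nn_integral_cong arg_cong[where f=h] enorm_cong) simp
  also have "\<dots> = ennreal (sph n) * (\<integral>\<^sup>+s. h s * ennreal (s ^ (n - 2)) * indicator {0<..} s \<partial>lborel)"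
    using nn_integral_radial[OF n1(1) h] by (simp add: sph_def n1(2))
  finally show ?thesis .
qed

lemma radial_near:
  assumes n: "n \<ge> 2" and \<rho>: "\<rho> \<ge> 0"
  shows "(\<integral>\<^sup>+y. ennreal (indicator {..<\<rho>} (enorm (n - 1) (\<lambda>i. y i - x i)) / enorm (n - 1) (\<lambda>i. y i - x i) ^ (n - 2)) \<partial>elebesgue (n - 1))
     \<le> ennreal (sph n * \<rho>)"
proof -
  have "(\<integral>\<^sup>+y. ennreal (indicator {..<\<rho>} (enorm (n - 1) (\<lambda>i. y i - x i)) / enorm (n - 1) (\<lambda>i. y i - x i) ^ (n - 2)) \<partial>elebesgue (n - 1))
    = ennreal (sph n) * (\<integral>\<^sup>+s. ennreal (indicator {..<\<rho>} s / s ^ (n - 2)) * ennreal (s ^ (n - 2)) * indicator {0<..} s \<partial>lborel)"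
    by (rule radial_translate[OF n, of "\<lambda>s. ennreal (indicator {..<\<rho>} s / s ^ (n - 2))"]) measurable
  also have "\<dots> \<le> ennreal (sph n) * (\<integral>\<^sup>+s. indicator {0..\<rho>} s \<partial>lborel)"
    by (intro mult_left_mono nn_integral_mono)
       (auto simp: indicator_def ennreal_mult[symmetric])
  also have "\<dots> = ennreal (sph n * \<rho>)" using \<rho> sph_pos[OF n] by (simp add: ennreal_mult)
  finally show ?thesis .
qed

lemma nn_integral_inverse_sqrt:
  assumes "\<rho> \<ge> 0"
  shows "(\<integral>\<^sup>+s. ennreal (indicator {0..\<rho>} s * (1 / sqrt s)) \<partial>lborel) = ennreal (2 * sqrt \<rho>)"
proof -
  have "((\<lambda>s. 1 / sqrt s) has_integral (2 * sqrt \<rho> - 2 * sqrt 0)) {0..\<rho>}"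
  proof (rule fundamental_theorem_of_calculus_interior[OF assms])
    show "continuous_on {0..\<rho>} (\<lambda>s. 2 * sqrt s)" by (intro continuous_intros)
    fix s assume "s \<in> {0<..<\<rho>}"
    then show "((\<lambda>s. 2 * sqrt s) has_vector_derivative 1 / sqrt s) (at s)"
      unfolding has_real_derivative_iff_has_vector_derivative[symmetric]
      by (auto intro!: derivative_eq_intros simp: field_simps)
  qed
  then have "((\<lambda>s. 1 / sqrt s) has_integral (2 * sqrt \<rho>)) {0..\<rho>}" by simp
  from nn_integral_has_integral_lebesgue[OF _ this] show ?thesis by simp
qed

lemma radial_near_sqrt:
  assumes n: "n \<ge> 2" and \<rho>: "\<rho> \<ge> 0"
  shows "(\<integral>\<^sup>+y. ennreal (indicator {..<\<rho>} (enorm (n - 1) (\<lambda>i. y i - x i)) *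
     (1 / sqrt (enorm (n - 1) (\<lambda>i. y i - x i))) / enorm (n - 1) (\<lambda>i. y i - x i) ^ (n - 2)) \<partial>elebesgue (n - 1))
     \<le> ennreal (sph n * (2 * sqrt \<rho>))"
proof -
  have "(\<integral>\<^sup>+y. ennreal (indicator {..<\<rho>} (enorm (n - 1) (\<lambda>i. y i - x i)) *
     (1 / sqrt (enorm (n - 1) (\<lambda>i. y i - x i))) / enorm (n - 1) (\<lambda>i. y i - x i) ^ (n - 2)) \<partial>elebesgue (n - 1))
    = ennreal (sph n) * (\<integral>\<^sup>+s. ennreal (indicator {..<\<rho>} s * (1 / sqrt s) / s ^ (n - 2)) * ennreal (s ^ (n - 2)) * indicator {0<..} s \<partial>lborel)"
    by (rule radial_translate[OF n, of "\<lambda>s. ennreal (indicator {..<\<rho>} s * (1 / sqrt s) / s ^ (n - 2))"]) measurable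
  also have "\<dots> \<le> ennreal (sph n) * (\<integral>\<^sup>+s. ennreal (indicator {0..\<rho>} s * (1 / sqrt s)) \<partial>lborel)"
    by (intro mult_left_mono nn_integral_mono)
       (auto simp: indicator_def ennreal_mult[symmetric])
  also have "\<dots> = ennreal (sph n * (2 * sqrt \<rho>))"
    unfolding nn_integral_inverse_sqrt[OF \<rho>] using \<rho> sph_pos[OF n] by (simp add: ennreal_mult)
  finally show ?thesis .
qed

lemma radial_far:
  assumes n: "n \<ge> 2" and \<tau>: "\<tau> > 0"
  shows "(\<integral>\<^sup>+y. ennreal (indicator {\<tau>..} (enorm (n - 1) y) / enorm (n - 1) y ^ n) \<partial>elebesgue (n - 1)) \<le> ennreal (sph n / \<tau>)"
proof -
  have n1: "n - 1 \<ge> 1" "n - 1 - 1 = n - 2" using n by auto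
  have "(\<integral>\<^sup>+y. ennreal (indicator {\<tau>..} (enorm (n - 1) y) / enorm (n - 1) y ^ n) \<partial>elebesgue (n - 1))
    = ennreal (sph n) * (\<integral>\<^sup>+s. ennreal (indicator {\<tau>..} s / s ^ n) * ennreal (s ^ (n - 2)) * indicator {0<..} s \<partial>lborel)"
    using nn_integral_radial[OF n1(1), of "\<lambda>s. ennreal (indicator {\<tau>..} s / s ^ n)"] by (simp add: sph_def n1(2))
  also have "\<dots> \<le> ennreal (sph n) * (\<integral>\<^sup>+s. ennreal (1 / s\<^sup>2) * indicator {\<tau>..} s \<partial>lborel)"
  proof (intro mult_left_mono nn_integral_mono)
    fix s :: real
    show "ennreal (indicator {\<tau>..} s / s ^ n) * ennreal (s ^ (n - 2)) * indicator {0<..} s \<le> ennreal (1 / s\<^sup>2) * indicator {\<tau>..} s"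
    proof (cases "\<tau> \<le> s")
      case True
      then have s: "s > 0" using \<tau> by simp
      have "s ^ n = s\<^sup>2 * s ^ (n - 2)"
      proof -
        have "n = 2 + (n - 2)" using n by simp
        then show ?thesis using power_add[of s 2 "n - 2"] by metis
      qed
      then have "1 / s ^ n * s ^ (n - 2) = 1 / s\<^sup>2" using s by simp
      then show ?thesis using True s by (simp add: ennreal_mult[symmetric])
    qed auto
  qed auto
  also have "(\<integral>\<^sup>+s. ennreal (1 / s\<^sup>2) * indicator {\<tau>..} s \<partial>lborel) = ennreal (0 - (- (1 / \<tau>)))"
  proof (rule nn_integral_FTC_atLeast)
    show "((\<lambda>s. - (1 / s)) has_real_derivative 1 / s\<^sup>2) (at s)" if "\<tau> \<le> s" for s
      using that \<tau> by (auto intro!: derivative_eq_intros simp: power2_eq_square)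
    show "((\<lambda>s::real. - (1 / s)) \<longlongrightarrow> 0) at_top"
    proof -
      have "((\<lambda>s::real. inverse s) \<longlongrightarrow> 0) at_top" by (rule tendsto_inverse_0_at_top[OF filterlim_ident])
      from tendsto_minus[OF this] show ?thesis by (simp add: inverse_eq_divide)
    qed
  qed auto
  finally show ?thesis using sph_pos[OF n] \<tau> by (simp add: ennreal_mult[symmetric])
qed

definition dint :: "(real \<Rightarrow> real) \<Rightarrow> real \<Rightarrow> real" where
  "dint w r = (LBINT t:{0<..r}. w t / t)"

lemma dini_set_integrable:
  assumes w: "dini w"
  shows "set_integrable lborel {0<..r} (\<lambda>t. w t / t)"
proof -
  obtain R0 where R0: "R0 > 0" "set_integrable lborel {0<..R0} (\<lambda>t. w t / t)" using w by (auto simp: dini_def)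
  have "set_integrable lborel {R0..r} (\<lambda>t. w t / t)"
    using w R0 by (intro borel_integrable_atLeastAtMost' continuous_intros) (auto simp: dini_def intro: continuous_on_subset)
  then have "set_integrable lborel ({0<..R0} \<union> {R0..r}) (\<lambda>t. w t / t)"
    by (intro set_integrable_Un R0) auto
  then show ?thesis by (rule set_integrable_subset) auto
qed

lemma dini_nonneg: "dini w \<Longrightarrow> 0 \<le> t \<Longrightarrow> 0 \<le> w t"
  by (simp add: dini_def)

lemma dini_mono: "dini w \<Longrightarrow> 0 \<le> s \<Longrightarrow> s \<le> t \<Longrightarrow> w s \<le> w t"
  by (auto simp: dini_def mono_on_def)

lemma dint_nonneg: "dini w \<Longrightarrow> 0 \<le> dint w r"
  unfolding dint_def set_lebesgue_integral_def
  by (intro Bochner_Integration.integral_nonneg) (auto simp: indicator_def dini_nonneg)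

lemma nn_integral_dint:
  assumes w: "dini w"
  shows "(\<integral>\<^sup>+t. ennreal (indicator {0<..r} t * (w t / t)) \<partial>lborel) = ennreal (dint w r)"
proof -
  have "integrable lborel (\<lambda>t. indicator {0<..r} t * (w t / t))"
    using dini_set_integrable[OF w] by (simp add: set_integrable_def)
  then show ?thesis
    unfolding dint_def set_lebesgue_integral_def
    by (subst nn_integral_eq_integral) (auto simp: indicator_def dini_nonneg[OF w])
qed

lemma dint_tendsto_0:
  assumes w: "dini w"
  shows "(dint w \<longlongrightarrow> 0) (at_right 0)"
proof (rule tendsto_at_right_sequentially[of 0 1])
  fix S :: "nat \<Rightarrow> real"
  assume S: "\<And>k. 0 < S k" "\<And>k. S k < 1" "S \<longlonglongrightarrow> 0"
  have i1: "integrable lborel (\<lambda>t. indicator {0<..1} t * (w t / t))"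
    using dini_set_integrable[OF w, of 1] by (simp add: set_integrable_def)
  have "(\<lambda>k. \<integral>t. indicator {0<..S k} t * (w t / t) \<partial>lborel) \<longlonglongrightarrow> (\<integral>t. 0 \<partial>(lborel :: real measure))"
  proof (rule integral_dominated_convergence[where w="\<lambda>t. indicator {0<..1} t * (w t / t)"])
    show "(\<lambda>t. indicator {0<..S k} t * (w t / t)) \<in> borel_measurable lborel" for k
      using dini_set_integrable[OF w, of "S k"] by (simp add: set_integrable_def)
    show "AE t in lborel. (\<lambda>k. indicator {0<..S k} t * (w t / t)) \<longlonglongrightarrow> 0"
    proof (rule AE_I2)
      fix t :: real
      show "(\<lambda>k. indicator {0<..S k} t * (w t / t)) \<longlonglongrightarrow> 0"
      proof (cases "t > 0")
        case True
        have "\<forall>\<^sub>F k in sequentially. S k < t" using order_tendstoD(2)[OF S(3) True] .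
        then have "\<forall>\<^sub>F k in sequentially. indicator {0<..S k} t * (w t / t) = 0"
          by eventually_elim (auto simp: indicator_def)
        then show ?thesis by (rule tendsto_eventually)
      qed simp
    qed
    show "AE t in lborel. norm (indicator {0<..S k} t * (w t / t)) \<le> indicator {0<..1} t * (w t / t)" for k
      using S(2)[of k] by (intro AE_I2) (auto simp: indicator_def dini_nonneg[OF w])
  qed (use i1 in auto)
  then show "(\<lambda>k. dint w (S k)) \<longlonglongrightarrow> 0"
    by (simp add: dint_def set_lebesgue_integral_def)
qed simp

text \<open>The power n - 1 equals the dimension of the base, so polar coordinates leave the measure
  ds/s. It is invariant under scaling by c, and the Dini integral appears with the area of the
  sphere as its only factor.\<close>

lemma radial_dini:
  assumes n: "n \<ge> 2" and w: "dini w" and c: "c > 0"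
  shows "(\<integral>\<^sup>+y. ennreal (indicator {0<..<\<tau>} (enorm (n - 1) y) * w (c * enorm (n - 1) y) / enorm (n - 1) y ^ (n - 1)) \<partial>elebesgue (n - 1))
     \<le> ennreal (sph n * dint w (c * \<tau>))"
proof -
  have n1: "n - 1 \<ge> 1" "n - 1 - 1 = n - 2" using n by auto
  have "(\<lambda>s. indicator {0..} s *\<^sub>R w s) \<in> borel_measurable borel"
    using w by (intro borel_measurable_continuous_on_indicator) (auto simp: dini_def)
  then have "(\<lambda>s. indicator {0..} s * w s) \<in> borel_measurable borel" by simp
  from measurable_compose[OF _ this, of "\<lambda>s. c * s" borel]
  have m1: "(\<lambda>s. indicator {0..} (c * s) * w (c * s)) \<in> borel_measurable borel" by simp
  have m2: "(\<lambda>s. indicator {0<..<\<tau>} s * w (c * s) / s ^ (n - 1)) \<in> borel_measurable borel"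
  proof -
    have "(\<lambda>s. indicator {0<..<\<tau>} s * (indicator {0..} (c * s) * w (c * s)) / s ^ (n - 1)) \<in> borel_measurable borel"
      using m1 by measurable
    moreover have "(\<lambda>s. indicator {0<..<\<tau>} s * (indicator {0..} (c * s) * w (c * s)) / s ^ (n - 1)) = (\<lambda>s. indicator {0<..<\<tau>} s * w (c * s) / s ^ (n - 1))"
      using c by (auto simp: fun_eq_iff indicator_def zero_le_mult_iff)
    ultimately show ?thesis by simp
  qed
  have "(\<integral>\<^sup>+y. ennreal (indicator {0<..<\<tau>} (enorm (n - 1) y) * w (c * enorm (n - 1) y) / enorm (n - 1) y ^ (n - 1)) \<partial>elebesgue (n - 1))
    = ennreal (sph n) * (\<integral>\<^sup>+s. ennreal (indicator {0<..<\<tau>} s * w (c * s) / s ^ (n - 1)) * ennreal (s ^ (n - 2)) * indicator {0<..} s \<partial>lborel)"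
    using nn_integral_radial[OF n1(1) measurable_compose[OF m2 measurable_ennreal]] by (simp add: sph_def n1(2))
  note I = this
  have "(\<integral>\<^sup>+s. ennreal (indicator {0<..<\<tau>} s * w (c * s) / s ^ (n - 1)) * ennreal (s ^ (n - 2)) * indicator {0<..} s \<partial>lborel)
     \<le> (\<integral>\<^sup>+s. ennreal c * ennreal (indicator {0<..c * \<tau>} (0 + c * s) * (w (0 + c * s) / (0 + c * s))) \<partial>lborel)"
  proof (rule nn_integral_mono)
    fix s :: real
    show "ennreal (indicator {0<..<\<tau>} s * w (c * s) / s ^ (n - 1)) * ennreal (s ^ (n - 2)) * indicator {0<..} s
      \<le> ennreal c * ennreal (indicator {0<..c * \<tau>} (0 + c * s) * (w (0 + c * s) / (0 + c * s)))"
    proof (cases "0 < s \<and> s < \<tau>")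
      case True
      then have s: "s > 0" by simp
      have "s ^ (n - 1) = s * s ^ (n - 2)"
      proof -
        have "n - 1 = Suc (n - 2)" using n by simp
        then show ?thesis by (simp only: power_Suc)
      qed
      then have "w (c * s) / s ^ (n - 1) * s ^ (n - 2) = c * (w (c * s) / (c * s))" using s c by simp
      then show ?thesis using True s c dini_nonneg[OF w, of "c * s"]
        by (simp add: ennreal_mult[symmetric])
    qed auto
  qed
  also have "\<dots> = (\<integral>\<^sup>+t. ennreal (indicator {0<..c * \<tau>} t * (w t / t)) \<partial>lborel)"
  proof -
    have m: "(\<lambda>t. ennreal (indicator {0<..c * \<tau>} t * (w t / t))) \<in> borel_measurable borel"
    proof -
      have "(\<lambda>t. indicator {0<..c * \<tau>} t * (w t / t)) \<in> borel_measurable lborel"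
        using dini_set_integrable[OF w, of "c * \<tau>"] by (simp add: set_integrable_def)
      then show ?thesis by simp
    qed
    have mc: "(\<lambda>s. ennreal (indicator {0<..c * \<tau>} (0 + c * s) * (w (0 + c * s) / (0 + c * s)))) \<in> borel_measurable lborel"
      using measurable_compose[OF _ m, of "\<lambda>s. 0 + c * s" lborel] by simp
    show ?thesis
      unfolding nn_integral_cmult[OF mc] using nn_integral_real_affine[OF m, of c 0] c by simp
  qed
  also have "\<dots> = ennreal (dint w (c * \<tau>))" by (rule nn_integral_dint[OF w])
  finally have "ennreal (sph n) * (\<integral>\<^sup>+s. ennreal (indicator {0<..<\<tau>} s * w (c * s) / s ^ (n - 1)) * ennreal (s ^ (n - 2)) * indicator {0<..} s \<partial>lborel)
    \<le> ennreal (sph n) * ennreal (dint w (c * \<tau>))" by (intro mult_left_mono) auto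
  then show ?thesis unfolding I using sph_pos[OF n] dint_nonneg[OF w] by (simp only: ennreal_mult less_imp_le)
qed

section \<open>The representation formula\<close>

lemma tendsto_affine_euc:
  assumes x: "x \<in> euc n" and e: "\<epsilon> \<longlonglongrightarrow> 0"
  shows "(\<lambda>k. evec n (\<lambda>i. x i + \<epsilon> k * z i)) \<longlonglongrightarrow> x"
proof -
  have "continuous_on UNIV (\<lambda>t. evec n (\<lambda>i. x i + t * z i))"
  proof (rule continuous_on_coordinatewise_then_product)
    fix j show "continuous_on UNIV (\<lambda>t. evec n (\<lambda>i. x i + t * z i) j)"
      by (cases "j \<in> {1..n}") (auto simp: evec_def intro!: continuous_intros)
  qed
  then have "isCont (\<lambda>t. evec n (\<lambda>i. x i + t * z i)) 0" by (simp add: continuous_on_eq_continuous_at)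
  from isCont_tendsto_compose[OF this e] show ?thesis using evec_id[OF x] by simp
qed

text \<open>The essential supremum bounds |u| off a null set, and continuity extends the bound to y.
  The approach is along y + \<epsilon> z with a single z that avoids countably many null sets, the
  affine preimages of the exceptional set. That the essential supremum is finite and nonnegative has
  to be checked too, because \<open>real_of_ereal\<close> maps infinite values to 0.\<close>

lemma abs_le_Linf_norm:
  assumes r: "0 < r" and c: "continuous_on (euc_ball n r) u" and b: "bounded (u ` euc_ball n r)"
    and y: "y \<in> euc_ball n r"
  shows "\<bar>u y\<bar> \<le> Linf_norm n (euc_ball n r) u"
proof -
  let ?M = "restrict_space (elebesgue n) (euc_ball n r)"
  have bs: "euc_ball n r \<subseteq> euc n" by (auto simp: euc_ball_def)
  have um: "u \<in> borel_measurable ?M" by (rule continuous_on_measurable_euc[OF c bs])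
  have fm: "(\<lambda>x. ereal \<bar>u x\<bar>) \<in> borel_measurable ?M" using um by measurable
  obtain B where B: "\<And>x. x \<in> euc_ball n r \<Longrightarrow> \<bar>u x\<bar> \<le> B" using b unfolding bounded_iff real_norm_def by blast
  have spM: "space ?M = euc_ball n r" using bs by (auto simp: space_restrict_space)
  define E where "E = esssup ?M (\<lambda>x. ereal \<bar>u x\<bar>)"
  have le: "E \<le> ereal B" unfolding E_def by (rule esssup_I[OF fm]) (auto intro!: AE_I2 simp: spM B)
  have emb: "emeasure ?M A = emeasure (elebesgue n) A" if "A \<subseteq> euc_ball n r" for A
    by (rule emeasure_restrict_space) (use that in auto)
  have pos: "emeasure ?M (space ?M) \<noteq> 0"
  proof
    assume "emeasure ?M (space ?M) = 0"
    then have "emeasure (elebesgue n) (euc_ball n r) = 0" using emb[of "euc_ball n r"] spM by simp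
    moreover have "emeasure (elebesgue n) {x\<in>euc n. enorm n x \<le> r / 2} \<le> emeasure (elebesgue n) (euc_ball n r)"
      using r by (intro emeasure_mono) (auto simp: euc_ball_def simp del: euc_ball_sets intro: euc_ball_sets[unfolded euc_ball_def])
    ultimately have "emeasure (elebesgue n) {x\<in>euc n. enorm n x \<le> r / 2} = 0" by (simp only: le_zero_eq)
    then have "ennreal (unit_ball_vol n * (r / 2) ^ n) = 0" using emeasure_euc_cball[of "r / 2" n] r by simp
    then have "unit_ball_vol n * (r / 2) ^ n \<le> 0" by (simp only: ennreal_eq_0_iff)
    moreover have "0 < unit_ball_vol n * (r / 2) ^ n" using r by (intro mult_pos_pos zero_less_power) auto
    ultimately show False by linarith
  qed
  have "0 \<le> E"
  proof -
    have "esssup ?M (\<lambda>x. 0) \<le> esssup ?M (\<lambda>x. ereal \<bar>u x\<bar>)" by (rule esssup_mono) auto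
    moreover have "esssup ?M (\<lambda>x. 0 :: ereal) = 0" by (rule esssup_const[OF pos])
    ultimately show ?thesis by (simp add: E_def)
  qed
  then obtain l where l: "E = ereal l" using le by (cases E) auto
  have L: "Linf_norm n (euc_ball n r) u = l" unfolding Linf_norm_def E_def[symmetric] l by simp
  have "AE x in ?M. ereal \<bar>u x\<bar> \<le> E" unfolding E_def by (rule esssup_AE)
  then have "AE x in ?M. \<bar>u x\<bar> \<le> l" unfolding l by simp
  then have ae: "AE x in elebesgue n. x \<in> euc_ball n r \<longrightarrow> \<bar>u x\<bar> \<le> l"
    by (subst (asm) AE_restrict_space_iff) auto
  then obtain N where N: "{x\<in>space (elebesgue n). \<not> (x \<in> euc_ball n r \<longrightarrow> \<bar>u x\<bar> \<le> l)} \<subseteq> N" "emeasure (elebesgue n) N = 0" "N \<in> sets (elebesgue n)"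
    by (rule AE_E)
  have ye: "y \<in> euc n" "enorm n y < r" using y by (auto simp: euc_ball_def)
  define \<epsilon> where "\<epsilon> k = 1 / real (Suc k)" for k
  have \<epsilon>: "\<epsilon> k > 0" for k by (simp add: \<epsilon>_def)
  have e0: "\<epsilon> \<longlonglongrightarrow> 0" unfolding \<epsilon>_def[abs_def] by (rule LIMSEQ_Suc[OF lim_1_over_n])
  let ?T = "\<lambda>k z. evec n (\<lambda>i. y i + \<epsilon> k * z i)"
  have "AE z in elebesgue n. ?T k z \<notin> N" for k
  proof (rule AE_I[where N="?T k -` N \<inter> space (elebesgue n)"])
    have m: "?T k -` N \<inter> space (elebesgue n) \<in> sets (elebesgue n)" by (rule measurable_sets[OF affine_measurable N(3)])
    have "emeasure (elebesgue n) (?T k -` N \<inter> space (elebesgue n)) = emeasure (distr (elebesgue n) (elebesgue n) (?T k)) N"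
      by (rule emeasure_distr[OF affine_measurable N(3), symmetric])
    also have "\<dots> = emeasure (density (elebesgue n) (\<lambda>_. ennreal (1 / \<bar>\<epsilon> k\<bar> ^ n))) N"
      using \<epsilon>[of k] by (subst distr_affine_elebesgue) auto
    also have "\<dots> = 0" using N by (simp add: emeasure_density_const)
    finally show "emeasure (elebesgue n) (?T k -` N \<inter> space (elebesgue n)) = 0" .
    show "?T k -` N \<inter> space (elebesgue n) \<in> sets (elebesgue n)" by (rule m)
  qed auto
  then have "AE z in elebesgue n. \<forall>k. ?T k z \<notin> N" by (simp add: AE_all_countable)
  moreover have "\<not> (AE z in elebesgue n. False)"
  proof
    assume "AE z in elebesgue n. False"
    then have "emeasure (elebesgue n) (euc n) = 0"
      using AE_iff_measurable[of "space (elebesgue n)" "elebesgue n" "\<lambda>_. False"] by simp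
    moreover have "emeasure (elebesgue n) (euc_ball n r) \<le> emeasure (elebesgue n) (euc n)"
      by (intro emeasure_mono bs) auto
    ultimately show False using pos spM emb[of "euc_ball n r"] by simp
  qed
  ultimately have "\<exists>z. z \<in> space (elebesgue n) \<and> (\<forall>k. ?T k z \<notin> N)"
  proof -
    assume a: "AE z in elebesgue n. \<forall>k. ?T k z \<notin> N" and b: "\<not> (AE z in elebesgue n. False)"
    show ?thesis
    proof (rule ccontr)
      assume c: "\<nexists>z. z \<in> space (elebesgue n) \<and> (\<forall>k. ?T k z \<notin> N)"
      have "AE z in elebesgue n. False" using a AE_space by eventually_elim (use c in blast)
      then show False using b by simp
    qed
  qed
  then obtain z where z: "\<And>k. ?T k z \<notin> N" by auto
  have lim: "(\<lambda>k. ?T k z) \<longlonglongrightarrow> y" by (rule tendsto_affine_euc[OF ye(1) e0])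
  have "isCont (enorm n) y" using continuous_on_enorm[of UNIV n] by (simp add: continuous_on_eq_continuous_at)
  from isCont_tendsto_compose[OF this lim] have "\<forall>\<^sub>F k in sequentially. enorm n (?T k z) < r"
    using order_tendstoD(2) ye(2) by blast
  then have ev: "\<forall>\<^sub>F k in sequentially. ?T k z \<in> euc_ball n r" by eventually_elim (simp add: euc_ball_def)
  have "(\<lambda>k. u (?T k z)) \<longlonglongrightarrow> u y" by (rule continuous_on_tendsto_compose[OF c lim y ev])
  then have "(\<lambda>k. \<bar>u (?T k z)\<bar>) \<longlonglongrightarrow> \<bar>u y\<bar>" by (rule tendsto_rabs)
  moreover have "\<forall>\<^sub>F k in sequentially. \<bar>u (?T k z)\<bar> \<le> l"
    using ev
  proof eventually_elim
    case (elim k)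
    have "?T k z \<in> space (elebesgue n)" by simp
    then show ?case using N(1) z[of k] elim by blast
  qed
  ultimately show ?thesis unfolding L by (intro tendsto_upperbound[OF _ _ sequentially_bot])
qed

locale dini_problem = dini_graph +
  fixes g u :: "vec \<Rightarrow> real"
  assumes gD: "C0_Dini n \<psi> g" and u_cont: "continuous_on (euc_ball n 1) u" and u_bdd: "bounded (u ` euc_ball n 1)"
    and sol: "distributional_solution n \<psi> g u"
begin

text \<open>Half of the chart radius: the kernels cut off at 2 \<rho> vanish outside the
  chart.\<close>

definition \<rho> :: real where "\<rho> = r0 / 2"
definition g0 :: real where "g0 = g (ezero n)"
text \<open>Truncated to the ball of radius R, because the final estimate involves the norm of u
  over that ball only, and a function bounded everywhere keeps the integrals free of side
  conditions.\<close>

definition vv :: "vec \<Rightarrow> real" where "vv y = indicator (euc_ball n R) y * (u y - g0 * max 0 (y n))"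
definition V :: real where "V = Linf_norm n (euc_ball n R) u + R * \<bar>g0\<bar>"
definition \<theta> :: "vec \<Rightarrow> real" where
  "\<theta> = (SOME \<theta>. \<theta> \<in> borel_measurable (elebesgue (n - 1)) \<and>
     (\<forall>y. 1 \<le> \<theta> y \<and> \<theta> y \<le> 1 + cdens * \<omega> (8 * real n * enorm (n - 1) y)) \<and>
     surfmeas = density (elebesgue (n - 1)) (\<lambda>y. ennreal (indicator D0 y * \<theta> y)))"

lemma theta:
  "\<theta> \<in> borel_measurable (elebesgue (n - 1))" "1 \<le> \<theta> y" "\<theta> y \<le> 1 + cdens * \<omega> (8 * real n * enorm (n - 1) y)"
  "surfmeas = density (elebesgue (n - 1)) (\<lambda>y. ennreal (indicator D0 y * \<theta> y))"
  using someI_ex[OF surf_density] unfolding \<theta>_def[symmetric] by blast+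

lemma rho: "0 < \<rho>" "2 * \<rho> = r0" "r0 < R" "r0 < 1"
proof -
  show "0 < \<rho>" "2 * \<rho> = r0" using r0_pos by (auto simp: \<rho>_def)
  show "r0 < R" using R n3 by (simp add: r0_def field_simps)
  then show "r0 < 1" using R by simp
qed

lemma ball_R_subset: "euc_ball n R \<subseteq> euc_ball n 1"
  using R by (auto simp: euc_ball_def)

lemma u_bound: "y \<in> euc_ball n R \<Longrightarrow> \<bar>u y\<bar> \<le> Linf_norm n (euc_ball n R) u"
  using ball_R_subset by (intro abs_le_Linf_norm R(1) continuous_on_subset[OF u_cont] bounded_subset[OF u_bdd]) auto

lemma vv_bound: "\<bar>vv y\<bar> \<le> V"
proof (cases "y \<in> euc_ball n R")
  case True
  have "\<bar>max 0 (y n)\<bar> \<le> R"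
    using True abs_coord_le_enorm[of n n y] n3 R by (auto simp: euc_ball_def)
  then have "\<bar>g0\<bar> * \<bar>max 0 (y n)\<bar> \<le> \<bar>g0\<bar> * R" by (intro mult_left_mono) auto
  then show ?thesis using True u_bound[OF True] by (simp add: vv_def V_def abs_mult mult.commute abs_triangle_ineq4[THEN order_trans])
next
  case False
  have "0 \<in> {0..R}" using R by simp
  have "ezero n \<in> euc_ball n R" using R by (simp add: euc_ball_def ezero_def enorm_alt)
  then have "0 \<le> Linf_norm n (euc_ball n R) u" using u_bound abs_ge_zero order_trans by blast
  then show ?thesis using False R by (simp add: vv_def V_def)
qed

lemma V_nonneg: "0 \<le> V"
  using vv_bound[of undefined] by linarith

lemma indicator_times_measurable:
  assumes "continuous_on A f" "A \<in> sets (elebesgue m)"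
  shows "(\<lambda>y. indicator A y * f y :: real) \<in> borel_measurable (elebesgue m)"
proof -
  have "A \<subseteq> euc m" using sets.sets_into_space[OF assms(2)] by simp
  from continuous_on_measurable_euc[OF assms(1) this]
  have "(\<lambda>y. indicator A y *\<^sub>R f y) \<in> borel_measurable (elebesgue m)"
    by (subst (asm) borel_measurable_restrict_space_iff) (use assms in auto)
  then show ?thesis by simp
qed

lemma vv_measurable [measurable]: "vv \<in> borel_measurable (elebesgue n)"
  unfolding vv_def[abs_def]
  by (intro indicator_times_measurable continuous_intros continuous_on_subset[OF u_cont ball_R_subset]) auto

lemma vv_integrable:
  assumes h: "continuous_on (euc n) h" "\<And>y. y \<in> euc n \<Longrightarrow> r0 < enorm n y \<Longrightarrow> h y = 0"
  shows "integrable (elebesgue n) (\<lambda>y. vv y * h y)"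
proof -
  have "compact (h ` {x\<in>euc n. enorm n x \<le> r0})"
    by (intro compact_continuous_image compact_euc_cball continuous_on_subset[OF h(1)]) auto
  then have "bounded (h ` {x\<in>euc n. enorm n x \<le> r0})" by (rule compact_imp_bounded)
  then obtain B where B: "\<And>x. x \<in> euc n \<Longrightarrow> enorm n x \<le> r0 \<Longrightarrow> \<bar>h x\<bar> \<le> B"
    unfolding bounded_iff real_norm_def by blast
  note continuous_measurable_euc[OF h(1), measurable]
  show ?thesis
  proof (rule integrable_euc_bounded_support[where r=r0 and B="V * B"])
    show "\<bar>vv y * h y\<bar> \<le> V * B" if "y \<in> euc n" "enorm n y \<le> r0" for y
      unfolding abs_mult using B[OF that] vv_bound V_nonneg by (intro mult_mono) auto
  qed (use h in auto)
qed

lemma cutoff_continuous: "continuous_on (euc n) (\<lambda>y. cutoff \<rho> k ((enorm n y)\<^sup>2))"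
proof (rule continuous_on_compose2[of UNIV "cutoff \<rho> k"])
  show "continuous_on UNIV (cutoff \<rho> k)"
    by (intro continuous_at_imp_continuous_on ballI DERIV_isCont[OF cutoff_deriv[OF rho(1)]])
qed (auto intro!: continuous_intros)

lemma bub_continuous: "0 < e \<Longrightarrow> continuous_on (euc n) (\<lambda>y. bub n e k ((enorm n (\<lambda>j. y j - x j))\<^sup>2))"
proof (rule continuous_on_compose2[of "{0..}" "bub n e k"])
  assume e: "0 < e"
  show "continuous_on {0..} (bub n e k)"
    by (intro continuous_at_imp_continuous_on ballI DERIV_isCont[OF bub_deriv]) (use e in auto)
  show "continuous_on (euc n) (\<lambda>y. (enorm n (\<lambda>j. y j - x j))\<^sup>2)"
    unfolding enorm_alt by (intro continuous_intros)
qed auto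

lemma bub_continuous0: "0 < e \<Longrightarrow> continuous_on (euc n) (\<lambda>y. bub n e k ((enorm n y)\<^sup>2))"
  using bub_continuous[of e k "\<lambda>_. 0"] by simp

lemma cutpart_continuous: "0 < e \<Longrightarrow> continuous_on (euc n) (cutpart n \<rho> e x)"
  unfolding cutpart_def[abs_def] einner_def
  by (intro continuous_intros cutoff_continuous bub_continuous)

lemma cutpart_zero: "r0 < enorm n y \<or> enorm n y < \<rho> \<Longrightarrow> cutpart n \<rho> e x y = 0"
proof -
  assume "r0 < enorm n y \<or> enorm n y < \<rho>"
  then have "cutoff \<rho> 1 ((enorm n y)\<^sup>2) = 0" "cutoff \<rho> 2 ((enorm n y)\<^sup>2) = 0"
    using cutoff_12_eq_0[OF rho(1), of "enorm n y"] rho(2) by auto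
  then show ?thesis by (simp add: cutpart_def)
qed

text \<open>The difference of the two surface terms in graph coordinates: the graph with its density
  \<theta> and the values of g, minus the hyperplane with constant density g(0). The pointwise
  cancellation between them is what the estimates near the origin use.\<close>

definition Jint :: "(vec \<Rightarrow> real) \<Rightarrow> vec \<Rightarrow> real" where
  "Jint f y = indicator D0 y * \<theta> y * (g (lift n \<psi> y) * f (lift n \<psi> y)) - g0 * f (y(n := 0))"

lemma small_D0:
  assumes "y \<in> D0"
  shows "y \<in> euc (n - 1)" "enorm (n - 1) y < r0" "lift n \<psi> y \<in> Gam n \<psi>" "lift n \<psi> y \<in> euc n"
proof -
  show y: "y \<in> euc (n - 1)" "enorm (n - 1) y < r0" using assms by (auto simp: D0_def euc_ball_def)
  have "r0 < R / (2 * real n)" using R n3 by (simp add: r0_def field_simps)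
  then show "lift n \<psi> y \<in> Gam n \<psi>" using y by (intro small(2)[OF R(1) order_refl]) auto
  show "lift n \<psi> y \<in> euc n" using n3 y by (intro lift_props) auto
qed

lemma lift_continuous: "continuous_on (euc (n - 1)) (lift n \<psi>)"
proof (rule continuous_on_coordinatewise_then_product)
  fix j show "continuous_on (euc (n - 1)) (\<lambda>y. lift n \<psi> y j)"
    unfolding lift_def by (cases "j = n") (auto intro: continuous_intros psi_continuous)
qed

lemma flat_continuous: "continuous_on (euc (n - 1)) (\<lambda>y. y(n := 0 :: real))"
proof (rule continuous_on_coordinatewise_then_product)
  fix j show "continuous_on (euc (n - 1)) (\<lambda>y. (y(n := 0 :: real)) j)"
    by (cases "j = n") (auto intro: continuous_intros)
qed

lemma flat_props:
  assumes "y \<in> euc (n - 1)"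
  shows "y(n := 0) \<in> euc n" "enorm n (y(n := 0)) = enorm (n - 1) y"
proof -
  show "y(n := 0) \<in> euc n" using assms n3 by (auto simp: euc_def PiE_def extensional_def)
  have "(enorm n (y(n := 0)))\<^sup>2 = (enorm (n - 1) (y(n := 0)))\<^sup>2 + ((y(n := 0)) n)\<^sup>2"
    using n3 by (intro enorm_split) auto
  also have "enorm (n - 1) (y(n := 0)) = enorm (n - 1) y" using n3 by (intro enorm_cong) auto
  finally have "(enorm n (y(n := 0)))\<^sup>2 = (enorm (n - 1) y)\<^sup>2"
    by (simp only: fun_upd_same power_zero_numeral add_0_right)
  then show "enorm n (y(n := 0)) = enorm (n - 1) y" by (rule power2_eq_imp_eq) simp_all
qed

lemma g_lift_measurable: "(\<lambda>y. indicator D0 y * g (lift n \<psi> y)) \<in> borel_measurable (elebesgue (n - 1))"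
proof (rule indicator_times_measurable[OF _ D0_sets(1)])
  show "continuous_on D0 (\<lambda>y. g (lift n \<psi> y))"
    by (rule continuous_on_compose2[of "Gam n \<psi>" g])
       (use gD small_D0 in \<open>auto simp: C0_Dini_def intro: continuous_on_subset[OF lift_continuous]\<close>)
qed

lemma g_bounded: "\<exists>B. \<forall>x\<in>Gam n \<psi>. \<bar>g x\<bar> \<le> B"
proof -
  obtain B where "\<And>x. x \<in> Gam n \<psi> \<Longrightarrow> fun_osc n g x \<le> B"
    using gD by (auto simp: C0_Dini_def bdd_above_def)
  then have "\<bar>g x\<bar> \<le> B + \<bar>g0\<bar>" if "x \<in> Gam n \<psi>" for x
    using that abs_triangle_ineq2[of "g x" g0] by (fastforce simp: fun_osc_def g0_def)
  then show ?thesis by blast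
qed

lemma F_lift_measurable:
  assumes f: "continuous_on (euc n) f"
  shows "(\<lambda>y. indicator D0 y * (g (lift n \<psi> y) * f (lift n \<psi> y))) \<in> borel_measurable (elebesgue (n - 1))"
    "(\<lambda>y. f (y(n := 0))) \<in> borel_measurable (elebesgue (n - 1))"
    "(\<lambda>y. f (lift n \<psi> y)) \<in> borel_measurable (elebesgue (n - 1))"
proof -
  have c1: "continuous_on (euc (n - 1)) (\<lambda>y. f (lift n \<psi> y))"
    by (rule continuous_on_compose2[OF f lift_continuous]) (use lift_props(1) n3 in auto)
  have c2: "continuous_on (euc (n - 1)) (\<lambda>y. f (y(n := 0)))"
    by (rule continuous_on_compose2[OF f flat_continuous]) (use flat_props in auto)
  show "(\<lambda>y. f (y(n := 0))) \<in> borel_measurable (elebesgue (n - 1))" by (rule continuous_measurable_euc[OF c2])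
  show m: "(\<lambda>y. f (lift n \<psi> y)) \<in> borel_measurable (elebesgue (n - 1))" by (rule continuous_measurable_euc[OF c1])
  have "(\<lambda>y. (indicator D0 y * g (lift n \<psi> y)) * f (lift n \<psi> y)) \<in> borel_measurable (elebesgue (n - 1))"
    by (intro borel_measurable_times g_lift_measurable m)
  then show "(\<lambda>y. indicator D0 y * (g (lift n \<psi> y) * f (lift n \<psi> y))) \<in> borel_measurable (elebesgue (n - 1))"
    by (simp add: mult.assoc)
qed

lemma Jint_parts_integrable:
  assumes f: "continuous_on (euc n) f" and z: "\<And>x. x \<in> euc n \<Longrightarrow> r0 \<le> enorm n x \<Longrightarrow> f x = 0"
  shows "integrable (elebesgue (n - 1)) (\<lambda>y. indicator D0 y * \<theta> y * (g (lift n \<psi> y) * f (lift n \<psi> y)))"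
    "integrable (elebesgue (n - 1)) (\<lambda>y. g0 * f (y(n := 0)))"
proof -
  have "compact (f ` {x\<in>euc n. enorm n x \<le> r0})"
    by (intro compact_continuous_image compact_euc_cball continuous_on_subset[OF f]) auto
  then have "bounded (f ` {x\<in>euc n. enorm n x \<le> r0})" by (rule compact_imp_bounded)
  then obtain B0 where B0: "\<And>x. x \<in> euc n \<Longrightarrow> enorm n x \<le> r0 \<Longrightarrow> \<bar>f x\<bar> \<le> B0"
    unfolding bounded_iff real_norm_def by blast
  define B where "B = max B0 0"
  have B: "\<bar>f x\<bar> \<le> B" if "x \<in> euc n" for x
    using B0[OF that] z[OF that] by (cases "enorm n x \<le> r0") (auto simp: B_def)
  obtain Bg where Bg: "\<And>x. x \<in> Gam n \<psi> \<Longrightarrow> \<bar>g x\<bar> \<le> Bg" using g_bounded by auto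
  have "integrable (elebesgue (n - 1)) (\<lambda>y. \<theta> y * (indicator D0 y * (g (lift n \<psi> y) * f (lift n \<psi> y))))"
  proof (rule integrable_euc_bounded_support[where r=r0 and B="(1 + cdens) * (Bg * B)"])
    show "(\<lambda>y. \<theta> y * (indicator D0 y * (g (lift n \<psi> y) * f (lift n \<psi> y)))) \<in> borel_measurable (elebesgue (n - 1))"
      by (intro borel_measurable_times theta F_lift_measurable f)
    fix y assume y: "y \<in> euc (n - 1)"
    have t: "0 \<le> (1 + cdens) * (Bg * B)"
    proof -
      have "0 \<le> Bg" using Bg[OF zero_in] by linarith
      moreover have "0 \<le> B" by (simp add: B_def)
      ultimately show ?thesis using cdens_nonneg by simp
    qed
    show "\<bar>\<theta> y * (indicator D0 y * (g (lift n \<psi> y) * f (lift n \<psi> y)))\<bar> \<le> (1 + cdens) * (Bg * B)"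
    proof (cases "y \<in> D0")
      case True
      have "8 * real n * enorm (n - 1) y \<le> R" using small_D0(2)[OF True] n3 by (simp add: r0_def field_simps)
      then have "\<omega> (8 * real n * enorm (n - 1) y) \<le> 1" by (intro om_le_1) auto
      then have "cdens * \<omega> (8 * real n * enorm (n - 1) y) \<le> cdens * 1" using cdens_nonneg by (intro mult_left_mono)
      then have "\<bar>\<theta> y\<bar> \<le> 1 + cdens" using theta(2,3)[of y] by simp
      then have "\<bar>\<theta> y\<bar> * (\<bar>g (lift n \<psi> y)\<bar> * \<bar>f (lift n \<psi> y)\<bar>) \<le> (1 + cdens) * (Bg * B)"
        using Bg[OF small_D0(3)[OF True]] B[OF small_D0(4)[OF True]] cdens_nonneg
        by (intro mult_mono) (auto simp: B_def intro: order_trans[OF abs_ge_zero])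
      then show ?thesis using True by (simp add: abs_mult)
    qed (use t in simp)
    show "\<theta> y * (indicator D0 y * (g (lift n \<psi> y) * f (lift n \<psi> y))) = 0" if "r0 < enorm (n - 1) y"
      using that by (auto simp: D0_def euc_ball_def)
  qed
  then show "integrable (elebesgue (n - 1)) (\<lambda>y. indicator D0 y * \<theta> y * (g (lift n \<psi> y) * f (lift n \<psi> y)))"
    by (simp add: mult_ac)
  show "integrable (elebesgue (n - 1)) (\<lambda>y. g0 * f (y(n := 0)))"
    by (intro integrable_mult_right, rule integrable_euc_bounded_support[where r=r0 and B=B])
       (use B z flat_props F_lift_measurable(2)[OF f] in auto)
qed

lemma Jint_integrable:
  assumes f: "continuous_on (euc n) f" and z: "\<And>x. x \<in> euc n \<Longrightarrow> r0 \<le> enorm n x \<Longrightarrow> f x = 0"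
  shows "integrable (elebesgue (n - 1)) (Jint f)"
  unfolding Jint_def[abs_def] by (intro Bochner_Integration.integrable_diff Jint_parts_integrable assms)

lemma ker_continuous: "0 < e \<Longrightarrow> continuous_on (euc n) (ker n \<rho> e x)"
  by (rule smooth_continuous[OF smooth_ker[OF rho(1)]])

lemma ker_zero': "r0 \<le> enorm n y \<Longrightarrow> ker n \<rho> e x y = 0"
  using ker_zero[OF rho(1)] rho(2) by simp

text \<open>The remainder, cut off and averaged against the bubble; for |x| < \<rho> it tends to a
  positive multiple of \<open>vv x\<close> as e tends to 0.\<close>

definition Dfun :: "real \<Rightarrow> vec \<Rightarrow> real" where
  "Dfun e x = real n * (real n - 2) *
     (\<integral>y. cutoff \<rho> 0 ((enorm n y)\<^sup>2) * vv y * (e * bub n e 2 ((enorm n (\<lambda>j. y j - x j))\<^sup>2)) \<partial>elebesgue n)"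

text \<open>The equation is tested with \<open>ker\<close>. For |y| \<le> r0 one has u = vv + g(0)
  max(0, y_n), and the second summand contributes the flat surface integral by
  \<open>laplacian_pos_part\<close>. What is left is the Laplacian of the kernel against
  \<open>vv\<close>, split into the bubble and the annulus.\<close>

lemma representation:
  assumes e: "0 < e"
  shows "Dfun e x = (\<integral>y. vv y * cutpart n \<rho> e x y \<partial>elebesgue n) - (\<integral>y. Jint (ker n \<rho> e x) y \<partial>elebesgue (n - 1))"
proof -
  let ?\<phi> = "ker n \<rho> e x"
  let ?K = "\<lambda>y. cutoff \<rho> 0 ((enorm n y)\<^sup>2) * (e * bub n e 2 ((enorm n (\<lambda>j. y j - x j))\<^sup>2))"
  have n2: "n \<ge> 2" using n3 by simp
  have sm: "smooth n ?\<phi>" by (rule smooth_ker[OF rho(1) e])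
  have lap: "laplacian n ?\<phi> y = - (real n * (real n - 2)) * ?K y + cutpart n \<rho> e x y" if "y \<in> euc n" for y
    by (rule laplacian_ker[OF rho(1) e that])
  have Kc: "continuous_on (euc n) ?K" by (intro continuous_intros cutoff_continuous bub_continuous e)
  have Kz: "?K y = 0" if "r0 < enorm n y" for y
    using that cutoff_0_eq_0[OF rho(1), of "enorm n y"] rho(2) by simp
  define h where "h y = - (real n * (real n - 2)) * ?K y + cutpart n \<rho> e x y" for y
  have hc: "continuous_on (euc n) h" unfolding h_def by (intro continuous_intros Kc[simplified] Kc cutpart_continuous e)
  have hz: "h y = 0" if "r0 < enorm n y" for y using Kz[OF that] cutpart_zero[of y] that by (simp add: h_def)
  have "test_function n ?\<phi>"
    by (rule test_functionI[OF sm rho(4)]) (use ker_zero' in auto)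
  then have s: "(LINT y:euc_ball n 1|elebesgue n. u y * laplacian n ?\<phi> y) = (LINT y:Gam n \<psi>|hausdorff n (n - 1). g y * ?\<phi> y)"
    using sol by (simp add: distributional_solution_def)
  have s2: "(LINT y:Gam n \<psi>|hausdorff n (n - 1). g y * ?\<phi> y)
     = (\<integral>y. indicator D0 y * \<theta> y * (indicator D0 y * (g (lift n \<psi> y) * ?\<phi> (lift n \<psi> y))) \<partial>elebesgue (n - 1))"
    by (rule surface_integral[OF theta(1,2,4) F_lift_measurable(1)[OF ker_continuous[OF e]]])
       (auto simp: ker_zero')
  also have "\<dots> = (\<integral>y. indicator D0 y * \<theta> y * (g (lift n \<psi> y) * ?\<phi> (lift n \<psi> y)) \<partial>elebesgue (n - 1))"
    by (intro Bochner_Integration.integral_cong) (auto simp: indicator_def)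
  finally have G: "(LINT y:Gam n \<psi>|hausdorff n (n - 1). g y * ?\<phi> y) =
    (\<integral>y. indicator D0 y * \<theta> y * (g (lift n \<psi> y) * ?\<phi> (lift n \<psi> y)) \<partial>elebesgue (n - 1))" .
  have P: "(\<integral>y. max 0 (y n) * laplacian n ?\<phi> y \<partial>elebesgue n) = (\<integral>y. ?\<phi> (y(n := 0)) \<partial>elebesgue (n - 1))"
    by (rule laplacian_pos_part[OF n2 sm, of r0]) (auto simp: ker_zero')
  have i2: "integrable (elebesgue n) (\<lambda>y. max 0 (y n) * h y)"
    by (rule integrable_euc_continuous[where r=r0]) (auto intro!: continuous_intros hc simp: hz)
  have i1: "integrable (elebesgue n) (\<lambda>y. vv y * h y)" by (rule vv_integrable[OF hc hz])
  have "(\<integral>y. vv y * h y \<partial>elebesgue n) + g0 * (\<integral>y. max 0 (y n) * h y \<partial>elebesgue n)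
     = (\<integral>y. vv y * h y + g0 * (max 0 (y n) * h y) \<partial>elebesgue n)"
    using i1 i2 by simp
  also have "\<dots> = (\<integral>y. indicator (euc_ball n 1) y *\<^sub>R (u y * laplacian n ?\<phi> y) \<partial>elebesgue n)"
  proof (intro Bochner_Integration.integral_cong refl)
    fix y assume "y \<in> space (elebesgue n)"
    then have y: "y \<in> euc n" by simp
    show "vv y * h y + g0 * (max 0 (y n) * h y) = indicator (euc_ball n 1) y *\<^sub>R (u y * laplacian n ?\<phi> y)"
    proof (cases "r0 < enorm n y")
      case True
      then show ?thesis using hz[OF True] lap[OF y] by (simp add: h_def)
    next
      case False
      then have "y \<in> euc_ball n R" "y \<in> euc_ball n 1" using y rho by (auto simp: euc_ball_def)
      then show ?thesis unfolding lap[OF y] h_def[symmetric] by (simp add: vv_def algebra_simps)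
    qed
  qed
  also have "\<dots> = (LINT y:euc_ball n 1|elebesgue n. u y * laplacian n ?\<phi> y)" by (simp add: set_lebesgue_integral_def)
  also have "\<dots> = (\<integral>y. indicator D0 y * \<theta> y * (g (lift n \<psi> y) * ?\<phi> (lift n \<psi> y)) \<partial>elebesgue (n - 1))" using s G by simp
  finally have 1: "(\<integral>y. vv y * h y \<partial>elebesgue n) + g0 * (\<integral>y. max 0 (y n) * h y \<partial>elebesgue n)
    = (\<integral>y. indicator D0 y * \<theta> y * (g (lift n \<psi> y) * ?\<phi> (lift n \<psi> y)) \<partial>elebesgue (n - 1))" .
  have 2: "(\<integral>y. max 0 (y n) * h y \<partial>elebesgue n) = (\<integral>y. ?\<phi> (y(n := 0)) \<partial>elebesgue (n - 1))"
    unfolding P[symmetric] by (intro Bochner_Integration.integral_cong refl) (simp add: lap h_def)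
  have 3: "(\<integral>y. vv y * h y \<partial>elebesgue n) = (\<integral>y. Jint ?\<phi> y \<partial>elebesgue (n - 1))"
    unfolding Jint_def using 1 2 Jint_parts_integrable[OF ker_continuous[OF e] ker_zero'] by simp
  have i3: "integrable (elebesgue n) (\<lambda>y. vv y * ?K y)" by (rule vv_integrable[OF Kc Kz])
  have i4: "integrable (elebesgue n) (\<lambda>y. vv y * cutpart n \<rho> e x y)"
    by (rule vv_integrable[OF cutpart_continuous[OF e]]) (simp add: cutpart_zero)
  have "(\<integral>y. vv y * h y \<partial>elebesgue n) = (\<integral>y. - (real n * (real n - 2)) * (vv y * ?K y) + vv y * cutpart n \<rho> e x y \<partial>elebesgue n)"
    by (intro Bochner_Integration.integral_cong refl) (simp add: h_def algebra_simps)
  also have "\<dots> = - (real n * (real n - 2)) * (\<integral>y. vv y * ?K y \<partial>elebesgue n) + (\<integral>y. vv y * cutpart n \<rho> e x y \<partial>elebesgue n)"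
    using i3 i4 by (subst Bochner_Integration.integral_add) (auto intro: integrable_mult_right simp del: mult_minus_left)
  also have "(\<integral>y. vv y * ?K y \<partial>elebesgue n) = (\<integral>y. cutoff \<rho> 0 ((enorm n y)\<^sup>2) * vv y * (e * bub n e 2 ((enorm n (\<lambda>j. y j - x j))\<^sup>2)) \<partial>elebesgue n)"
    by (intro Bochner_Integration.integral_cong refl) (simp add: mult_ac)
  finally show ?thesis using 3 by (simp add: Dfun_def)
qed

end

section \<open>The surface potential\<close>

lemma cutoff_1_mult_le: "0 < \<rho> \<Longrightarrow> 0 \<le> s \<Longrightarrow> \<bar>cutoff \<rho> 1 s\<bar> * s \<le> 4 * chiB"
proof -
  assume \<rho>: "0 < \<rho>" and s: "0 \<le> s"
  show ?thesis
  proof (cases "2 * \<rho> < sqrt s")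
    case True
    then have "cutoff \<rho> 1 ((sqrt s)\<^sup>2) = 0" using s by (intro cutoff_12_eq_0(1)[OF \<rho>]) auto
    then show ?thesis using s chiB_nonneg by simp
  next
    case False
    then have "(sqrt s)\<^sup>2 \<le> (2 * \<rho>)\<^sup>2" using s by (intro power_mono) auto
    then have "s \<le> 4 * \<rho>\<^sup>2" using s by (simp add: power_mult_distrib)
    then have "\<bar>cutoff \<rho> 1 s\<bar> * s \<le> (chiB / \<rho>\<^sup>2) * (4 * \<rho>\<^sup>2)"
      using s by (intro mult_mono cutoff_bounds) (auto simp: chiB_nonneg)
    then show ?thesis using \<rho> by simp
  qed
qed

context dini_problem
begin

definition \<omega>g :: "real \<Rightarrow> real" where "\<omega>g = omega_fun n \<psi> g"
text \<open>Both moduli are taken at 8n|y| with y in the base: large enough for the lifted point to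
  lie in the open ball and for the bound on \<theta>, and at most R on the chart.\<close>

definition Og :: "real \<Rightarrow> real" where "Og s = \<omega>g (8 * real n * s)"
definition Om :: "real \<Rightarrow> real" where "Om s = \<omega> (8 * real n * s)"

lemma dini_wg: "dini \<omega>g" using gD by (simp add: C0_Dini_def \<omega>g_def)
lemma dini_w: "dini \<omega>" using C1D by (simp add: C1_Dini_def \<omega>_def)

lemma Og_mono: "0 \<le> s \<Longrightarrow> s \<le> t \<Longrightarrow> Og s \<le> Og t"
  unfolding Og_def by (intro dini_mono[OF dini_wg] mult_left_mono) auto
lemma Om_mono: "0 \<le> s \<Longrightarrow> s \<le> t \<Longrightarrow> Om s \<le> Om t"
  unfolding Om_def by (intro dini_mono[OF dini_w] mult_left_mono) auto
lemma Og_nonneg: "0 \<le> s \<Longrightarrow> 0 \<le> Og s"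
  unfolding Og_def by (intro dini_nonneg[OF dini_wg]) auto
lemma Om_nonneg: "0 \<le> s \<Longrightarrow> 0 \<le> Om s"
  unfolding Om_def by (intro dini_nonneg[OF dini_w]) auto
lemma Om_le_1: "0 \<le> s \<Longrightarrow> s \<le> r0 \<Longrightarrow> Om s \<le> 1"
proof -
  assume s: "0 \<le> s" "s \<le> r0"
  have "8 * real n * s \<le> 8 * real n * r0" using s by (intro mult_left_mono) auto
  also have "\<dots> = R" using n3 by (simp add: r0_def)
  finally show ?thesis unfolding Om_def using s by (intro om_le_1) auto
qed

lemma lift_bounds:
  assumes y: "y \<in> D0" "0 < enorm (n - 1) y"
  shows "\<bar>\<psi> y\<bar> \<le> real n * Om (enorm (n - 1) y) * enorm (n - 1) y"
    "enorm (n - 1) y \<le> enorm n (lift n \<psi> y)" "enorm n (lift n \<psi> y) \<le> real n * enorm (n - 1) y"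
proof -
  let ?t = "enorm (n - 1) y"
  have ye: "y \<in> euc (n - 1)" "?t < r0" using small_D0[OF y(1)] by auto
  have s: "0 < 4 * real n * ?t" "4 * real n * ?t \<le> R" "?t < 4 * real n * ?t / (2 * real n)"
  proof -
    show "0 < 4 * real n * ?t" using y n3 by simp
    have "4 * real n * ?t \<le> 4 * real n * r0" using ye by (intro mult_left_mono) auto
    also have "\<dots> \<le> R" using n3 R by (simp add: r0_def)
    finally show "4 * real n * ?t \<le> R" .
    show "?t < 4 * real n * ?t / (2 * real n)" using y n3 by simp
  qed
  have m: "\<omega> (4 * real n * ?t) \<le> Om ?t" unfolding Om_def by (intro om_mono) auto
  have 1: "\<bar>\<psi> y\<bar> \<le> real (n - 1) * \<omega> (4 * real n * ?t) * ?t" using small(1)[OF s(1,2) ye(1) s(3)] .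
  also have "\<dots> \<le> real (n - 1) * Om ?t * ?t" using m by (intro mult_right_mono mult_left_mono) auto
  finally have 2: "\<bar>\<psi> y\<bar> \<le> real (n - 1) * Om ?t * ?t" .
  also have "\<dots> \<le> real n * Om ?t * ?t" using Om_nonneg[of ?t] by (intro mult_right_mono) auto
  finally show "\<bar>\<psi> y\<bar> \<le> real n * Om ?t * ?t" .
  have "real (n - 1) * Om ?t * ?t \<le> real (n - 1) * 1 * ?t"
    using Om_le_1[of ?t] ye by (intro mult_right_mono mult_left_mono) auto
  from order_trans[OF 2 this] have "\<bar>\<psi> y\<bar> \<le> (real n - 1) * ?t" using n3 by (simp add: of_nat_diff)
  then show "enorm n (lift n \<psi> y) \<le> real n * ?t"
    using enorm_lift_le[OF ye(1)] by (simp add: left_diff_distrib)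
  show "?t \<le> enorm n (lift n \<psi> y)"
    by (rule power2_le_imp_le) (use lift_props(4)[of n y \<psi>] n3 ye in auto)
qed

lemma g_osc_le:
  assumes y: "y \<in> D0" "0 < enorm (n - 1) y"
  shows "\<bar>g (lift n \<psi> y) - g0\<bar> \<le> Og (enorm (n - 1) y)"
proof -
  let ?t = "8 * real n * enorm (n - 1) y"
  have t: "0 < ?t" using y n3 by simp
  have "enorm n (lift n \<psi> y) < ?t"
  proof -
    have "enorm n (lift n \<psi> y) \<le> real n * enorm (n - 1) y" by (rule lift_bounds[OF y])
    also have "\<dots> < ?t" using y n3 by simp
    finally show ?thesis .
  qed
  then have "lift n \<psi> y \<in> Gam n \<psi> \<inter> euc_ball n ?t" using small_D0[OF y(1)] by (simp add: euc_ball_def)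
  then have "fun_osc n g (lift n \<psi> y) \<le> (SUP x\<in>Gam n \<psi> \<inter> euc_ball n ?t. fun_osc n g x)"
  proof (rule cSUP_upper)
    show "bdd_above (fun_osc n g ` (Gam n \<psi> \<inter> euc_ball n ?t))"
      by (rule bdd_above_mono[of "fun_osc n g ` Gam n \<psi>"]) (use gD in \<open>auto simp: C0_Dini_def\<close>)
  qed
  then show ?thesis using t by (simp add: fun_osc_def g0_def Og_def \<omega>g_def omega_fun_def sup_modulus_def)
qed

lemma theta_le:
  assumes y: "y \<in> D0"
  shows "\<theta> y \<le> 1 + cdens" "\<theta> y - 1 \<le> cdens * Om (enorm (n - 1) y)" "0 \<le> \<theta> y - 1"
proof -
  show 1: "\<theta> y - 1 \<le> cdens * Om (enorm (n - 1) y)" using theta(3)[of y] by (simp add: Om_def)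
  have "cdens * Om (enorm (n - 1) y) \<le> cdens * 1"
    using Om_le_1[of "enorm (n - 1) y"] small_D0(2)[OF y] cdens_nonneg by (intro mult_left_mono) auto
  then show "\<theta> y \<le> 1 + cdens" using 1 by simp
  show "0 \<le> \<theta> y - 1" using theta(2)[of y] by simp
qed

text \<open>Let T be the lifted point and F its shadow on the hyperplane. Then \<theta> g f(T) -
  g(0) f(F) = (\<theta> g - g(0)) f(T) + g(0) (f(T) - f(F)). The first term is controlled by the
  moduli of g and of the density, the second by the small vertical shift.\<close>

lemma Jint_bound:
  assumes y: "y \<in> D0" "0 < enorm (n - 1) y"
  shows "\<bar>Jint f y\<bar> \<le> (1 + cdens) * (Og (enorm (n - 1) y) + \<bar>g0\<bar> * Om (enorm (n - 1) y)) * \<bar>f (lift n \<psi> y)\<bar>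
     + \<bar>g0\<bar> * \<bar>f (lift n \<psi> y) - f (y(n := 0))\<bar>"
proof -
  let ?t = "enorm (n - 1) y" and ?T = "lift n \<psi> y"
  have "\<theta> y * g ?T - g0 = \<theta> y * (g ?T - g0) + g0 * (\<theta> y - 1)" by (simp add: algebra_simps)
  then have "\<bar>\<theta> y * g ?T - g0\<bar> \<le> \<bar>\<theta> y * (g ?T - g0)\<bar> + \<bar>g0 * (\<theta> y - 1)\<bar>" by simp
  also have "\<dots> = \<theta> y * \<bar>g ?T - g0\<bar> + \<bar>g0\<bar> * (\<theta> y - 1)"
    using theta_le(3)[OF y(1)] by (simp add: abs_mult)
  also have "\<dots> \<le> (1 + cdens) * Og ?t + \<bar>g0\<bar> * (cdens * Om ?t)"
    using theta_le[OF y(1)] g_osc_le[OF y] by (intro add_mono mult_mono) (auto simp: cdens_nonneg)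
  also have "\<dots> \<le> (1 + cdens) * (Og ?t + \<bar>g0\<bar> * Om ?t)"
    using Om_nonneg[of ?t] by (simp add: algebra_simps)
  finally have 1: "\<bar>\<theta> y * g ?T - g0\<bar> \<le> (1 + cdens) * (Og ?t + \<bar>g0\<bar> * Om ?t)" .
  have "Jint f y = (\<theta> y * g ?T - g0) * f ?T + g0 * (f ?T - f (y(n := 0)))"
    using y by (simp add: Jint_def algebra_simps)
  then have "\<bar>Jint f y\<bar> \<le> \<bar>\<theta> y * g ?T - g0\<bar> * \<bar>f ?T\<bar> + \<bar>g0\<bar> * \<bar>f ?T - f (y(n := 0))\<bar>"
    by (simp add: abs_mult[symmetric])
  also have "\<dots> \<le> (1 + cdens) * (Og ?t + \<bar>g0\<bar> * Om ?t) * \<bar>f ?T\<bar> + \<bar>g0\<bar> * \<bar>f ?T - f (y(n := 0))\<bar>"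
    by (intro add_right_mono mult_right_mono 1) auto
  finally show ?thesis .
qed

lemma Jint_zero:
  assumes "y \<in> euc (n - 1)" "y \<notin> D0" "\<And>x. x \<in> euc n \<Longrightarrow> r0 \<le> enorm n x \<Longrightarrow> f x = 0"
  shows "Jint f y = 0"
proof -
  have "r0 \<le> enorm (n - 1) y" using assms by (simp add: D0_def euc_ball_def)
  then have "f (y(n := 0)) = 0" using flat_props[OF assms(1)] by (intro assms(3)) auto
  then show ?thesis using assms by (simp add: Jint_def)
qed

lemma shift_split:
  assumes y: "y \<in> euc (n - 1)"
  shows "(enorm n (\<lambda>j. lift n \<psi> y j - x j))\<^sup>2 = (enorm (n - 1) (\<lambda>j. y j - x j))\<^sup>2 + (\<psi> y - x n)\<^sup>2"
    "(enorm n (\<lambda>j. (y(n := 0)) j - x j))\<^sup>2 = (enorm (n - 1) (\<lambda>j. y j - x j))\<^sup>2 + (0 - x n)\<^sup>2"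
proof -
  have n2: "n \<ge> 2" using n3 by simp
  have "enorm (n - 1) (\<lambda>j. lift n \<psi> y j - x j) = enorm (n - 1) (\<lambda>j. y j - x j)"
    by (rule enorm_cong) (use n3 in \<open>auto simp: lift_def\<close>)
  then show "(enorm n (\<lambda>j. lift n \<psi> y j - x j))\<^sup>2 = (enorm (n - 1) (\<lambda>j. y j - x j))\<^sup>2 + (\<psi> y - x n)\<^sup>2"
    using enorm_split[OF n2, of "\<lambda>j. lift n \<psi> y j - x j"] lift_props(3)[OF n2 y, of \<psi>] by (simp only:)
  have "enorm (n - 1) (\<lambda>j. (y(n := 0)) j - x j) = enorm (n - 1) (\<lambda>j. y j - x j)"
    by (rule enorm_cong) (use n3 in auto)
  then show "(enorm n (\<lambda>j. (y(n := 0)) j - x j))\<^sup>2 = (enorm (n - 1) (\<lambda>j. y j - x j))\<^sup>2 + (0 - x n)\<^sup>2"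
    using enorm_split[OF n2, of "\<lambda>j. (y(n := 0)) j - x j"] by (simp only: fun_upd_same)
qed

text \<open>The cut-off equals 1 at the lifted point and at its shadow, so the two kernel values lie
  on one vertical line, where \<open>bub_vertical\<close> applies with the shift |\<psi>(y)| \<le> n
  Om(\<tau>) \<tau>.\<close>

lemma Jint_ker_near:
  assumes e: "0 < e" and y: "y \<in> D0" "0 < enorm (n - 1) y" "enorm (n - 1) y < \<tau>" and \<tau>: "real n * \<tau> \<le> \<rho>"
    and w: "0 < enorm (n - 1) (\<lambda>j. y j - x j)"
  shows "\<bar>Jint (ker n \<rho> e x) y\<bar> \<le> (1 + cdens) * (Og \<tau> + \<bar>g0\<bar> * Om \<tau>) * (1 / enorm (n - 1) (\<lambda>j. y j - x j) ^ (n - 2))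
    + \<bar>g0\<bar> * real n * sqrt (real n * Om \<tau> * \<tau>) * (1 / sqrt (enorm (n - 1) (\<lambda>j. y j - x j)) / enorm (n - 1) (\<lambda>j. y j - x j) ^ (n - 2))"
proof -
  let ?t = "enorm (n - 1) y" and ?T = "lift n \<psi> y" and ?F = "y(n := 0)"
  let ?w = "enorm (n - 1) (\<lambda>j. y j - x j)"
  have ye: "y \<in> euc (n - 1)" using small_D0[OF y(1)] by auto
  have "enorm n ?T \<le> real n * ?t" by (rule lift_bounds[OF y(1,2)])
  also have "\<dots> \<le> real n * \<tau>" using y by (intro mult_left_mono) auto
  finally have T: "enorm n ?T \<le> \<rho>" using \<tau> by simp
  have "?t \<le> real n * ?t" using n3 y mult_right_mono[of 1 "real n" ?t] by simp
  also have "\<dots> \<le> real n * \<tau>" using y by (intro mult_left_mono) auto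
  finally have F: "enorm n ?F \<le> \<rho>" using \<tau> flat_props[OF ye] by simp
  have kT: "ker n \<rho> e x ?T = bub n e 0 (?w\<^sup>2 + (\<psi> y - x n)\<^sup>2)"
    using T cutoff_0_eq_1[OF rho(1) _ T] shift_split(1)[OF ye] by (simp add: ker_def)
  have "cutoff \<rho> 0 ((enorm n ?F)\<^sup>2) = 1" by (rule cutoff_0_eq_1[OF rho(1) _ F]) simp
  then have kF: "ker n \<rho> e x ?F = bub n e 0 (?w\<^sup>2 + (0 - x n)\<^sup>2)"
    unfolding ker_def shift_split(2)[OF ye] by simp
  have b1: "\<bar>ker n \<rho> e x ?T\<bar> \<le> 1 / ?w ^ (n - 2)"
  proof -
    have "?w \<le> sqrt (?w\<^sup>2 + (\<psi> y - x n)\<^sup>2)" by (simp add: real_le_rsqrt)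
    from bub_le[OF _ w this e, of n 0] n3 show ?thesis unfolding kT by simp
  qed
  have psi: "\<bar>\<psi> y\<bar> \<le> real n * Om \<tau> * \<tau>"
  proof -
    have "\<bar>\<psi> y\<bar> \<le> real n * Om ?t * ?t" by (rule lift_bounds[OF y(1,2)])
    also have "\<dots> \<le> real n * Om \<tau> * \<tau>"
      using y Om_mono[of ?t \<tau>] Om_nonneg[of ?t] Om_nonneg[of \<tau>] by (intro mult_mono) auto
    finally show ?thesis .
  qed
  have "\<bar>ker n \<rho> e x ?T - ker n \<rho> e x ?F\<bar> \<le> real n * sqrt (\<bar>(\<psi> y - x n) - (0 - x n)\<bar> / ?w) / ?w ^ (n - 2)"
    unfolding kT kF by (rule bub_vertical[OF n3 e w])
  also have "\<dots> \<le> real n * sqrt ((real n * Om \<tau> * \<tau>) / ?w) / ?w ^ (n - 2)"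
    using psi w by (intro divide_right_mono mult_left_mono real_sqrt_le_mono) auto
  also have "\<dots> = real n * sqrt (real n * Om \<tau> * \<tau>) * (1 / sqrt ?w / ?w ^ (n - 2))"
    by (simp add: real_sqrt_divide)
  finally have b2: "\<bar>ker n \<rho> e x ?T - ker n \<rho> e x ?F\<bar> \<le> real n * sqrt (real n * Om \<tau> * \<tau>) * (1 / sqrt ?w / ?w ^ (n - 2))" .
  have "(1 + cdens) * (Og ?t + \<bar>g0\<bar> * Om ?t) * \<bar>ker n \<rho> e x ?T\<bar> \<le> (1 + cdens) * (Og \<tau> + \<bar>g0\<bar> * Om \<tau>) * (1 / ?w ^ (n - 2))"
    using cdens_nonneg y Og_mono[of ?t \<tau>] Om_mono[of ?t \<tau>] Og_nonneg[of ?t] Om_nonneg[of ?t] Og_nonneg[of \<tau>] Om_nonneg[of \<tau>] b1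
    by (intro mult_mono add_mono mult_left_mono) (auto intro!: mult_nonneg_nonneg add_nonneg_nonneg)
  moreover have "\<bar>g0\<bar> * \<bar>ker n \<rho> e x ?T - ker n \<rho> e x ?F\<bar> \<le> \<bar>g0\<bar> * (real n * sqrt (real n * Om \<tau> * \<tau>) * (1 / sqrt ?w / ?w ^ (n - 2)))"
    by (intro mult_left_mono b2) auto
  ultimately show ?thesis using Jint_bound[OF y(1,2), of "ker n \<rho> e x"] by (simp only: mult.assoc)
qed

text \<open>The derivative of \<open>ker\<close> in \<open>x i\<close> at x = 0.\<close>

definition kP :: "real \<Rightarrow> nat \<Rightarrow> vec \<Rightarrow> real" where
  "kP e i y = cutoff \<rho> 0 ((enorm n y)\<^sup>2) * ((real n - 2) * y i * bub n e 1 ((enorm n y)\<^sup>2))"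

lemma kP_continuous: "0 < e \<Longrightarrow> continuous_on (euc n) (kP e i)"
  unfolding kP_def[abs_def] by (intro continuous_intros cutoff_continuous bub_continuous0)

lemma kP_zero: "r0 \<le> enorm n y \<Longrightarrow> kP e i y = 0"
  using cutoff_0_eq_0[OF rho(1), of "enorm n y"] rho(2) by (simp add: kP_def)

lemma coord_bub1_le:
  assumes e: "0 < e" and i: "i \<in> {1..n}" and t: "0 < t" "t \<le> enorm n z"
  shows "\<bar>z i\<bar> * bub n e 1 ((enorm n z)\<^sup>2) \<le> 1 / t ^ (n - 1)"
proof -
  have zp: "0 < enorm n z" using t by simp
  have "bub n e 1 ((enorm n z)\<^sup>2) \<le> 1 / enorm n z ^ (n - 2 + 2 * 1)"
    by (rule bub_le[OF _ zp order_refl e]) (use n3 in simp)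
  then have "\<bar>z i\<bar> * bub n e 1 ((enorm n z)\<^sup>2) \<le> enorm n z * (1 / enorm n z ^ (n - 2 + 2 * 1))"
    using abs_coord_le_enorm[OF i, of z] by (intro mult_mono) auto
  also have "n - 2 + 2 * 1 = Suc (n - 1)" using n3 by simp
  also have "enorm n z * (1 / enorm n z ^ Suc (n - 1)) = 1 / enorm n z ^ (n - 1)" using zp by simp
  also have "\<dots> \<le> 1 / t ^ (n - 1)" using t by (intro divide_left_mono power_mono) auto
  finally show ?thesis .
qed

definition K3 :: real where "K3 = real n * (8 * chiB + 1 + real n)"

text \<open>Mean value theorem on the vertical line through y. At the origin the full Lipschitz
  bound can be afforded in place of the interpolation of \<open>bub_vertical\<close>: the shift
  |\<psi>(y)| is at most n Om(|y|) |y|, which lowers the power n to n - 1 and leaves the modulus as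
  a factor.\<close>

lemma kP_vertical:
  assumes e: "0 < e" and i: "i \<in> {1..n}" and y: "y \<in> euc (n - 1)" "0 < enorm (n - 1) y"
  shows "\<bar>kP e i (y(n := a)) - kP e i (y(n := b))\<bar> \<le> K3 / enorm (n - 1) y ^ n * \<bar>a - b\<bar>"
proof -
  have n2: "n \<ge> 2" using n3 by simp
  let ?t = "enorm (n - 1) y"
  define s where "s t = ?t\<^sup>2 + t\<^sup>2" for t
  define z where "z t = (if i = n then t else y i)" for t
  define z' :: real where "z' = (if i = n then 1 else 0)"
  have nrm: "(enorm n (y(n := t)))\<^sup>2 = s t" for t
  proof -
    have "enorm (n - 1) (y(n := t)) = ?t" by (rule enorm_cong) (use n3 in auto)
    then show ?thesis using enorm_split[OF n2, of "y(n := t)"] by (simp only: fun_upd_same s_def)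
  qed
  have zi: "(y(n := t)) i = z t" for t by (simp add: z_def)
  have kP: "kP e i (y(n := t)) = cutoff \<rho> 0 (s t) * ((real n - 2) * z t * bub n e 1 (s t))" for t
    unfolding kP_def nrm zi ..
  have s0: "?t\<^sup>2 \<le> s t" "0 < s t" for t using y by (auto simp: s_def intro: add_pos_nonneg)
  have ds: "(s has_real_derivative 2 * t) (at t)" for t unfolding s_def by (auto intro!: derivative_eq_intros)
  have dz: "(z has_real_derivative z') (at t)" for t unfolding z_def z'_def by (cases "i = n") auto
  have zs: "\<bar>t\<bar> * \<bar>z t\<bar> \<le> s t" for t
  proof -
    have "\<bar>z t\<bar>\<^sup>2 \<le> s t"
    proof -
      have "\<bar>(y(n := t)) i\<bar>\<^sup>2 \<le> (enorm n (y(n := t)))\<^sup>2" by (intro power_mono abs_coord_le_enorm i) auto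
      then show ?thesis unfolding nrm zi .
    qed
    moreover have "\<bar>t\<bar>\<^sup>2 \<le> s t" by (simp add: s_def)
    moreover have "2 * (\<bar>t\<bar> * \<bar>z t\<bar>) \<le> \<bar>t\<bar>\<^sup>2 + \<bar>z t\<bar>\<^sup>2" using sum_squares_bound[of "\<bar>t\<bar>" "\<bar>z t\<bar>"] by simp
    ultimately show ?thesis by linarith
  qed
  define D where "D t = (cutoff \<rho> (Suc 0) (s t) * (2 * t)) * (z t * bub n e 1 (s t))
     + (z' * bub n e 1 (s t) + (- bexp n 1 * bub n e (Suc 1) (s t) * (2 * t)) * z t) * cutoff \<rho> 0 (s t)" for t
  have dk: "((\<lambda>t. cutoff \<rho> 0 (s t) * (z t * bub n e 1 (s t))) has_real_derivative D t) (at t)" for t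
  proof -
    have "s t > - e" using s0(2)[of t] e by linarith
    then have db: "((\<lambda>t. bub n e 1 (s t)) has_real_derivative - bexp n 1 * bub n e (Suc 1) (s t) * (2 * t)) (at t)"
      unfolding bexp_def by (rule DERIV_chain2[OF bub_deriv ds])
    show ?thesis unfolding D_def
      by (rule DERIV_mult[OF DERIV_chain2[OF cutoff_deriv[OF rho(1)] ds] DERIV_mult[OF dz db]])
  qed
  have bnd: "\<bar>D t\<bar> \<le> (8 * chiB + 1 + real n) / ?t ^ n" for t
  proof -
    have b1: "bub n e 1 (s t) \<le> 1 / ?t ^ n"
    proof -
      have "?t \<le> sqrt (s t)" using s0(1)[of t] by (simp add: real_le_rsqrt)
      from bub_le[OF n2 y(2) this e, of 1] have "bub n e 1 (s t) \<le> 1 / ?t ^ (n - 2 + 2 * 1)"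
        using s0(2)[of t] by simp
      moreover have "n - 2 + 2 * 1 = n" using n2 by simp
      ultimately show ?thesis by (simp only:)
    qed
    have "\<bar>(cutoff \<rho> (Suc 0) (s t) * (2 * t)) * (z t * bub n e 1 (s t))\<bar> = 2 * (\<bar>cutoff \<rho> 1 (s t)\<bar> * (\<bar>t\<bar> * \<bar>z t\<bar>)) * bub n e 1 (s t)"
      by (simp add: abs_mult One_nat_def)
    also have "\<dots> \<le> 2 * (\<bar>cutoff \<rho> 1 (s t)\<bar> * s t) * bub n e 1 (s t)"
      by (intro mult_right_mono mult_left_mono zs) auto
    also have "\<dots> \<le> 2 * (4 * chiB) * bub n e 1 (s t)"
      using s0(2)[of t] by (intro mult_right_mono mult_left_mono cutoff_1_mult_le rho) auto
    finally have 1: "\<bar>(cutoff \<rho> (Suc 0) (s t) * (2 * t)) * (z t * bub n e 1 (s t))\<bar> \<le> 8 * chiB * bub n e 1 (s t)" by simp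
    have "\<bar>(- bexp n 1 * bub n e (Suc 1) (s t) * (2 * t)) * z t\<bar> = 2 * bexp n 1 * (bub n e (Suc 1) (s t) * (\<bar>t\<bar> * \<bar>z t\<bar>))"
      using bexp_nonneg[OF n2, of 1] by (simp add: abs_mult)
    also have "\<dots> \<le> 2 * bexp n 1 * (bub n e (Suc 1) (s t) * s t)"
      using bexp_nonneg[OF n2, of 1] by (intro mult_left_mono zs) auto
    also have "\<dots> \<le> 2 * bexp n 1 * bub n e 1 (s t)"
      using bexp_nonneg[OF n2, of 1] s0(2)[of t] by (intro mult_left_mono bub_Suc_mult_le e) auto
    also have "2 * bexp n 1 = real n" by (simp add: bexp_def)
    finally have 2: "\<bar>(- bexp n 1 * bub n e (Suc 1) (s t) * (2 * t)) * z t\<bar> \<le> real n * bub n e 1 (s t)" .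
    have 3: "\<bar>z' * bub n e 1 (s t)\<bar> \<le> 1 * bub n e 1 (s t)" by (auto simp: z'_def)
    have "\<bar>z' * bub n e 1 (s t) + (- bexp n 1 * bub n e (Suc 1) (s t) * (2 * t)) * z t\<bar> \<le> (1 + real n) * bub n e 1 (s t)"
      using 2 3 by (simp only: distrib_right)
    then have "\<bar>(z' * bub n e 1 (s t) + (- bexp n 1 * bub n e (Suc 1) (s t) * (2 * t)) * z t) * cutoff \<rho> 0 (s t)\<bar> \<le> ((1 + real n) * bub n e 1 (s t)) * 1"
      unfolding abs_mult by (intro mult_mono) (auto simp: cutoff_01)
    then have "\<bar>D t\<bar> \<le> (8 * chiB + 1 + real n) * bub n e 1 (s t)"
      using 1 unfolding D_def by (simp only: distrib_right)
    also have "\<dots> \<le> (8 * chiB + 1 + real n) * (1 / ?t ^ n)" using b1 chiB_nonneg by (intro mult_left_mono) auto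
    finally show ?thesis by simp
  qed
  have "norm (cutoff \<rho> 0 (s a) * (z a * bub n e 1 (s a)) - cutoff \<rho> 0 (s b) * (z b * bub n e 1 (s b))) \<le> (8 * chiB + 1 + real n) / ?t ^ n * norm (a - b)"
    by (rule field_differentiable_bound[of UNIV "\<lambda>t. cutoff \<rho> 0 (s t) * (z t * bub n e 1 (s t))" D])
       (use dk bnd in auto)
  then have 1: "\<bar>cutoff \<rho> 0 (s a) * (z a * bub n e 1 (s a)) - cutoff \<rho> 0 (s b) * (z b * bub n e 1 (s b))\<bar> \<le> (8 * chiB + 1 + real n) / ?t ^ n * \<bar>a - b\<bar>"
    by simp
  have "kP e i (y(n := a)) - kP e i (y(n := b)) = (real n - 2) * (cutoff \<rho> 0 (s a) * (z a * bub n e 1 (s a)) - cutoff \<rho> 0 (s b) * (z b * bub n e 1 (s b)))"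
    unfolding kP by (simp add: algebra_simps)
  then have "\<bar>kP e i (y(n := a)) - kP e i (y(n := b))\<bar> = (real n - 2) * \<bar>cutoff \<rho> 0 (s a) * (z a * bub n e 1 (s a)) - cutoff \<rho> 0 (s b) * (z b * bub n e 1 (s b))\<bar>"
    using n3 by (simp add: abs_mult)
  also have "\<dots> \<le> real n * ((8 * chiB + 1 + real n) / ?t ^ n * \<bar>a - b\<bar>)"
    using n3 by (intro mult_mono 1) auto
  finally show ?thesis by (simp add: K3_def mult_ac)
qed

definition K2 :: real where "K2 = (1 + cdens) * real n + K3 * real n"

lemma K3_nonneg: "0 \<le> K3" using chiB_nonneg by (simp add: K3_def)
lemma K2_nonneg: "0 \<le> K2" using K3_nonneg cdens_nonneg by (simp add: K2_def)

text \<open>Here the Dini condition enters: both contributions have the size of a modulus divided by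
  |y|^(n-1), which on a base of dimension n - 1 integrates to the Dini integrals.\<close>

lemma Jint_kP:
  assumes e: "0 < e" and i: "i \<in> {1..n}" and y: "y \<in> D0" "0 < enorm (n - 1) y"
  shows "\<bar>Jint (kP e i) y\<bar> \<le> K2 * ((Og (enorm (n - 1) y) + \<bar>g0\<bar> * Om (enorm (n - 1) y)) / enorm (n - 1) y ^ (n - 1))"
proof -
  let ?t = "enorm (n - 1) y" and ?T = "lift n \<psi> y"
  have ye: "y \<in> euc (n - 1)" using small_D0[OF y(1)] by auto
  have W0: "0 \<le> Og ?t" "0 \<le> Om ?t" using Og_nonneg[of ?t] Om_nonneg[of ?t] by auto
  have k1: "\<bar>kP e i ?T\<bar> \<le> real n * (1 / ?t ^ (n - 1))"
  proof -
    have "\<bar>kP e i ?T\<bar> = cutoff \<rho> 0 ((enorm n ?T)\<^sup>2) * ((real n - 2) * (\<bar>?T i\<bar> * bub n e 1 ((enorm n ?T)\<^sup>2)))"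
      using n3 cutoff_01(1) by (simp add: kP_def abs_mult mult.assoc)
    also have "\<dots> \<le> 1 * (real n * (1 / ?t ^ (n - 1)))"
      using n3 cutoff_01 coord_bub1_le[OF e i y(2) lift_bounds(2)[OF y]] by (intro mult_mono) auto
    finally show ?thesis by simp
  qed
  have "\<bar>kP e i ?T - kP e i (y(n := 0))\<bar> \<le> K3 / ?t ^ n * \<bar>\<psi> y - 0\<bar>"
    unfolding lift_def by (rule kP_vertical[OF e i ye y(2)])
  also have "\<dots> \<le> K3 / ?t ^ n * (real n * Om ?t * ?t)"
    using lift_bounds(1)[OF y] K3_nonneg by (intro mult_left_mono) auto
  also have "\<dots> = K3 * real n * (Om ?t / ?t ^ (n - 1))"
  proof -
    have "?t ^ n = ?t * ?t ^ (n - 1)" using n3 by (metis One_nat_def Suc_pred less_le_trans power_Suc zero_less_numeral)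
    then show ?thesis using y(2) by simp
  qed
  finally have k2: "\<bar>kP e i ?T - kP e i (y(n := 0))\<bar> \<le> K3 * real n * (Om ?t / ?t ^ (n - 1))" .
  have "\<bar>Jint (kP e i) y\<bar> \<le> (1 + cdens) * (Og ?t + \<bar>g0\<bar> * Om ?t) * \<bar>kP e i ?T\<bar> + \<bar>g0\<bar> * \<bar>kP e i ?T - kP e i (y(n := 0))\<bar>"
    by (rule Jint_bound[OF y])
  also have "\<dots> \<le> (1 + cdens) * (Og ?t + \<bar>g0\<bar> * Om ?t) * (real n * (1 / ?t ^ (n - 1))) + \<bar>g0\<bar> * (K3 * real n * (Om ?t / ?t ^ (n - 1)))"
    using W0 cdens_nonneg by (intro add_mono mult_left_mono k1 k2) auto
  also have "\<dots> = (1 + cdens) * real n * ((Og ?t + \<bar>g0\<bar> * Om ?t) / ?t ^ (n - 1)) + K3 * real n * ((\<bar>g0\<bar> * Om ?t) / ?t ^ (n - 1))"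
    by (simp add: mult_ac)
  also have "\<dots> \<le> (1 + cdens) * real n * ((Og ?t + \<bar>g0\<bar> * Om ?t) / ?t ^ (n - 1)) + K3 * real n * ((Og ?t + \<bar>g0\<bar> * Om ?t) / ?t ^ (n - 1))"
    using W0 K3_nonneg by (intro add_left_mono mult_left_mono divide_right_mono) auto
  finally show ?thesis unfolding K2_def distrib_right[of "(1 + cdens) * real n" "K3 * real n"] .
qed

text \<open>What remains of \<open>ker\<close> after subtracting its first order Taylor polynomial
  in x about 0.\<close>

definition kF :: "real \<Rightarrow> vec \<Rightarrow> vec \<Rightarrow> real" where
  "kF e x z = ker n \<rho> e x z - ker n \<rho> e (\<lambda>_. 0) z - (\<Sum>i=1..n. x i * kP e i z)"

lemma kF_le:
  assumes e: "0 < e" and z: "2 * enorm n x \<le> t" "0 < t" "t \<le> enorm n z"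
  shows "\<bar>kF e x z\<bar> \<le> tayc n 0 * (enorm n x)\<^sup>2 / t ^ n"
proof -
  have n2: "n \<ge> 2" using n3 by simp
  have b: "2 * bexp n 0 = real n - 2" by (simp add: bexp_def)
  have "(\<Sum>i=1..n. x i * kP e i z) = cutoff \<rho> 0 ((enorm n z)\<^sup>2) * ((real n - 2) * einner n x z * bub n e 1 ((enorm n z)\<^sup>2))"
    by (simp add: kP_def einner_def sum_distrib_left sum_distrib_right mult_ac)
  then have "kF e x z = cutoff \<rho> 0 ((enorm n z)\<^sup>2) *
     (bub n e 0 ((enorm n (\<lambda>j. z j - x j))\<^sup>2) - bub n e 0 ((enorm n z)\<^sup>2) - 2 * bexp n 0 * einner n x z * bub n e (Suc 0) ((enorm n z)\<^sup>2))"
    unfolding b by (simp add: kF_def ker_def algebra_simps One_nat_def)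
  then have "\<bar>kF e x z\<bar> \<le> 1 * (tayc n 0 * (enorm n x)\<^sup>2 / enorm n z ^ (n + 2 * 0))"
    unfolding \<open>kF e x z = _\<close> abs_mult using z by (intro mult_mono bub_taylor n2 e) (auto simp: cutoff_01)
  also have "\<dots> \<le> tayc n 0 * (enorm n x)\<^sup>2 / t ^ n"
    using z tayc_nonneg[OF n2, of 0] by (auto intro!: divide_left_mono power_mono mult_pos_pos)
  finally show ?thesis .
qed

end

lemma nn_integral_le_lin2:
  fixes a b f :: "'a \<Rightarrow> real"
  assumes m: "a \<in> borel_measurable M" "b \<in> borel_measurable M"
    and nn: "\<And>x. 0 \<le> a x" "\<And>x. 0 \<le> b x" "0 \<le> P" "0 \<le> Q" "0 \<le> A" "0 \<le> B"
    and int: "(\<integral>\<^sup>+x. ennreal (a x) \<partial>M) \<le> ennreal A" "(\<integral>\<^sup>+x. ennreal (b x) \<partial>M) \<le> ennreal B"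
    and le: "AE x in M. f x \<le> P * a x + Q * b x"
  shows "(\<integral>\<^sup>+x. ennreal (f x) \<partial>M) \<le> ennreal (P * A + Q * B)"
proof -
  have "(\<integral>\<^sup>+x. ennreal (f x) \<partial>M) \<le> (\<integral>\<^sup>+x. ennreal P * ennreal (a x) + ennreal Q * ennreal (b x) \<partial>M)"
  proof (rule nn_integral_mono_AE)
    show "AE x in M. ennreal (f x) \<le> ennreal P * ennreal (a x) + ennreal Q * ennreal (b x)"
      using le
    proof eventually_elim
      case (elim x)
      have "ennreal P * ennreal (a x) + ennreal Q * ennreal (b x) = ennreal (P * a x + Q * b x)"
        using nn by (simp add: ennreal_mult)
      then show ?case using elim by (simp add: ennreal_leI)
    qed
  qed
  also have "\<dots> = ennreal P * (\<integral>\<^sup>+x. ennreal (a x) \<partial>M) + ennreal Q * (\<integral>\<^sup>+x. ennreal (b x) \<partial>M)"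
    using m by (simp add: nn_integral_add nn_integral_cmult)
  also have "\<dots> \<le> ennreal P * ennreal A + ennreal Q * ennreal B"
    by (intro add_mono mult_left_mono int) auto
  also have "\<dots> = ennreal (P * A + Q * B)" using nn by (simp add: ennreal_mult)
  finally show ?thesis .
qed

lemma integral_le_of_nn_integral:
  fixes f :: "'a \<Rightarrow> real"
  assumes "integrable M f" "\<And>x. 0 \<le> f x" "(\<integral>\<^sup>+x. ennreal (f x) \<partial>M) \<le> ennreal A" "0 \<le> A"
  shows "(\<integral>x. f x \<partial>M) \<le> A"
  using nn_integral_eq_integral[OF assms(1)] assms(2-4) by simp

lemma AE_enorm_shift:
  assumes n: "n \<ge> 2"
  shows "AE y in elebesgue (n - 1). 0 < enorm (n - 1) (\<lambda>j. y j - x j)"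
proof -
  have "(\<integral>\<^sup>+y. indicator {0} (enorm (n - 1) (\<lambda>i. y i - x i)) \<partial>elebesgue (n - 1)) =
         ennreal (sph n) * (\<integral>\<^sup>+s. indicator {0} s * ennreal (s ^ (n - 2)) * indicator {0<..} s \<partial>lborel)"
    by (rule radial_translate[OF n]) measurable
  also have "(\<integral>\<^sup>+s. indicator {0} s * ennreal (s ^ (n - 2)) * indicator {0<..} s \<partial>lborel) = (\<integral>\<^sup>+s. 0 \<partial>(lborel :: real measure))"
    by (intro nn_integral_cong) (auto simp: indicator_def)
  finally have "(\<integral>\<^sup>+y. indicator {0} (enorm (n - 1) (\<lambda>i. y i - x i)) \<partial>elebesgue (n - 1)) = 0" by simp
  then have "AE y in elebesgue (n - 1). indicator {0} (enorm (n - 1) (\<lambda>i. y i - x i)) = (0 :: ennreal)"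
    by (subst (asm) nn_integral_0_iff_AE) auto
  then show ?thesis
    by eventually_elim (auto simp: indicator_def less_le split: if_splits)
qed

context dini_problem
begin

lemma n2: "n \<ge> 2" using n3 by simp

definition K1 :: real where "K1 = sph n * (2 * (1 + cdens) + 4 * (real n)\<^sup>2)"

lemma tau_lt_r0: "real n * \<tau> \<le> \<rho> \<Longrightarrow> 0 < \<tau> \<Longrightarrow> \<tau> < r0"
proof -
  assume t: "real n * \<tau> \<le> \<rho>" "0 < \<tau>"
  have "\<tau> \<le> real n * \<tau>" using n3 t mult_right_mono[of 1 "real n" \<tau>] by simp
  then show ?thesis using t rho by linarith
qed

text \<open>For |x| \<le> \<tau> the ball of radius \<tau> about 0 lies in the ball of radius 2
  \<tau> about x, over which powers of the distance to x are integrated. The trivial singularity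
  gives a multiple of \<tau>; the one from the vertical shift gives sqrt(Om(\<tau>) \<tau>) times
  sqrt \<tau>, again \<tau> times a small factor.\<close>

lemma Jint_ker_near_integral:
  assumes e: "0 < e" and \<tau>: "0 < \<tau>" "real n * \<tau> \<le> \<rho>" and x: "enorm n x \<le> \<tau>"
  shows "(\<integral>\<^sup>+y. ennreal (indicator {..<\<tau>} (enorm (n - 1) y) * \<bar>Jint (ker n \<rho> e x) y\<bar>) \<partial>elebesgue (n - 1))
    \<le> ennreal (K1 * (\<tau> * (Og \<tau> + \<bar>g0\<bar> * sqrt (Om \<tau>))))"
proof -
  let ?w = "\<lambda>y. enorm (n - 1) (\<lambda>j. y j - x j)"
  have tr: "\<tau> < r0" by (rule tau_lt_r0[OF \<tau>(2,1)])
  have O: "0 \<le> Og \<tau>" "0 \<le> Om \<tau>" "Om \<tau> \<le> 1" using Og_nonneg Om_nonneg Om_le_1 \<tau> tr by auto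
  define P where "P = (1 + cdens) * (Og \<tau> + \<bar>g0\<bar> * Om \<tau>)"
  define Q where "Q = \<bar>g0\<bar> * real n * sqrt (real n * Om \<tau> * \<tau>)"
  have PQ: "0 \<le> P" "0 \<le> Q" using O cdens_nonneg \<tau> by (auto simp: P_def Q_def)
  have "(\<integral>\<^sup>+y. ennreal (indicator {..<\<tau>} (enorm (n - 1) y) * \<bar>Jint (ker n \<rho> e x) y\<bar>) \<partial>elebesgue (n - 1))
    \<le> ennreal (P * (sph n * (2 * \<tau>)) + Q * (sph n * (2 * sqrt (2 * \<tau>))))"
  proof (rule nn_integral_le_lin2[where a="\<lambda>y. indicator {..<2 * \<tau>} (?w y) / ?w y ^ (n - 2)"
        and b="\<lambda>y. indicator {..<2 * \<tau>} (?w y) * (1 / sqrt (?w y)) / ?w y ^ (n - 2)"])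
    show "(\<integral>\<^sup>+y. ennreal (indicator {..<2 * \<tau>} (?w y) / ?w y ^ (n - 2)) \<partial>elebesgue (n - 1)) \<le> ennreal (sph n * (2 * \<tau>))"
      by (rule radial_near[OF n2]) (use \<tau> in simp)
    show "(\<integral>\<^sup>+y. ennreal (indicator {..<2 * \<tau>} (?w y) * (1 / sqrt (?w y)) / ?w y ^ (n - 2)) \<partial>elebesgue (n - 1)) \<le> ennreal (sph n * (2 * sqrt (2 * \<tau>)))"
      by (rule radial_near_sqrt[OF n2]) (use \<tau> in simp)
    show "AE y in elebesgue (n - 1). indicator {..<\<tau>} (enorm (n - 1) y) * \<bar>Jint (ker n \<rho> e x) y\<bar> \<le>
       P * (indicator {..<2 * \<tau>} (?w y) / ?w y ^ (n - 2)) + Q * (indicator {..<2 * \<tau>} (?w y) * (1 / sqrt (?w y)) / ?w y ^ (n - 2))"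
      using AE_enorm_shift[OF n2, of x] AE_enorm_shift[OF n2, of "\<lambda>_. 0"] AE_space
    proof eventually_elim
      case (elim y)
      have nn: "0 \<le> P * (indicator {..<2 * \<tau>} (?w y) / ?w y ^ (n - 2)) + Q * (indicator {..<2 * \<tau>} (?w y) * (1 / sqrt (?w y)) / ?w y ^ (n - 2))"
        using PQ by (intro add_nonneg_nonneg mult_nonneg_nonneg) (auto simp: indicator_def)
      show ?case
      proof (cases "enorm (n - 1) y < \<tau>")
        case True
        have y: "y \<in> D0" "0 < enorm (n - 1) y" using True elim tr by (auto simp: D0_def euc_ball_def)
        have "?w y \<le> enorm (n - 1) y + enorm (n - 1) x"
          using enorm_triangle[of "n - 1" y "\<lambda>j. - x j"] enorm_minus[of "n - 1" x] by simp
        also have "\<dots> < 2 * \<tau>" using True x enorm_pred_le[OF n2, of x] by linarith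
        finally have w: "?w y < 2 * \<tau>" .
        show ?thesis
          using Jint_ker_near[OF e y True \<tau>(2) elim(1)] True w by (simp add: P_def Q_def)
      qed (use nn in simp)
    qed
  qed (use PQ \<tau> sph_pos[OF n2] in \<open>auto simp: indicator_def\<close>)
  also have "\<dots> \<le> ennreal (K1 * (\<tau> * (Og \<tau> + \<bar>g0\<bar> * sqrt (Om \<tau>))))"
  proof (rule ennreal_leI)
    \<comment> \<open>Since Om(\<tau>) \<le> 1, its square root dominates it and measures both
      contributions.\<close>
    have sq: "Om \<tau> \<le> sqrt (Om \<tau>)"
    proof -
      have "Om \<tau> = sqrt (Om \<tau>) * sqrt (Om \<tau>)" using O by simp
      also have "\<dots> \<le> 1 * sqrt (Om \<tau>)" using O by (intro mult_right_mono) auto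
      finally show ?thesis by simp
    qed
    let ?S = "Og \<tau> + \<bar>g0\<bar> * sqrt (Om \<tau>)"
    have 1: "P * (sph n * (2 * \<tau>)) \<le> sph n * (2 * (1 + cdens)) * (\<tau> * ?S)"
    proof -
      have "Og \<tau> + \<bar>g0\<bar> * Om \<tau> \<le> ?S" using sq by (intro add_left_mono mult_left_mono) auto
      then have "(1 + cdens) * (Og \<tau> + \<bar>g0\<bar> * Om \<tau>) * (sph n * (2 * \<tau>)) \<le> (1 + cdens) * ?S * (sph n * (2 * \<tau>))"
        using cdens_nonneg sph_pos[OF n2] \<tau> by (intro mult_right_mono mult_left_mono) auto
      also have "\<dots> = sph n * (2 * (1 + cdens)) * (\<tau> * ?S)" by (simp only: mult_ac)
      finally show ?thesis by (simp only: P_def)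
    qed
    have 2: "Q * (sph n * (2 * sqrt (2 * \<tau>))) \<le> sph n * (4 * (real n)\<^sup>2) * (\<tau> * ?S)"
    proof -
      have "sqrt (real n * Om \<tau> * \<tau>) * sqrt (2 * \<tau>) = sqrt (2 * real n) * sqrt (Om \<tau>) * \<tau>"
      proof -
        have "sqrt (real n * Om \<tau> * \<tau>) * sqrt (2 * \<tau>) = sqrt ((2 * real n) * Om \<tau> * \<tau>\<^sup>2)"
          unfolding real_sqrt_mult[symmetric] by (simp add: power2_eq_square mult_ac)
        then show ?thesis using \<tau> by (simp add: real_sqrt_mult)
      qed
      moreover have "sqrt (2 * real n) \<le> 2 * real n"
        by (rule real_le_lsqrt) (use n3 in \<open>auto simp: power2_eq_square\<close>)
      ultimately have "sqrt (real n * Om \<tau> * \<tau>) * sqrt (2 * \<tau>) \<le> 2 * real n * sqrt (Om \<tau>) * \<tau>"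
        using O \<tau> by (simp add: mult_right_mono)
      then have "(\<bar>g0\<bar> * real n * (2 * sph n)) * (sqrt (real n * Om \<tau> * \<tau>) * sqrt (2 * \<tau>)) \<le> (\<bar>g0\<bar> * real n * (2 * sph n)) * (2 * real n * sqrt (Om \<tau>) * \<tau>)"
        using sph_pos[OF n2] by (intro mult_left_mono) auto
      also have "\<dots> = sph n * (4 * (real n)\<^sup>2) * (\<tau> * (\<bar>g0\<bar> * sqrt (Om \<tau>)))" by (simp add: power2_eq_square mult_ac)
      also have "\<dots> \<le> sph n * (4 * (real n)\<^sup>2) * (\<tau> * ?S)"
        using sph_pos[OF n2] \<tau> O by (intro mult_left_mono) auto
      finally show ?thesis by (simp add: Q_def mult_ac)
    qed
    show "P * (sph n * (2 * \<tau>)) + Q * (sph n * (2 * sqrt (2 * \<tau>))) \<le> K1 * (\<tau> * ?S)"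
    proof -
      have "c * (a + b) * d = c * a * d + c * b * d" for a b c d :: real by (simp add: algebra_simps)
      then show ?thesis unfolding K1_def using add_mono[OF 1 2] by (simp only:)
    qed
  qed
  finally show ?thesis .
qed

lemma dini_measurable:
  assumes w: "dini w"
  shows "(\<lambda>y. indicator {0<..<\<tau>} (enorm (n - 1) y) * w (8 * real n * enorm (n - 1) y) / enorm (n - 1) y ^ (n - 1)) \<in> borel_measurable (elebesgue (n - 1))"
proof -
  have wc: "continuous_on {0..} w" using w by (simp add: dini_def)
  have "continuous_on (euc (n - 1)) (\<lambda>y. 8 * real n * enorm (n - 1) y)" by (intro continuous_intros)
  then have "continuous_on (euc (n - 1)) (\<lambda>y. w (8 * real n * enorm (n - 1) y))"
    by (rule continuous_on_compose2[OF wc]) (simp add: image_subset_iff)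
  from continuous_measurable_euc[OF this]
  have m: "(\<lambda>y. w (8 * real n * enorm (n - 1) y)) \<in> borel_measurable (elebesgue (n - 1))" .
  have "(\<lambda>t :: real. indicator {0<..<\<tau>} t :: real) \<in> borel_measurable borel" by simp
  from measurable_compose[OF enorm_measurable this]
  have i: "(\<lambda>y. indicator {0<..<\<tau>} (enorm (n - 1) y) :: real) \<in> borel_measurable (elebesgue (n - 1))" .
  show ?thesis by (intro borel_measurable_divide borel_measurable_times borel_measurable_power i m enorm_measurable)
qed

lemma Jint_kP_integral:
  assumes e: "0 < e" and i: "i \<in> {1..n}" and \<tau>: "0 < \<tau>" "\<tau> \<le> r0"
  shows "(\<integral>\<^sup>+y. ennreal (indicator {..<\<tau>} (enorm (n - 1) y) * \<bar>Jint (kP e i) y\<bar>) \<partial>elebesgue (n - 1))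
    \<le> ennreal (K2 * sph n * (dint \<omega>g (8 * real n * \<tau>) + \<bar>g0\<bar> * dint \<omega> (8 * real n * \<tau>)))"
proof -
  let ?t = "\<lambda>y. enorm (n - 1) y"
  let ?a = "\<lambda>w y. indicator {0<..<\<tau>} (?t y) * w (8 * real n * ?t y) / ?t y ^ (n - 1)"
  have N: "0 < 8 * real n" using n3 by simp
  have "(\<integral>\<^sup>+y. ennreal (indicator {..<\<tau>} (enorm (n - 1) y) * \<bar>Jint (kP e i) y\<bar>) \<partial>elebesgue (n - 1))
    \<le> ennreal (K2 * (sph n * dint \<omega>g (8 * real n * \<tau>)) + (K2 * \<bar>g0\<bar>) * (sph n * dint \<omega> (8 * real n * \<tau>)))"
  proof (rule nn_integral_le_lin2[where a="?a \<omega>g" and b="?a \<omega>"])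
    show "?a \<omega>g \<in> borel_measurable (elebesgue (n - 1))" "?a \<omega> \<in> borel_measurable (elebesgue (n - 1))"
      by (intro dini_measurable dini_wg dini_w)+
    show "(\<integral>\<^sup>+y. ennreal (?a \<omega>g y) \<partial>elebesgue (n - 1)) \<le> ennreal (sph n * dint \<omega>g (8 * real n * \<tau>))"
      by (rule radial_dini[OF n2 dini_wg N])
    show "(\<integral>\<^sup>+y. ennreal (?a \<omega> y) \<partial>elebesgue (n - 1)) \<le> ennreal (sph n * dint \<omega> (8 * real n * \<tau>))"
      by (rule radial_dini[OF n2 dini_w N])
    show "0 \<le> ?a \<omega>g y" "0 \<le> ?a \<omega> y" for y
      using dini_nonneg[OF dini_wg, of "8 * real n * ?t y"] dini_nonneg[OF dini_w, of "8 * real n * ?t y"] by (auto simp: indicator_def)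
    show "AE y in elebesgue (n - 1). indicator {..<\<tau>} (?t y) * \<bar>Jint (kP e i) y\<bar> \<le> K2 * ?a \<omega>g y + (K2 * \<bar>g0\<bar>) * ?a \<omega> y"
      using AE_enorm_shift[OF n2, of "\<lambda>_. 0"] AE_space
    proof eventually_elim
      case (elim y)
      show ?case
      proof (cases "?t y < \<tau>")
        case True
        have y: "y \<in> D0" "0 < enorm (n - 1) y" using True elim \<tau> by (auto simp: D0_def euc_ball_def)
        show ?thesis using Jint_kP[OF e i y] True y(2)
          by (simp add: Og_def Om_def add_divide_distrib distrib_left mult_ac)
      next
        case False
        then show ?thesis by simp
      qed
    qed
  qed (use K2_nonneg sph_pos[OF n2] dint_nonneg[OF dini_wg] dint_nonneg[OF dini_w] in auto)
  also have "K2 * (sph n * dint \<omega>g (8 * real n * \<tau>)) + (K2 * \<bar>g0\<bar>) * (sph n * dint \<omega> (8 * real n * \<tau>))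
    = K2 * sph n * (dint \<omega>g (8 * real n * \<tau>) + \<bar>g0\<bar> * dint \<omega> (8 * real n * \<tau>))" by (simp add: algebra_simps)
  finally show ?thesis .
qed

lemma kF_zero: "r0 \<le> enorm n z \<Longrightarrow> kF e x z = 0"
  by (simp add: kF_def ker_zero' kP_zero)

lemma kF_continuous: "0 < e \<Longrightarrow> continuous_on (euc n) (kF e x)"
  unfolding kF_def[abs_def] by (intro continuous_intros ker_continuous kP_continuous)

lemma Jint_kF_eq:
  "Jint (kF e x) y = Jint (ker n \<rho> e x) y - Jint (ker n \<rho> e (\<lambda>_. 0)) y - (\<Sum>i=1..n. x i * Jint (kP e i) y)"
proof -
  have "(\<Sum>i=1..n. x i * Jint (kP e i) y) = indicator D0 y * \<theta> y * (g (lift n \<psi> y) * (\<Sum>i=1..n. x i * kP e i (lift n \<psi> y)))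
     - g0 * (\<Sum>i=1..n. x i * kP e i (y(n := 0)))"
    by (simp add: Jint_def right_diff_distrib sum_subtractf sum_distrib_left mult_ac)
  then show ?thesis by (simp add: Jint_def kF_def algebra_simps)
qed

definition K4 :: real where "K4 = (2 + cdens) * tayc n 0 * sph n"

text \<open>Far from 0 the two surface integrals are bounded separately, with |g| \<le> |g(0)| +
  \<omega>g(1) because 8n|y| \<le> R \<le> 1 on the chart. The decay |y|^(-n) integrates to
  1/\<tau>, and with |x|^2 in front this gains the factor |x|/\<tau> over a linear term.\<close>

lemma Jint_kF_far_integral:
  assumes e: "0 < e" and \<tau>: "0 < \<tau>" and x: "2 * enorm n x \<le> \<tau>"
  shows "(\<integral>\<^sup>+y. ennreal (indicator {\<tau>..} (enorm (n - 1) y) * \<bar>Jint (kF e x) y\<bar>) \<partial>elebesgue (n - 1))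
    \<le> ennreal (K4 * ((\<bar>g0\<bar> + \<omega>g 1) * (enorm n x)\<^sup>2 / \<tau>))"
proof -
  let ?t = "\<lambda>y. enorm (n - 1) y"
  define P where "P = (2 + cdens) * (\<bar>g0\<bar> + \<omega>g 1) * (tayc n 0 * (enorm n x)\<^sup>2)"
  have wg1: "0 \<le> \<omega>g 1" by (rule dini_nonneg[OF dini_wg]) simp
  have P0: "0 \<le> P" using wg1 cdens_nonneg tayc_nonneg[OF n2, of 0] by (simp add: P_def)
  have "(\<integral>\<^sup>+y. ennreal (indicator {\<tau>..} (enorm (n - 1) y) * \<bar>Jint (kF e x) y\<bar>) \<partial>elebesgue (n - 1))
    \<le> ennreal (P * (sph n / \<tau>) + 0 * 0)"
  proof (rule nn_integral_le_lin2[where a="\<lambda>y. indicator {\<tau>..} (?t y) / ?t y ^ n" and b="\<lambda>_. 0"])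
    show "(\<integral>\<^sup>+y. ennreal (indicator {\<tau>..} (?t y) / ?t y ^ n) \<partial>elebesgue (n - 1)) \<le> ennreal (sph n / \<tau>)"
      by (rule radial_far[OF n2 \<tau>])
    show "AE y in elebesgue (n - 1). indicator {\<tau>..} (?t y) * \<bar>Jint (kF e x) y\<bar> \<le> P * (indicator {\<tau>..} (?t y) / ?t y ^ n) + 0 * 0"
    proof (rule AE_I2)
      fix y assume "y \<in> space (elebesgue (n - 1))"
      then have ye: "y \<in> euc (n - 1)" by simp
      show "indicator {\<tau>..} (?t y) * \<bar>Jint (kF e x) y\<bar> \<le> P * (indicator {\<tau>..} (?t y) / ?t y ^ n) + 0 * 0"
      proof (cases "\<tau> \<le> ?t y")
        case True
        have t0: "0 < ?t y" using True \<tau> by simp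
        have "\<bar>Jint (kF e x) y\<bar> \<le> P * (1 / ?t y ^ n)"
        proof (cases "y \<in> D0")
          case D: True
          let ?B = "tayc n 0 * (enorm n x)\<^sup>2 / ?t y ^ n"
          have B0: "0 \<le> ?B" using tayc_nonneg[OF n2, of 0] by simp
          have xt: "2 * enorm n x \<le> ?t y" using x True by simp
          have f1: "\<bar>kF e x (lift n \<psi> y)\<bar> \<le> ?B" by (rule kF_le[OF e xt t0 lift_bounds(2)[OF D t0]])
          have f2: "\<bar>kF e x (y(n := 0))\<bar> \<le> ?B" by (rule kF_le[OF e xt t0]) (use flat_props[OF ye] in simp)
          have gb: "\<bar>g (lift n \<psi> y)\<bar> \<le> \<bar>g0\<bar> + \<omega>g 1"
          proof -
            have "8 * real n * ?t y \<le> 8 * real n * r0" using small_D0(2)[OF D] by (intro mult_left_mono) auto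
            also have "\<dots> \<le> 1" using R n3 by (simp add: r0_def)
            finally have "Og (?t y) \<le> \<omega>g 1" unfolding Og_def by (intro dini_mono[OF dini_wg]) auto
            then show ?thesis using g_osc_le[OF D t0] by linarith
          qed
          have "\<bar>Jint (kF e x) y\<bar> \<le> \<bar>\<theta> y * (g (lift n \<psi> y) * kF e x (lift n \<psi> y))\<bar> + \<bar>g0 * kF e x (y(n := 0))\<bar>"
            using D by (simp add: Jint_def)
          also have "\<dots> \<le> (1 + cdens) * ((\<bar>g0\<bar> + \<omega>g 1) * ?B) + (\<bar>g0\<bar> + \<omega>g 1) * ?B"
            unfolding abs_mult using theta_le[OF D] gb f1 f2 B0 wg1 cdens_nonneg
            by (intro add_mono mult_mono) auto
          also have "\<dots> = P * (1 / ?t y ^ n)"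
          proof -
            have "(1 + a) * (b * (c / d)) + b * (c / d) = (2 + a) * b * c * (1 / d)" for a b c d :: real
              by (simp add: divide_inverse algebra_simps)
            then show ?thesis unfolding P_def .
          qed
          finally show ?thesis .
        next
          case False
          then have "Jint (kF e x) y = 0" by (intro Jint_zero[OF ye]) (auto simp: kF_zero)
          then show ?thesis using P0 t0 by simp
        qed
        then show ?thesis using True by simp
      qed simp
    qed
  qed (use P0 \<tau> sph_pos[OF n2] in \<open>auto simp: indicator_def\<close>)
  also have "P * (sph n / \<tau>) + 0 * 0 = K4 * ((\<bar>g0\<bar> + \<omega>g 1) * (enorm n x)\<^sup>2 / \<tau>)" by (simp add: P_def K4_def mult_ac)
  finally show ?thesis .
qed

definition K5 :: real where "K5 = 2 * K1 + real n * (K2 * sph n) + K4"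

text \<open>The error of the surface potential at |x| = r when the integral is cut at distance
  \<tau>: the kernel values at x and at 0 inside the cut, the linear Taylor terms inside, and the
  quadratic remainder outside. With \<tau> = M r each summand is r times a quantity that can be made
  small.\<close>

definition rem :: "real \<Rightarrow> real \<Rightarrow> real" where
  "rem r \<tau> = \<tau> * (Og \<tau> + \<bar>g0\<bar> * sqrt (Om \<tau>)) + r * (dint \<omega>g (8 * real n * \<tau>) + \<bar>g0\<bar> * dint \<omega> (8 * real n * \<tau>))
     + (\<bar>g0\<bar> + \<omega>g 1) * r\<^sup>2 / \<tau>"

lemma Ks_nonneg: "0 \<le> K1" "0 \<le> K4" "0 \<le> K5"
proof -
  show 1: "0 \<le> K1" using sph_pos[OF n2] cdens_nonneg by (simp add: K1_def)
  show 4: "0 \<le> K4" using sph_pos[OF n2] cdens_nonneg tayc_nonneg[OF n2, of 0] by (simp add: K4_def)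
  show "0 \<le> K5" using 1 4 K2_nonneg sph_pos[OF n2] by (simp add: K5_def)
qed

lemma Jint_kF_integral:
  assumes e: "0 < e" and \<tau>: "0 < \<tau>" "real n * \<tau> \<le> \<rho>" and x: "2 * enorm n x \<le> \<tau>"
  shows "\<bar>\<integral>y. Jint (kF e x) y \<partial>elebesgue (n - 1)\<bar> \<le> K5 * rem (enorm n x) \<tau>"
proof -
  let ?L = "elebesgue (n - 1)" and ?t = "\<lambda>y. enorm (n - 1) y"
  let ?r = "enorm n x"
  have tr: "\<tau> < r0" by (rule tau_lt_r0[OF \<tau>(2,1)])
  have iJ: "integrable ?L (\<lambda>y. indicator A (?t y) * \<bar>Jint f y\<bar>)"
    if "continuous_on (euc n) f" "\<And>z. r0 \<le> enorm n z \<Longrightarrow> f z = 0" "A \<in> sets borel" for f A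
  proof -
    have i: "integrable ?L (Jint f)" by (rule Jint_integrable[OF that(1)]) (rule that(2))
    have "integrable ?L (\<lambda>y. indicator ((\<lambda>y. ?t y) -` A \<inter> space ?L) y *\<^sub>R \<bar>Jint f y\<bar>)"
      by (intro integrable_mult_indicator integrable_abs i measurable_sets[OF enorm_measurable that(3)])
    then show ?thesis
      by (rule Bochner_Integration.integrable_cong[THEN iffD1, rotated 2]) (auto simp: indicator_def)
  qed
  let ?n1 = "\<lambda>y. indicator {..<\<tau>} (?t y) * \<bar>Jint (ker n \<rho> e x) y\<bar>"
  let ?n2 = "\<lambda>y. indicator {..<\<tau>} (?t y) * \<bar>Jint (ker n \<rho> e (\<lambda>_. 0)) y\<bar>"
  let ?n3 = "\<lambda>i y. indicator {..<\<tau>} (?t y) * \<bar>Jint (kP e i) y\<bar>"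
  let ?n4 = "\<lambda>y. indicator {\<tau>..} (?t y) * \<bar>Jint (kF e x) y\<bar>"
  have int: "integrable ?L ?n1" "integrable ?L ?n2" "integrable ?L (?n3 i)" "integrable ?L ?n4" for i
    by (intro iJ ker_continuous kP_continuous kF_continuous e ker_zero' kP_zero kF_zero; simp)+
  have pw: "\<bar>Jint (kF e x) y\<bar> \<le> ?n1 y + ?n2 y + (\<Sum>i=1..n. ?r * ?n3 i y) + ?n4 y" for y
  proof (cases "?t y < \<tau>")
    case True
    have "\<bar>\<Sum>i=1..n. x i * Jint (kP e i) y\<bar> \<le> (\<Sum>i=1..n. ?r * \<bar>Jint (kP e i) y\<bar>)"
    proof (rule order.trans[OF sum_abs sum_mono])
      fix i assume "i \<in> {1..n}"
      then show "\<bar>x i * Jint (kP e i) y\<bar> \<le> ?r * \<bar>Jint (kP e i) y\<bar>"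
        unfolding abs_mult by (intro mult_right_mono abs_coord_le_enorm) auto
    qed
    then have "\<bar>Jint (kF e x) y\<bar> \<le> \<bar>Jint (ker n \<rho> e x) y\<bar> + \<bar>Jint (ker n \<rho> e (\<lambda>_. 0)) y\<bar> + (\<Sum>i=1..n. ?r * \<bar>Jint (kP e i) y\<bar>)"
      unfolding Jint_kF_eq by linarith
    then show ?thesis using True by simp
  next
    case False
    then show ?thesis by simp
  qed
  define E1 where "E1 = \<tau> * (Og \<tau> + \<bar>g0\<bar> * sqrt (Om \<tau>))"
  define E2 where "E2 = dint \<omega>g (8 * real n * \<tau>) + \<bar>g0\<bar> * dint \<omega> (8 * real n * \<tau>)"
  define E3 where "E3 = (\<bar>g0\<bar> + \<omega>g 1) * ?r\<^sup>2 / \<tau>"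
  have E: "0 \<le> E1" "0 \<le> E2" "0 \<le> E3"
    using \<tau> Og_nonneg[of \<tau>] Om_nonneg[of \<tau>] dint_nonneg[OF dini_wg] dint_nonneg[OF dini_w] dini_nonneg[OF dini_wg, of 1]
    by (auto simp: E1_def E2_def E3_def)
  have xr: "?r \<le> \<tau>" using x enorm_nonneg[of n x] by linarith
  have b1: "(\<integral>y. ?n1 y \<partial>?L) \<le> K1 * E1"
    unfolding E1_def by (rule integral_le_of_nn_integral[OF int(1) _ Jint_ker_near_integral[OF e \<tau> xr]])
       (use Ks_nonneg E in \<open>auto simp: E1_def\<close>)
  have b2: "(\<integral>y. ?n2 y \<partial>?L) \<le> K1 * E1"
    unfolding E1_def by (rule integral_le_of_nn_integral[OF int(2) _ Jint_ker_near_integral[OF e \<tau>]])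
       (use Ks_nonneg E \<tau> in \<open>auto simp: E1_def enorm_alt\<close>)
  have b3: "(\<integral>y. ?n3 i y \<partial>?L) \<le> K2 * sph n * E2" if "i \<in> {1..n}" for i
    unfolding E2_def by (rule integral_le_of_nn_integral[OF int(3) _ Jint_kP_integral[OF e that \<tau>(1) less_imp_le[OF tr]]])
       (use K2_nonneg sph_pos[OF n2] E in \<open>auto simp: E2_def\<close>)
  have "0 \<le> K4 * E3" using Ks_nonneg E by simp
  note E3 = this[unfolded E3_def]
  have b4: "(\<integral>y. ?n4 y \<partial>?L) \<le> K4 * E3"
    unfolding E3_def by (rule integral_le_of_nn_integral[OF int(4) _ Jint_kF_far_integral[OF e \<tau>(1) x]])
       (use E3 in auto)
  have iF: "integrable ?L (Jint (kF e x))" by (intro Jint_integrable kF_continuous e kF_zero)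
  have iS: "integrable ?L (\<lambda>y. \<Sum>i=1..n. ?r * ?n3 i y)"
    by (intro Bochner_Integration.integrable_sum integrable_mult_right int)
  have "\<bar>\<integral>y. Jint (kF e x) y \<partial>?L\<bar> \<le> (\<integral>y. \<bar>Jint (kF e x) y\<bar> \<partial>?L)" by (rule integral_abs_bound)
  also have "\<dots> \<le> (\<integral>y. ?n1 y + ?n2 y + (\<Sum>i=1..n. ?r * ?n3 i y) + ?n4 y \<partial>?L)"
    by (intro integral_mono pw integrable_abs iF Bochner_Integration.integrable_add int iS)
  also have "\<dots> = (\<integral>y. ?n1 y \<partial>?L) + (\<integral>y. ?n2 y \<partial>?L) + (\<Sum>i=1..n. ?r * (\<integral>y. ?n3 i y \<partial>?L)) + (\<integral>y. ?n4 y \<partial>?L)"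
    using int iS by (simp add: Bochner_Integration.integral_add Bochner_Integration.integrable_add Bochner_Integration.integral_sum)
  also have "\<dots> \<le> K1 * E1 + K1 * E1 + (\<Sum>i=1..n. ?r * (K2 * sph n * E2)) + K4 * E3"
    by (intro add_mono b1 b2 b4 sum_mono mult_left_mono b3) auto
  also have "\<dots> = 2 * K1 * E1 + real n * (K2 * sph n) * (?r * E2) + K4 * E3" by (simp add: mult_ac)
  also have "\<dots> \<le> K5 * E1 + K5 * (?r * E2) + K5 * E3"
    using E Ks_nonneg K2_nonneg sph_pos[OF n2] by (intro add_mono mult_right_mono) (auto simp: K5_def)
  also have "\<dots> = K5 * rem ?r \<tau>" by (simp add: rem_def E1_def E2_def E3_def distrib_left)
  finally show ?thesis .
qed

text \<open>The choice \<tau> = r0 covers the whole chart, and 8n r0 = R.\<close>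

lemma Jint_kP_total:
  assumes e: "0 < e" and i: "i \<in> {1..n}"
  shows "\<bar>\<integral>y. Jint (kP e i) y \<partial>elebesgue (n - 1)\<bar> \<le> K2 * sph n * (dint \<omega>g R + \<bar>g0\<bar> * dint \<omega> R)"
proof -
  let ?L = "elebesgue (n - 1)"
  have RR: "8 * real n * r0 = R" using n3 by (simp add: r0_def)
  have iJ: "integrable ?L (Jint (kP e i))" by (intro Jint_integrable kP_continuous e kP_zero)
  have "\<bar>\<integral>y. Jint (kP e i) y \<partial>?L\<bar> \<le> (\<integral>y. \<bar>Jint (kP e i) y\<bar> \<partial>?L)" by (rule integral_abs_bound)
  also have "\<dots> \<le> K2 * sph n * (dint \<omega>g R + \<bar>g0\<bar> * dint \<omega> R)"
  proof (rule integral_le_of_nn_integral)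
    have "(\<integral>\<^sup>+y. ennreal \<bar>Jint (kP e i) y\<bar> \<partial>?L) = (\<integral>\<^sup>+y. ennreal (indicator {..<r0} (enorm (n - 1) y) * \<bar>Jint (kP e i) y\<bar>) \<partial>?L)"
    proof (intro nn_integral_cong)
      fix y assume "y \<in> space ?L"
      then have ye: "y \<in> euc (n - 1)" by simp
      show "ennreal \<bar>Jint (kP e i) y\<bar> = ennreal (indicator {..<r0} (enorm (n - 1) y) * \<bar>Jint (kP e i) y\<bar>)"
      proof (cases "enorm (n - 1) y < r0")
        case False
        then have "Jint (kP e i) y = 0" by (intro Jint_zero[OF ye]) (auto simp: D0_def euc_ball_def kP_zero)
        then show ?thesis by simp
      qed simp
    qed
    also have "\<dots> \<le> ennreal (K2 * sph n * (dint \<omega>g R + \<bar>g0\<bar> * dint \<omega> R))"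
      using Jint_kP_integral[OF e i r0_pos order_refl] unfolding RR .
    finally show "(\<integral>\<^sup>+y. ennreal \<bar>Jint (kP e i) y\<bar> \<partial>?L) \<le> ennreal (K2 * sph n * (dint \<omega>g R + \<bar>g0\<bar> * dint \<omega> R))" .
  qed (use iJ K2_nonneg sph_pos[OF n2] dint_nonneg[OF dini_wg] dint_nonneg[OF dini_w] in auto)
  finally show ?thesis .
qed

end

section \<open>The first order expansion\<close>

context dini_problem
begin

text \<open>The derivative of \<open>cutpart\<close> in \<open>x i\<close> at x = 0.\<close>

definition cutP :: "real \<Rightarrow> nat \<Rightarrow> vec \<Rightarrow> real" where
  "cutP e i y =
     (2 * real n * cutoff \<rho> 1 ((enorm n y)\<^sup>2) + 4 * (enorm n y)\<^sup>2 * cutoff \<rho> 2 ((enorm n y)\<^sup>2))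
       * ((real n - 2) * (y i * bub n e 1 ((enorm n y)\<^sup>2)))
     - 4 * (real n - 2) * cutoff \<rho> 1 ((enorm n y)\<^sup>2)
       * (y i * (real n * (bub n e 2 ((enorm n y)\<^sup>2) * (enorm n y)\<^sup>2) - bub n e 1 ((enorm n y)\<^sup>2)))"

lemma cutP_continuous: "0 < e \<Longrightarrow> continuous_on (euc n) (cutP e i)"
  unfolding cutP_def[abs_def] by (intro continuous_intros cutoff_continuous bub_continuous0)

lemma cutP_zero: "r0 < enorm n y \<or> enorm n y < \<rho> \<Longrightarrow> cutP e i y = 0"
proof -
  assume "r0 < enorm n y \<or> enorm n y < \<rho>"
  then have "cutoff \<rho> 1 ((enorm n y)\<^sup>2) = 0" "cutoff \<rho> 2 ((enorm n y)\<^sup>2) = 0"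
    using cutoff_12_eq_0[OF rho(1), of "enorm n y"] rho(2) by auto
  then show ?thesis by (simp add: cutP_def)
qed

lemma cut_coeff_le:
  assumes "enorm n y \<le> r0"
  shows "\<bar>2 * real n * cutoff \<rho> 1 ((enorm n y)\<^sup>2) + 4 * (enorm n y)\<^sup>2 * cutoff \<rho> 2 ((enorm n y)\<^sup>2)\<bar>
    \<le> (2 * real n + 16) * (chiB / \<rho>\<^sup>2)"
proof -
  let ?Y = "enorm n y"
  have "4 * ?Y\<^sup>2 * \<bar>cutoff \<rho> 2 (?Y\<^sup>2)\<bar> \<le> 4 * (2 * \<rho>)\<^sup>2 * (chiB / \<rho> ^ 4)"
    using assms rho by (intro mult_mono cutoff_bounds power_mono) auto
  also have "\<dots> = 16 * (chiB / \<rho>\<^sup>2)" using rho(1) by (simp add: power_mult_distrib power2_eq_square power4_eq_xxxx)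
  finally have 1: "4 * ?Y\<^sup>2 * \<bar>cutoff \<rho> 2 (?Y\<^sup>2)\<bar> \<le> 16 * (chiB / \<rho>\<^sup>2)" .
  have 2: "2 * real n * \<bar>cutoff \<rho> 1 (?Y\<^sup>2)\<bar> \<le> 2 * real n * (chiB / \<rho>\<^sup>2)"
    by (intro mult_left_mono cutoff_bounds) auto
  have "\<bar>2 * real n * cutoff \<rho> 1 (?Y\<^sup>2) + 4 * ?Y\<^sup>2 * cutoff \<rho> 2 (?Y\<^sup>2)\<bar>
    \<le> 2 * real n * \<bar>cutoff \<rho> 1 (?Y\<^sup>2)\<bar> + 4 * ?Y\<^sup>2 * \<bar>cutoff \<rho> 2 (?Y\<^sup>2)\<bar>"
    by (rule order_trans[OF abs_triangle_ineq]) (simp add: abs_mult)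
  also have "\<dots> \<le> (2 * real n + 16) * (chiB / \<rho>\<^sup>2)" unfolding distrib_right by (intro add_mono 1 2)
  finally show ?thesis .
qed

definition K6 :: real where
  "K6 = chiB * ((2 * real n + 16) * tayc n 0 + 4 * real n * (2 * tayc n 1 + real n))"

definition K7 :: real where
  "K7 = chiB * ((2 * real n + 16) * real n + 4 * real n * (real n + 1))"

lemma cutpart_expand:
  assumes e: "0 < e" and x: "2 * enorm n x \<le> \<rho>" and y: "\<rho> \<le> enorm n y" "enorm n y \<le> r0"
  shows "\<bar>cutpart n \<rho> e x y - cutpart n \<rho> e (\<lambda>_. 0) y - (\<Sum>i=1..n. x i * cutP e i y)\<bar>
    \<le> K6 * ((enorm n x)\<^sup>2 / \<rho>\<^sup>2) / \<rho> ^ n"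
proof -
  define X where "X = enorm n x"
  define Y where "Y = enorm n y"
  define c where "c = einner n x y"
  define c1 where "c1 = 2 * real n * cutoff \<rho> 1 (Y\<^sup>2) + 4 * Y\<^sup>2 * cutoff \<rho> 2 (Y\<^sup>2)"
  define X1 where "X1 = cutoff \<rho> 1 (Y\<^sup>2)"
  define s where "s = (enorm n (\<lambda>j. y j - x j))\<^sup>2"
  define b where "b k = bub n e k (Y\<^sup>2)" for k
  define d where "d k = bub n e k s" for k
  define T0 where "T0 = d 0 - b 0 - (real n - 2) * c * b 1"
  define T1 where "T1 = d 1 - b 1 - real n * c * b 2"
  have XY: "0 \<le> X" "0 < Y" "2 * X \<le> Y" "\<rho> \<le> Y" using x y rho by (auto simp: X_def Y_def)
  have bx: "2 * bexp n 0 = real n - 2" "2 * bexp n 1 = real n" by (simp_all add: bexp_def)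
  have S: "Suc 0 = 1" "Suc 1 = 2" by simp_all
  have t1: "0 \<le> tayc n 1" "0 \<le> tayc n 0" using tayc_nonneg[OF n2] by auto
  have "(\<Sum>i=1..n. x i * cutP e i y) = c1 * ((real n - 2) * (c * b 1)) - 4 * (real n - 2) * X1 * (c * (real n * (b 2 * Y\<^sup>2) - b 1))"
  proof -
    have "x i * cutP e i y = c1 * ((real n - 2) * (x i * y i * b 1)) - 4 * (real n - 2) * X1 * (x i * y i * (real n * (b 2 * Y\<^sup>2) - b 1))" for i
      unfolding cutP_def Y_def[symmetric] c1_def[symmetric] unfolding X1_def[symmetric] b_def[symmetric] by (simp only: right_diff_distrib mult_ac)
    then show ?thesis
      unfolding c_def einner_def by (simp only: sum_subtractf sum_distrib_left sum_distrib_right)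
  qed
  moreover have "cutpart n \<rho> e x y = c1 * d 0 - 4 * (real n - 2) * X1 * d 1 * (Y\<^sup>2 - c)"
    unfolding cutpart_def c1_def X1_def d_def s_def c_def Y_def ..
  moreover have "cutpart n \<rho> e (\<lambda>_. 0) y = c1 * b 0 - 4 * (real n - 2) * X1 * b 1 * Y\<^sup>2"
    unfolding cutpart_def c1_def X1_def b_def Y_def by (simp add: einner_def)
  \<comment> \<open>T0 and T1 are Taylor remainders of two powers of the kernel, hence quadratic in
    x. The last product is quadratic as well: the inner product c and the difference
    \<open>d 1 - b 1\<close> are each of first order.\<close>
  ultimately have eq: "cutpart n \<rho> e x y - cutpart n \<rho> e (\<lambda>_. 0) y - (\<Sum>i=1..n. x i * cutP e i y)
    = c1 * T0 - 4 * (real n - 2) * X1 * (Y\<^sup>2 * T1 - c * (d 1 - b 1))"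
    unfolding T0_def T1_def by (simp only:) (simp add: algebra_simps)
  have pn: "X\<^sup>2 / Y ^ n \<le> X\<^sup>2 / \<rho> ^ n"
    using XY rho by (intro divide_left_mono power_mono mult_pos_pos zero_less_power) auto
  have B0: "\<bar>T0\<bar> \<le> tayc n 0 * (X\<^sup>2 / \<rho> ^ n)"
  proof -
    have "\<bar>T0\<bar> \<le> tayc n 0 * (X\<^sup>2 / Y ^ n)"
      using bub_taylor[OF n2 e, of x y 0] XY unfolding T0_def d_def b_def s_def c_def X_def Y_def bx S by simp
    also have "\<dots> \<le> tayc n 0 * (X\<^sup>2 / \<rho> ^ n)" by (intro mult_left_mono pn t1)
    finally show ?thesis .
  qed
  have Yn: "Y ^ (n + 2 * 1) = Y\<^sup>2 * Y ^ n" by (simp add: power_add power2_eq_square mult_ac)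
  have B1: "\<bar>Y\<^sup>2 * T1\<bar> \<le> tayc n 1 * (X\<^sup>2 / \<rho> ^ n)"
  proof -
    have "\<bar>T1\<bar> \<le> tayc n 1 * X\<^sup>2 / Y ^ (n + 2 * 1)"
      using bub_taylor[OF n2 e, of x y 1] XY unfolding T1_def d_def b_def s_def c_def X_def Y_def bx S by simp
    then have "Y\<^sup>2 * \<bar>T1\<bar> \<le> Y\<^sup>2 * (tayc n 1 * X\<^sup>2 / Y ^ (n + 2 * 1))" by (intro mult_left_mono) auto
    also have "\<dots> = tayc n 1 * (X\<^sup>2 / Y ^ n)" unfolding Yn using XY by simp
    also have "\<dots> \<le> tayc n 1 * (X\<^sup>2 / \<rho> ^ n)" by (intro mult_left_mono pn t1)
    finally show ?thesis by (simp add: abs_mult)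
  qed
  have B2: "\<bar>c * (d 1 - b 1)\<bar> \<le> (tayc n 1 + real n) * (X\<^sup>2 / \<rho> ^ n)"
  proof -
    have 1: "\<bar>c\<bar> \<le> X * Y" using einner_le[of n x y] by (simp add: c_def X_def Y_def)
    have 2: "\<bar>d 1 - b 1\<bar> \<le> (tayc n 1 + real n) * (X * Y) / Y ^ (n + 2 * 1)"
      using bub_diff_le[OF n2 e, of x y 1] XY unfolding d_def b_def s_def X_def Y_def bx by simp
    have "\<bar>c * (d 1 - b 1)\<bar> \<le> (X * Y) * ((tayc n 1 + real n) * (X * Y) / Y ^ (n + 2 * 1))"
      unfolding abs_mult using 1 2 XY by (intro mult_mono) auto
    also have "\<dots> = (tayc n 1 + real n) * (X\<^sup>2 / Y ^ n)" unfolding Yn using XY by (simp add: power2_eq_square)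
    also have "\<dots> \<le> (tayc n 1 + real n) * (X\<^sup>2 / \<rho> ^ n)" using t1 by (intro mult_left_mono pn) auto
    finally show ?thesis .
  qed
  let ?q = "X\<^sup>2 / \<rho> ^ n"
  have q0: "0 \<le> ?q" using rho by simp
  have b3: "\<bar>c1 * T0\<bar> \<le> ((2 * real n + 16) * (chiB / \<rho>\<^sup>2)) * (tayc n 0 * ?q)"
    unfolding abs_mult by (intro mult_mono B0) (use cut_coeff_le[OF y(2)] chiB_nonneg in \<open>auto simp: c1_def Y_def\<close>)
  have b4: "\<bar>4 * (real n - 2) * X1 * (Y\<^sup>2 * T1 - c * (d 1 - b 1))\<bar> \<le> (4 * real n * (chiB / \<rho>\<^sup>2)) * ((2 * tayc n 1 + real n) * ?q)"
  proof -
    have "\<bar>Y\<^sup>2 * T1 - c * (d 1 - b 1)\<bar> \<le> tayc n 1 * ?q + (tayc n 1 + real n) * ?q"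
      using B1 B2 by linarith
    also have "\<dots> = (2 * tayc n 1 + real n) * ?q"
    proof -
      have "a * z + (a + b) * z = (2 * a + b) * z" for a b z :: real by (simp add: algebra_simps)
      then show ?thesis .
    qed
    finally have 1: "\<bar>Y\<^sup>2 * T1 - c * (d 1 - b 1)\<bar> \<le> (2 * tayc n 1 + real n) * ?q" .
    have 2: "\<bar>4 * (real n - 2) * X1\<bar> \<le> 4 * real n * (chiB / \<rho>\<^sup>2)"
      unfolding abs_mult using cutoff_bounds(1)[of \<rho> "Y\<^sup>2"] n3 by (intro mult_mono) (auto simp: X1_def)
    show ?thesis unfolding abs_mult[of _ "Y\<^sup>2 * T1 - c * (d 1 - b 1)"] using 1 2 chiB_nonneg
      by (intro mult_mono) auto
  qed
  have "\<bar>c1 * T0 - 4 * (real n - 2) * X1 * (Y\<^sup>2 * T1 - c * (d 1 - b 1))\<bar>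
    \<le> ((2 * real n + 16) * (chiB / \<rho>\<^sup>2)) * (tayc n 0 * ?q) + (4 * real n * (chiB / \<rho>\<^sup>2)) * ((2 * tayc n 1 + real n) * ?q)"
    using b3 b4 by linarith
  also have "\<dots> = K6 * (X\<^sup>2 / \<rho>\<^sup>2) / \<rho> ^ n"
    by (simp add: K6_def divide_inverse algebra_simps)
  finally show ?thesis unfolding eq X_def .
qed

lemma cutP_le:
  assumes e: "0 < e" and i: "i \<in> {1..n}" and y: "\<rho> \<le> enorm n y" "enorm n y \<le> r0"
  shows "\<bar>cutP e i y\<bar> \<le> K7 / \<rho> / \<rho> ^ n"
proof -
  define Y where "Y = enorm n y"
  define c1 where "c1 = 2 * real n * cutoff \<rho> 1 (Y\<^sup>2) + 4 * Y\<^sup>2 * cutoff \<rho> 2 (Y\<^sup>2)"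
  define b where "b k = bub n e k (Y\<^sup>2)" for k
  let ?q = "1 / \<rho> ^ (n - 1)"
  have c1: "\<bar>c1\<bar> \<le> (2 * real n + 16) * (chiB / \<rho>\<^sup>2)" using cut_coeff_le[OF y(2)] by (simp add: c1_def Y_def)
  have b1: "\<bar>y i\<bar> * b 1 \<le> ?q" using coord_bub1_le[OF e i rho(1) y(1)] by (simp add: b_def Y_def)
  have b2: "0 \<le> b 2 * Y\<^sup>2" "b 2 * Y\<^sup>2 \<le> b 1" "0 \<le> b 1"
    using bub_Suc_mult_le[OF e, of "Y\<^sup>2" n 1] by (simp_all add: b_def numeral_2_eq_2 One_nat_def)
  have 1: "\<bar>c1 * ((real n - 2) * (y i * b 1))\<bar> \<le> ((2 * real n + 16) * (chiB / \<rho>\<^sup>2)) * (real n * ?q)"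
  proof -
    have "\<bar>(real n - 2) * (y i * b 1)\<bar> \<le> real n * ?q"
      unfolding abs_mult using b1 b2 n3 by (intro mult_mono) auto
    then show ?thesis unfolding abs_mult[of c1] using c1 chiB_nonneg by (intro mult_mono) auto
  qed
  have 2: "\<bar>4 * (real n - 2) * cutoff \<rho> 1 (Y\<^sup>2) * (y i * (real n * (b 2 * Y\<^sup>2) - b 1))\<bar> \<le> (4 * real n * (chiB / \<rho>\<^sup>2)) * ((real n + 1) * ?q)"
  proof -
    have "real n * (b 2 * Y\<^sup>2) \<le> real n * b 1" using b2 by (intro mult_left_mono) auto
    moreover have "0 \<le> real n * (b 2 * Y\<^sup>2)" "0 \<le> real n * b 1" using b2 by auto
    ultimately have "\<bar>real n * (b 2 * Y\<^sup>2) - b 1\<bar> \<le> (real n + 1) * b 1" unfolding distrib_right using b2 by linarith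
    then have "\<bar>y i\<bar> * \<bar>real n * (b 2 * Y\<^sup>2) - b 1\<bar> \<le> \<bar>y i\<bar> * ((real n + 1) * b 1)" by (intro mult_left_mono) auto
    also have "\<dots> = (real n + 1) * (\<bar>y i\<bar> * b 1)" by simp
    also have "\<dots> \<le> (real n + 1) * ?q" by (intro mult_left_mono b1) auto
    finally have 3: "\<bar>y i * (real n * (b 2 * Y\<^sup>2) - b 1)\<bar> \<le> (real n + 1) * ?q" by (simp only: abs_mult)
    have 4: "\<bar>4 * (real n - 2) * cutoff \<rho> 1 (Y\<^sup>2)\<bar> \<le> 4 * real n * (chiB / \<rho>\<^sup>2)"
      unfolding abs_mult using cutoff_bounds(1)[of \<rho> "Y\<^sup>2"] n3 by (intro mult_mono) auto
    show ?thesis unfolding abs_mult[of _ "y i * (real n * (b 2 * Y\<^sup>2) - b 1)"] using 3 4 chiB_nonneg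
      by (intro mult_mono) auto
  qed
  have "cutP e i y = c1 * ((real n - 2) * (y i * b 1)) - 4 * (real n - 2) * cutoff \<rho> 1 (Y\<^sup>2) * (y i * (real n * (b 2 * Y\<^sup>2) - b 1))"
    unfolding cutP_def c1_def b_def Y_def ..
  then have "\<bar>cutP e i y\<bar> \<le> ((2 * real n + 16) * (chiB / \<rho>\<^sup>2)) * (real n * ?q) + (4 * real n * (chiB / \<rho>\<^sup>2)) * ((real n + 1) * ?q)"
    using 1 2 by linarith
  also have "\<dots> = K7 * (?q / \<rho>\<^sup>2)"
    by (simp add: K7_def divide_inverse algebra_simps)
  also have "?q / \<rho>\<^sup>2 = 1 / \<rho> / \<rho> ^ n"
  proof -
    have "\<rho> ^ n = \<rho> * \<rho> ^ (n - 1)" using n3 by (simp add: power_eq_if)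
    then show ?thesis by (simp add: power2_eq_square mult_ac)
  qed
  finally show ?thesis by simp
qed

text \<open>The volume of the ball of radius 2 \<rho> cancels the power \<rho>^n, so the radius
  enters the bound only through c and V.\<close>

lemma vv_integral_bound:
  assumes h: "continuous_on (euc n) h" "\<And>y. y \<in> euc n \<Longrightarrow> r0 < enorm n y \<or> enorm n y < \<rho> \<Longrightarrow> h y = 0"
    and b: "\<And>y. y \<in> euc n \<Longrightarrow> \<rho> \<le> enorm n y \<Longrightarrow> enorm n y \<le> r0 \<Longrightarrow> \<bar>h y\<bar> \<le> c / \<rho> ^ n" and c: "0 \<le> c"
  shows "\<bar>\<integral>y. vv y * h y \<partial>elebesgue n\<bar> \<le> unit_ball_vol n * 2 ^ n * V * c"
proof -
  let ?S = "{y\<in>euc n. enorm n y \<le> r0}"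
  have iv: "integrable (elebesgue n) (\<lambda>y. vv y * h y)" by (rule vv_integrable[OF h(1)]) (use h(2) in auto)
  have em: "emeasure (elebesgue n) ?S = ennreal (unit_ball_vol n * r0 ^ n)"
    using emeasure_euc_cball[of r0 n] r0_pos by simp
  have S: "?S \<in> sets (elebesgue n)" using euc_sets by auto
  have iI: "integrable (elebesgue n) (\<lambda>y. V * (c / \<rho> ^ n) * indicator ?S y)"
    using em S by (intro integrable_mult_right integrable_real_indicator) auto
  have "\<bar>\<integral>y. vv y * h y \<partial>elebesgue n\<bar> \<le> (\<integral>y. \<bar>vv y * h y\<bar> \<partial>elebesgue n)" by (rule integral_abs_bound)
  also have "\<dots> \<le> (\<integral>y. V * (c / \<rho> ^ n) * indicator ?S y \<partial>elebesgue n)"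
  proof (rule integral_mono[OF integrable_abs[OF iv] iI])
    fix y assume "y \<in> space (elebesgue n)"
    then have y: "y \<in> euc n" by simp
    show "\<bar>vv y * h y\<bar> \<le> V * (c / \<rho> ^ n) * indicator ?S y"
    proof (cases "r0 < enorm n y \<or> enorm n y < \<rho>")
      case True
      have "0 \<le> V * (c / \<rho> ^ n) * indicator ?S y" using V_nonneg c rho by (intro mult_nonneg_nonneg) (auto simp: indicator_def)
      then show ?thesis using h(2)[OF y True] by simp
    next
      case False
      have "\<bar>vv y * h y\<bar> \<le> V * (c / \<rho> ^ n)"
        unfolding abs_mult using b[OF y] False vv_bound V_nonneg by (intro mult_mono) auto
      then show ?thesis using False y by (simp add: not_less)
    qed
  qed
  also have "\<dots> = V * (c / \<rho> ^ n) * (unit_ball_vol n * r0 ^ n)"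
  proof -
    have "?S \<inter> euc n = ?S" by auto
    then show ?thesis using em S r0_pos by (simp add: measure_def)
  qed
  also have "r0 ^ n = 2 ^ n * \<rho> ^ n" unfolding rho(2)[symmetric] by (rule power_mult_distrib)
  also have "V * (c / \<rho> ^ n) * (unit_ball_vol n * (2 ^ n * \<rho> ^ n)) = unit_ball_vol n * 2 ^ n * V * c" using rho(1) by simp
  finally show ?thesis .
qed

text \<open>The representation formula differentiated in \<open>x i\<close> at 0 under both
  integrals: up to the normalising factor, the i-th derivative of the regularised remainder.\<close>

definition Acoef :: "real \<Rightarrow> nat \<Rightarrow> real" where
  "Acoef e i = (\<integral>y. vv y * cutP e i y \<partial>elebesgue n) - (\<integral>y. Jint (kP e i) y \<partial>elebesgue (n - 1))"

lemma K67_nonneg: "0 \<le> K6" "0 \<le> K7"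
  using chiB_nonneg tayc_nonneg[OF n2] by (auto simp: K6_def K7_def intro!: mult_nonneg_nonneg add_nonneg_nonneg)

lemma Acoef_bound:
  assumes e: "0 < e" and i: "i \<in> {1..n}"
  shows "\<bar>Acoef e i\<bar> \<le> unit_ball_vol n * 2 ^ n * V * (K7 / \<rho>) + K2 * sph n * (dint \<omega>g R + \<bar>g0\<bar> * dint \<omega> R)"
proof -
  have "\<bar>\<integral>y. vv y * cutP e i y \<partial>elebesgue n\<bar> \<le> unit_ball_vol n * 2 ^ n * V * (K7 / \<rho>)"
    by (rule vv_integral_bound[OF cutP_continuous[OF e]]) (use cutP_zero cutP_le[OF e i] K67_nonneg rho in auto)
  then show ?thesis using Jint_kP_total[OF e i] unfolding Acoef_def by linarith
qed

lemma expansion: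
  assumes e: "0 < e" and \<tau>: "0 < \<tau>" "real n * \<tau> \<le> \<rho>" and x: "2 * enorm n x \<le> \<tau>"
  shows "\<bar>Dfun e x - Dfun e (\<lambda>_. 0) - (\<Sum>i=1..n. x i * Acoef e i)\<bar>
    \<le> unit_ball_vol n * 2 ^ n * V * (K6 * ((enorm n x)\<^sup>2 / \<rho>\<^sup>2)) + K5 * rem (enorm n x) \<tau>"
proof -
  let ?L = "elebesgue (n - 1)" and ?E = "elebesgue n"
  define h where "h y = cutpart n \<rho> e x y - cutpart n \<rho> e (\<lambda>_. 0) y - (\<Sum>i=1..n. x i * cutP e i y)" for y
  have xr: "2 * enorm n x \<le> \<rho>"
  proof -
    have "\<tau> \<le> real n * \<tau>" using n3 \<tau> mult_right_mono[of 1 "real n" \<tau>] by simp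
    then show ?thesis using x \<tau> by linarith
  qed
  have hc: "continuous_on (euc n) h"
    unfolding h_def[abs_def] by (intro continuous_intros cutpart_continuous cutP_continuous e)
  have 1: "\<bar>\<integral>y. vv y * h y \<partial>?E\<bar> \<le> unit_ball_vol n * 2 ^ n * V * (K6 * ((enorm n x)\<^sup>2 / \<rho>\<^sup>2))"
    by (rule vv_integral_bound[OF hc])
       (use cutpart_zero cutP_zero cutpart_expand[OF e xr] K67_nonneg in \<open>auto simp: h_def\<close>)
  have ic: "integrable ?E (\<lambda>y. vv y * cutpart n \<rho> e z y)" for z
    by (rule vv_integrable[OF cutpart_continuous[OF e]]) (use cutpart_zero in auto)
  have iP: "integrable ?E (\<lambda>y. vv y * cutP e i y)" for i
    by (rule vv_integrable[OF cutP_continuous[OF e]]) (use cutP_zero in auto)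
  have I1: "(\<integral>y. vv y * h y \<partial>?E) = (\<integral>y. vv y * cutpart n \<rho> e x y \<partial>?E) - (\<integral>y. vv y * cutpart n \<rho> e (\<lambda>_. 0) y \<partial>?E)
     - (\<Sum>i=1..n. x i * (\<integral>y. vv y * cutP e i y \<partial>?E))"
  proof -
    have "vv y * h y = vv y * cutpart n \<rho> e x y - vv y * cutpart n \<rho> e (\<lambda>_. 0) y - (\<Sum>i=1..n. x i * (vv y * cutP e i y))" for y
      by (simp add: h_def right_diff_distrib sum_distrib_left mult_ac)
    then show ?thesis using ic iP by (simp add: Bochner_Integration.integral_diff Bochner_Integration.integral_sum)
  qed
  have jk: "integrable ?L (Jint (ker n \<rho> e z))" for z
    by (rule Jint_integrable[OF ker_continuous[OF e]]) (rule ker_zero')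
  have jP: "integrable ?L (Jint (kP e i))" for i
    by (rule Jint_integrable[OF kP_continuous[OF e]]) (rule kP_zero)
  have I2: "(\<integral>y. Jint (kF e x) y \<partial>?L) = (\<integral>y. Jint (ker n \<rho> e x) y \<partial>?L) - (\<integral>y. Jint (ker n \<rho> e (\<lambda>_. 0)) y \<partial>?L)
     - (\<Sum>i=1..n. x i * (\<integral>y. Jint (kP e i) y \<partial>?L))"
    unfolding Jint_kF_eq using jk jP by (simp add: Bochner_Integration.integral_diff Bochner_Integration.integral_sum)
  have "(\<Sum>i=1..n. x i * Acoef e i) = (\<Sum>i=1..n. x i * (\<integral>y. vv y * cutP e i y \<partial>?E)) - (\<Sum>i=1..n. x i * (\<integral>y. Jint (kP e i) y \<partial>?L))"
    by (simp add: Acoef_def right_diff_distrib sum_subtractf)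
  then have "Dfun e x - Dfun e (\<lambda>_. 0) - (\<Sum>i=1..n. x i * Acoef e i) = (\<integral>y. vv y * h y \<partial>?E) - (\<integral>y. Jint (kF e x) y \<partial>?L)"
    unfolding I1 I2 representation[OF e] by linarith
  then show ?thesis using 1 Jint_kF_integral[OF e \<tau> x] by linarith
qed

end

section \<open>The limit of vanishing regularisation\<close>

context dini_problem
begin

text \<open>The factor in front of \<open>vv x\<close> in the limit of \<open>Dfun\<close>: the
  total mass of the bubble times n (n - 2).\<close>

definition NN :: real where "NN = real n * (real n - 2) * bubint n"

lemma NN_pos: "0 < NN"
  unfolding NN_def using n3 bubint_pos[of n] by (intro mult_pos_pos) auto

definition epsk :: "nat \<Rightarrow> real" where "epsk k = 1 / real (Suc k)"

lemma epsk: "0 < epsk k" "epsk \<longlonglongrightarrow> 0"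
  unfolding epsk_def[abs_def] by (simp, rule LIMSEQ_Suc[OF lim_1_over_n])

lemma rho_lt_R: "\<rho> < R"
  using rho by linarith

text \<open>The function \<open>vv\<close> may jump at the sphere of radius R, but the rescaled
  points converge to x and eventually lie in the ball, where it is continuous; at x itself the
  cut-off is 1.\<close>

lemma Dfun_tendsto:
  assumes x: "x \<in> euc n" "enorm n x < \<rho>"
  shows "(\<lambda>k. Dfun ((epsk k)\<^sup>2) x) \<longlonglongrightarrow> NN * vv x"
proof -
  let ?w = "\<lambda>y. cutoff \<rho> 0 ((enorm n y)\<^sup>2) * vv y"
  let ?f = "\<lambda>y. cutoff \<rho> 0 ((enorm n y)\<^sup>2) * (u y - g0 * max 0 (y n))"
  have xR: "x \<in> euc_ball n R" using x rho_lt_R by (simp add: euc_ball_def)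
  have sub: "euc_ball n R \<subseteq> euc n" by (auto simp: euc_ball_def)
  have fc: "continuous_on (euc_ball n R) ?f"
    by (intro continuous_intros continuous_on_subset[OF cutoff_continuous sub] continuous_on_subset[OF u_cont ball_R_subset])
  have fw: "?w y = ?f y" if "y \<in> euc_ball n R" for y using that by (simp add: vv_def)
  have wm: "?w \<in> borel_measurable (elebesgue n)"
    by (intro borel_measurable_times continuous_measurable_euc[OF cutoff_continuous] vv_measurable)
  have "(\<lambda>k. \<integral>y. ?w y * ((epsk k)\<^sup>2 * bub n ((epsk k)\<^sup>2) 2 ((enorm n (\<lambda>j. y j - x j))\<^sup>2)) \<partial>elebesgue n) \<longlonglongrightarrow> bubint n * ?w x"
  proof (rule bubble_approximate_identity[OF _ wm _ epsk(1)])
    show "n \<ge> 1" using n3 by simp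
    show "\<bar>?w y\<bar> \<le> 1 * V" for y
      unfolding abs_mult using cutoff_01[of \<rho> "(enorm n y)\<^sup>2"] by (intro mult_mono vv_bound) auto
    fix z :: vec assume "z \<in> euc n"
    let ?T = "\<lambda>k. evec n (\<lambda>i. x i + epsk k * z i)"
    have lim: "?T \<longlonglongrightarrow> x" by (rule tendsto_affine_euc[OF x(1) epsk(2)])
    have "isCont (enorm n) x" using continuous_on_enorm[of UNIV n] by (simp add: continuous_on_eq_continuous_at)
    from isCont_tendsto_compose[OF this lim] have "\<forall>\<^sub>F k in sequentially. enorm n (?T k) < R"
      using order_tendstoD(2) x(2) rho_lt_R less_trans by blast
    then have ev: "\<forall>\<^sub>F k in sequentially. ?T k \<in> euc_ball n R" by eventually_elim (simp add: euc_ball_def)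
    have "(\<lambda>k. ?f (?T k)) \<longlonglongrightarrow> ?f x" by (rule continuous_on_tendsto_compose[OF fc lim xR ev])
    then show "(\<lambda>k. ?w (?T k)) \<longlonglongrightarrow> ?w x"
      unfolding fw[OF xR] by (rule Lim_transform_eventually) (use ev in eventually_elim, simp only: fw)
  qed
  moreover have "cutoff \<rho> 0 ((enorm n x)\<^sup>2) = 1" using x by (intro cutoff_0_eq_1 rho) auto
  ultimately show ?thesis unfolding Dfun_def NN_def by (simp add: mult.assoc tendsto_mult_left)
qed

definition Abound :: real where
  "Abound = unit_ball_vol n * 2 ^ n * V * (K7 / \<rho>) + K2 * sph n * (dint \<omega>g R + \<bar>g0\<bar> * dint \<omega> R)"

text \<open>By the Dini bounds the coefficient vectors lie in a fixed compact ball for all e, so a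
  subsequence converges, and the expansion, being uniform in e, passes to the limit. The same vector
  a serves all x and all \<tau>.\<close>

lemma linear_approximation:
  obtains a where "a \<in> euc n" "enorm n a \<le> real n * Abound / NN"
    "\<And>x \<tau>. x \<in> euc n \<Longrightarrow> 0 < \<tau> \<Longrightarrow> real n * \<tau> \<le> \<rho> \<Longrightarrow> 2 * enorm n x \<le> \<tau> \<Longrightarrow>
      \<bar>vv x - vv (ezero n) - einner n a x\<bar>
        \<le> (unit_ball_vol n * 2 ^ n * V * (K6 * ((enorm n x)\<^sup>2 / \<rho>\<^sup>2)) + K5 * rem (enorm n x) \<tau>) / NN"
proof -
  define A where "A k = evec n (Acoef ((epsk k)\<^sup>2))" for k
  have e: "0 < (epsk k)\<^sup>2" for k using epsk(1)[of k] by simp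
  have Ai: "A k i = Acoef ((epsk k)\<^sup>2) i" if "i \<in> {1..n}" for k i using that by (simp add: A_def evec_def)
  have "enorm n (A k) \<le> real n * Abound" for k
  proof -
    have "enorm n (A k) \<le> (\<Sum>i=1..n. \<bar>A k i\<bar>)" unfolding enorm_def by (rule L2_set_le_sum_abs)
    also have "\<dots> \<le> (\<Sum>i=1..n. Abound)"
      using Acoef_bound[OF e] by (intro sum_mono) (simp add: Ai Abound_def)
    finally show ?thesis by simp
  qed
  then have Ain: "A k \<in> {x\<in>euc n. enorm n x \<le> real n * Abound}" for k by (simp add: A_def)
  have "seq_compact {x\<in>euc n. enorm n x \<le> real n * Abound}"
    by (intro compact_imp_seq_compact compact_euc_cball)
  from this[unfolded seq_compact_def, rule_format, of A] Ain
  obtain a' s where a': "a' \<in> {x\<in>euc n. enorm n x \<le> real n * Abound}" and s: "strict_mono (s :: nat \<Rightarrow> nat)" "(A \<circ> s) \<longlonglongrightarrow> a'"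
    by auto
  have Alim: "(\<lambda>k. Acoef ((epsk (s k))\<^sup>2) i) \<longlonglongrightarrow> a' i" if i: "i \<in> {1..n}" for i
  proof -
    have "isCont (\<lambda>x :: vec. x i) a'"
      using continuous_on_eq_continuous_at[OF open_UNIV, THEN iffD1, OF continuous_on_coord] by blast
    from isCont_tendsto_compose[OF this s(2)] show ?thesis using Ai[OF i] by (simp add: o_def)
  qed
  define a where "a = evec n (\<lambda>i. a' i / NN)"
  show ?thesis
  proof (rule that)
    show "a \<in> euc n" by (simp add: a_def)
    have "enorm n a = enorm n (\<lambda>i. (1 / NN) * a' i)" by (rule enorm_cong) (simp add: a_def evec_def)
    also have "\<dots> = enorm n a' / NN" unfolding enorm_scale using NN_pos by simp
    also have "\<dots> \<le> real n * Abound / NN" using a' NN_pos by (intro divide_right_mono) auto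
    finally show "enorm n a \<le> real n * Abound / NN" .
    fix x \<tau> assume x: "x \<in> euc n" and \<tau>: "0 < \<tau>" "real n * \<tau> \<le> \<rho>" and x2: "2 * enorm n x \<le> \<tau>"
    let ?E = "unit_ball_vol n * 2 ^ n * V * (K6 * ((enorm n x)\<^sup>2 / \<rho>\<^sup>2)) + K5 * rem (enorm n x) \<tau>"
    have xr: "enorm n x < \<rho>"
    proof -
      have "\<tau> \<le> real n * \<tau>" using n3 \<tau> mult_right_mono[of 1 "real n" \<tau>] by simp
      then show ?thesis using x2 \<tau> rho by linarith
    qed
    have sub: "f (s k) = (f \<circ> s) k" for f :: "nat \<Rightarrow> real" and k by simp
    have l1: "(\<lambda>k. Dfun ((epsk (s k))\<^sup>2) x) \<longlonglongrightarrow> NN * vv x"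
      using LIMSEQ_subseq_LIMSEQ[OF Dfun_tendsto[OF x xr] s(1)] by (simp add: o_def)
    have z: "ezero n \<in> euc n" "enorm n (ezero n) < \<rho>" using rho by (simp_all add: ezero_def enorm_alt)
    \<comment> \<open>\<open>ezero n\<close> and \<open>\<lambda>_. 0\<close> differ outside the
      index range, which \<open>Dfun\<close> does not see.\<close>
    have D0: "Dfun d (ezero n) = Dfun d (\<lambda>_. 0)" for d
    proof -
      have "enorm n (\<lambda>j. y j - ezero n j) = enorm n (\<lambda>j. y j - 0)" for y
        by (rule enorm_cong) (simp add: ezero_def evec_def)
      then show ?thesis by (simp add: Dfun_def)
    qed
    have l0: "(\<lambda>k. Dfun ((epsk (s k))\<^sup>2) (\<lambda>_. 0)) \<longlonglongrightarrow> NN * vv (ezero n)"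
      using LIMSEQ_subseq_LIMSEQ[OF Dfun_tendsto[OF z] s(1)] by (simp add: o_def D0)
    have "(\<lambda>k. \<bar>Dfun ((epsk (s k))\<^sup>2) x - Dfun ((epsk (s k))\<^sup>2) (\<lambda>_. 0) - (\<Sum>i=1..n. x i * Acoef ((epsk (s k))\<^sup>2) i)\<bar>)
      \<longlonglongrightarrow> \<bar>NN * vv x - NN * vv (ezero n) - (\<Sum>i=1..n. x i * a' i)\<bar>"
      by (intro tendsto_intros l1 l0 Alim)
    then have "\<bar>NN * vv x - NN * vv (ezero n) - (\<Sum>i=1..n. x i * a' i)\<bar> \<le> ?E"
      by (rule tendsto_upperbound) (use expansion[OF e \<tau> x2] in auto)
    also have "NN * vv x - NN * vv (ezero n) - (\<Sum>i=1..n. x i * a' i) = NN * (vv x - vv (ezero n) - einner n a x)"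
    proof -
      have "einner n a x = (\<Sum>i=1..n. x i * a' i) / NN"
        unfolding einner_def sum_divide_distrib by (intro sum.cong) (auto simp: a_def evec_def)
      then show ?thesis using NN_pos by (simp add: right_diff_distrib)
    qed
    finally show "\<bar>vv x - vv (ezero n) - einner n a x\<bar> \<le> ?E / NN"
      using NN_pos by (simp add: abs_mult pos_le_divide_eq mult.commute)
  qed
qed

end

section \<open>The modulus of the error\<close>

text \<open>The error divided by r. The term \<open>A * r\<close> is the quadratic error of the
  annulus integral, B multiplies \<open>rem r (M * r) / r\<close>, and the last summand accounts for
  the strip between graph and hyperplane, where max(0, x_n) is replaced by x_n or by 0.\<close>

definition err_scale :: "real \<Rightarrow> real \<Rightarrow> real \<Rightarrow> (real \<Rightarrow> real) \<Rightarrow> (real \<Rightarrow> real) \<Rightarrow> nat \<Rightarrow> real \<Rightarrow> real \<Rightarrow> real" where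
  "err_scale A B c w v n M r = A * r + B * (M * (v (8 * real n * (M * r)) + c * sqrt (w (8 * real n * (M * r))))
     + (dint v (8 * real n * (M * r)) + c * dint w (8 * real n * (M * r))) + (c + v 1) / M) + c * (real n * w (8 * real n * r))"

text \<open>
  The expansion at scale \<open>r\<close> is done with a cut at distance \<open>M * r\<close>, where the factor \<open>M\<close> is free;
  it has to grow slowly as \<open>r\<close> tends to \<open>0\<close>, and the infimum makes the optimal choice.
\<close>

definition err_modulus :: "real \<Rightarrow> real \<Rightarrow> real \<Rightarrow> real \<Rightarrow> real \<Rightarrow> (real \<Rightarrow> real) \<Rightarrow> (real \<Rightarrow> real) \<Rightarrow> nat \<Rightarrow> real \<Rightarrow> real" where
  "err_modulus A B T q c w v n r = (if real n * (2 * r) \<le> q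
     then INF M\<in>{M. 2 \<le> M \<and> real n * (M * r) \<le> q}. err_scale A B c w v n M r else T / r)"

lemma err_scale_nonneg:
  assumes "dini w" "dini v" "0 \<le> A" "0 \<le> B" "0 \<le> c" "0 \<le> r" "0 < M"
  shows "0 \<le> err_scale A B c w v n M r"
  unfolding err_scale_def using assms
  by (intro add_nonneg_nonneg mult_nonneg_nonneg divide_nonneg_nonneg dint_nonneg dini_nonneg[OF assms(1)] dini_nonneg[OF assms(2)] real_sqrt_ge_zero) auto

lemma tendsto_at_right_0_scale:
  fixes f :: "real \<Rightarrow> real"
  assumes "(f \<longlongrightarrow> l) (at_right 0)" "c > 0"
  shows "((\<lambda>r. f (c * r)) \<longlongrightarrow> l) (at_right 0)"
proof (rule filterlim_compose[OF assms(1)])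
  have "((\<lambda>r. c * r) \<longlongrightarrow> c * 0) (at_right 0)" by (intro tendsto_intros)
  then show "filterlim (\<lambda>r. c * r) (at_right 0) (at_right 0)"
    unfolding filterlim_at using assms(2) by (auto simp: eventually_at_filter)
qed

lemma dini_tendsto_0:
  assumes "dini w" "w 0 = 0"
  shows "(w \<longlongrightarrow> 0) (at_right 0)"
proof -
  have "(w \<longlongrightarrow> w 0) (at 0 within {0..})" using assms(1) by (simp add: dini_def continuous_on_def)
  then show ?thesis unfolding assms(2) by (rule tendsto_within_subset) auto
qed

lemma err_modulus_tendsto_0:
  assumes d: "dini w" "dini v" and w0: "w 0 = 0" "v 0 = 0" and c: "0 \<le> A" "0 \<le> B" "0 \<le> c" and q: "0 < q" and n: "n \<ge> 1"
  shows "(err_modulus A B T q c w v n \<longlongrightarrow> 0) (at_right 0)"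
proof (rule tendstoI)
  fix \<delta> :: real assume \<delta>: "0 < \<delta>"
  have v1: "0 \<le> v 1" using dini_nonneg[OF d(2)] by simp
  \<comment> \<open>The term (c + v 1)/M does not improve as r decreases, so M is fixed first, large
    enough to keep B times this term below \<delta>. With M fixed all other terms tend to 0.\<close>
  define M where "M = 2 + 2 * B * (c + v 1) / \<delta>"
  have M: "2 \<le> M" using c v1 \<delta> by (simp add: M_def)
  have M0: "0 < M" using M by simp
  have "B * ((c + v 1) / M) < \<delta>"
  proof -
    have "\<delta> * M = 2 * \<delta> + 2 * (B * (c + v 1))" using \<delta> by (simp add: M_def field_simps)
    moreover have "0 \<le> B * (c + v 1)" using c v1 by simp
    ultimately have "B * (c + v 1) < \<delta> * M" using \<delta> by linarith
    then show ?thesis using M0 by (simp add: pos_divide_less_eq)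
  qed
  moreover have "((\<lambda>r. err_scale A B c w v n M r) \<longlongrightarrow> A * 0 + B * (M * (0 + c * sqrt 0) + (0 + c * 0) + (c + v 1) / M) + c * (real n * 0)) (at_right 0)"
  proof -
    have k: "8 * real n * M > 0" "8 * real n > 0" using n M by auto
    have l1: "((\<lambda>r. f (8 * real n * (M * r))) \<longlongrightarrow> 0) (at_right 0)" if "(f \<longlongrightarrow> 0) (at_right 0)" for f :: "real \<Rightarrow> real"
      using tendsto_at_right_0_scale[OF that k(1)] by (simp only: mult.assoc)
    note l = l1[OF dini_tendsto_0[OF d(1) w0(1)]] l1[OF dini_tendsto_0[OF d(2) w0(2)]]
      l1[OF dint_tendsto_0[OF d(1)]] l1[OF dint_tendsto_0[OF d(2)]] tendsto_at_right_0_scale[OF dini_tendsto_0[OF d(1) w0(1)] k(2)]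
    define C where "C = (c + v 1) / M"
    show ?thesis unfolding err_scale_def C_def[symmetric]
      by (rule tendsto_add[OF tendsto_add[OF tendsto_mult[OF tendsto_const tendsto_ident_at]
            tendsto_mult[OF tendsto_const tendsto_add[OF tendsto_add[OF tendsto_mult[OF tendsto_const
              tendsto_add[OF l(2) tendsto_mult[OF tendsto_const tendsto_real_sqrt[OF l(1)]]]]
              tendsto_add[OF l(4) tendsto_mult[OF tendsto_const l(3)]]] tendsto_const]]]
            tendsto_mult[OF tendsto_const tendsto_mult[OF tendsto_const l(5)]]])
  qed
  ultimately have 1: "\<forall>\<^sub>F r in at_right 0. err_scale A B c w v n M r < \<delta>"
    by (intro order_tendstoD(2)) auto
  have "((\<lambda>r. real n * (M * r)) \<longlongrightarrow> real n * (M * 0)) (at_right 0)" by (intro tendsto_intros)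
  then have 2: "\<forall>\<^sub>F r in at_right 0. real n * (M * r) < q" using q by (intro order_tendstoD(2)) auto
  have 3: "\<forall>\<^sub>F r in at_right (0::real). 0 < r" by (rule eventually_at_right_less)
  show "\<forall>\<^sub>F r in at_right 0. dist (err_modulus A B T q c w v n r) 0 < \<delta>"
    using 1 2 3
  proof eventually_elim
    case (elim r)
    let ?S = "{M. 2 \<le> M \<and> real n * (M * r) \<le> q}"
    have nn: "0 \<le> err_scale A B c w v n M' r" if "M' \<in> ?S" for M'
      using that elim by (intro err_scale_nonneg d c) auto
    have MS: "M \<in> ?S" using M elim by simp
    have "real n * (2 * r) \<le> real n * (M * r)" using M elim by (intro mult_left_mono mult_right_mono) auto
    then have eq: "err_modulus A B T q c w v n r = (INF M\<in>?S. err_scale A B c w v n M r)"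
      using elim by (simp add: err_modulus_def)
    have "(INF M\<in>?S. err_scale A B c w v n M r) \<le> err_scale A B c w v n M r"
      by (intro cINF_lower MS bdd_belowI2[of _ 0] nn)
    moreover have "0 \<le> (INF M\<in>?S. err_scale A B c w v n M r)"
      using MS by (intro cINF_greatest nn) blast+
    ultimately show ?case unfolding eq using elim by simp
  qed
qed

lemma Linf_norm_le:
  assumes c: "continuous_on S u" "S \<subseteq> euc n" and le: "\<And>x. x \<in> S \<Longrightarrow> \<bar>u x\<bar> \<le> B" and B: "0 \<le> B" and S: "S \<in> sets (elebesgue n)"
  shows "Linf_norm n S u \<le> B"
proof -
  let ?M = "restrict_space (elebesgue n) S"
  have um: "u \<in> borel_measurable ?M" by (rule continuous_on_measurable_euc[OF c])
  have fm: "(\<lambda>x. ereal \<bar>u x\<bar>) \<in> borel_measurable ?M" using um by measurable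
  have "esssup ?M (\<lambda>x. ereal \<bar>u x\<bar>) \<le> ereal B"
    by (rule esssup_I[OF fm]) (use le c(2) in \<open>auto intro!: AE_I2 simp: space_restrict_space\<close>)
  \<comment> \<open>On a null set the essential supremum may be minus infinity, which
    \<open>real_of_ereal\<close> maps to 0; the assumption B \<ge> 0 covers that case.\<close>
  then show ?thesis unfolding Linf_norm_def using B by (cases "esssup ?M (\<lambda>x. ereal \<bar>u x\<bar>)") auto
qed

text \<open>A function of the modulus alone, which is the dependence claimed for the radius. The
  bound on the modulus serves the chart; the bound on its Dini integral keeps \<omega> out of the
  final estimate of the coefficients.\<close>

definition rad_choice :: "(real \<Rightarrow> real) \<Rightarrow> real" where
  "rad_choice w = (SOME R. 0 < R \<and> R \<le> 1 \<and> w R \<le> 1 \<and> dint w R \<le> 1)"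

lemma rad_choice:
  assumes "dini w" "w 0 = 0"
  shows "0 < rad_choice w" "rad_choice w \<le> 1" "w (rad_choice w) \<le> 1" "dint w (rad_choice w) \<le> 1"
proof -
  have "\<forall>\<^sub>F r in at_right 0. w r < 1" using dini_tendsto_0[OF assms] by (rule order_tendstoD(2)) simp
  moreover have "\<forall>\<^sub>F r in at_right 0. dint w r < 1" using dint_tendsto_0[OF assms(1)] by (rule order_tendstoD(2)) simp
  moreover have "\<forall>\<^sub>F r in at_right (0::real). 0 < r" by (rule eventually_at_right_less)
  moreover have "\<forall>\<^sub>F r in at_right (0::real). r < 1" by (rule order_tendstoD(2)[OF tendsto_ident_at]) simp
  ultimately have "\<forall>\<^sub>F r in at_right 0. 0 < r \<and> r \<le> 1 \<and> w r \<le> 1 \<and> dint w r \<le> 1"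
    by eventually_elim auto
  then have "\<exists>R. 0 < R \<and> R \<le> 1 \<and> w R \<le> 1 \<and> dint w R \<le> 1"
    using eventually_happens trivial_limit_at_right_real by blast
  from someI_ex[OF this]
  show "0 < rad_choice w" "rad_choice w \<le> 1" "w (rad_choice w) \<le> 1" "dint w (rad_choice w) \<le> 1"
    by (simp_all add: rad_choice_def)
qed

section \<open>Bounds for the coefficients and the error in terms of the data\<close>

context dini_problem
begin

definition CA :: real where
  "CA = real n / NN * (16 * real n * (unit_ball_vol n * 2 ^ n * K7) + K2 * sph n)"

lemma CA_nonneg: "0 \<le> CA"
proof -
  have "0 \<le> sph n" using sph_pos[OF n2] by simp
  then show ?thesis unfolding CA_def using K2_nonneg NN_pos K67_nonneg
    by (intro mult_nonneg_nonneg add_nonneg_nonneg divide_nonneg_nonneg) auto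
qed

definition U :: real where "U = Linf_norm n (euc_ball n 1) u"

text \<open>The bracket on the right of the final estimate.\<close>

definition S :: real where "S = Linf_norm n (euc_ball n R) u + R * \<bar>g0\<bar> + R * dint \<omega>g R"

lemma abs_u_le_U: "x \<in> euc_ball n 1 \<Longrightarrow> \<bar>u x\<bar> \<le> U"
  unfolding U_def by (rule abs_le_Linf_norm[OF zero_less_one u_cont u_bdd])

lemma zero_in_ball: "ezero n \<in> euc_ball n R"
  using R by (simp add: euc_ball_def ezero_def enorm_alt)

lemma U_nonneg: "0 \<le> U"
  using abs_u_le_U[of "ezero n"] zero_in_ball ball_R_subset by fastforce

lemma Linf_R_le_U: "Linf_norm n (euc_ball n R) u \<le> U"
proof (rule Linf_norm_le)
  show "continuous_on (euc_ball n R) u" by (rule continuous_on_subset[OF u_cont ball_R_subset])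
  show "\<bar>u x\<bar> \<le> U" if "x \<in> euc_ball n R" for x using abs_u_le_U that ball_R_subset by auto
qed (use U_nonneg in \<open>auto simp: euc_ball_def simp del: euc_ball_sets intro: euc_ball_sets[unfolded euc_ball_def]\<close>)

lemma S_bounds: "V \<le> S" "R * dint \<omega>g R + R * \<bar>g0\<bar> \<le> S" "0 \<le> S" "S \<le> U + \<bar>g0\<bar> + dint \<omega>g R" "V \<le> U + \<bar>g0\<bar>"
  "\<bar>vv (ezero n)\<bar> \<le> S" "R * \<bar>g0\<bar> \<le> S"
proof -
  have d: "0 \<le> dint \<omega>g R" by (rule dint_nonneg[OF dini_wg])
  have Rg: "R * \<bar>g0\<bar> \<le> \<bar>g0\<bar>" "R * dint \<omega>g R \<le> dint \<omega>g R" "0 \<le> R * \<bar>g0\<bar>" "0 \<le> R * dint \<omega>g R"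
    using R d by (simp_all add: mult_left_le_one_le)
  have L: "0 \<le> Linf_norm n (euc_ball n R) u" using u_bound[OF zero_in_ball] by linarith
  show "V \<le> S" "R * dint \<omega>g R + R * \<bar>g0\<bar> \<le> S" "0 \<le> S" "R * \<bar>g0\<bar> \<le> S" using Rg L by (simp_all add: S_def V_def)
  show "S \<le> U + \<bar>g0\<bar> + dint \<omega>g R" "V \<le> U + \<bar>g0\<bar>" using Rg Linf_R_le_U by (simp_all add: S_def V_def)
  show "\<bar>vv (ezero n)\<bar> \<le> S" using vv_bound[of "ezero n"] \<open>V \<le> S\<close> by linarith
qed

text \<open>The ratio R/\<rho> is 16 n, so multiplication by R makes the coefficient of V in the
  annulus term a dimensional constant. The assumption on \<open>dint \<omega> R\<close> replaces
  |g(0)| times this integral by |g(0)|.\<close>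

lemma R_Abound_le:
  assumes "dint \<omega> R \<le> 1"
  shows "R * (real n * Abound / NN) \<le> CA * S"
proof -
  let ?c = "unit_ball_vol n * 2 ^ n * K7"
  have c: "0 \<le> ?c" using K67_nonneg by simp
  have k: "0 \<le> K2 * sph n" using K2_nonneg sph_pos[OF n2] by (intro mult_nonneg_nonneg) auto
  have "R / \<rho> = 16 * real n" using n3 R by (simp add: \<rho>_def r0_def)
  moreover have "R * (unit_ball_vol n * 2 ^ n * V * (K7 / \<rho>)) = (R / \<rho> * ?c) * V" by simp
  ultimately have "R * (unit_ball_vol n * 2 ^ n * V * (K7 / \<rho>)) = (16 * real n * ?c) * V" by (simp only:)
  also have "\<dots> \<le> (16 * real n * ?c) * S" using c S_bounds(1) by (intro mult_left_mono) auto
  finally have 1: "R * (unit_ball_vol n * 2 ^ n * V * (K7 / \<rho>)) \<le> (16 * real n * ?c) * S" .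
  have "R * (K2 * sph n * (dint \<omega>g R + \<bar>g0\<bar> * dint \<omega> R)) = K2 * sph n * (R * dint \<omega>g R + R * (\<bar>g0\<bar> * dint \<omega> R))"
    by (simp add: algebra_simps)
  also have "\<dots> \<le> K2 * sph n * (R * dint \<omega>g R + R * (\<bar>g0\<bar> * 1))"
    using k assms R by (intro mult_left_mono add_left_mono) auto
  also have "\<dots> \<le> K2 * sph n * S" using k S_bounds(2) by (intro mult_left_mono) auto
  finally have 2: "R * (K2 * sph n * (dint \<omega>g R + \<bar>g0\<bar> * dint \<omega> R)) \<le> K2 * sph n * S" .
  have "R * Abound = R * (unit_ball_vol n * 2 ^ n * V * (K7 / \<rho>)) + R * (K2 * sph n * (dint \<omega>g R + \<bar>g0\<bar> * dint \<omega> R))"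
    unfolding Abound_def by (rule distrib_left)
  also have "\<dots> \<le> (16 * real n * ?c) * S + K2 * sph n * S" by (rule add_mono[OF 1 2])
  also have "\<dots> = (16 * real n * ?c + K2 * sph n) * S" by (simp only: distrib_right)
  finally have "R * Abound \<le> (16 * real n * ?c + K2 * sph n) * S" .
  then have "real n / NN * (R * Abound) \<le> real n / NN * ((16 * real n * ?c + K2 * sph n) * S)"
    using NN_pos by (intro mult_left_mono) auto
  then show ?thesis by (simp add: CA_def mult_ac)
qed

lemma rem_scale:
  assumes "0 \<le> s" "s \<le> r" "0 < r" "0 < M"
  shows "rem s (M * r) \<le> r * (M * (Og (M * r) + \<bar>g0\<bar> * sqrt (Om (M * r)))
     + (dint \<omega>g (8 * real n * (M * r)) + \<bar>g0\<bar> * dint \<omega> (8 * real n * (M * r))) + (\<bar>g0\<bar> + \<omega>g 1) / M)"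
proof -
  let ?D = "dint \<omega>g (8 * real n * (M * r)) + \<bar>g0\<bar> * dint \<omega> (8 * real n * (M * r))"
  have D: "0 \<le> ?D" using dint_nonneg[OF dini_wg] dint_nonneg[OF dini_w] by simp
  have v1: "0 \<le> \<bar>g0\<bar> + \<omega>g 1" using dini_nonneg[OF dini_wg, of 1] by simp
  have 1: "s * ?D \<le> r * ?D" using assms D by (intro mult_right_mono)
  have "(\<bar>g0\<bar> + \<omega>g 1) * s\<^sup>2 / (M * r) \<le> (\<bar>g0\<bar> + \<omega>g 1) * r\<^sup>2 / (M * r)"
    using assms v1 by (intro divide_right_mono mult_left_mono power_mono) auto
  also have "\<dots> = r * ((\<bar>g0\<bar> + \<omega>g 1) / M)" using assms by (simp add: power2_eq_square)
  finally have 2: "(\<bar>g0\<bar> + \<omega>g 1) * s\<^sup>2 / (M * r) \<le> r * ((\<bar>g0\<bar> + \<omega>g 1) / M)" .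
  have "r * (M * x + d + f) = M * r * x + r * d + r * f" for x d f by (simp add: algebra_simps)
  then show ?thesis unfolding rem_def using 1 2 by simp
qed

lemma psi_le:
  assumes x: "x \<in> euc n" "enorm n x < r" and r: "0 < r" "r \<le> r0"
  shows "\<bar>\<psi> (evec (n - 1) x)\<bar> \<le> real n * Om r * r"
proof -
  let ?y = "evec (n - 1) x"
  have "enorm (n - 1) ?y = enorm (n - 1) x" by (rule enorm_cong) simp
  then have y: "enorm (n - 1) ?y < r" using enorm_pred_le[OF n2, of x] x by simp
  have s: "0 < 8 * real n * r" "8 * real n * r \<le> R" "r \<le> 8 * real n * r / (2 * real n)"
    using r n3 by (simp_all add: r0_def field_simps)
  have "\<bar>\<psi> ?y\<bar> \<le> real (n - 1) * \<omega> (8 * real n * r) * enorm (n - 1) ?y"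
    by (rule small(1)[OF s(1,2)]) (use y s(3) in auto)
  also have "\<dots> \<le> real n * \<omega> (8 * real n * r) * r"
    using y om_nonneg[of "8 * real n * r"] s by (intro mult_mono) auto
  finally show ?thesis by (simp add: Om_def)
qed

abbreviation Acon :: real where "Acon \<equiv> unit_ball_vol n * 2 ^ n * (U + \<bar>g0\<bar>) * K6 / \<rho>\<^sup>2 / NN"

text \<open>It will be used with s = x_n above the graph and s = 0 below it. Then max(0, x_n)
  differs from s only between the hyperplane and the graph, by at most |\<psi>|, which is o(r). This
  transfers the expansion from the two sides of the hyperplane to the two sides of the
  graph.\<close>

lemma scale_error:
  assumes a: "\<And>x \<tau>. x \<in> euc n \<Longrightarrow> 0 < \<tau> \<Longrightarrow> real n * \<tau> \<le> \<rho> \<Longrightarrow> 2 * enorm n x \<le> \<tau> \<Longrightarrow>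
      \<bar>vv x - vv (ezero n) - einner n a x\<bar>
        \<le> (unit_ball_vol n * 2 ^ n * V * (K6 * ((enorm n x)\<^sup>2 / \<rho>\<^sup>2)) + K5 * rem (enorm n x) \<tau>) / NN"
    and x: "x \<in> euc n" "enorm n x < r" and M: "2 \<le> M" "real n * (M * r) \<le> \<rho>"
    and s: "\<bar>max 0 (x n) - s\<bar> \<le> \<bar>\<psi> (evec (n - 1) x)\<bar>"
  shows "\<bar>u x - (einner n a x + g0 * s + vv (ezero n))\<bar> \<le> r * err_scale Acon (K5 / NN) \<bar>g0\<bar> \<omega> \<omega>g n M r"
proof -
  let ?t = "enorm n x"
  have r: "0 < r" using x enorm_nonneg[of n x] by linarith
  have Mr: "0 < M * r" using M r by simp
  have M2: "2 * r \<le> M * r" using M r by (intro mult_right_mono) auto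
  have rr: "r \<le> r0"
    using tau_lt_r0[OF M(2) Mr] M2 r by linarith
  have xR: "x \<in> euc_ball n R" using x rr rho by (simp add: euc_ball_def)
  have vx: "vv x = u x - g0 * max 0 (x n)" using xR by (simp add: vv_def)
  let ?E = "M * (Og (M * r) + \<bar>g0\<bar> * sqrt (Om (M * r)))
     + (dint \<omega>g (8 * real n * (M * r)) + \<bar>g0\<bar> * dint \<omega> (8 * real n * (M * r))) + (\<bar>g0\<bar> + \<omega>g 1) / M"
  have "\<bar>vv x - vv (ezero n) - einner n a x\<bar>
        \<le> (unit_ball_vol n * 2 ^ n * V * (K6 * (?t\<^sup>2 / \<rho>\<^sup>2)) + K5 * rem ?t (M * r)) / NN"
    by (rule a[OF x(1) Mr M(2)]) (use x M2 in linarith)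
  also have "\<dots> \<le> (unit_ball_vol n * 2 ^ n * (U + \<bar>g0\<bar>) * (K6 * ((r * r) / \<rho>\<^sup>2)) + K5 * (r * ?E)) / NN"
  proof (intro divide_right_mono add_mono)
    have "?t\<^sup>2 \<le> r * r" unfolding power2_eq_square using x r by (intro mult_mono) auto
    then show "unit_ball_vol n * 2 ^ n * V * (K6 * (?t\<^sup>2 / \<rho>\<^sup>2)) \<le> unit_ball_vol n * 2 ^ n * (U + \<bar>g0\<bar>) * (K6 * ((r * r) / \<rho>\<^sup>2))"
      using S_bounds(5) V_nonneg K67_nonneg by (intro mult_mono divide_right_mono) auto
    show "K5 * rem ?t (M * r) \<le> K5 * (r * ?E)"
      using x r M by (intro mult_left_mono rem_scale Ks_nonneg) auto
    show "0 \<le> NN" using NN_pos by simp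
  qed
  also have "\<dots> = r * (Acon * r + K5 / NN * ?E)"
    by (simp only: add_divide_distrib distrib_left) (simp add: mult_ac)
  finally have 1: "\<bar>vv x - vv (ezero n) - einner n a x\<bar> \<le> r * (Acon * r + K5 / NN * ?E)" .
  have "\<bar>g0 * (max 0 (x n) - s)\<bar> \<le> \<bar>g0\<bar> * (real n * Om r * r)"
    unfolding abs_mult using s psi_le[OF x r rr] by (intro mult_left_mono) auto
  also have "\<dots> = r * (\<bar>g0\<bar> * (real n * Om r))" by simp
  finally have 2: "\<bar>g0 * (max 0 (x n) - s)\<bar> \<le> r * (\<bar>g0\<bar> * (real n * Om r))" .
  have "u x - (einner n a x + g0 * s + vv (ezero n)) = (vv x - vv (ezero n) - einner n a x) + g0 * (max 0 (x n) - s)"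
    unfolding vx by (simp add: right_diff_distrib)
  then have "\<bar>u x - (einner n a x + g0 * s + vv (ezero n))\<bar> \<le> r * (Acon * r + K5 / NN * ?E) + r * (\<bar>g0\<bar> * (real n * Om r))"
    using 1 2 by linarith
  also have "\<dots> = r * err_scale Acon (K5 / NN) \<bar>g0\<bar> \<omega> \<omega>g n M r"
    unfolding err_scale_def Og_def Om_def by (simp only: distrib_left[of r])
  finally show ?thesis .
qed

text \<open>\<sigma> is written out, so that its dependence can be read off: besides constants of
  the dimension, its arguments are built from U, |g(0)|, the two moduli, and the lengths R and
  \<rho>, which will be functions of \<omega>.\<close>

lemma main:
  assumes d1: "dint \<omega> R \<le> 1"
  defines "\<sigma> \<equiv> err_modulus Acon (K5 / NN) (U + (2 * CA + 3) * (U + \<bar>g0\<bar> + dint \<omega>g R)) \<rho> \<bar>g0\<bar> \<omega> \<omega>g n"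
  shows "\<exists>ap\<in>euc n. \<exists>am\<in>euc n. \<exists>b :: real.
     (\<forall>r. 0 < r \<and> r \<le> R \<longrightarrow>
        (\<forall>x\<in>Omega_plus n \<psi> \<inter> euc_ball n r. \<bar>u x - (einner n ap x + b)\<bar> \<le> r * \<sigma> r) \<and>
        (\<forall>x\<in>Omega_minus n \<psi> \<inter> euc_ball n r. \<bar>u x - (einner n am x + b)\<bar> \<le> r * \<sigma> r)) \<and>
     evec n (\<lambda>i. ap i - am i) = evec n (\<lambda>i. g0 * eaxis n n i) \<and>
     R * enorm n ap + R * enorm n am + \<bar>b\<bar> \<le> (2 * CA + 3) * S"
proof -
  obtain a where a: "a \<in> euc n" "enorm n a \<le> real n * Abound / NN"
    "\<And>x \<tau>. x \<in> euc n \<Longrightarrow> 0 < \<tau> \<Longrightarrow> real n * \<tau> \<le> \<rho> \<Longrightarrow> 2 * enorm n x \<le> \<tau> \<Longrightarrow>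
      \<bar>vv x - vv (ezero n) - einner n a x\<bar>
        \<le> (unit_ball_vol n * 2 ^ n * V * (K6 * ((enorm n x)\<^sup>2 / \<rho>\<^sup>2)) + K5 * rem (enorm n x) \<tau>) / NN"
    by (rule linear_approximation) blast
  define b where "b = vv (ezero n)"
  \<comment> \<open>Below the graph the gradient is that of the remainder, a. Above it the gradient
    g(0) e_n of the subtracted term is added.\<close>
  define ap where "ap = evec n (\<lambda>i. a i + g0 * eaxis n n i)"
  have nn: "n \<in> {1..n}" using n3 by simp
  have ein: "einner n ap x = einner n a x + g0 * x n" for x
  proof -
    have "einner n ap x = (\<Sum>i=1..n. a i * x i + (if i = n then g0 * x i else 0))"
      unfolding einner_def ap_def by (intro sum.cong) (auto simp: eaxis_def distrib_right)
    also have "\<dots> = einner n a x + g0 * x n" using nn by (simp add: einner_def sum.distrib)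
    finally show ?thesis .
  qed
  have Ra: "R * enorm n a \<le> CA * S"
    using mult_left_mono[OF a(2), of R] R_Abound_le[OF d1] R by linarith
  have Rap: "R * enorm n ap \<le> CA * S + S"
  proof -
    have "enorm n ap = enorm n (\<lambda>i. a i + g0 * eaxis n n i)" by (rule enorm_cong) (simp add: ap_def)
    also have "\<dots> \<le> enorm n a + enorm n (\<lambda>i. g0 * eaxis n n i)" by (rule enorm_triangle)
    also have "enorm n (\<lambda>i. g0 * eaxis n n i) = \<bar>g0\<bar>"
    proof -
      have "(enorm n (eaxis n n))\<^sup>2 = (\<Sum>i=1..n. if i = n then 1 else 0)"
        unfolding enorm_power2 by (intro sum.cong) (auto simp: eaxis_def)
      then have "(enorm n (eaxis n n))\<^sup>2 = 1" using nn by simp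
      then have "enorm n (eaxis n n) = 1" using enorm_nonneg[of n "eaxis n n"] by (simp add: power2_eq_1_iff)
      then show ?thesis unfolding enorm_scale by simp
    qed
    finally have "R * enorm n ap \<le> R * (enorm n a + \<bar>g0\<bar>)" using R by (intro mult_left_mono) auto
    then show ?thesis using Ra S_bounds(7) by (simp add: distrib_left)
  qed
  have coef: "R * enorm n ap + R * enorm n a + \<bar>b\<bar> \<le> (2 * CA + 3) * S"
  proof -
    have "(2 * CA + 3) * S = 2 * (CA * S) + 3 * S" by (simp add: algebra_simps)
    then show ?thesis using Ra Rap S_bounds(3,6) unfolding b_def by linarith
  qed
  have far: "\<bar>u x - (einner n c x + b)\<bar> \<le> U + (2 * CA + 3) * (U + \<bar>g0\<bar> + dint \<omega>g R)"
    if x: "x \<in> euc_ball n R" and c: "R * enorm n c + \<bar>b\<bar> \<le> (2 * CA + 3) * S" for x c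
  proof -
    have "\<bar>einner n c x\<bar> \<le> enorm n c * enorm n x" by (rule einner_le)
    also have "\<dots> \<le> enorm n c * R" using x by (intro mult_left_mono) (auto simp: euc_ball_def)
    finally have "\<bar>einner n c x\<bar> \<le> R * enorm n c" by (simp add: mult.commute)
    moreover have "(2 * CA + 3) * S \<le> (2 * CA + 3) * (U + \<bar>g0\<bar> + dint \<omega>g R)"
      using S_bounds(4) CA_nonneg by (intro mult_left_mono) auto
    moreover have "\<bar>u x\<bar> \<le> U" using abs_u_le_U x ball_R_subset by auto
    ultimately show ?thesis using c by linarith
  qed
  have err: "\<bar>u x - (einner n c x + b)\<bar> \<le> r * \<sigma> r"
    if x: "x \<in> euc_ball n r" and r: "0 < r" "r \<le> R" and c: "R * enorm n c + \<bar>b\<bar> \<le> (2 * CA + 3) * S"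
      and s: "\<bar>max 0 (x n) - s\<bar> \<le> \<bar>\<psi> (evec (n - 1) x)\<bar>" and cs: "einner n c x = einner n a x + g0 * s" for x r c s
  proof (cases "real n * (2 * r) \<le> \<rho>")
    case True
    let ?Ms = "{M. 2 \<le> M \<and> real n * (M * r) \<le> \<rho>}"
    have xe: "x \<in> euc n" "enorm n x < r" using x by (auto simp: euc_ball_def)
    \<comment> \<open>The polynomial was fixed before M, so the estimate for every admissible M
      bounds the same quantity and the infimum may be taken.\<close>
    have "\<bar>u x - (einner n c x + b)\<bar> / r \<le> (INF M\<in>?Ms. err_scale Acon (K5 / NN) \<bar>g0\<bar> \<omega> \<omega>g n M r)"
    proof (rule cINF_greatest)
      have "2 \<in> ?Ms" using True by simp
      then show "?Ms \<noteq> {}" by blast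
      fix M assume "M \<in> ?Ms"
      then have "\<bar>u x - (einner n a x + g0 * s + vv (ezero n))\<bar> \<le> r * err_scale Acon (K5 / NN) \<bar>g0\<bar> \<omega> \<omega>g n M r"
        by (intro scale_error a(3) xe s) auto
      then show "\<bar>u x - (einner n c x + b)\<bar> / r \<le> err_scale Acon (K5 / NN) \<bar>g0\<bar> \<omega> \<omega>g n M r"
        using r unfolding cs b_def by (simp add: pos_divide_le_eq mult.commute)
    qed
    then show ?thesis using r True by (simp add: \<sigma>_def err_modulus_def pos_divide_le_eq mult.commute)
  next
    case False
    have "x \<in> euc_ball n R" using x r by (auto simp: euc_ball_def)
    from far[OF this c] show ?thesis using False r by (simp add: \<sigma>_def err_modulus_def)
  qed
  have cp: "R * enorm n ap + \<bar>b\<bar> \<le> (2 * CA + 3) * S" "R * enorm n a + \<bar>b\<bar> \<le> (2 * CA + 3) * S"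
  proof -
    have "0 \<le> R * enorm n ap" "0 \<le> R * enorm n a" using R by auto
    then show "R * enorm n ap + \<bar>b\<bar> \<le> (2 * CA + 3) * S" "R * enorm n a + \<bar>b\<bar> \<le> (2 * CA + 3) * S"
      using coef by linarith+
  qed
  show ?thesis
  proof (rule bexI[of _ ap], rule bexI[of _ a], rule exI[of _ b], intro conjI allI impI ballI)
    fix r x assume r: "0 < r \<and> r \<le> R" and x: "x \<in> Omega_plus n \<psi> \<inter> euc_ball n r"
    show "\<bar>u x - (einner n ap x + b)\<bar> \<le> r * \<sigma> r"
      by (rule err[OF _ _ _ cp(1) _ ein]) (use r x in \<open>auto simp: Omega_plus_def\<close>)
  next
    fix r x assume r: "0 < r \<and> r \<le> R" and x: "x \<in> Omega_minus n \<psi> \<inter> euc_ball n r"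
    show "\<bar>u x - (einner n a x + b)\<bar> \<le> r * \<sigma> r"
      by (rule err[OF _ _ _ cp(2), where s=0]) (use r x in \<open>auto simp: Omega_minus_def\<close>)
  next
    show "evec n (\<lambda>i. ap i - a i) = evec n (\<lambda>i. g0 * eaxis n n i)"
      by (rule euc_eqI[of _ n]) (auto simp: ap_def)
  qed (use a coef in \<open>auto simp: ap_def\<close>)
qed

end

theorem theorem1p2:
  shows "\<exists>(Rad :: (real \<Rightarrow> real) \<Rightarrow> real)
     (sig :: nat \<Rightarrow> real \<Rightarrow> real \<Rightarrow> (real \<Rightarrow> real) \<Rightarrow> (real \<Rightarrow> real) \<Rightarrow> real \<Rightarrow> real)
     (C :: nat \<Rightarrow> real).
     \<forall>n\<ge>3. C n > 0 \<and>
       (\<forall>\<psi> g u :: vec \<Rightarrow> real.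
          ezero n \<in> Gam n \<psi> \<and>
          grad (n - 1) \<psi> (ezero (n - 1)) = ezero (n - 1) \<and>
          C1_Dini n \<psi> \<and>
          C0_Dini n \<psi> g \<and>
          continuous_on (euc_ball n 1) u \<and>
          bounded (u ` euc_ball n 1) \<and>
          distributional_solution n \<psi> g u \<longrightarrow>
          (let R = Rad (omega_grad n \<psi>);
               g0 = g (ezero n);
               \<sigma> = sig n (Linf_norm n (euc_ball n 1) u) \<bar>g0\<bar> (omega_grad n \<psi>) (omega_fun n \<psi> g)
           in 0 < R \<and> R \<le> 1 \<and> (\<sigma> \<longlongrightarrow> 0) (at_right 0) \<and>
              (\<exists>ap\<in>euc n. \<exists>am\<in>euc n. \<exists>b :: real.
                 (\<forall>r. 0 < r \<and> r \<le> R \<longrightarrow>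
                    (\<forall>x\<in>Omega_plus n \<psi> \<inter> euc_ball n r. \<bar>u x - (einner n ap x + b)\<bar> \<le> r * \<sigma> r) \<and>
                    (\<forall>x\<in>Omega_minus n \<psi> \<inter> euc_ball n r. \<bar>u x - (einner n am x + b)\<bar> \<le> r * \<sigma> r)) \<and>
                 evec n (\<lambda>i. ap i - am i) = evec n (\<lambda>i. g0 * eaxis n n i) \<and>
                 R * enorm n ap + R * enorm n am + \<bar>b\<bar>
                   \<le> C n * (Linf_norm n (euc_ball n R) u + R * \<bar>g0\<bar>
                        + R * (LBINT r:{0<..R}. omega_fun n \<psi> g r / r)))))"
proof -
  define q where "q n w = rad_choice w / (8 * real n) / 2" for n w
  \<comment> \<open>Outside the locale its constants take only the parameters that they mention,
    here n alone, and the radius is a function of w. So the claimed dependence of \<sigma> and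
    \<open>C\<close> is visible in the arguments.\<close>
  define sg where "sg n U c w v = err_modulus
      (unit_ball_vol n * 2 ^ n * (U + c) * dini_problem.K6 n / (q n w)\<^sup>2 / dini_problem.NN n)
      (dini_problem.K5 n / dini_problem.NN n) (U + (2 * dini_problem.CA n + 3) * (U + c + dint v (rad_choice w))) (q n w) c w v n" for n U c w v
  \<comment> \<open>That \<open>CA\<close> is nonnegative is known only inside the locale, that is,
    for an actual solution. The absolute value makes \<open>C n\<close> positive for every
    n.\<close>
  define C where "C n = 2 * \<bar>dini_problem.CA n\<bar> + 3" for n
  show ?thesis
  proof (intro exI[of _ rad_choice] exI[of _ sg] exI[of _ C] allI impI conjI)
    fix n :: nat assume n3: "n \<ge> 3"
    show "0 < C n" by (simp add: C_def add_nonneg_pos)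
    fix \<psi> g u :: "vec \<Rightarrow> real"
    assume asm: "ezero n \<in> Gam n \<psi> \<and> grad (n - 1) \<psi> (ezero (n - 1)) = ezero (n - 1) \<and>
          C1_Dini n \<psi> \<and> C0_Dini n \<psi> g \<and> continuous_on (euc_ball n 1) u \<and>
          bounded (u ` euc_ball n 1) \<and> distributional_solution n \<psi> g u"
    let ?w = "omega_grad n \<psi>" and ?v = "omega_fun n \<psi> g"
    let ?R = "rad_choice ?w"
    have d: "dini ?w" "?w 0 = 0" "dini ?v" "?v 0 = 0"
      using asm by (auto simp: C1_Dini_def C0_Dini_def omega_grad_def omega_fun_def sup_modulus_def)
    note rad = rad_choice[OF d(1,2)]
    interpret dini_problem n \<psi> ?R g u
      by unfold_locales (use asm n3 rad in auto)
    have qr: "q n ?w = \<rho>" by (simp add: q_def \<rho>_def r0_def)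
    have w: "?w = \<omega>" "?v = \<omega>g" by (simp_all add: \<omega>_def \<omega>g_def)
    have sig: "sg n (Linf_norm n (euc_ball n 1) u) \<bar>g (ezero n)\<bar> ?w ?v
      = err_modulus Acon (K5 / NN) (U + (2 * CA + 3) * (U + \<bar>g0\<bar> + dint \<omega>g ?R)) \<rho> \<bar>g0\<bar> \<omega> \<omega>g n"
      unfolding sg_def qr unfolding w U_def g0_def ..
    have lim: "(sg n (Linf_norm n (euc_ball n 1) u) \<bar>g (ezero n)\<bar> ?w ?v \<longlongrightarrow> 0) (at_right 0)"
      unfolding sig
    proof (rule err_modulus_tendsto_0)
      show "0 \<le> Acon" using U_nonneg K67_nonneg NN_pos by (intro divide_nonneg_nonneg mult_nonneg_nonneg) auto
      show "0 \<le> K5 / NN" using Ks_nonneg NN_pos by simp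
    qed (use d w rho n3 in auto)
    have C: "C n = 2 * CA + 3" using CA_nonneg by (simp add: C_def)
    have SS: "S = Linf_norm n (euc_ball n ?R) u + ?R * \<bar>g (ezero n)\<bar> + ?R * (LBINT r:{0<..?R}. ?v r / r)"
      by (simp only: S_def g0_def dint_def \<omega>g_def)
    have "dint \<omega> ?R \<le> 1" using rad(4) unfolding w(1) .
    note mn = main[OF this, unfolded sig[symmetric], unfolded C[symmetric] SS g0_def]
    show "let R = rad_choice ?w; g0 = g (ezero n);
               \<sigma> = sg n (Linf_norm n (euc_ball n 1) u) \<bar>g0\<bar> ?w ?v
           in 0 < R \<and> R \<le> 1 \<and> (\<sigma> \<longlongrightarrow> 0) (at_right 0) \<and>
              (\<exists>ap\<in>euc n. \<exists>am\<in>euc n. \<exists>b :: real.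
                 (\<forall>r. 0 < r \<and> r \<le> R \<longrightarrow>
                    (\<forall>x\<in>Omega_plus n \<psi> \<inter> euc_ball n r. \<bar>u x - (einner n ap x + b)\<bar> \<le> r * \<sigma> r) \<and>
                    (\<forall>x\<in>Omega_minus n \<psi> \<inter> euc_ball n r. \<bar>u x - (einner n am x + b)\<bar> \<le> r * \<sigma> r)) \<and>
                 evec n (\<lambda>i. ap i - am i) = evec n (\<lambda>i. g0 * eaxis n n i) \<and>
                 R * enorm n ap + R * enorm n am + \<bar>b\<bar>
                   \<le> C n * (Linf_norm n (euc_ball n R) u + R * \<bar>g0\<bar>
                        + R * (LBINT r:{0<..R}. ?v r / r)))"
      unfolding Let_def by (intro conjI rad(1,2) lim mn)
  qed
qed

end
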